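(* Let $\mu\in C^5$ be a real-valued function on a neighborhood $\mathcal N$ of $0$ with $\mu(0)=0$, $\mu'(0)=1$, and $\mu(t)=0\Leftrightarrow t=0$ in $\mathcal N$. Fix $\delta>0$ and $\nu>0$, both small enough, let $I:=[-\nu,\nu]\subset\mathcal N$, and define $$J_1:=[-\nu,-\epsilon^{2/3}\delta^{-2/3}],\quad J_2:=[-\epsilon^{2/3}\delta^{-2/3},\epsilon^{2/3}\delta^{-2/3}],\quad J_3:=[\epsilon^{2/3}\delta^{-2/3},\nu],$$ so that $I=J_1\cup J_2\cup J_3$, with the interiors of $J_1,J_2,J_3$ disjoint, for all $0<\epsilon\ll1$. Then for any $0<\epsilon\ll 1$ the following holds. (1) There exists a solution $(x(t),y(t),t)\in W^u$, $t\in I$, of the system $\dot x=y,\ \dot y=-\mu(t)x,\ \dot t=\epsilon$ (parametrized by $t$), having the following asymptotic expansions. (1a) Uniformly within $t\in J_1$: $$x(t)=\widehat\mu(t)^{-1/4}\operatorname{Ai}(-\epsilon^{-2/3}t)\,\exp\Big(\tfrac1\epsilon\Big(\int_0^t\sqrt{-\mu(s)}\,ds+\tfrac23(-t)^{3/2}\Big)\Big)(1+\mathcal O(\epsilon^{2/3})),$$ $$y(t)=-\epsilon^{1/3}\widehat\mu(t)^{1/4}\operatorname{Ai}'(-\epsilon^{-2/3}t)\,\exp\Big(\tfrac1\epsilon\Big(\int_0^t\sqrt{-\mu(s)}\,ds+\tfrac23(-t)^{3/2}\Big)\Big)(1+\mathcal O(\epsilon^{2/3})).$$ (1b) Uniformly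 within $t\in J_2$: $$x(t)=\operatorname{Ai}(-\epsilon^{-2/3}t)\left(1+\mathcal O(\epsilon^{2/3})\right),\qquad y(t)=-\epsilon^{1/3}\operatorname{Ai}'(-\epsilon^{-2/3}t)\left(1+\mathcal O(\epsilon^{2/3})\right).$$ (1c) Uniformly within $t\in J_3$: $$x(t)=\widehat\mu(t)^{-1/4}\operatorname{Re}\Big((\operatorname{Ai}-i\operatorname{Bi})(-\epsilon^{-2/3}t)\,\exp\Big(\tfrac i\epsilon\Big(\int_0^t\sqrt{\mu(s)}\,ds-\tfrac23t^{3/2}\Big)\Big)(1+\mathcal O(\epsilon^{2/3}))\Big),$$ $$y(t)=-\epsilon^{1/3}\widehat\mu(t)^{1/4}\operatorname{Re}\Big((\operatorname{Ai}-i\operatorname{Bi})'(-\epsilon^{-2/3}t)\,\exp\Big(\tfrac i\epsilon\Big(\int_0^t\sqrt{\mu(s)}\,ds-\tfrac23t^{3/2}\Big)\Big)(1+\mathcal O(\epsilon^{2/3}))\Big).$$ (2) Moreover, let $W^u(\nu)$ denote the projection of $W^u\cap\{t=\nu\}$ onto the $(x,y)$-plane. Then $$W^u(\nu)=\operatorname{span}\begin{pmatrix}\cos\left(\epsilon^{-1}\int_0^\nu\sqrt{\mu(\tau)}\,d\tau-\frac\pi4\right)+\mathcal O(\epsilon^{2/3})\\[2pt] -\sqrt{\mu(\nu)}\,\sin\left(\epsilon^{-1}\int_0^\nu\sqrt{\mu(\tau)}\,d\tau-\frac\pi4\right)+\mathcal O(\epsilon^{2/3})\end{pmatrix}.$$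
   Context: $\operatorname{Ai},\operatorname{Bi}$ are the standard Airy functions; $(\operatorname{Ai}-i\operatorname{Bi})(z):=\operatorname{Ai}(z)-i\operatorname{Bi}(z)$ and $(\operatorname{Ai}-i\operatorname{Bi})'$ is its derivative with respect to its argument. $\widehat\mu(t):=t^{-1}\mu(t)$ for $t\ne0$ and $\widehat\mu(0):=1$. "$0<\epsilon\ll1$" means for all $\epsilon\in(0,\epsilon_0)$ with $\epsilon_0>0$ sufficiently small. $\mathcal O(\epsilon^{2/3})$ denotes terms bounded by $C\epsilon^{2/3}$ with $C$ independent of $\epsilon$ and of $t$ in the indicated interval (in (1c) these terms may be complex valued). The unstable manifold $W^u$: for $\epsilon=0$ and $t<0$ in $\mathcal N$ the equilibria $(0,0,t)$ of $\dot x=y,\ \dot y=-\mu(t)x,\ \dot t=\epsilon$ are partially hyperbolic with unstable manifold $\{y=\sqrt{-\mu(t)}\,x\}$. By Fenichel theory, over a compact interval $I_-\subset\mathcal N\cap\{t<0\}$ (taken here to contain $-\nu$) it perturbs, for $0<\epsilon\ll1$, to a locally invariant line bundle $$W^u=\{(x,y,t):y=h_u(t,\epsilon)x,\ t\in I_-,\ x\in\mathbb R\},$$ where $h_u$ has the same finite smoothness as $\mu$ jointly in $(t,\epsilon)$, $h_u(t,0)=\sqrt{-\mu(t)}$, and invariance means $\epsilon\,\partial_th_u=-\mu(t)-h_u^2$. Such $W^u$ is not unique (different choices differ by $\mathcal O(e^{-c/\epsilon})$) but one choice is fixed. $W^u$ is extended to all $t\in\mathcal N$, $t\ge -\nu$,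 by the flow of the system.
   Formalization: In (1b), since Ai and Ai' have zeros in the range of J_2, where a purely relative error fails, the factor 1+O(ε^{2/3}) is replaced by an additive O(ε^{2/3}) error on all of J_2, with the relative form kept wherever |Ai| (resp. |Ai'|) is at least any fixed η>0, with constant C/η. *)

theory Defs
  imports "HOL-Analysis.Analysis"
begin

text \<open>The Maclaurin series of the standard Airy functions. The two series below are the solutions
  of \<open>w'' = z * w\<close> with initial data \<open>(w, w') = (1, 0)\<close> and \<open>(0, 1)\<close> at \<open>0\<close>; the constants are the
  usual values \<open>Ai(0)\<close>, \<open>- Ai'(0)\<close>, \<open>Bi(0)\<close>, \<open>Bi'(0)\<close>.\<close>

definition airy_f :: "real \<Rightarrow> real" where
  "airy_f z = (\<Sum>k. 3 ^ k * pochhammer (1/3) k / fact (3 * k) * z ^ (3 * k))"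

definition airy_g :: "real \<Rightarrow> real" where
  "airy_g z = (\<Sum>k. 3 ^ k * pochhammer (2/3) k / fact (3 * k + 1) * z ^ (3 * k + 1))"

definition Ai :: "real \<Rightarrow> real" where
  "Ai z = airy_f z / (3 powr (2/3) * Gamma (2/3)) - airy_g z / (3 powr (1/3) * Gamma (1/3))"

definition Bi :: "real \<Rightarrow> real" where
  "Bi z = airy_f z / (3 powr (1/6) * Gamma (2/3)) + 3 powr (1/6) / Gamma (1/3) * airy_g z"

definition AimiBi :: "real \<Rightarrow> complex" where
  "AimiBi z = complex_of_real (Ai z) - \<i> * complex_of_real (Bi z)"

definition AimiBi' :: "real \<Rightarrow> complex" where
  "AimiBi' z = vector_derivative AimiBi (at z)"

text \<open>Derivatives are taken within \<open>S\<close>. For open \<open>S\<close> this is the usual notion; on a nondegenerate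
  box (the only other use, where derivatives within the box are unique) it is \<open>C\<^sup>k\<close> up to the
  part of the boundary that belongs to the box.\<close>

primrec Ck_on :: "nat \<Rightarrow> ('a::euclidean_space \<Rightarrow> real) \<Rightarrow> 'a set \<Rightarrow> bool" where
  "Ck_on 0 f S \<longleftrightarrow> continuous_on S f"
| "Ck_on (Suc k) f S \<longleftrightarrow>
     (\<exists>f'. (\<forall>x\<in>S. (f has_derivative f' x) (at x within S)) \<and> (\<forall>v. Ck_on k (\<lambda>x. f' x v) S))"

definition mu_hat :: "(real \<Rightarrow> real) \<Rightarrow> real \<Rightarrow> real" where
  "mu_hat \<mu> t = (if t = 0 then 1 else \<mu> t / t)"

definition vfield :: "(real \<Rightarrow> real) \<Rightarrow> real \<Rightarrow> real \<times> real \<times> real \<Rightarrow> real \<times> real \<times> real" where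
  "vfield \<mu> \<epsilon> = (\<lambda>(x, y, t). (y, - \<mu> t * x, \<epsilon>))"

text \<open>Here \<open>\<tau>\<close> is the time of the autonomous system (the dot), not the state variable \<open>t\<close>.\<close>

definition solution_on ::
  "(real \<Rightarrow> real) \<Rightarrow> real \<Rightarrow> real set \<Rightarrow> (real \<Rightarrow> real \<times> real \<times> real) \<Rightarrow> bool" where
  "solution_on \<mu> \<epsilon> T u \<longleftrightarrow>
     (\<forall>\<tau>\<in>T. (u has_vector_derivative vfield \<mu> \<epsilon> (u \<tau>)) (at \<tau> within T))"

text \<open>A choice of the slope function \<open>h\<^sub>u\<close> of the Fenichel line bundle over \<open>I\<^sub>- = {a..b}\<close>, for
  \<open>0 \<le> \<epsilon> < \<epsilon>\<^sub>1\<close>. It is not unique, so it enters as a parameter.\<close>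

definition fenichel_slope ::
  "(real \<Rightarrow> real) \<Rightarrow> real \<Rightarrow> real \<Rightarrow> real \<Rightarrow> (real \<Rightarrow> real \<Rightarrow> real) \<Rightarrow> bool" where
  "fenichel_slope \<mu> a b \<epsilon>\<^sub>1 h \<longleftrightarrow>
     Ck_on 5 (\<lambda>(t, \<epsilon>). h t \<epsilon>) ({a..b} \<times> {0..<\<epsilon>\<^sub>1}) \<and>
     (\<forall>t\<in>{a..b}. h t 0 = sqrt (- \<mu> t)) \<and>
     (\<forall>\<epsilon>\<in>{0<..<\<epsilon>\<^sub>1}. \<forall>t\<in>{a..b}. \<exists>h'.
        ((\<lambda>s. h s \<epsilon>) has_real_derivative h') (at t within {a..b}) \<and>
        \<epsilon> * h' = - \<mu> t - (h t \<epsilon>)\<^sup>2)"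

definition Wu_local :: "real \<Rightarrow> real \<Rightarrow> (real \<Rightarrow> real \<Rightarrow> real) \<Rightarrow> real \<Rightarrow> (real \<times> real \<times> real) set" where
  "Wu_local a b h \<epsilon> = {(x, y, t). t \<in> {a..b} \<and> y = h t \<epsilon> * x}"

text \<open>Extension of the local bundle by the forward flow, as long as \<open>t\<close> stays in \<open>N\<close>
  (\<open>T = 0\<close> gives the local bundle itself).\<close>

definition Wu ::
  "(real \<Rightarrow> real) \<Rightarrow> real set \<Rightarrow> real \<Rightarrow> real \<Rightarrow> (real \<Rightarrow> real \<Rightarrow> real) \<Rightarrow> real \<Rightarrow>
     (real \<times> real \<times> real) set" where
  "Wu \<mu> N a b h \<epsilon> =
     {p. \<exists>T\<ge>0. \<exists>u. solution_on \<mu> \<epsilon> {0..T} u \<and> u 0 \<in> Wu_local a b h \<epsilon> \<and> u T = p \<and>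
           (\<forall>\<tau>\<in>{0..T}. snd (snd (u \<tau>)) \<in> N)}"

definition Wu_section ::
  "(real \<Rightarrow> real) \<Rightarrow> real set \<Rightarrow> real \<Rightarrow> real \<Rightarrow> (real \<Rightarrow> real \<Rightarrow> real) \<Rightarrow> real \<Rightarrow> real \<Rightarrow>
     (real \<times> real) set" where
  "Wu_section \<mu> N a b h \<epsilon> t = {(x, y). (x, y, t) \<in> Wu \<mu> N a b h \<epsilon>}"

definition J1 :: "real \<Rightarrow> real \<Rightarrow> real \<Rightarrow> real set" where
  "J1 \<delta> \<nu> \<epsilon> = {- \<nu> .. - (\<epsilon> powr (2/3) * \<delta> powr (-2/3))}"

definition J2 :: "real \<Rightarrow> real \<Rightarrow> real set" where
  "J2 \<delta> \<epsilon> = {- (\<epsilon> powr (2/3) * \<delta> powr (-2/3)) .. \<epsilon> powr (2/3) * \<delta> powr (-2/3)}"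

definition J3 :: "real \<Rightarrow> real \<Rightarrow> real \<Rightarrow> real set" where
  "J3 \<delta> \<nu> \<epsilon> = {\<epsilon> powr (2/3) * \<delta> powr (-2/3) .. \<nu>}"

text \<open>The meaning of \<open>v = a * (1 + O(\<epsilon>\<^sup>2\<^sup>/\<^sup>3))\<close> with error bound \<open>B\<close> for a factor \<open>a\<close> that runs through zeros
  (\<open>Ai\<close> and \<open>Ai'\<close> on \<open>J2\<close> when \<open>\<delta>\<close> is small). The error is relative, uniformly, as long as \<open>a\<close> is
  bounded away from \<open>0\<close>; in general it is measured relative to the amplitude of the oscillation,
  which is of order one there, because \<open>v\<close> need not vanish exactly where \<open>a\<close> does.\<close>

definition osc_approx :: "real \<Rightarrow> real \<Rightarrow> real \<Rightarrow> bool" where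
  "osc_approx B a v \<longleftrightarrow>
     (\<exists>r. \<bar>r\<bar> \<le> B \<and> v = a + r) \<and>
     (\<forall>\<eta>>0. \<eta> \<le> \<bar>a\<bar> \<longrightarrow> (\<exists>r. \<bar>r\<bar> \<le> B / \<eta> \<and> v = a * (1 + r)))"

end

(*
  In the scaled time s = t / k with k = epsilon^(2/3) the system is a'' = - s mu_hat(k s) a, a perturbation
  of Airy's equation. The approximants of the theorem are exact solutions of nearby equations: they satisfy
  X'' = (q + R) X, where q is the true coefficient and the residual R is O(k / s). This needs the logarithmic
  derivatives of Ai and Ai - i Bi at infinity up to O(s^(-5/2)), which come from the steepest descent
  integrals of these functions.

  On J1 the approximant is recessive towards t = -nu, where the Riccati slope of W^u differs by O(epsilon)
  from sqrt(-mu). Reduction of order with a barrier shows that the solution of W^u that agrees with the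
  approximant at -nu stays within a relative error O(k). On J2 it is an O(k) perturbation of
  Ai(-s) = Re (Ai - i Bi)(-s). On J3 one follows the Wronskian with the conjugate of the oscillating
  approximant, whose variation is the integral of |R| |X|^2 = O(k s^(-3/2)), hence O(k) uniformly up to
  t = nu. The fibre of W^u over nu is a line, so it is spanned by the solution just described.
*)
theory Submission
  imports Defs "HOL-Probability.Probability" "HOL-Real_Asymp.Real_Asymp" "HOL-Complex_Analysis.Complex_Analysis"
begin

section \<open>Airy functions as contour integrals\<close>

text \<open>The Airy functions are given only by Maclaurin series, which say nothing about infinity.
  The bridge is a moment computation: the moments of exp (-s^3 / 3) are Gamma values, so a single
  entire function \<open>airy\<close> has both the prescribed series and a contour integral. On the
  ray of argument -2 \<theta> it gives Ai(s) for \<theta> = 0 and, up to a constant factor, (Ai - i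
  Bi)(-s) for \<theta> = pi/6; hence one expansion serves both sides of the turning point.

  Two obstacles shape the comparison. On the left the solution varies by factors exponentially large
  in 1/\<epsilon>, so the error has to be measured on a quotient. On the right the solution has
  zeros, so it is compared with a complex approximant that has none, and the error becomes a complex
  factor.

  The number \<delta> enters through s0 = \<delta>^(-2/3), the fixed place where the large-argument
  estimates begin. It has to be large for reasons of the Airy functions alone, whereas \<nu> is
  small for reasons of \<mu> alone. Each region hands its O(\<kappa>) error to the next one as an
  initial tolerance.\<close>

lemma integrable_abs_power_gauss:
  fixes \<beta> :: real
  assumes "\<beta> > 0"
  shows "integrable lborel (\<lambda>x. \<bar>x\<bar> ^ n * exp (- \<beta> * x\<^sup>2))"
proof -
  \<comment> \<open>Chosen so that exp (-x^2 / (2 \<sigma>^2)) is exp (-\<beta> x^2); the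
    normalising factor of the density is multiplied away.\<close>
  define \<sigma> where "\<sigma> = 1 / sqrt (2 * \<beta>)"
  have \<sigma>: "\<sigma> > 0" "2 * \<sigma>\<^sup>2 = 1 / \<beta>"
    using assms by (auto simp: \<sigma>_def power_divide)
  have "integrable lborel (\<lambda>x. sqrt (2 * pi * \<sigma>\<^sup>2) * (normal_density 0 \<sigma> x * \<bar>x - 0\<bar> ^ n))"
    by (intro integrable_mult_right integrable_normal_moment_abs \<sigma>)
  also have "(\<lambda>x. sqrt (2 * pi * \<sigma>\<^sup>2) * (normal_density 0 \<sigma> x * \<bar>x - 0\<bar> ^ n)) = (\<lambda>x. \<bar>x\<bar> ^ n * exp (- \<beta> * x\<^sup>2))"
    using \<sigma> by (auto simp: normal_density_def fun_eq_iff)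
  finally show ?thesis .
qed

lemma cubic_exp_bound:
  fixes a :: real
  shows "\<exists>C. \<forall>s\<ge>0. exp (a * s - s ^ 3 / 3) \<le> C * exp (- (s\<^sup>2))"
proof (intro exI allI impI)
  fix s :: real assume s: "s \<ge> 0"
  \<comment> \<open>Beyond S the factor s/3 - 1 exceeds |a|, so the cubic beats a s + s^2; on [0, S]
    each term is bounded by its value at S.\<close>
  define S where "S = 3 + 3 * \<bar>a\<bar>"
  have "a * s - s ^ 3 / 3 + s\<^sup>2 \<le> S\<^sup>2 + \<bar>a\<bar> * S"
  proof (cases "s \<le> S")
    case True
    have "a * s \<le> \<bar>a\<bar> * s" using s by (intro mult_right_mono) auto
    also have "\<dots> \<le> \<bar>a\<bar> * S" using True by (intro mult_left_mono) auto
    moreover have "s\<^sup>2 \<le> S\<^sup>2" using True s by (intro power_mono)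
    moreover have "s ^ 3 \<ge> 0" using s by simp
    ultimately show ?thesis by linarith
  next
    case False
    have "s * (s / 3 - 1) \<ge> S * \<bar>a\<bar>" using False by (intro mult_mono) (auto simp: S_def)
    moreover have "S * \<bar>a\<bar> \<ge> 1 * \<bar>a\<bar>" by (intro mult_right_mono) (auto simp: S_def)
    ultimately have "s * (s / 3 - 1) - a \<ge> 0" by linarith
    then have "s * (s * (s / 3 - 1) - a) \<ge> 0" using s by simp
    then have "a * s - s ^ 3 / 3 + s\<^sup>2 \<le> 0" by (simp add: algebra_simps power2_eq_square power3_eq_cube)
    moreover have "S \<ge> 0" by (simp add: S_def)
    ultimately show ?thesis by (smt (verit) mult_nonneg_nonneg zero_le_power2)
  qed
  then have "exp (a * s - s ^ 3 / 3) \<le> exp (S\<^sup>2 + \<bar>a\<bar> * S - s\<^sup>2)" by simp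
  then show "exp (a * s - s ^ 3 / 3) \<le> exp ((3 + 3 * \<bar>a\<bar>)\<^sup>2 + \<bar>a\<bar> * (3 + 3 * \<bar>a\<bar>)) * exp (- (s\<^sup>2))"
    by (simp add: S_def flip: exp_add)
qed

lemma set_integrable_cubic_exp:
  fixes a :: real
  shows "set_integrable lborel {0..} (\<lambda>s. exp (a * s - s ^ 3 / 3))"
proof -
  obtain C where C: "\<And>s. s \<ge> 0 \<Longrightarrow> exp (a * s - s ^ 3 / 3) \<le> C * exp (- (s\<^sup>2))"
    using cubic_exp_bound by blast
  have "C * exp (- (0\<^sup>2)) \<ge> 0" using C[of 0] by (smt (verit) exp_gt_zero)
  then have "C \<ge> 0" by simp
  show ?thesis unfolding set_integrable_def
  proof (rule Bochner_Integration.integrable_bound)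
    show "integrable lborel (\<lambda>x. C * (\<bar>x\<bar> ^ 0 * exp (- 1 * x\<^sup>2)))"
      by (intro integrable_mult_right integrable_abs_power_gauss) auto
  qed (use C \<open>C \<ge> 0\<close> in \<open>auto simp: indicator_def\<close>)
qed

section \<open>Moments of exp (-s^3 / 3), which are the Maclaurin coefficients of the ray integrals
  up to factorials\<close>

definition cubic_moment :: "nat \<Rightarrow> real" where
  "cubic_moment n = (LBINT s:{0..}. s ^ n * exp (- (s ^ 3) / 3))"

text \<open>Domination by s^n \<le> n! exp s reduces the integrand to the case a = 1 of
  \<open>set_integrable_cubic_exp\<close>.\<close>

lemma set_integrable_cubic_moment:
  "set_integrable lborel {0..} (\<lambda>s::real. s ^ n * exp (- (s ^ 3) / 3))"
  unfolding set_integrable_def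
proof (rule Bochner_Integration.integrable_bound)
  show "integrable lborel (\<lambda>x::real. fact n * (indicat_real {0..} x *\<^sub>R exp (1 * x - x ^ 3 / 3)))"
    using set_integrable_cubic_exp[of 1] unfolding set_integrable_def by (intro integrable_mult_right) simp
  have "x ^ n * exp (- (x ^ 3) / 3) \<le> fact n * exp (x - x ^ 3 / 3)" if "x \<ge> 0" for x :: real
  proof -
    have "x ^ n / fact n \<le> exp x"
    proof -
      have "(\<Sum>k\<in>{n}. x ^ k /\<^sub>R fact k) \<le> (\<Sum>k. x ^ k /\<^sub>R fact k)"
        using that exp_converges[of x] by (intro sum_le_suminf) (auto simp: sums_iff)
      then have "x ^ n /\<^sub>R fact n \<le> exp x" unfolding exp_def by simp
      then show ?thesis by (simp add: divide_inverse mult.commute)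
    qed
    then have "x ^ n \<le> fact n * exp x" by (simp add: field_simps)
    then have "x ^ n * exp (- (x ^ 3) / 3) \<le> (fact n * exp x) * exp (- (x ^ 3) / 3)"
      by (rule mult_right_mono) simp
    also have "\<dots> = fact n * exp (x - x ^ 3 / 3)" by (simp only: mult.assoc mult_exp_exp) simp
    finally show ?thesis .
  qed
  then show "AE x::real in lborel. norm (indicator {0..} x *\<^sub>R (x ^ n * exp (- (x ^ 3) / 3)))
      \<le> norm (fact n * (indicator {0..} x *\<^sub>R exp (1 * x - x ^ 3 / 3)))"
    by (intro AE_I2) (auto simp: indicator_def)
qed auto

text \<open>The substitution t = s^3 / 3 in Euler's integral for Gamma; p = (n + 1) / 3 is the
  argument it produces.\<close>

lemma cubic_moment_Gamma:
  "cubic_moment n = 3 powr ((real n - 2) / 3) * Gamma ((real n + 1) / 3)"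
proof -
  define p where "p = (real n + 1) / 3"
  have p: "p > 0" by (simp add: p_def)
  define f where "f = (\<lambda>t::real. t powr (p - 1) / exp t)"
  have eq: "f (x ^ 3 / 3) * x\<^sup>2 = 3 powr (1 - p) * (x ^ n * exp (- (x ^ 3) / 3))" if "x > 0" for x :: real
  proof -
    have x3: "x ^ 3 = x powr 3" using that by simp
    have "(x ^ 3 / 3) powr (p - 1) = x powr (3 * (p - 1)) / 3 powr (p - 1)"
      unfolding x3 using that by (subst powr_divide) (simp_all only: powr_powr powr_ge_zero)
    then have "(x ^ 3 / 3) powr (p - 1) * x\<^sup>2 = x powr (3 * (p - 1)) * x\<^sup>2 * (1 / 3 powr (p - 1))" by simp
    also have "x powr (3 * (p - 1)) * x\<^sup>2 = x ^ n"
    proof -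
      have "x powr (3 * (p - 1)) * x powr 2 = x powr real n"
        unfolding powr_add [symmetric] by (rule arg_cong[where f="\<lambda>e. x powr e"]) (simp add: p_def field_simps)
      then show ?thesis using that by (simp add: powr_realpow)
    qed
    also have "1 / 3 powr (p - 1) = (3::real) powr (1 - p)"
      using powr_minus[of "3::real" "p - 1"] by (simp add: divide_inverse)
    finally have "(x ^ 3 / 3) powr (p - 1) * x\<^sup>2 * exp (- (x ^ 3 / 3)) = 3 powr (1 - p) * (x ^ n * exp (- (x ^ 3 / 3)))" by simp
    moreover have "f (x ^ 3 / 3) * x\<^sup>2 = (x ^ 3 / 3) powr (p - 1) * x\<^sup>2 * exp (- (x ^ 3 / 3))"
      unfolding f_def exp_minus by (simp only: divide_inverse mult_ac)
    ultimately show ?thesis by simp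
  qed
  have ein: "einterval 0 \<infinity> = {0<..}" by (auto simp: einterval_def)
  \<comment> \<open>The substitution rule works on the open half-line, the moments on the closed
    one; the two differ by a null set.\<close>
  have null: "set_integrable lborel {0<..} h \<longleftrightarrow> set_integrable lborel {0..} h"
    "set_lebesgue_integral lborel {0<..} h = set_lebesgue_integral lborel {0..} h" for h :: "real \<Rightarrow> real"
    by (rule set_integrable_discrete_difference[where X="{0}"] set_integral_discrete_difference[where X="{0}"]; auto)+
  have int: "set_integrable lborel {0<..} (\<lambda>x. f (x ^ 3 / 3) * x\<^sup>2)"
  proof -
    have "set_integrable lborel {0<..} (\<lambda>x. 3 powr (1 - p) * (x ^ n * exp (- (x ^ 3) / 3)))"
      unfolding null by (intro set_integrable_mult_right set_integrable_cubic_moment)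
    then show ?thesis
      by (subst set_integrable_cong[OF refl refl eq]) auto
  qed
  have g0: "((ereal \<circ> (\<lambda>x. x ^ 3 / 3) \<circ> real_of_ereal) \<longlongrightarrow> 0) (at_right 0)"
    unfolding zero_ereal_def ereal_tendsto_simps lim_ereal by (auto intro!: tendsto_eq_intros)
  have ginf: "((ereal \<circ> (\<lambda>x. x ^ 3 / 3) \<circ> real_of_ereal) \<longlongrightarrow> \<infinity>) (at_left \<infinity>)"
    unfolding ereal_tendsto_simps by real_asymp
  have *: "set_integrable lborel (einterval 0 \<infinity>) f"
       "(LBINT x=0..\<infinity>. f x) = (LBINT x=0..\<infinity>. f (x ^ 3 / 3) * x\<^sup>2)"
  proof -
    have d: "((\<lambda>x. x ^ 3 / 3) has_real_derivative x\<^sup>2) (at x)" for x :: real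
      by (auto intro!: derivative_eq_intros)
    have c: "isCont f (x ^ 3 / 3)" if "0 < ereal x" for x
      using that unfolding f_def by (intro continuous_intros) auto
    have c': "isCont (\<lambda>x::real. x\<^sup>2) x" for x by (intro continuous_intros)
    have n: "0 \<le> f (x ^ 3 / 3)" for x by (simp add: f_def)
    note * = interval_integral_substitution_nonneg[where g="\<lambda>x. x ^ 3 / 3" and g'="\<lambda>x. x\<^sup>2" and f=f
        and a=0 and b=\<infinity> and A=0 and B=\<infinity>, OF _ d c c' n _ g0 ginf int[folded ein]]
    show "set_integrable lborel (einterval 0 \<infinity>) f" by (rule *(1)) simp_all
    show "(LBINT x=0..\<infinity>. f x) = (LBINT x=0..\<infinity>. f (x ^ 3 / 3) * x\<^sup>2)" by (rule *(2)) simp_all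
  qed
  have "((\<lambda>t. f t) has_integral Gamma p) {0..}"
    unfolding f_def by (rule Gamma_integral_real) (rule p)
  moreover have "set_integrable lborel {0..} f" using * null by (simp add: ein)
  ultimately have G: "(LBINT x:{0..}. f x) = Gamma p"
    by (simp add: set_borel_integral_eq_integral(2) integral_unique)
  have "Gamma p = (LBINT x:{0<..}. f (x ^ 3 / 3) * x\<^sup>2)"
    using *(2) G null by (simp add: interval_lebesgue_integral_def ein)
  also have "\<dots> = (LBINT x:{0<..}. 3 powr (1 - p) * (x ^ n * exp (- (x ^ 3) / 3)))"
    by (rule set_lebesgue_integral_cong) (use eq in auto)
  also have "\<dots> = 3 powr (1 - p) * cubic_moment n"
    unfolding null cubic_moment_def by (rule set_integral_mult_right)
  finally have "3 powr (p - 1) * Gamma p = (3 powr (p - 1) * 3 powr (1 - p)) * cubic_moment n" by simp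
  also have "3 powr (p - 1) * 3 powr (1 - p) = (1::real)" by (simp flip: powr_add)
  also have "p - 1 = (real n - 2) / 3" by (simp add: p_def field_simps)
  finally show ?thesis by (simp add: p_def)
qed

text \<open>Gamma's functional equation at (n + 1) / 3; the step 3 in n is what makes the series
  satisfy w'' = z w later.\<close>

lemma cubic_moment_rec: "cubic_moment (n + 3) = (real n + 1) * cubic_moment n"
proof -
  have "Gamma ((real n + 1) / 3 + 1) = (real n + 1) / 3 * Gamma ((real n + 1) / 3)"
    by (rule Gamma_plus1) (auto elim!: nonpos_Ints_cases simp: field_simps)
  moreover have "(3::real) powr ((real n - 2) / 3 + 1) = 3 powr ((real n - 2) / 3) * 3"
    by (subst powr_add) simp
  moreover have "(real (n + 3) - 2) / 3 = (real n - 2) / 3 + 1" "(real (n + 3) + 1) / 3 = (real n + 1) / 3 + 1"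
    by (simp_all add: field_simps)
  ultimately show ?thesis
    unfolding cubic_moment_Gamma by (simp only:) simp
qed

lemma cubic_moment_pos: "cubic_moment n > 0"
  unfolding cubic_moment_Gamma by (intro mult_pos_pos Gamma_real_pos) auto

text \<open>Expansion of exp (u s) under the integral. The series of absolute values sums to exp
  (|u| s - s^3 / 3), which is integrable, so summation and integration may be exchanged.\<close>

lemma cubic_exp_sums:
  fixes u :: complex
  shows "(\<lambda>n. of_real (cubic_moment n) / fact n * u ^ n) sums
           (LBINT s:{0..}. exp (u * of_real s - of_real s ^ 3 / 3))"
proof -
  define f where "f = (\<lambda>n s. (u ^ n / fact n) * of_real (indicator {0..} s *\<^sub>R (s ^ n * exp (- (s ^ 3) / 3))) :: complex)"
  have intf: "integrable lborel (f n)" for n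
    unfolding f_def using set_integrable_cubic_moment[of n]
    unfolding set_integrable_def by (intro integrable_mult_right integrable_of_real)
  have normf: "norm (f n s) = indicator {0..} s *\<^sub>R ((norm u * s) ^ n /\<^sub>R fact n * exp (- (s ^ 3) / 3))" for n s
    by (cases "s \<ge> 0") (simp_all add: f_def norm_mult norm_divide norm_power power_mult_distrib field_simps)
  have sumf: "(\<lambda>n. norm (f n s)) sums (indicator {0..} s *\<^sub>R exp (norm u * s - s ^ 3 / 3))" for s
  proof -
    have "(\<lambda>n. (norm u * s) ^ n /\<^sub>R fact n * exp (- (s ^ 3) / 3)) sums (exp (norm u * s) * exp (- (s ^ 3) / 3))"
      by (intro sums_mult2 exp_converges)
    also have "exp (norm u * s) * exp (- (s ^ 3) / 3) = exp (norm u * s - s ^ 3 / 3)"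
      by (simp flip: exp_add)
    finally show ?thesis unfolding normf by (rule sums_scaleR_right)
  qed
  have sumf': "(\<lambda>n. f n s) sums (indicator {0..} s *\<^sub>R exp (u * of_real s - of_real s ^ 3 / 3))" for s
  proof -
    have "(\<lambda>n. (u * of_real s) ^ n /\<^sub>R fact n * of_real (exp (- (s ^ 3) / 3))) sums (exp (u * of_real s) * of_real (exp (- (s ^ 3) / 3)))"
      by (intro sums_mult2 exp_converges)
    also have "exp (u * of_real s) * of_real (exp (- (s ^ 3) / 3)) = exp (u * of_real s - of_real s ^ 3 / 3)"
      by (simp flip: exp_add exp_of_real)
    finally have "(\<lambda>n. indicator {0..} s *\<^sub>R ((u * of_real s) ^ n /\<^sub>R fact n * of_real (exp (- (s ^ 3) / 3)))) sums
        (indicator {0..} s *\<^sub>R exp (u * of_real s - of_real s ^ 3 / 3))" by (rule sums_scaleR_right)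
    also have "(\<lambda>n. indicator {0..} s *\<^sub>R ((u * of_real s) ^ n /\<^sub>R fact n * of_real (exp (- (s ^ 3) / 3)))) = (\<lambda>n. f n s)"
      by (rule ext, cases "s \<ge> 0") (simp_all add: f_def power_mult_distrib scaleR_conv_of_real field_simps)
    finally show ?thesis .
  qed
  have "(\<lambda>n. integral\<^sup>L lborel (f n)) sums (\<integral>s. (\<Sum>n. f n s) \<partial>lborel)"
  proof (rule sums_integral)
    show "AE s in lborel. summable (\<lambda>i. norm (f i s))"
      using sumf by (auto simp: sums_iff)
    \<comment> \<open>All terms are nonnegative, so it is enough that the partial sums stay below
      the integral of the full absolute series.\<close>
    show "summable (\<lambda>i. \<integral>s. norm (f i s) \<partial>lborel)"
    proof (rule bounded_imp_summable)
      fix n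
      have "(\<Sum>i\<le>n. \<integral>s. norm (f i s) \<partial>lborel) = (\<integral>s. (\<Sum>i\<le>n. norm (f i s)) \<partial>lborel)"
        by (rule Bochner_Integration.integral_sum [symmetric]) (intro integrable_norm intf)
      also have "\<dots> \<le> (\<integral>s. indicator {0..} s *\<^sub>R exp (norm u * s - s ^ 3 / 3) \<partial>lborel)"
      proof (rule integral_mono)
        show "integrable lborel (\<lambda>s. indicator {0..} s *\<^sub>R exp (norm u * s - s ^ 3 / 3))"
          using set_integrable_cubic_exp[of "norm u"] unfolding set_integrable_def .
        show "(\<Sum>i\<le>n. norm (f i s)) \<le> indicator {0..} s *\<^sub>R exp (norm u * s - s ^ 3 / 3)" for s
          unfolding sums_unique[OF sumf] by (intro sum_le_suminf sums_summable[OF sumf]) auto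
        show "integrable lborel (\<lambda>s. \<Sum>i\<le>n. norm (f i s))"
          by (intro Bochner_Integration.integrable_sum integrable_norm intf)
      qed
      finally show "(\<Sum>i\<le>n. \<integral>s. norm (f i s) \<partial>lborel) \<le> (\<integral>s. indicator {0..} s *\<^sub>R exp (norm u * s - s ^ 3 / 3) \<partial>lborel)" .
    qed auto
  qed (rule intf)
  moreover have "integral\<^sup>L lborel (f n) = of_real (cubic_moment n) / fact n * u ^ n" for n
    unfolding f_def cubic_moment_def set_lebesgue_integral_def integral_mult_right_zero integral_complex_of_real
    by (rule mult.commute[THEN trans]) simp
  moreover have "(\<Sum>n. f n s) = indicator {0..} s *\<^sub>R exp (u * of_real s - of_real s ^ 3 / 3)" for s
    using sumf'[of s] by (rule sums_unique[symmetric])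
  ultimately show ?thesis by (simp only: set_lebesgue_integral_def)
qed

text \<open>This is pi times Scorer's function Hi. Integrals of exp (z s - s^3 / 3) along the rays
  through the cube roots of unity reduce to it.\<close>

definition scorer :: "complex \<Rightarrow> complex" where
  "scorer u = (LBINT s:{0..}. exp (u * of_real s - of_real s ^ 3 / 3))"

definition \<omega>3 :: complex where "\<omega>3 = cis (2 * pi / 3)"

text \<open>The contour integral of exp (z s - s^3 / 3) / (2 pi i), coming in along the ray of
  \<open>\<omega>3\<^sup>2\<close> and leaving along the ray of \<open>\<omega>3\<close>;
  substituting a cube root of unity times r for s leaves the cube unchanged.\<close>

definition airy :: "complex \<Rightarrow> complex" where
  "airy z = (\<omega>3 * scorer (\<omega>3 * z) - \<omega>3\<^sup>2 * scorer (\<omega>3\<^sup>2 * z)) / (2 * pi * \<i>)"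

text \<open>The factors 1, -1, 0 come from \<open>omega3_coeff\<close>, and sqrt 3 / (2 pi) is i
  sqrt 3 divided by 2 pi i.\<close>

definition airy_coeff :: "nat \<Rightarrow> complex" where
  "airy_coeff n = of_real (sqrt 3 / (2 * pi) * (if n mod 3 = 0 then 1 else if n mod 3 = 1 then - 1 else 0)
     * cubic_moment n / fact n)"

lemma omega3: "\<omega>3 = Complex (- 1 / 2) (sqrt 3 / 2)"
  by (simp add: \<omega>3_def cis.ctr complex_eq_iff cos_120 sin_120)

lemma omega3_sq: "\<omega>3\<^sup>2 = Complex (- 1 / 2) (- sqrt 3 / 2)"
  by (simp add: omega3 power2_eq_square complex_eq_iff)

lemma omega3_cube: "\<omega>3 ^ 3 = 1"
proof -
  have "\<omega>3 ^ 3 = cis (2 * pi)" unfolding \<omega>3_def using Complex.DeMoivre[of "2 * pi / 3" 3] by simp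
  then show ?thesis by simp
qed

text \<open>Both sides are 2 i sin (2 pi (n + 1) / 3); the exponent is reduced mod 3 and the three
  cases are computed.\<close>

lemma omega3_coeff: "\<omega>3 ^ (n + 1) - (\<omega>3\<^sup>2) ^ (n + 1) =
    \<i> * sqrt 3 * (if n mod 3 = 0 then 1 else if n mod 3 = 1 then - 1 else 0)"
proof -
  have p: "\<zeta> ^ (n + 1) = \<zeta> * \<zeta> ^ (n mod 3)" if "\<zeta> ^ 3 = 1" for \<zeta> :: complex
  proof -
    have "\<zeta> ^ (n + 1) = \<zeta> ^ (3 * (n div 3) + n mod 3 + 1)" by simp
    then show ?thesis unfolding power_add power_mult that by simp
  qed
  have c: "(\<omega>3\<^sup>2) ^ 3 = 1"
  proof -
    have "(\<omega>3\<^sup>2) ^ 3 = (\<omega>3 ^ 3)\<^sup>2" by (simp flip: power_mult)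
    then show ?thesis by (simp add: omega3_cube)
  qed
  have "n mod 3 = 0 \<or> n mod 3 = 1 \<or> n mod 3 = 2" by auto
  then show ?thesis
    unfolding p[OF omega3_cube] p[OF c]
  proof (elim disjE)
    assume "n mod 3 = 0"
    then show "\<omega>3 * \<omega>3 ^ (n mod 3) - \<omega>3\<^sup>2 * \<omega>3\<^sup>2 ^ (n mod 3) =
        \<i> * sqrt 3 * (if n mod 3 = 0 then 1 else if n mod 3 = 1 then - 1 else 0)"
      unfolding omega3_sq unfolding omega3 by (simp add: complex_eq_iff)
  next
    assume "n mod 3 = 1"
    then show "\<omega>3 * \<omega>3 ^ (n mod 3) - \<omega>3\<^sup>2 * \<omega>3\<^sup>2 ^ (n mod 3) =
        \<i> * sqrt 3 * (if n mod 3 = 0 then 1 else if n mod 3 = 1 then - 1 else 0)"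
      unfolding omega3_sq unfolding omega3 by (simp add: complex_eq_iff)
  next
    assume "n mod 3 = 2"
    moreover have "\<omega>3 * \<omega>3\<^sup>2 = 1" "\<omega>3\<^sup>2 * (\<omega>3\<^sup>2)\<^sup>2 = 1"
      using omega3_cube c by (simp_all add: power3_eq_cube power2_eq_square mult.assoc)
    ultimately show "\<omega>3 * \<omega>3 ^ (n mod 3) - \<omega>3\<^sup>2 * \<omega>3\<^sup>2 ^ (n mod 3) =
        \<i> * sqrt 3 * (if n mod 3 = 0 then 1 else if n mod 3 = 1 then - 1 else 0)"
      by simp
  qed
qed

lemma airy_sums: "(\<lambda>n. airy_coeff n * z ^ n) sums airy z"
proof -
  have S: "(\<lambda>n. of_real (cubic_moment n) / fact n * u ^ n) sums scorer u" for u
    unfolding scorer_def by (rule cubic_exp_sums)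
  have "(\<lambda>n. (\<omega>3 * (of_real (cubic_moment n) / fact n * (\<omega>3 * z) ^ n)
          - \<omega>3\<^sup>2 * (of_real (cubic_moment n) / fact n * (\<omega>3\<^sup>2 * z) ^ n)) / (2 * pi * \<i>)) sums airy z"
    unfolding airy_def by (intro sums_divide sums_diff sums_mult S)
  also have "(\<lambda>n. (\<omega>3 * (of_real (cubic_moment n) / fact n * (\<omega>3 * z) ^ n)
          - \<omega>3\<^sup>2 * (of_real (cubic_moment n) / fact n * (\<omega>3\<^sup>2 * z) ^ n)) / (2 * pi * \<i>)) =
     (\<lambda>n. airy_coeff n * z ^ n)"
  proof
    fix n
    have "(\<omega>3 * (of_real (cubic_moment n) / fact n * (\<omega>3 * z) ^ n)
          - \<omega>3\<^sup>2 * (of_real (cubic_moment n) / fact n * (\<omega>3\<^sup>2 * z) ^ n)) / (2 * pi * \<i>)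
       = (\<omega>3 ^ (n + 1) - (\<omega>3\<^sup>2) ^ (n + 1)) / (2 * pi * \<i>) * (of_real (cubic_moment n) / fact n * z ^ n)"
    proof -
      have "(w * (a * (P * Z)) - v * (a * (Q * Z))) / D = (P * w - Q * v) / D * (a * Z)" for w a P Z v Q D :: complex
        unfolding times_divide_eq_left by (rule arg_cong[where f="\<lambda>x. x / D"]) (simp add: algebra_simps)
      then show ?thesis unfolding power_mult_distrib power_add power_one_right .
    qed
    also have "\<dots> = airy_coeff n * z ^ n"
    proof -
      have "\<i> * s * c / (p * \<i>) * (m / f * y) = s / p * c * m / f * y" for s c p m f y :: complex
        by simp
      then show ?thesis unfolding omega3_coeff airy_coeff_def by simp
    qed
    finally show "(\<omega>3 * (of_real (cubic_moment n) / fact n * (\<omega>3 * z) ^ n)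
          - \<omega>3\<^sup>2 * (of_real (cubic_moment n) / fact n * (\<omega>3\<^sup>2 * z) ^ n)) / (2 * pi * \<i>) = airy_coeff n * z ^ n" .
  qed
  finally show ?thesis .
qed

definition airy' :: "complex \<Rightarrow> complex" where
  "airy' z = (\<Sum>n. diffs airy_coeff n * z ^ n)"

text \<open>This is Airy's equation w'' = z w read off coefficient by coefficient.\<close>

lemma airy_coeff_rec: "of_nat (n + 2) * of_nat (n + 3) * airy_coeff (n + 3) = airy_coeff n"
proof -
  have m: "(n + 3) mod 3 = n mod 3" by simp
  have n3: "n + 3 = Suc (Suc (Suc n))" by simp
  have f: "(fact (n + 3) :: real) = real (n + 3) * (real (n + 2) * ((real n + 1) * fact n))"
    unfolding n3 fact_Suc by (simp only: of_nat_Suc) simp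
  have *: "a * b * (K * (c * m) / (b * (a * (c * F)))) = K * m / F" if "a > 0" "b > 0" "c > 0" for a b c m F K :: real
    using that by simp
  have "real (n + 2) * real (n + 3) * (K * cubic_moment (n + 3) / fact (n + 3)) = K * cubic_moment n / fact n" for K
    unfolding f cubic_moment_rec by (rule *) simp_all
  then have "complex_of_real (real (n + 2) * real (n + 3) * (K * cubic_moment (n + 3) / fact (n + 3)))
    = of_real (K * cubic_moment n / fact n)" for K by (simp only:)
  then show ?thesis
    unfolding airy_coeff_def m of_real_mult of_real_of_nat_eq .
qed

lemma airy_has_field_derivative: "(airy has_field_derivative airy' z) (at z)"
  and airy'_has_field_derivative: "(airy' has_field_derivative z * airy z) (at z)"
proof -
  have sm: "summable (\<lambda>n. airy_coeff n * z ^ n)" for z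
    using airy_sums by (rule sums_summable)
  have a: "airy = (\<lambda>z. \<Sum>n. airy_coeff n * z ^ n)"
    using airy_sums by (auto simp: sums_iff)
  show "(airy has_field_derivative airy' z) (at z)"
    unfolding airy'_def a by (rule termdiffs_strong_converges_everywhere[OF sm])
  have sm': "summable (\<lambda>n. diffs airy_coeff n * z ^ n)" for z
    using termdiff_converges_all[of airy_coeff z] sm by blast
  have "(airy' has_field_derivative (\<Sum>n. diffs (diffs airy_coeff) n * z ^ n)) (at z)"
    unfolding airy'_def by (rule termdiffs_strong_converges_everywhere[OF sm'])
  moreover have "(\<Sum>n. diffs (diffs airy_coeff) n * z ^ n) = z * airy z"
  proof -
    have "(\<lambda>n. z * (airy_coeff n * z ^ n)) sums (z * airy z)"
      by (intro sums_mult airy_sums)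
    also have "(\<lambda>n. z * (airy_coeff n * z ^ n)) = (\<lambda>n. diffs (diffs airy_coeff) (Suc n) * z ^ Suc n)"
    proof
      fix n
      have "diffs (diffs airy_coeff) (Suc n) = of_nat (n + 2) * of_nat (n + 3) * airy_coeff (n + 3)"
        by (simp add: diffs_def numeral_3_eq_3 algebra_simps)
      then show "z * (airy_coeff n * z ^ n) = diffs (diffs airy_coeff) (Suc n) * z ^ Suc n"
        unfolding airy_coeff_rec by simp
    qed
    finally have "(\<lambda>n. diffs (diffs airy_coeff) n * z ^ n) sums (z * airy z + diffs (diffs airy_coeff) 0 * z ^ 0)"
      by (rule sums_Suc)
    \<comment> \<open>The constant term of the second derivative is twice the coefficient of z^2,
      which vanishes because 2 mod 3 is neither 0 nor 1.\<close>
    moreover have "diffs (diffs airy_coeff) 0 = 0" by (simp add: diffs_def airy_coeff_def)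
    ultimately show ?thesis by (simp add: sums_iff)
  qed
  ultimately show "(airy' has_field_derivative z * airy z) (at z)" by simp
qed

text \<open>Iterating the recursion produces the rising factorials in the series
  \<open>airy_f\<close>; the next lemma does the same for \<open>airy_g\<close>.\<close>

lemma cubic_moment_3k: "cubic_moment (3 * k) = 3 ^ k * pochhammer (1 / 3) k * cubic_moment 0"
proof (induction k)
  case (Suc k)
  have "cubic_moment (3 * Suc k) = (real (3 * k) + 1) * cubic_moment (3 * k)"
    using cubic_moment_rec[of "3 * k"] by (simp add: add.commute)
  then show ?case unfolding Suc by (simp add: pochhammer_Suc algebra_simps)
qed simp

lemma cubic_moment_3k1: "cubic_moment (3 * k + 1) = 3 ^ k * pochhammer (2 / 3) k * cubic_moment 1"
proof (induction k)
  case (Suc k)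
  have "cubic_moment (3 * Suc k + 1) = (real (3 * k + 1) + 1) * cubic_moment (3 * k + 1)"
    using cubic_moment_rec[of "3 * k + 1"] by (simp add: algebra_simps)
  then show ?case unfolding Suc by (simp add: pochhammer_Suc algebra_simps)
qed simp

text \<open>These fix the normalisation of Ai. Euler's reflection formula gives Gamma (1/3) Gamma
  (2/3) = 2 pi / sqrt 3, which cancels the factor sqrt 3 / (2 pi) of
  \<open>airy_coeff\<close>.\<close>

lemma cubic_moment_0: "sqrt 3 / (2 * pi) * cubic_moment 0 = 1 / (3 powr (2/3) * Gamma (2/3))"
  and cubic_moment_1: "sqrt 3 / (2 * pi) * cubic_moment 1 = 1 / (3 powr (1/3) * Gamma (1/3))"
proof -
  have "Gamma (1/3 :: complex) * Gamma (1 - 1/3) = of_real pi / sin (of_real pi * (1/3))"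
    by (rule Gamma_reflection_complex)
  also have "of_real pi * (1/3) = complex_of_real (pi / 3)" by simp
  also have "sin (complex_of_real (pi / 3)) = of_real (sqrt 3 / 2)"
    by (simp only: sin_of_real sin_60)
  also have "Gamma (1/3 :: complex) = of_real (Gamma (1/3))"
    using Gamma_complex_of_real[of "1/3"] by simp
  also have "Gamma (1 - 1/3 :: complex) = of_real (Gamma (2/3))"
    using Gamma_complex_of_real[of "2/3"] by simp
  finally have "complex_of_real (Gamma (1/3) * Gamma (2/3)) = of_real (pi / (sqrt 3 / 2))" by simp
  then have G: "Gamma (1/3 :: real) * Gamma (2/3) = pi / (sqrt 3 / 2)" by (simp only: of_real_eq_iff)
  have pos: "Gamma (1/3 :: real) \<noteq> 0" "Gamma (2/3 :: real) \<noteq> 0"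
    using Gamma_real_pos[of "1/3"] Gamma_real_pos[of "2/3"] by (metis less_irrefl zero_less_divide_iff zero_less_numeral zero_less_one)+
  have p: "(3::real) powr (2/3) * 3 powr - (2/3) = 1" "(3::real) powr (1/3) * 3 powr - (1/3) = 1"
    by (simp_all flip: powr_add)
  have "(sqrt 3 / (2 * pi) * cubic_moment 0) * (3 powr (2/3) * Gamma (2/3)) =
      (3 powr (2/3) * 3 powr - (2/3)) * (sqrt 3 / (2 * pi) * (Gamma (1/3) * Gamma (2/3)))"
    by (simp add: cubic_moment_Gamma)
  also have "\<dots> = 1" unfolding p G by simp
  finally show "sqrt 3 / (2 * pi) * cubic_moment 0 = 1 / (3 powr (2/3) * Gamma (2/3))"
    by (rule nonzero_eq_divide_eq[THEN iffD2, rotated]) (use pos in auto)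
  have "(sqrt 3 / (2 * pi) * cubic_moment 1) * (3 powr (1/3) * Gamma (1/3)) =
      (3 powr (1/3) * 3 powr - (1/3)) * (sqrt 3 / (2 * pi) * (Gamma (1/3) * Gamma (2/3)))"
    by (simp add: cubic_moment_Gamma)
  also have "\<dots> = 1" unfolding p G by simp
  finally show "sqrt 3 / (2 * pi) * cubic_moment 1 = 1 / (3 powr (1/3) * Gamma (1/3))"
    by (rule nonzero_eq_divide_eq[THEN iffD2, rotated]) (use pos in auto)
qed

text \<open>The gaps between the exponents are filled with zeros, so that the two residue classes
  mod 3 can be added termwise to one series over all n.\<close>

lemma airy_f_g_sums:
  "(\<lambda>n. of_real (if n mod 3 = 0 then cubic_moment n / fact n else 0) * of_real x ^ n) sums (of_real (cubic_moment 0 * airy_f x) :: complex)"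
  "(\<lambda>n. of_real (if n mod 3 = 1 then cubic_moment n / fact n else 0) * of_real x ^ n) sums (of_real (cubic_moment 1 * airy_g x) :: complex)"
proof -
  have "summable (\<lambda>n. complex_of_real (cubic_moment n / fact n * \<bar>x\<bar> ^ n))"
    using cubic_exp_sums[of "of_real \<bar>x\<bar>", THEN sums_summable] by simp
  then have sm': "summable (\<lambda>n. cubic_moment n / fact n * \<bar>x\<bar> ^ n)"
    by (simp only: summable_complex_of_real)
  define F where "F = (\<lambda>r n. (if n mod 3 = r then cubic_moment n / fact n else 0) * x ^ n)"
  have smF: "summable (F r)" for r
    by (rule summable_comparison_test'[OF sm'])
       (use cubic_moment_pos in \<open>auto simp: F_def abs_mult power_abs less_imp_le\<close>)
  have 0: "(\<lambda>k. F 0 (3 * k)) sums suminf (F 0)"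
  proof (subst sums_mono_reindex)
    show "F 0 n = 0" if "n \<notin> range (\<lambda>k. 3 * k)" for n
    proof -
      have "n mod 3 \<noteq> 0"
      proof
        assume "n mod 3 = 0"
        then have "n = 3 * (n div 3)" by presburger
        then show False using that by blast
      qed
      then show ?thesis by (simp add: F_def)
    qed
  qed (use smF in \<open>auto simp: strict_mono_def sums_iff\<close>)
  have 1: "(\<lambda>k. F 1 (3 * k + 1)) sums suminf (F 1)"
  proof (subst sums_mono_reindex)
    show "F 1 n = 0" if "n \<notin> range (\<lambda>k. 3 * k + 1)" for n
    proof -
      have "n mod 3 \<noteq> 1"
      proof
        assume "n mod 3 = 1"
        then have "n = 3 * (n div 3) + 1" by presburger
        then show False using that by blast
      qed
      then show ?thesis by (simp add: F_def)
    qed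
  qed (use smF in \<open>auto simp: strict_mono_def sums_iff\<close>)
  have "suminf (F 0) = cubic_moment 0 * airy_f x"
  proof -
    have "F 0 (3 * k) = cubic_moment 0 * (3 ^ k * pochhammer (1/3) k / fact (3 * k) * x ^ (3 * k))" for k
      by (simp add: F_def cubic_moment_3k)
    then have "(\<lambda>k. cubic_moment 0 * (3 ^ k * pochhammer (1/3) k / fact (3 * k) * x ^ (3 * k))) sums suminf (F 0)"
      using 0 by simp
    moreover have "cubic_moment 0 \<noteq> 0" using cubic_moment_pos[of 0] by simp
    ultimately have "(\<lambda>k. 3 ^ k * pochhammer (1/3) k / fact (3 * k) * x ^ (3 * k)) sums (suminf (F 0) / cubic_moment 0)"
      by (rule sums_mult_D)
    then have "airy_f x = suminf (F 0) / cubic_moment 0" unfolding airy_f_def by (rule sums_unique[symmetric])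
    then show ?thesis using cubic_moment_pos[of 0] by simp
  qed
  moreover have "suminf (F 1) = cubic_moment 1 * airy_g x"
  proof -
    have "F 1 (3 * k + 1) = cubic_moment 1 * (3 ^ k * pochhammer (2/3) k / fact (3 * k + 1) * x ^ (3 * k + 1))" for k
      unfolding F_def cubic_moment_3k1 by simp
    then have "(\<lambda>k. cubic_moment 1 * (3 ^ k * pochhammer (2/3) k / fact (3 * k + 1) * x ^ (3 * k + 1))) sums suminf (F 1)"
      using 1 by simp
    moreover have "cubic_moment 1 \<noteq> 0" using cubic_moment_pos[of 1] by simp
    ultimately have "(\<lambda>k. 3 ^ k * pochhammer (2/3) k / fact (3 * k + 1) * x ^ (3 * k + 1)) sums (suminf (F 1) / cubic_moment 1)"
      by (rule sums_mult_D)
    then have "airy_g x = suminf (F 1) / cubic_moment 1" unfolding airy_g_def by (rule sums_unique[symmetric])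
    then show ?thesis using cubic_moment_pos[of 1] by simp
  qed
  moreover have S: "(\<lambda>n. complex_of_real (F r n)) sums of_real (suminf (F r))" for r
    using smF by (intro sums_of_real summable_sums)
  note S[of 0] S[of 1]
  ultimately show
    "(\<lambda>n. of_real (if n mod 3 = 0 then cubic_moment n / fact n else 0) * of_real x ^ n) sums (of_real (cubic_moment 0 * airy_f x) :: complex)"
    "(\<lambda>n. of_real (if n mod 3 = 1 then cubic_moment n / fact n else 0) * of_real x ^ n) sums (of_real (cubic_moment 1 * airy_g x) :: complex)"
    unfolding F_def by (simp_all only: of_real_mult of_real_power)
qed

text \<open>Since \<open>\<zeta> ^ n\<close> depends on n mod 3 only, the rotation multiplies the
  \<open>airy_g\<close> part by \<zeta> and leaves the \<open>airy_f\<close> part alone. The roots 1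
  and \<open>\<omega>3\<close> yield Ai and Ai - i Bi.\<close>

lemma airy_root_of_unity:
  assumes "\<zeta> ^ 3 = 1"
  shows "airy (\<zeta> * of_real x) = of_real (airy_f x / (3 powr (2/3) * Gamma (2/3)))
           - \<zeta> * of_real (airy_g x / (3 powr (1/3) * Gamma (1/3)))"
proof -
  have z: "\<zeta> ^ n = \<zeta> ^ (n mod 3)" for n
  proof -
    have "\<zeta> ^ n = \<zeta> ^ (3 * (n div 3) + n mod 3)" by simp
    then show ?thesis unfolding power_add power_mult assms by simp
  qed
  have "(\<lambda>n. of_real (sqrt 3 / (2 * pi)) * (of_real (if n mod 3 = 0 then cubic_moment n / fact n else 0) * of_real x ^ n)
      - of_real (sqrt 3 / (2 * pi)) * \<zeta> * (of_real (if n mod 3 = 1 then cubic_moment n / fact n else 0) * of_real x ^ n)) sums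
      (of_real (sqrt 3 / (2 * pi)) * of_real (cubic_moment 0 * airy_f x) - of_real (sqrt 3 / (2 * pi)) * \<zeta> * of_real (cubic_moment 1 * airy_g x))"
    by (intro sums_diff sums_mult airy_f_g_sums)
  also have "(\<lambda>n. of_real (sqrt 3 / (2 * pi)) * (of_real (if n mod 3 = 0 then cubic_moment n / fact n else 0) * of_real x ^ n)
      - of_real (sqrt 3 / (2 * pi)) * \<zeta> * (of_real (if n mod 3 = 1 then cubic_moment n / fact n else 0) * of_real x ^ n))
     = (\<lambda>n. airy_coeff n * (\<zeta> * of_real x) ^ n)"
  proof
    fix n :: nat
    have "n mod 3 = 0 \<or> n mod 3 = 1 \<or> n mod 3 = 2" by auto
    then show "of_real (sqrt 3 / (2 * pi)) * (of_real (if n mod 3 = 0 then cubic_moment n / fact n else 0) * of_real x ^ n)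
      - of_real (sqrt 3 / (2 * pi)) * \<zeta> * (of_real (if n mod 3 = 1 then cubic_moment n / fact n else 0) * of_real x ^ n)
      = airy_coeff n * (\<zeta> * of_real x) ^ n"
      unfolding power_mult_distrib z[of n] airy_coeff_def
      by (elim disjE) (simp_all add: mult_ac)
  qed
  finally have "airy (\<zeta> * of_real x) = of_real (sqrt 3 / (2 * pi)) * of_real (cubic_moment 0 * airy_f x) - of_real (sqrt 3 / (2 * pi)) * \<zeta> * of_real (cubic_moment 1 * airy_g x)"
    using airy_sums sums_unique2 by blast
  also have "\<dots> = of_real ((sqrt 3 / (2 * pi) * cubic_moment 0) * airy_f x) - \<zeta> * of_real ((sqrt 3 / (2 * pi) * cubic_moment 1) * airy_g x)"
    by (simp only: of_real_mult mult_ac)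
  finally show ?thesis unfolding cubic_moment_0 cubic_moment_1 by simp
qed

lemma Ai_eq_airy: "of_real (Ai x) = airy (of_real x)"
  using airy_root_of_unity[of 1 x] by (simp add: Ai_def)

text \<open>A classical connection formula. Writing Ai = F - G one has Bi = sqrt 3 (F + G), so it
  remains to compare the coefficients of F and of G.\<close>

lemma AimiBi_eq_airy: "AimiBi x = 2 * cis (- pi / 3) * airy (\<omega>3 * of_real x)"
proof -
  define F G where "F = airy_f x / (3 powr (2/3) * Gamma (2/3))" and "G = airy_g x / (3 powr (1/3) * Gamma (1/3))"
  have B: "Bi x = sqrt 3 * F + sqrt 3 * G"
  proof -
    have a: "(3::real) powr (1/6) * sqrt 3 = 3 powr (2/3)"
      using powr_add[of "3::real" "1/6" "1/2"] by (simp add: powr_half_sqrt)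
    have b: "(3::real) powr (1/6) * 3 powr (1/3) = sqrt 3"
      using powr_add[of "3::real" "1/6" "1/3"] by (simp add: powr_half_sqrt)
    have "sqrt 3 * F = airy_f x / (3 powr (1/6) * Gamma (2/3))"
      unfolding F_def a [symmetric] by simp
    moreover have "sqrt 3 * G = 3 powr (1/6) / Gamma (1/3) * airy_g x"
      unfolding G_def b [symmetric] by simp
    ultimately show ?thesis unfolding Bi_def by simp
  qed
  have A: "Ai x = F - G" by (simp add: Ai_def F_def G_def)
  have c: "cis (- pi / 3) = Complex (1 / 2) (- sqrt 3 / 2)"
    by (simp add: cis.ctr cos_60 sin_60)
  have r: "airy (\<omega>3 * of_real x) = of_real F - \<omega>3 * of_real G"
    unfolding F_def G_def by (rule airy_root_of_unity[OF omega3_cube])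
  show ?thesis unfolding r AimiBi_def A B c unfolding omega3
    by (simp add: complex_eq_iff algebra_simps)
qed

section \<open>Deformation of the two rays into a vertical line through a saddle\<close>

lemma primitive_ray_limit:
  fixes \<phi> :: "complex \<Rightarrow> complex"
  assumes \<Phi>: "\<And>s. (\<Phi> has_field_derivative \<phi> s) (at s)" and cont: "continuous_on UNIV \<phi>"
    and int: "set_integrable lborel {0..} (\<lambda>s. \<phi> (\<zeta> * of_real s))"
  shows "((\<lambda>R. \<Phi> (\<zeta> * of_real R) - \<Phi> 0) \<longlongrightarrow> \<zeta> * (LBINT s:{0..}. \<phi> (\<zeta> * of_real s))) at_top"
proof -
  define f where "f = (\<lambda>s::real. \<phi> (\<zeta> * of_real s))"
  have "((\<lambda>R. \<zeta> * set_lebesgue_integral lborel {0..R} f) \<longlongrightarrow> \<zeta> * set_lebesgue_integral lborel {0..} f) at_top"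
    unfolding f_def by (intro tendsto_mult_left tendsto_set_lebesgue_integral_at_top int) auto
  moreover have "\<zeta> * set_lebesgue_integral lborel {0..R} f = \<Phi> (\<zeta> * of_real R) - \<Phi> 0" if "R \<ge> 0" for R
  proof -
    have "((\<lambda>s. \<Phi> (\<zeta> * of_real s)) has_vector_derivative \<zeta> * f s) (at s within {0..R})" for s
    proof -
      have "((\<lambda>w. \<Phi> (\<zeta> * w)) has_field_derivative f s * \<zeta>) (at (of_real s))"
        unfolding f_def by (rule DERIV_chain2[OF \<Phi>]) (auto intro!: derivative_eq_intros)
      then have "((\<lambda>s. \<Phi> (\<zeta> * of_real s)) has_vector_derivative f s * \<zeta>) (at s within {0..R})"
        by (rule has_vector_derivative_real_field)
      then show ?thesis by (simp add: mult.commute)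
    qed
    moreover have "continuous_on {0..R} (\<lambda>s. \<zeta> * f s)"
      unfolding f_def by (intro continuous_intros continuous_on_compose2[OF cont]) auto
    ultimately have "(\<integral>s. indicator {0..R} s *\<^sub>R (\<zeta> * f s) \<partial>lborel) = \<Phi> (\<zeta> * of_real R) - \<Phi> (\<zeta> * of_real 0)"
      using that by (intro integral_FTC_Icc) auto
    moreover have "(\<integral>s. indicator {0..R} s *\<^sub>R (\<zeta> * f s) \<partial>lborel) = \<zeta> * set_lebesgue_integral lborel {0..R} f"
      unfolding set_lebesgue_integral_def
      by (subst integral_mult_right_zero [symmetric]) (intro arg_cong[where f="integral\<^sup>L lborel"] ext, simp)
    ultimately show ?thesis by simp
  qed
  then have "\<forall>\<^sub>F R in at_top. \<zeta> * set_lebesgue_integral lborel {0..R} f = \<Phi> (\<zeta> * of_real R) - \<Phi> 0"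
    by (auto intro!: eventually_at_top_linorderI[of 0])
  ultimately show ?thesis unfolding f_def
    by (rule Lim_transform_eventually)
qed

text \<open>On such a ray the cubic term decays as on the positive axis, so the integral converges
  and is a value of \<open>scorer\<close>.\<close>

lemma ray_integral_limit:
  fixes z \<zeta> :: complex
  assumes \<Phi>: "\<And>s. (\<Phi> has_field_derivative exp (z * s - s ^ 3 / 3)) (at s)" and \<zeta>: "\<zeta> ^ 3 = 1"
  shows "((\<lambda>R. \<Phi> (\<zeta> * of_real R) - \<Phi> 0) \<longlongrightarrow> \<zeta> * scorer (\<zeta> * z)) at_top"
proof -
  define f where "f = (\<lambda>s::real. exp (\<zeta> * z * of_real s - of_real s ^ 3 / 3) :: complex)"
  have eq: "exp (z * (\<zeta> * of_real s) - (\<zeta> * of_real s) ^ 3 / 3) = f s" for s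
    unfolding power_mult_distrib \<zeta> f_def by (simp add: mult_ac)
  have int: "set_integrable lborel {0..} f"
    unfolding set_integrable_def
  proof (rule Bochner_Integration.integrable_bound)
    show "integrable lborel (\<lambda>s. indicator {0..} s *\<^sub>R exp (Re (\<zeta> * z) * s - s ^ 3 / 3))"
      using set_integrable_cubic_exp unfolding set_integrable_def .
    show "AE s in lborel. norm (indicator {0..} s *\<^sub>R f s) \<le> norm (indicator {0..} s *\<^sub>R exp (Re (\<zeta> * z) * s - s ^ 3 / 3))"
      by (intro AE_I2) (auto simp: f_def indicator_def simp flip: of_real_power)
    show "(\<lambda>s. indicator {0..} s *\<^sub>R f s) \<in> borel_measurable lborel"
      unfolding f_def by measurable
  qed
  have "continuous_on UNIV (\<lambda>s. exp (z * s - s ^ 3 / 3))"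
    by (auto intro!: continuous_intros)
  from primitive_ray_limit[of \<Phi> "\<lambda>s. exp (z * s - s ^ 3 / 3)" \<zeta>, OF \<Phi> this] int
  show ?thesis unfolding eq scorer_def f_def by simp
qed

text \<open>At height h, between the vertical line Re s = -d and the ray through a cube root of
  unity, Re (s^3) = 3 a h^2 - a^3 with a \<le> h / sqrt 3, hence at least 8/3 a h^2. The integrand
  is therefore as small as a Gaussian in h.\<close>

lemma cubic_exp_horizontal_bound:
  fixes z :: complex and a d h \<sigma> :: real
  assumes "0 \<le> d" "d \<le> a" "a \<le> h / sqrt 3" "h \<ge> 0" "\<sigma>\<^sup>2 = 1"
  shows "norm (exp (z * Complex (- a) (\<sigma> * h) - Complex (- a) (\<sigma> * h) ^ 3 / 3)) \<le> exp (2 * norm z * h - 8 / 9 * d * h\<^sup>2)"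
proof -
  have "a\<^sup>2 \<le> (h / sqrt 3)\<^sup>2" using assms by (intro power_mono) auto
  then have a2: "a\<^sup>2 \<le> h\<^sup>2 / 3" by (simp add: power_divide)
  have 0: "norm (Complex (- a) (\<sigma> * h)) \<le> 2 * h"
    unfolding complex_norm
  proof (rule real_le_lsqrt)
    have "(- a)\<^sup>2 + (\<sigma> * h)\<^sup>2 = a\<^sup>2 + h\<^sup>2" by (simp add: power_mult_distrib assms)
    also have "\<dots> \<le> 4 * h\<^sup>2" using a2 zero_le_power2[of h] by linarith
    finally show "(- a)\<^sup>2 + (\<sigma> * h)\<^sup>2 \<le> (2 * h)\<^sup>2" by (simp add: power_mult_distrib)
  qed (use assms in auto)
  have "Re (z * Complex (- a) (\<sigma> * h)) \<le> norm z * norm (Complex (- a) (\<sigma> * h))"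
    using complex_Re_le_cmod[of "z * Complex (- a) (\<sigma> * h)"] unfolding norm_mult .
  also have "\<dots> \<le> norm z * (2 * h)"
    using 0 by (rule mult_left_mono) simp
  finally have 1: "Re (z * Complex (- a) (\<sigma> * h)) \<le> 2 * norm z * h"
    by linarith
  have re: "Re (Complex (- a) (\<sigma> * h) ^ 3) = - (a ^ 3) + 3 * a * (\<sigma>\<^sup>2 * h\<^sup>2)"
    by (simp add: power3_eq_cube power2_eq_square algebra_simps)
  have "a ^ 3 \<le> a * (h\<^sup>2 / 3)"
    using mult_left_mono[OF a2, of a] assms by (simp add: power3_eq_cube power2_eq_square)
  then have "- (a ^ 3) + 3 * a * (\<sigma>\<^sup>2 * h\<^sup>2) \<ge> 8 / 3 * (a * h\<^sup>2)"
    unfolding assms by (simp add: field_simps)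
  moreover have "a * h\<^sup>2 \<ge> d * h\<^sup>2" using assms by (intro mult_right_mono) auto
  ultimately have "Re (Complex (- a) (\<sigma> * h) ^ 3) \<ge> 8 / 3 * (d * h\<^sup>2)" using re by linarith
  with 1 show ?thesis by simp
qed

text \<open>Moving the ends of the contour from the rays to the vertical line costs nothing in the
  limit: the connecting segment has length at most h, which the Gaussian decay of the integrand
  beats.\<close>

lemma horizontal_limit:
  fixes z :: complex and d \<sigma> :: real
  assumes \<Phi>: "\<And>s. (\<Phi> has_field_derivative exp (z * s - s ^ 3 / 3)) (at s)" and d: "d > 0" and \<sigma>: "\<sigma>\<^sup>2 = 1"
  shows "((\<lambda>h. \<Phi> (Complex (- d) (\<sigma> * h)) - \<Phi> (Complex (- (h / sqrt 3)) (\<sigma> * h))) \<longlongrightarrow> 0) at_top"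
proof (rule Lim_null_comparison)
  show "((\<lambda>h. h * exp (2 * norm z * h - 8 / 9 * d * h\<^sup>2)) \<longlongrightarrow> 0) at_top"
    using d by real_asymp
  show "\<forall>\<^sub>F h in at_top. norm (\<Phi> (Complex (- d) (\<sigma> * h)) - \<Phi> (Complex (- (h / sqrt 3)) (\<sigma> * h))) \<le> h * exp (2 * norm z * h - 8 / 9 * d * h\<^sup>2)"
  proof (rule eventually_at_top_linorderI)
    fix h assume "h \<ge> d * sqrt 3"
    then have h: "d \<le> h / sqrt 3" and h0: "h \<ge> 0" using d
      using order_trans[OF mult_nonneg_nonneg[of d "sqrt 3"]] by (simp_all add: pos_le_divide_eq)
    define S where "S = closed_segment (Complex (- d) (\<sigma> * h)) (Complex (- (h / sqrt 3)) (\<sigma> * h))"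
    have "norm (exp (z * s - s ^ 3 / 3)) \<le> exp (2 * norm z * h - 8 / 9 * d * h\<^sup>2)" if "s \<in> S" for s
    proof -
      obtain u where u: "0 \<le> u" "u \<le> 1" "s = (1 - u) *\<^sub>R Complex (- d) (\<sigma> * h) + u *\<^sub>R Complex (- (h / sqrt 3)) (\<sigma> * h)"
        using \<open>s \<in> S\<close> by (auto simp: S_def in_segment)
      define a where "a = (1 - u) * d + u * (h / sqrt 3)"
      have s: "s = Complex (- a) (\<sigma> * h)"
        unfolding u a_def by (simp add: complex_eq_iff algebra_simps)
      have "a = d + u * (h / sqrt 3 - d)" by (simp add: a_def algebra_simps)
      moreover have "0 \<le> u * (h / sqrt 3 - d)" using u h by simp
      moreover have "u * (h / sqrt 3 - d) \<le> 1 * (h / sqrt 3 - d)" using u h by (intro mult_right_mono) auto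
      ultimately have "d \<le> a" "a \<le> h / sqrt 3" by auto
      then show ?thesis unfolding s by (intro cubic_exp_horizontal_bound) (use d h0 \<sigma> in auto)
    qed
    moreover have "convex S" by (simp add: S_def)
    ultimately have "norm (\<Phi> (Complex (- d) (\<sigma> * h)) - \<Phi> (Complex (- (h / sqrt 3)) (\<sigma> * h)))
       \<le> exp (2 * norm z * h - 8 / 9 * d * h\<^sup>2) * norm (Complex (- d) (\<sigma> * h) - Complex (- (h / sqrt 3)) (\<sigma> * h))"
      by (intro field_differentiable_bound[of S _ "\<lambda>s. exp (z * s - s ^ 3 / 3)"])
         (auto simp: S_def intro: has_field_derivative_at_within[OF \<Phi>])
    also have "Complex (- d) (\<sigma> * h) - Complex (- (h / sqrt 3)) (\<sigma> * h) = of_real (h / sqrt 3 - d)"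
      by (simp add: complex_eq_iff)
    also have "norm (of_real (h / sqrt 3 - d) :: complex) = h / sqrt 3 - d" unfolding norm_of_real using h by simp
    also have "\<dots> \<le> h / sqrt 3" using d by simp
    also have "\<dots> \<le> h / 1" using h0 by (intro divide_left_mono) auto
    finally show "norm (\<Phi> (Complex (- d) (\<sigma> * h)) - \<Phi> (Complex (- (h / sqrt 3)) (\<sigma> * h))) \<le> h * exp (2 * norm z * h - 8 / 9 * d * h\<^sup>2)"
      by (simp add: mult.commute[of h] mult_left_mono)
  qed
qed

text \<open>The exponent c^2 s - s^3 / 3 has a saddle at s = -c with value -2/3 c^3. The contour of
  \<open>airy\<close> is moved to the vertical line through it, and s = -c + i t leaves a quadratic
  and a cubic term in t.\<close>

lemma airy_vertical_line:
  fixes c :: complex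
  assumes c: "Re c > 0"
  shows "integrable lborel (\<lambda>t. exp (- c * of_real t ^ 2 + \<i> * of_real t ^ 3 / 3))"
    and "2 * pi * airy (c\<^sup>2) = exp (- (2 / 3) * c ^ 3) * (\<integral>t. exp (- c * of_real t ^ 2 + \<i> * of_real t ^ 3 / 3) \<partial>lborel)"
proof -
  define f where "f = (\<lambda>t::real. exp (- c * of_real t ^ 2 + \<i> * of_real t ^ 3 / 3))"
  show int: "integrable lborel (\<lambda>t. exp (- c * of_real t ^ 2 + \<i> * of_real t ^ 3 / 3))"
  proof (rule Bochner_Integration.integrable_bound)
    show "integrable lborel (\<lambda>t. \<bar>t\<bar> ^ 0 * exp (- Re c * t\<^sup>2))"
      by (rule integrable_abs_power_gauss[OF c])
  qed (auto simp flip: of_real_power)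
  then have intf: "integrable lborel f" by (simp add: f_def)
  define d where "d = Re c"
  have d: "d > 0" using c by (simp add: d_def)
  have "(\<lambda>s. exp (c\<^sup>2 * s - s ^ 3 / 3)) holomorphic_on UNIV" by (intro holomorphic_intros) auto
  then obtain \<Phi> where \<Phi>: "\<And>s. (\<Phi> has_field_derivative exp (c\<^sup>2 * s - s ^ 3 / 3)) (at s)"
    by (rule holomorphic_convex_primitive'[OF convex_UNIV open_UNIV]) auto
  let ?V = "\<lambda>h. \<Phi> (Complex (- d) h) - \<Phi> (Complex (- d) (- h))"
  \<comment> \<open>With this factor the points on the two rays lie at heights h and -h.\<close>
  have sc: "filterlim (\<lambda>h. 2 / sqrt 3 * h) at_top at_top" by real_asymp
  have L1: "((\<lambda>h. \<Phi> (\<omega>3 * of_real (2 / sqrt 3 * h)) - \<Phi> 0) \<longlongrightarrow> \<omega>3 * scorer (\<omega>3 * c\<^sup>2)) at_top"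
    by (rule filterlim_compose[OF ray_integral_limit[OF \<Phi> omega3_cube] sc])
  have w2: "(\<omega>3\<^sup>2) ^ 3 = 1"
  proof -
    have "(\<omega>3\<^sup>2) ^ 3 = (\<omega>3 ^ 3)\<^sup>2" by (simp flip: power_mult)
    then show ?thesis by (simp add: omega3_cube)
  qed
  have L2: "((\<lambda>h. \<Phi> (\<omega>3\<^sup>2 * of_real (2 / sqrt 3 * h)) - \<Phi> 0) \<longlongrightarrow> \<omega>3\<^sup>2 * scorer (\<omega>3\<^sup>2 * c\<^sup>2)) at_top"
    by (rule filterlim_compose[OF ray_integral_limit[OF \<Phi> w2] sc])
  have L3: "((\<lambda>h. \<Phi> (Complex (- d) h) - \<Phi> (\<omega>3 * of_real (2 / sqrt 3 * h))) \<longlongrightarrow> 0) at_top"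
  proof -
    have "\<omega>3 * of_real (2 / sqrt 3 * h) = Complex (- (h / sqrt 3)) (1 * h)" for h
      by (simp add: omega3 complex_eq_iff)
    then show ?thesis using horizontal_limit[OF \<Phi> d, of 1] by simp
  qed
  have L4: "((\<lambda>h. \<Phi> (Complex (- d) (- h)) - \<Phi> (\<omega>3\<^sup>2 * of_real (2 / sqrt 3 * h))) \<longlongrightarrow> 0) at_top"
  proof -
    have "\<omega>3\<^sup>2 * of_real (2 / sqrt 3 * h) = Complex (- (h / sqrt 3)) (- 1 * h)" for h
      by (simp add: omega3_sq complex_eq_iff)
    then show ?thesis using horizontal_limit[OF \<Phi> d, of "- 1"] by simp
  qed
  have "(?V \<longlongrightarrow> 0 + \<omega>3 * scorer (\<omega>3 * c\<^sup>2) - (0 + \<omega>3\<^sup>2 * scorer (\<omega>3\<^sup>2 * c\<^sup>2))) at_top"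
    using tendsto_diff[OF tendsto_add[OF L3 L1] tendsto_add[OF L4 L2]] by (simp add: algebra_simps)
  then have V: "(?V \<longlongrightarrow> 2 * pi * \<i> * airy (c\<^sup>2)) at_top"
    by (simp add: airy_def)
  \<comment> \<open>The integrand on the line Re s = -Re c, parametrised by y = Im s. Then t = y +
    Im c, a shift that disappears in the integral over the whole line.\<close>
  define q where "q = (\<lambda>y::real. exp (- (2 / 3) * c ^ 3) * f (y + Im c))"
  have q: "q y = exp (c\<^sup>2 * Complex (- d) y - Complex (- d) y ^ 3 / 3)" for y
  proof -
    define t where "t = y + Im c"
    have "Complex (- d) y = - c + \<i> * of_real t" by (simp add: complex_eq_iff d_def t_def)
    moreover have "c\<^sup>2 * (- c + \<i> * of_real t) - (- c + \<i> * of_real t) ^ 3 / 3 =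
        - (2 / 3) * c ^ 3 + (- c * of_real t ^ 2 + \<i> * of_real t ^ 3 / 3)"
      by (simp add: power3_eq_cube power2_eq_square field_simps)
    ultimately show ?thesis unfolding q_def f_def t_def [symmetric] by (simp only: mult_exp_exp)
  qed
  have intq: "integrable lborel q"
    unfolding q_def using intf lborel_integrable_real_affine[of f 1 "Im c"] by (simp add: add.commute)
  have "((\<lambda>h. \<integral>y. indicator {-h..h} y *\<^sub>R q y \<partial>lborel) \<longlongrightarrow> (\<integral>y. q y \<partial>lborel)) at_top"
  proof (rule integral_dominated_convergence_at_top[where w="\<lambda>y. norm (q y)"])
    show "AE y in lborel. ((\<lambda>h. indicator {-h..h} y *\<^sub>R q y) \<longlongrightarrow> q y) at_top"
    proof (rule AE_I2)
      fix y :: real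
      have "\<forall>\<^sub>F h in at_top. indicator {-h..h} y *\<^sub>R q y = q y"
        using eventually_ge_at_top[of "\<bar>y\<bar>"] by eventually_elim (auto simp: indicator_def)
      then show "((\<lambda>h. indicator {-h..h} y *\<^sub>R q y) \<longlongrightarrow> q y) at_top"
        by (rule tendsto_eventually)
    qed
    show "\<forall>\<^sub>F h in at_top. AE y in lborel. norm (indicator {-h..h} y *\<^sub>R q y) \<le> norm (q y)"
      by (intro always_eventually allI AE_I2) (auto simp: indicator_def)
  qed (use intq in \<open>auto intro: integrable_norm borel_measurable_integrable\<close>)
  then have "((\<lambda>h. \<i> * (\<integral>y. indicator {-h..h} y *\<^sub>R q y \<partial>lborel)) \<longlongrightarrow> \<i> * (\<integral>y. q y \<partial>lborel)) at_top"
    by (rule tendsto_mult_left)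
  moreover have "\<forall>\<^sub>F h in at_top. \<i> * (\<integral>y. indicator {-h..h} y *\<^sub>R q y \<partial>lborel) = ?V h"
  proof (rule eventually_at_top_linorderI)
    fix h :: real assume "h \<ge> 0"
    have "((\<lambda>y. \<Phi> (Complex (- d) y)) has_vector_derivative \<i> * q y) (at y within {-h..h})" for y
    proof -
      have C: "Complex (- d) y = - of_real d + \<i> * of_real y" for y by (simp add: complex_eq_iff)
      have "((\<lambda>w. \<Phi> (- of_real d + \<i> * w)) has_field_derivative q y * \<i>) (at (of_real y))"
        unfolding q C by (rule DERIV_chain2[OF \<Phi>]) (auto intro!: derivative_eq_intros)
      then have "((\<lambda>s. \<Phi> (- of_real d + \<i> * of_real s)) has_vector_derivative q y * \<i>) (at y within {-h..h})"
        by (rule has_vector_derivative_real_field)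
      then show ?thesis by (simp add: mult.commute C)
    qed
    moreover have "continuous_on {-h..h} (\<lambda>s. \<i> * q s)"
      unfolding q_def f_def by (auto intro!: continuous_intros)
    ultimately have "(\<integral>s. indicator {-h..h} s *\<^sub>R (\<i> * q s) \<partial>lborel) = ?V h"
      using \<open>h \<ge> 0\<close> by (intro integral_FTC_Icc) auto
    moreover have "(\<integral>s. indicator {-h..h} s *\<^sub>R (\<i> * q s) \<partial>lborel) = \<i> * (\<integral>y. indicator {-h..h} y *\<^sub>R q y \<partial>lborel)"
      by (subst integral_mult_right_zero [symmetric]) (intro arg_cong[where f="integral\<^sup>L lborel"] ext, simp)
    ultimately show "\<i> * (\<integral>y. indicator {-h..h} y *\<^sub>R q y \<partial>lborel) = ?V h" by simp
  qed
  ultimately have "(?V \<longlongrightarrow> \<i> * (\<integral>y. q y \<partial>lborel)) at_top"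
    by (rule Lim_transform_eventually)
  with V have "2 * pi * \<i> * airy (c\<^sup>2) = \<i> * (\<integral>y. q y \<partial>lborel)"
    by (rule tendsto_unique[rotated]) simp
  also have "(\<integral>y. q y \<partial>lborel) = exp (- (2 / 3) * c ^ 3) * (\<integral>y. f (y + Im c) \<partial>lborel)"
    unfolding q_def by simp
  also have "(\<integral>y. f (y + Im c) \<partial>lborel) = (\<integral>y. f y \<partial>lborel)"
    using lborel_integral_real_affine[of 1 f "Im c"] by (simp add: add.commute)
  finally show "2 * pi * airy (c\<^sup>2) = exp (- (2 / 3) * c ^ 3) * (\<integral>t. exp (- c * of_real t ^ 2 + \<i> * of_real t ^ 3 / 3) \<partial>lborel)"
    unfolding f_def by (simp add: mult.assoc)
qed

section \<open>Large-argument asymptotics\<close>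

text \<open>The saddle point integral in a scaled variable. Large arguments correspond to small k,
  and k = 0 leaves a pure Gaussian.\<close>

definition gauss_osc :: "real \<Rightarrow> real \<Rightarrow> complex" where
  "gauss_osc \<theta> k = (\<integral>w. exp (- cis (- \<theta>) * of_real w ^ 2 + \<i> * of_real k * of_real w ^ 3 / 3) \<partial>lborel)"

text \<open>Here c = sqrt s cis (-\<theta>) and t = s^(-1/4) w, which frees the quadratic
  coefficient from s and puts k = s^(-3/4) in front of the cubic term.\<close>

lemma airy_gauss_osc:
  assumes \<theta>: "\<bar>\<theta>\<bar> < pi / 2" and s: "s > 0"
  shows "airy (of_real s * cis (- 2 * \<theta>)) =
    of_real (s powr (-1/4) / (2 * pi)) * exp (- cis (- 3 * \<theta>) * of_real (2 / 3 * s powr (3/2))) * gauss_osc \<theta> (s powr (-3/4))"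
proof -
  define r c q where "r = s powr (1/2)" and "c = of_real r * cis (- \<theta>)" and "q = s powr (-1/4)"
  have r: "r > 0" using s by (simp add: r_def)
  have q: "q > 0" using s by (simp add: q_def)
  have cos: "cos \<theta> > 0" using \<theta> by (intro cos_gt_zero_pi) auto
  have Rc: "Re c > 0" using r cos by (simp add: c_def)
  have c2: "c\<^sup>2 = of_real s * cis (- 2 * \<theta>)"
  proof -
    have "r\<^sup>2 = s" using s unfolding r_def by (simp add: powr_half_sqrt)
    then show ?thesis unfolding c_def power_mult_distrib Complex.DeMoivre by (simp flip: of_real_power)
  qed
  have c3: "c ^ 3 = of_real (s powr (3/2)) * cis (- 3 * \<theta>)"
  proof -
    have "r ^ 3 = s powr (3/2)" using s unfolding r_def by (simp add: powr_power)
    then show ?thesis unfolding c_def power_mult_distrib Complex.DeMoivre by (simp flip: of_real_power)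
  qed
  define f where "f = (\<lambda>t::real. exp (- c * of_real t ^ 2 + \<i> * of_real t ^ 3 / 3))"
  have rq2: "r * q\<^sup>2 = 1" and q3: "q ^ 3 = s powr (-3/4)"
    using s unfolding r_def q_def by (simp_all add: powr_power flip: powr_add)
  have "(\<integral>t. f t \<partial>lborel) = \<bar>q\<bar> *\<^sub>R (\<integral>w. f (0 + q * w) \<partial>lborel)"
    using q by (intro lborel_integral_real_affine) auto
  also have "(\<lambda>w. f (0 + q * w)) = (\<lambda>w. exp (- cis (- \<theta>) * of_real w ^ 2 + \<i> * of_real (s powr (-3/4)) * of_real w ^ 3 / 3))"
  proof
    fix w :: real
    have "- c * of_real (q * w) ^ 2 = - of_real (r * q\<^sup>2) * cis (- \<theta>) * of_real w ^ 2"
      by (simp add: c_def power_mult_distrib)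
    moreover have "\<i> * of_real (q * w) ^ 3 / 3 = \<i> * of_real (q ^ 3) * of_real w ^ 3 / 3"
      by (simp add: power_mult_distrib)
    ultimately show "f (0 + q * w) = exp (- cis (- \<theta>) * of_real w ^ 2 + \<i> * of_real (s powr (-3/4)) * of_real w ^ 3 / 3)"
      unfolding f_def rq2 q3 by (simp add: mult.assoc)
  qed
  finally have "(\<integral>t. f t \<partial>lborel) = of_real q * gauss_osc \<theta> (s powr (-3/4))"
    using q by (simp add: gauss_osc_def scaleR_conv_of_real)
  moreover have "2 * pi * airy (c\<^sup>2) = exp (- (2 / 3) * c ^ 3) * (\<integral>t. f t \<partial>lborel)"
    unfolding f_def by (rule airy_vertical_line(2)[OF Rc])
  ultimately have "2 * pi * airy (c\<^sup>2) = exp (- (2 / 3) * c ^ 3) * (of_real q * gauss_osc \<theta> (s powr (-3/4)))"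
    by simp
  moreover have "- (2 / 3) * c ^ 3 = - cis (- 3 * \<theta>) * of_real (2 / 3 * s powr (3/2))"
    unfolding c3 by simp
  ultimately show ?thesis unfolding c2 q_def[symmetric] by (simp add: field_simps)
qed

text \<open>This segment closes the contour when the Gaussian is rotated. Its end points share the
  real part R cos (\<theta>/2), so Re (s^2) \<ge> R^2 cos \<theta> on it.\<close>

lemma vertical_limit_gauss:
  fixes \<theta> :: real
  assumes \<Phi>: "\<And>s. (\<Phi> has_field_derivative exp (- (s\<^sup>2))) (at s)" and c: "cos \<theta> > 0"
  shows "((\<lambda>R. \<Phi> (of_real (R * cos (\<theta> / 2))) - \<Phi> (cis (- \<theta> / 2) * of_real R)) \<longlongrightarrow> 0) at_top"
proof (rule Lim_null_comparison)
  show "((\<lambda>R. R * exp (- (R\<^sup>2 * cos \<theta>))) \<longlongrightarrow> 0) at_top"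
    using c by real_asymp
  have ct: "cos \<theta> = (cos (\<theta> / 2))\<^sup>2 - (sin (\<theta> / 2))\<^sup>2"
    using cos_double[of "\<theta> / 2"] by simp
  show "\<forall>\<^sub>F R in at_top. norm (\<Phi> (of_real (R * cos (\<theta> / 2))) - \<Phi> (cis (- \<theta> / 2) * of_real R)) \<le> R * exp (- (R\<^sup>2 * cos \<theta>))"
  proof (rule eventually_at_top_linorderI)
    fix R :: real assume R: "R \<ge> 0"
    define S where "S = closed_segment (of_real (R * cos (\<theta> / 2))) (cis (- \<theta> / 2) * of_real R)"
    have "norm (exp (- (s\<^sup>2))) \<le> exp (- (R\<^sup>2 * cos \<theta>))" if "s \<in> S" for s
    proof -
      obtain u where u: "0 \<le> u" "u \<le> 1" "s = (1 - u) *\<^sub>R of_real (R * cos (\<theta> / 2)) + u *\<^sub>R (cis (- \<theta> / 2) * of_real R)"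
        using \<open>s \<in> S\<close> by (auto simp: S_def in_segment)
      have s: "s = Complex (R * cos (\<theta> / 2)) (- (u * R * sin (\<theta> / 2)))"
        unfolding u by (simp add: complex_eq_iff algebra_simps)
      have "Re (s\<^sup>2) = (R * cos (\<theta> / 2))\<^sup>2 - u\<^sup>2 * (R * sin (\<theta> / 2))\<^sup>2"
        unfolding s by (simp add: power2_eq_square algebra_simps)
      moreover have "u\<^sup>2 * (R * sin (\<theta> / 2))\<^sup>2 \<le> 1 * (R * sin (\<theta> / 2))\<^sup>2"
        using u by (intro mult_right_mono) (auto simp: power_le_one)
      ultimately have "Re (s\<^sup>2) \<ge> (R * cos (\<theta> / 2))\<^sup>2 - (R * sin (\<theta> / 2))\<^sup>2" by linarith
      also have "(R * cos (\<theta> / 2))\<^sup>2 - (R * sin (\<theta> / 2))\<^sup>2 = R\<^sup>2 * cos \<theta>"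
        unfolding ct by (simp add: power_mult_distrib algebra_simps)
      finally show ?thesis by simp
    qed
    moreover have "convex S" by (simp add: S_def)
    ultimately have "norm (\<Phi> (of_real (R * cos (\<theta> / 2))) - \<Phi> (cis (- \<theta> / 2) * of_real R))
       \<le> exp (- (R\<^sup>2 * cos \<theta>)) * norm (of_real (R * cos (\<theta> / 2)) - cis (- \<theta> / 2) * of_real R)"
      by (intro field_differentiable_bound[of S _ "\<lambda>s. exp (- (s\<^sup>2))"])
         (auto simp: S_def intro: has_field_derivative_at_within[OF \<Phi>])
    also have "of_real (R * cos (\<theta> / 2)) - cis (- \<theta> / 2) * of_real R = \<i> * of_real (R * sin (\<theta> / 2))"
      by (simp add: complex_eq_iff)
    also have "norm (\<i> * of_real (R * sin (\<theta> / 2))) = R * \<bar>sin (\<theta> / 2)\<bar>"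
      using R by (simp add: norm_mult abs_mult)
    also have "\<dots> \<le> R * 1" using R by (intro mult_left_mono) auto
    finally show "norm (\<Phi> (of_real (R * cos (\<theta> / 2))) - \<Phi> (cis (- \<theta> / 2) * of_real R)) \<le> R * exp (- (R\<^sup>2 * cos \<theta>))"
      by (simp add: mult.commute[of R] mult_left_mono)
  qed
qed

lemma set_integrable_cis_gauss:
  assumes "cos \<theta> > 0"
  shows "set_integrable lborel {0..} (\<lambda>w. exp (- cis (- \<theta>) * of_real w ^ 2))"
  unfolding set_integrable_def
proof (rule Bochner_Integration.integrable_bound)
  show "integrable lborel (\<lambda>t. \<bar>t\<bar> ^ 0 * exp (- cos \<theta> * t\<^sup>2))"
    by (rule integrable_abs_power_gauss[OF assms])
qed (auto simp: indicator_def simp flip: of_real_power)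

text \<open>Rotating the path by \<theta>/2 turns the complex Gaussian on a half-line into the real
  one; evenness supplies the other half.\<close>

lemma gauss_osc_0:
  assumes \<theta>: "\<bar>\<theta>\<bar> < pi / 2"
  shows "gauss_osc \<theta> 0 = of_real (sqrt pi) * cis (\<theta> / 2)"
proof -
  have cos: "cos \<theta> > 0" using \<theta> by (intro cos_gt_zero_pi) auto
  have cos2: "cos (\<theta> / 2) > 0" using \<theta> by (intro cos_gt_zero_pi) auto
  have "(\<lambda>s::complex. exp (- (s\<^sup>2))) holomorphic_on UNIV" by (intro holomorphic_intros)
  then obtain \<Phi> :: "complex \<Rightarrow> complex" where \<Phi>: "\<And>s. (\<Phi> has_field_derivative exp (- (s\<^sup>2))) (at s)"
    by (rule holomorphic_convex_primitive'[OF convex_UNIV open_UNIV]) auto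
  have cont: "continuous_on UNIV (\<lambda>s::complex. exp (- (s\<^sup>2)))" by (intro continuous_intros)
  define G where "G = (\<lambda>w::real. exp (- cis (- \<theta>) * of_real w ^ 2))"
  have eqG: "exp (- ((cis (- \<theta> / 2) * of_real s)\<^sup>2)) = G s" for s
    unfolding power_mult_distrib Complex.DeMoivre G_def by simp
  have intG: "set_integrable lborel {0..} G"
    unfolding G_def by (rule set_integrable_cis_gauss[OF cos])
  have L1: "((\<lambda>R. \<Phi> (cis (- \<theta> / 2) * of_real R) - \<Phi> 0) \<longlongrightarrow> cis (- \<theta> / 2) * (LBINT s:{0..}. G s)) at_top"
    using primitive_ray_limit[of \<Phi> "\<lambda>s. exp (- (s\<^sup>2))" "cis (- \<theta> / 2)", OF \<Phi> cont] intG unfolding eqG by auto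
  have eq1: "exp (- ((1 * of_real s)\<^sup>2)) = complex_of_real (exp (- (s\<^sup>2)))" for s
    by (simp flip: of_real_power of_real_minus exp_of_real)
  have int1: "set_integrable lborel {0..} (\<lambda>s. complex_of_real (exp (- (s\<^sup>2))))"
    using set_integrable_cis_gauss[of 0] by (simp flip: of_real_power of_real_minus exp_of_real)
  have "(LBINT s:{0..}. complex_of_real (exp (- (s\<^sup>2)))) = of_real (sqrt pi / 2)"
  proof -
    have "(\<integral>s. complex_of_real (indicator {0..} s *\<^sub>R exp (- (s\<^sup>2))) \<partial>lborel) = of_real (sqrt pi / 2)"
      using gaussian_moment_0 by (simp only: integral_complex_of_real has_bochner_integral_iff)
    then show ?thesis unfolding set_lebesgue_integral_def by (simp add: scaleR_conv_of_real)
  qed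
  then have "((\<lambda>R. \<Phi> (1 * of_real R) - \<Phi> 0) \<longlongrightarrow> 1 * of_real (sqrt pi / 2)) at_top"
    using primitive_ray_limit[of \<Phi> "\<lambda>s. exp (- (s\<^sup>2))" 1, OF \<Phi> cont] int1 unfolding eq1 by (simp only:)
  moreover have "filterlim (\<lambda>R. R * cos (\<theta> / 2)) at_top at_top" using cos2 by real_asymp
  ultimately have "((\<lambda>R. \<Phi> (1 * of_real (R * cos (\<theta> / 2))) - \<Phi> 0) \<longlongrightarrow> 1 * of_real (sqrt pi / 2)) at_top"
    by (rule filterlim_compose)
  from tendsto_diff[OF this vertical_limit_gauss[OF \<Phi> cos]]
  have "((\<lambda>R. \<Phi> (cis (- \<theta> / 2) * of_real R) - \<Phi> 0) \<longlongrightarrow> of_real (sqrt pi / 2)) at_top"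
    by simp
  with L1 have "cis (- \<theta> / 2) * (LBINT s:{0..}. G s) = of_real (sqrt pi / 2)"
    by (rule tendsto_unique[rotated]) simp
  then have "cis (\<theta> / 2) * (cis (- \<theta> / 2) * (LBINT s:{0..}. G s)) = cis (\<theta> / 2) * of_real (sqrt pi / 2)" by (simp only:)
  then have half: "(LBINT s:{0..}. G s) = cis (\<theta> / 2) * of_real (sqrt pi / 2)"
    by (simp add: cis_mult flip: mult.assoc)
  have "has_bochner_integral lborel (\<lambda>s. indicator {0..} s *\<^sub>R G s) (cis (\<theta> / 2) * of_real (sqrt pi / 2))"
    using intG half unfolding set_integrable_def set_lebesgue_integral_def has_bochner_integral_iff by simp
  then have "has_bochner_integral lborel G (2 *\<^sub>R (cis (\<theta> / 2) * of_real (sqrt pi / 2)))"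
    by (rule has_bochner_integral_even_function) (simp add: G_def)
  then show ?thesis
    unfolding gauss_osc_def G_def by (simp add: has_bochner_integral_iff scaleR_conv_of_real)
qed

section \<open>Behaviour of the scaled saddle point integral near k = 0\<close>

lemma has_vector_derivative_quadratic:
  fixes f :: "real \<Rightarrow> 'a :: real_normed_vector"
  assumes "\<And>h. norm (f (x + h) - f x - h *\<^sub>R D) \<le> C * h\<^sup>2"
  shows "(f has_vector_derivative D) (at x)"
  unfolding has_vector_derivative_def has_derivative_at
proof (intro conjI bounded_linear_scaleR_left)
  show "(\<lambda>h. norm (f (x + h) - f x - h *\<^sub>R D) / norm h) \<midarrow>0\<rightarrow> 0"
  proof (rule Lim_null_comparison)
    show "((\<lambda>h. C * \<bar>h\<bar>) \<longlongrightarrow> 0) (at (0::real))"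
      by (auto intro!: tendsto_eq_intros)
    have "norm (f (x + h) - f x - h *\<^sub>R D) / \<bar>h\<bar> \<le> C * \<bar>h\<bar>" if "h \<noteq> 0" for h
      using assms[of h] that by (simp add: divide_le_eq power2_eq_square mult.assoc abs_mult_self_eq)
    then show "\<forall>\<^sub>F h in at 0. norm (norm (f (x + h) - f x - h *\<^sub>R D) / norm h) \<le> C * \<bar>h\<bar>"
      by (auto simp: eventually_at_filter)
  qed
qed

text \<open>Differentiation under the integral. At k = 0 the derivative is the integral of an odd
  function, hence 0. This gains one order in k, and it is the reason why the logarithmic derivatives
  are known up to O(s^(-5/2)).\<close>

lemma gauss_osc_derivative:
  assumes \<theta>: "\<bar>\<theta>\<bar> < pi / 2"
  shows "\<exists>M1 K. \<forall>k. (gauss_osc \<theta> has_vector_derivative M1 k) (at k) \<and> norm (M1 k) \<le> K * \<bar>k\<bar>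
             \<and> norm (gauss_osc \<theta> k - gauss_osc \<theta> 0) \<le> K * k\<^sup>2"
proof -
  define \<beta> where "\<beta> = cos \<theta>"
  have \<beta>: "\<beta> > 0" unfolding \<beta>_def using \<theta> by (intro cos_gt_zero_pi) auto
  define G where "G = (\<lambda>w::real. exp (- cis (- \<theta>) * of_real w ^ 2))"
  have normG: "norm (G w) = exp (- \<beta> * w\<^sup>2)" for w
    by (simp add: G_def \<beta>_def flip: of_real_power)
  have Gm: "G \<in> borel_measurable lborel" unfolding G_def by measurable
  define a where "a = (\<lambda>w::real. w ^ 3 / 3)"
  have am: "a \<in> borel_measurable lborel" unfolding a_def by measurable
  define e where "e = (\<lambda>k w. iexp (k * a w))"
  have em: "e k \<in> borel_measurable lborel" for k unfolding e_def a_def by measurable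
  have ne: "norm (e k w) = 1" for k w by (simp add: e_def)
  have M: "gauss_osc \<theta> k = (\<integral>w. e k w * G w \<partial>lborel)" for k
    unfolding gauss_osc_def e_def G_def a_def by (simp add: mult_exp_exp mult_ac)
  \<comment> \<open>All three errors are bounded pointwise by multiples of (a w)^2 |G w|, so this
    one moment controls them.\<close>
  define K where "K = (\<integral>w. (a w)\<^sup>2 * exp (- \<beta> * w\<^sup>2) \<partial>lborel)"
  have int2: "integrable lborel (\<lambda>w. (a w)\<^sup>2 * exp (- \<beta> * w\<^sup>2))"
  proof -
    have "integrable lborel (\<lambda>x. (1 / 9) * (\<bar>x\<bar> ^ 6 * exp (- \<beta> * x\<^sup>2)))"
      by (intro integrable_mult_right integrable_abs_power_gauss \<beta>)
    also have "(\<lambda>x. (1 / 9) * (\<bar>x\<bar> ^ 6 * exp (- \<beta> * x\<^sup>2))) = (\<lambda>w. (a w)\<^sup>2 * exp (- \<beta> * w\<^sup>2))"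
      by (simp add: a_def power_divide power_even_abs flip: power_mult)
    finally show ?thesis .
  qed
  have int0: "integrable lborel (\<lambda>w. e k w * G w)" for k
    by (rule Bochner_Integration.integrable_bound[OF integrable_abs_power_gauss[OF \<beta>, of 0]])
       (use em Gm in \<open>auto simp: norm_mult ne normG\<close>)
  have int1: "integrable lborel (\<lambda>w. \<i> * of_real (a w) * e k w * G w)" for k
  proof (rule Bochner_Integration.integrable_bound[OF integrable_abs_power_gauss[OF \<beta>, of 3]])
    have "norm (\<i> * of_real (a w) * e k w * G w) \<le> \<bar>w\<bar> ^ 3 * exp (- \<beta> * w\<^sup>2)" for w
    proof -
      have "norm (\<i> * of_real (a w) * e k w * G w) = \<bar>a w\<bar> * exp (- \<beta> * w\<^sup>2)"
        unfolding norm_mult ne normG norm_of_real by simp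
      also have "\<bar>a w\<bar> \<le> \<bar>w\<bar> ^ 3" by (simp add: a_def power_abs)
      finally show ?thesis by (simp add: mult_right_mono)
    qed
    then show "AE w in lborel. norm (\<i> * of_real (a w) * e k w * G w) \<le> norm (\<bar>w\<bar> ^ 3 * exp (- \<beta> * w\<^sup>2))"
      by (intro AE_I2) simp
    show "(\<lambda>w. \<i> * of_real (a w) * e k w * G w) \<in> borel_measurable lborel"
      unfolding a_def e_def G_def by measurable
  qed
  define M1 where "M1 = (\<lambda>k. \<integral>w. \<i> * of_real (a w) * e k w * G w \<partial>lborel)"
  have K: "K \<ge> 0" unfolding K_def by (rule integral_nonneg_AE) auto
  have est: "norm (\<integral>w. F w \<partial>lborel) \<le> c * K"
    if "integrable lborel F" "\<And>w. norm (F w) \<le> c * (a w)\<^sup>2 * norm (G w)" for F :: "real \<Rightarrow> complex" and c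
  proof -
    have "norm (\<integral>w. F w \<partial>lborel) \<le> (\<integral>w. norm (F w) \<partial>lborel)"
      by (rule integral_norm_bound)
    also have "\<dots> \<le> (\<integral>w. c * ((a w)\<^sup>2 * exp (- \<beta> * w\<^sup>2)) \<partial>lborel)"
      using that(2) by (intro integral_mono integrable_norm that integrable_mult_right int2) (simp add: normG mult.assoc)
    also have "\<dots> = c * K" by (simp add: K_def)
    finally show ?thesis .
  qed
  have ex1: "norm (iexp x - 1) \<le> \<bar>x\<bar>" for x using iexp_approx1[of x 0] by simp
  have ex2: "norm (iexp x - 1 - \<i> * of_real x) \<le> x\<^sup>2" for x
  proof -
    have "norm (iexp x - 1 - \<i> * of_real x) \<le> x\<^sup>2 / 2"
      using iexp_approx1[of x 1] by (simp add: algebra_simps power2_eq_square)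
    also have "\<dots> \<le> x\<^sup>2" by simp
    finally show ?thesis .
  qed
  have odd: "(\<integral>w. \<i> * of_real (a w) * e 0 w * G w \<partial>lborel) = 0" (is "?I = 0")
  proof -
    have "?I = \<bar>- 1\<bar> *\<^sub>R (\<integral>w. \<i> * of_real (a (0 + - 1 * w)) * e 0 (0 + - 1 * w) * G (0 + - 1 * w) \<partial>lborel)"
      by (rule lborel_integral_real_affine) simp
    also have "\<dots> = (\<integral>w. - (\<i> * of_real (a w) * e 0 w * G w) \<partial>lborel)"
      by (simp add: a_def e_def G_def)
    also have "\<dots> = - ?I" by (rule integral_minus)
    finally show ?thesis by simp
  qed
  have d: "(gauss_osc \<theta> has_vector_derivative M1 k) (at k)" for k
  proof (rule has_vector_derivative_quadratic)
    fix h
    have "gauss_osc \<theta> (k + h) - gauss_osc \<theta> k - h *\<^sub>R M1 k =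
       (\<integral>w. e (k + h) w * G w - e k w * G w - h *\<^sub>R (\<i> * of_real (a w) * e k w * G w) \<partial>lborel)"
      unfolding M M1_def using int0 int1 by simp
    also have "norm \<dots> \<le> h\<^sup>2 * K"
    proof (rule est)
      fix w
      have "e (k + h) w * G w - e k w * G w - h *\<^sub>R (\<i> * of_real (a w) * e k w * G w)
        = (iexp (h * a w) - 1 - \<i> * of_real (h * a w)) * (e k w * G w)"
        by (simp add: e_def algebra_simps exp_add scaleR_conv_of_real)
      also have "norm \<dots> \<le> (h * a w)\<^sup>2 * norm (G w)"
        unfolding norm_mult ne mult_1 by (rule mult_right_mono[OF ex2[of "h * a w"]]) simp
      finally show "norm (e (k + h) w * G w - e k w * G w - h *\<^sub>R (\<i> * of_real (a w) * e k w * G w)) \<le> h\<^sup>2 * (a w)\<^sup>2 * norm (G w)"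
        by (simp add: power_mult_distrib)
    qed (use int0 int1 in auto)
    finally show "norm (gauss_osc \<theta> (k + h) - gauss_osc \<theta> k - h *\<^sub>R M1 k) \<le> K * h\<^sup>2"
      by (simp add: mult.commute)
  qed
  have b1: "norm (M1 k) \<le> K * \<bar>k\<bar>" for k
  proof -
    have "M1 k = (\<integral>w. \<i> * of_real (a w) * e k w * G w - \<i> * of_real (a w) * e 0 w * G w \<partial>lborel)"
      unfolding M1_def using int1 odd by simp
    also have "norm \<dots> \<le> \<bar>k\<bar> * K"
    proof (rule est)
      fix w
      have "\<i> * of_real (a w) * e k w * G w - \<i> * of_real (a w) * e 0 w * G w = (\<i> * of_real (a w) * (iexp (k * a w) - 1)) * G w"
        by (simp add: e_def algebra_simps)
      also have "norm \<dots> = \<bar>a w\<bar> * norm (iexp (k * a w) - 1) * norm (G w)"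
        by (simp add: norm_mult)
      also have "\<dots> \<le> \<bar>a w\<bar> * \<bar>k * a w\<bar> * norm (G w)"
        by (intro mult_right_mono mult_left_mono ex1) auto
      also have "\<bar>a w\<bar> * \<bar>k * a w\<bar> = \<bar>k\<bar> * (\<bar>a w\<bar> * \<bar>a w\<bar>)" by (simp add: abs_mult)
      also have "\<bar>a w\<bar> * \<bar>a w\<bar> = (a w)\<^sup>2" by (simp add: power2_eq_square)
      finally show "norm (\<i> * of_real (a w) * e k w * G w - \<i> * of_real (a w) * e 0 w * G w) \<le> \<bar>k\<bar> * (a w)\<^sup>2 * norm (G w)" .
    qed (use int1 in auto)
    finally show ?thesis by (simp add: mult.commute)
  qed
  have b0: "norm (gauss_osc \<theta> k - gauss_osc \<theta> 0) \<le> K * k\<^sup>2" for k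
  proof -
    have "gauss_osc \<theta> k - gauss_osc \<theta> 0 =
       (\<integral>w. e k w * G w - e 0 w * G w - k *\<^sub>R (\<i> * of_real (a w) * e 0 w * G w) \<partial>lborel)"
      unfolding M using int0 int1 odd by simp
    also have "norm \<dots> \<le> k\<^sup>2 * K"
    proof (rule est)
      fix w
      have "e k w * G w - e 0 w * G w - k *\<^sub>R (\<i> * of_real (a w) * e 0 w * G w)
        = (iexp (k * a w) - 1 - \<i> * of_real (k * a w)) * G w"
        by (simp add: e_def algebra_simps scaleR_conv_of_real)
      also have "norm \<dots> \<le> (k * a w)\<^sup>2 * norm (G w)"
        unfolding norm_mult by (rule mult_right_mono[OF ex2[of "k * a w"]]) simp
      finally show "norm (e k w * G w - e 0 w * G w - k *\<^sub>R (\<i> * of_real (a w) * e 0 w * G w)) \<le> k\<^sup>2 * (a w)\<^sup>2 * norm (G w)"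
        by (simp add: power_mult_distrib)
    qed (use int0 int1 in auto)
    finally show ?thesis by (simp add: mult.commute)
  qed
  show ?thesis using d b1 b0 by blast
qed

text \<open>Both branches solve \<open>E'' = \<rho>\<^sup>2 s E\<close>: \<open>\<rho> = - 1\<close> is \<open>Ai(s)\<close>, and \<open>\<rho> = \<i>\<close> is \<open>(Ai - i Bi)(- s)\<close>, so that
  the two sides of the turning point can be treated at once.\<close>

locale airy_branch =
  fixes \<rho> :: complex and E E1 :: "real \<Rightarrow> complex" and \<gamma> :: complex and s1 K :: real
  assumes s1: "s1 \<ge> 1" and K: "K \<ge> 0" and norm_\<rho>: "norm \<rho> = 1" and \<gamma>: "\<gamma> \<noteq> 0"
    and dE: "\<And>s. (E has_vector_derivative E1 s) (at s)"
    and dE1: "\<And>s. (E1 has_vector_derivative \<rho>\<^sup>2 * of_real s * E s) (at s)"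
    and E_nz: "\<And>s. s \<ge> s1 \<Longrightarrow> E s \<noteq> 0"
    and log_deriv: "\<And>s. s \<ge> s1 \<Longrightarrow> norm (E1 s / E s - \<rho> * of_real (sqrt s) + of_real (1 / (4 * s))) \<le> K * s powr (-5/2)"
    and asymp: "\<And>s. s \<ge> s1 \<Longrightarrow>
       norm (E s * of_real (s powr (1/4)) * exp (- \<rho> * of_real (2 / 3 * s powr (3/2))) - \<gamma>) \<le> K * s powr (-3/2)"

text \<open>\<open>E\<close> is a constant times s^(-1/4), an exponential, and M =
  \<open>gauss_osc\<close> at k = s^(-3/4). Its logarithmic derivative is -1 / (4 s) + \<rho> sqrt s
  + M' / M, where M' = O(s^(-7/4) s^(-3/4)) by the chain rule.\<close>

lemma airy_branch_exists:
  assumes \<theta>: "\<bar>\<theta>\<bar> < pi / 2" and c: "c \<noteq> 0"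
  defines "\<rho> \<equiv> - cis (- 3 * \<theta>)"
    and "E \<equiv> \<lambda>s. c * airy (of_real s * cis (- 2 * \<theta>))"
    and "E1 \<equiv> \<lambda>s. c * cis (- 2 * \<theta>) * airy' (of_real s * cis (- 2 * \<theta>))"
  shows "\<exists>s1 K. airy_branch \<rho> E E1 (c * cis (\<theta> / 2) / of_real (2 * sqrt pi)) s1 K"
proof -
  obtain M1 K where M1: "\<And>k. (gauss_osc \<theta> has_vector_derivative M1 k) (at k)"
    "\<And>k. norm (M1 k) \<le> K * \<bar>k\<bar>" "\<And>k. norm (gauss_osc \<theta> k - gauss_osc \<theta> 0) \<le> K * k\<^sup>2"
    using gauss_osc_derivative[OF \<theta>] by blast
  have K: "K \<ge> 0" using M1(2)[of 1] norm_ge_zero[of "M1 1"] by linarith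
  have M0: "norm (gauss_osc \<theta> 0) = sqrt pi" unfolding gauss_osc_0[OF \<theta>] by (simp add: norm_mult)
  \<comment> \<open>From here on |M| is at least half of its limit sqrt pi, so it may be divided
    by.\<close>
  define s1 where "s1 = max 1 (2 * K / sqrt pi)"
  define c0 where "c0 = norm c / (2 * pi)"
  define K' where "K' = max (3 / 2 * K / sqrt pi) (c0 * K)"
  have dE: "(E has_vector_derivative E1 s) (at s)" for s
  proof -
    have "((\<lambda>w. c * airy (w * cis (- 2 * \<theta>))) has_field_derivative c * (airy' (of_real s * cis (- 2 * \<theta>)) * cis (- 2 * \<theta>))) (at (of_real s))"
      by (intro DERIV_cmult DERIV_chain2[OF airy_has_field_derivative]) (auto intro!: derivative_eq_intros)
    from has_vector_derivative_real_field[OF this] show ?thesis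
      unfolding E_def E1_def by (simp add: mult_ac)
  qed
  have dE1: "(E1 has_vector_derivative \<rho>\<^sup>2 * of_real s * E s) (at s)" for s
  proof -
    have "((\<lambda>w. c * cis (- 2 * \<theta>) * airy' (w * cis (- 2 * \<theta>))) has_field_derivative
        c * cis (- 2 * \<theta>) * ((of_real s * cis (- 2 * \<theta>)) * airy (of_real s * cis (- 2 * \<theta>)) * cis (- 2 * \<theta>))) (at (of_real s))"
      by (intro DERIV_cmult DERIV_chain2[OF airy'_has_field_derivative]) (auto intro!: derivative_eq_intros)
    from has_vector_derivative_real_field[OF this]
    have "(E1 has_vector_derivative c * cis (- 2 * \<theta>) * ((of_real s * cis (- 2 * \<theta>)) * airy (of_real s * cis (- 2 * \<theta>)) * cis (- 2 * \<theta>))) (at s)"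
      unfolding E1_def .
    also have "c * cis (- 2 * \<theta>) * ((of_real s * cis (- 2 * \<theta>)) * airy (of_real s * cis (- 2 * \<theta>)) * cis (- 2 * \<theta>))
       = cis (- 2 * \<theta>) ^ 3 * of_real s * E s"
      by (simp add: E_def power3_eq_cube)
    also have "cis (- 2 * \<theta>) ^ 3 = \<rho>\<^sup>2"
      by (simp add: \<rho>_def Complex.DeMoivre)
    finally show ?thesis .
  qed
  define P where "P = (\<lambda>s. s powr (-1/4) / (2 * pi))"
  define X where "X = (\<lambda>s. exp (\<rho> * of_real (2 / 3 * s powr (3/2))))"
  have E_eq: "E s = c * of_real (P s) * X s * gauss_osc \<theta> (s powr (-3/4))" if "s > 0" for s
    unfolding E_def airy_gauss_osc[OF \<theta> that] by (simp add: P_def X_def \<rho>_def)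
  have nzM: "norm (gauss_osc \<theta> (s powr (-3/4))) \<ge> sqrt pi / 2"
    and M_close: "norm (gauss_osc \<theta> (s powr (-3/4)) - gauss_osc \<theta> 0) \<le> K * s powr (-3/2)" if "s \<ge> s1" for s
  proof -
    have s: "s \<ge> 1" "2 * K / sqrt pi \<le> s" using that by (auto simp: s1_def)
    have "(s powr (-3/4))\<^sup>2 = s powr (-3/2)" using s by (simp add: powr_power)
    then show 1: "norm (gauss_osc \<theta> (s powr (-3/4)) - gauss_osc \<theta> 0) \<le> K * s powr (-3/2)"
      using M1(3)[of "s powr (-3/4)"] by simp
    have "s powr (-3/2) \<le> s powr (-1)" using s by (intro powr_mono) auto
    then have "K * s powr (-3/2) \<le> K * (1 / s)" using K s by (intro mult_left_mono) (auto simp: powr_minus_divide)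
    also have "\<dots> \<le> sqrt pi / 2" using s by (simp add: field_simps)
    finally have "norm (gauss_osc \<theta> (s powr (-3/4)) - gauss_osc \<theta> 0) \<le> sqrt pi / 2" using 1 by linarith
    moreover have "norm (gauss_osc \<theta> 0) \<le> norm (gauss_osc \<theta> (s powr (-3/4))) + norm (gauss_osc \<theta> (s powr (-3/4)) - gauss_osc \<theta> 0)"
      by (metis norm_minus_commute norm_triangle_sub)
    ultimately show "norm (gauss_osc \<theta> (s powr (-3/4))) \<ge> sqrt pi / 2" unfolding M0 by simp
  qed
  have E_nz: "E s \<noteq> 0" if "s \<ge> s1" for s
  proof -
    have "s > 0" using that by (simp add: s1_def)
    moreover have "norm (gauss_osc \<theta> (s powr (-3/4))) > 0" by (rule less_le_trans[OF _ nzM[OF that]]) simp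
    ultimately show ?thesis using c by (simp add: E_eq P_def X_def)
  qed
  have ld: "norm (E1 s / E s - \<rho> * of_real (sqrt s) + of_real (1 / (4 * s))) \<le> K' * s powr (-5/2)" if "s \<ge> s1" for s
  proof -
    have s: "s > 0" "s \<ge> 1" using that by (auto simp: s1_def)
    define m where "m = gauss_osc \<theta> (s powr (-3/4))"
    have m: "norm m \<ge> sqrt pi / 2" using nzM[OF that] by (simp add: m_def)
    have "norm m > 0" by (rule less_le_trans[OF _ m]) simp
    then have m0: "m \<noteq> 0" by simp
    have dP: "(P has_real_derivative P s * (- 1 / (4 * s))) (at s)"
    proof -
      have "(P has_real_derivative (- 1 / 4) * s powr (- 1 / 4 - 1) / (2 * pi)) (at s)"
        unfolding P_def using s by (intro DERIV_cdivide has_real_derivative_powr)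
      moreover have "s powr (- 1 / 4 - 1) = s powr (- 1 / 4) / s" using s by (subst powr_diff) simp
      ultimately show ?thesis by (simp add: P_def mult_ac)
    qed
    have dX: "(X has_vector_derivative X s * (\<rho> * of_real (sqrt s))) (at s)"
    proof -
      have "((\<lambda>s. 2 / 3 * s powr (3/2)) has_real_derivative sqrt s) (at s)"
        using s by (auto intro!: derivative_eq_intros simp: powr_half_sqrt)
      then have "((\<lambda>s. \<rho> * of_real (2 / 3 * s powr (3/2))) has_vector_derivative \<rho> * of_real (sqrt s)) (at s)"
        by (intro has_vector_derivative_mult_right has_vector_derivative_of_real)
      from field_vector_diff_chain_at[OF this DERIV_exp] show ?thesis
        by (simp add: X_def o_def mult_ac)
    qed
    have dm: "((\<lambda>s. gauss_osc \<theta> (s powr (-3/4))) has_vector_derivative (- 3 / 4 * s powr (-7/4)) *\<^sub>R M1 (s powr (-3/4))) (at s)"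
    proof -
      have "((\<lambda>s. s powr (-3/4)) has_real_derivative (- 3 / 4 * s powr (-7/4))) (at s)"
        using s by (auto intro!: derivative_eq_intros)
      then have "((\<lambda>s. s powr (-3/4)) has_vector_derivative (- 3 / 4 * s powr (-7/4))) (at s)"
        by (simp add: has_real_derivative_iff_has_vector_derivative)
      from vector_diff_chain_at[OF this M1(1)] show ?thesis by (simp add: o_def)
    qed
    have "((\<lambda>s. c * of_real (P s) * X s * gauss_osc \<theta> (s powr (-3/4))) has_vector_derivative
       c * of_real (P s) * X s * ((- 3 / 4 * s powr (-7/4)) *\<^sub>R M1 (s powr (-3/4))) +
       (c * of_real (P s) * (X s * (\<rho> * of_real (sqrt s))) + c * of_real (P s * (- 1 / (4 * s))) * X s) * m) (at s)"
      unfolding m_def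
      by (intro has_vector_derivative_mult dm dX has_vector_derivative_mult_right has_vector_derivative_of_real dP)
    then have "(E has_vector_derivative
       c * of_real (P s) * X s * ((- 3 / 4 * s powr (-7/4)) *\<^sub>R M1 (s powr (-3/4))) +
       (c * of_real (P s) * (X s * (\<rho> * of_real (sqrt s))) + c * of_real (P s * (- 1 / (4 * s))) * X s) * m) (at s)"
      by (rule has_vector_derivative_transform_within_open[of _ _ _ "{0<..}"]) (use s E_eq in auto)
    then have "E1 s = c * of_real (P s) * X s * ((- 3 / 4 * s powr (-7/4)) *\<^sub>R M1 (s powr (-3/4))) +
       (c * of_real (P s) * (X s * (\<rho> * of_real (sqrt s))) + c * of_real (P s * (- 1 / (4 * s))) * X s) * m"
      using dE[of s] by (rule vector_derivative_unique_at[rotated])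
    also have "\<dots> = E s * (of_real (- 3 / 4 * s powr (-7/4)) * (M1 (s powr (-3/4)) / m) + \<rho> * of_real (sqrt s) - of_real (1 / (4 * s)))"
      using m0 s unfolding E_eq[OF s(1)] m_def[symmetric] by (simp add: scaleR_conv_of_real field_simps)
    finally have "E1 s / E s = of_real (- 3 / 4 * s powr (-7/4)) * (M1 (s powr (-3/4)) / m) + \<rho> * of_real (sqrt s) - of_real (1 / (4 * s))"
      using E_nz[OF that] by simp
    then have "E1 s / E s - \<rho> * of_real (sqrt s) + of_real (1 / (4 * s)) = of_real (- 3 / 4 * s powr (-7/4)) * (M1 (s powr (-3/4)) / m)"
      by simp
    also have "norm \<dots> = 3 / 4 * s powr (-7/4) * (norm (M1 (s powr (-3/4))) / norm m)"
      unfolding norm_mult norm_of_real norm_divide by (simp add: abs_mult)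
    also have "\<dots> \<le> 3 / 4 * s powr (-7/4) * ((K * s powr (-3/4)) / (sqrt pi / 2))"
      using M1(2)[of "s powr (-3/4)"] m K by (intro mult_left_mono frac_le) auto
    also have "\<dots> = (3 / 2 * K / sqrt pi) * (s powr (-7/4) * s powr (-3/4))" by simp
    also have "s powr (-7/4) * s powr (-3/4) = s powr (-5/2)" by (simp flip: powr_add)
    also have "(3 / 2 * K / sqrt pi) * s powr (-5/2) \<le> K' * s powr (-5/2)" by (intro mult_right_mono) (auto simp: K'_def)
    finally show ?thesis .
  qed
  have as: "norm (E s * of_real (s powr (1/4)) * exp (- \<rho> * of_real (2 / 3 * s powr (3/2))) - c * cis (\<theta> / 2) / of_real (2 * sqrt pi)) \<le> K' * s powr (-3/2)"
    if "s \<ge> s1" for s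
  proof -
    have s: "s > 0" "s \<ge> 1" using that by (auto simp: s1_def)
    have X: "X s * exp (- \<rho> * of_real (2 / 3 * s powr (3/2))) = 1"
      unfolding X_def mult_exp_exp by simp
    have "s powr (-1/4) * s powr (1/4) = 1" using s by (simp flip: powr_add)
    then have P: "complex_of_real (P s) * of_real (s powr (1/4)) = of_real (1 / (2 * pi))"
      unfolding P_def of_real_mult[symmetric] by simp
    have "E s * of_real (s powr (1/4)) * exp (- \<rho> * of_real (2 / 3 * s powr (3/2))) =
       c * (complex_of_real (P s) * of_real (s powr (1/4))) * (X s * exp (- \<rho> * of_real (2 / 3 * s powr (3/2)))) * gauss_osc \<theta> (s powr (-3/4))"
      unfolding E_eq[OF s(1)] by (simp only: mult_ac)
    also have "\<dots> = c / (2 * pi) * gauss_osc \<theta> (s powr (-3/4))" unfolding X P by simp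
    finally have 1: "E s * of_real (s powr (1/4)) * exp (- \<rho> * of_real (2 / 3 * s powr (3/2))) = c / (2 * pi) * gauss_osc \<theta> (s powr (-3/4))" .
    have "sqrt pi / (2 * pi) = 1 / (2 * sqrt pi)" by (simp add: field_simps)
    then have "complex_of_real (sqrt pi) / (2 * of_real pi) = 1 / (2 * of_real (sqrt pi))"
      by (metis of_real_1 of_real_divide of_real_mult of_real_numeral)
    then have 2: "c * cis (\<theta> / 2) / of_real (2 * sqrt pi) = c / (2 * pi) * gauss_osc \<theta> 0"
      unfolding gauss_osc_0[OF \<theta>] by (simp add: field_simps)
    have "norm (c / (2 * pi) * gauss_osc \<theta> (s powr (-3/4)) - c / (2 * pi) * gauss_osc \<theta> 0) = c0 * norm (gauss_osc \<theta> (s powr (-3/4)) - gauss_osc \<theta> 0)"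
      unfolding right_diff_distrib[symmetric] norm_mult c0_def by (simp add: norm_divide norm_mult)
    also have "\<dots> \<le> c0 * (K * s powr (-3/2))"
      by (intro mult_left_mono M_close that) (simp add: c0_def)
    also have "\<dots> = (c0 * K) * s powr (-3/2)" by simp
    also have "\<dots> \<le> K' * s powr (-3/2)" by (intro mult_right_mono) (auto simp: K'_def)
    finally show ?thesis unfolding 1 2 .
  qed
  have "airy_branch \<rho> E E1 (c * cis (\<theta> / 2) / of_real (2 * sqrt pi)) s1 K'"
  proof
    show "K' \<ge> 0" using K by (auto simp: K'_def c0_def le_max_iff_disj)
    show "norm \<rho> = 1" by (simp add: \<rho>_def)
    show "c * cis (\<theta> / 2) / of_real (2 * sqrt pi) \<noteq> 0" using c by simp
  qed (use dE dE1 E_nz ld as in \<open>auto simp: s1_def\<close>)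
  then show ?thesis by blast
qed

section \<open>The two branches that are used: Ai and Ai - i Bi\<close>

lemma Ai_has_derivative: "(Ai has_real_derivative Re (airy' (of_real x))) (at x)"
proof -
  have "((\<lambda>x. airy (of_real x)) has_vector_derivative airy' (of_real x)) (at x)"
    by (rule has_vector_derivative_real_field[OF airy_has_field_derivative])
  then have "((\<lambda>x. Re (airy (of_real x))) has_vector_derivative Re (airy' (of_real x))) (at x)"
    by (rule bounded_linear.has_vector_derivative[OF bounded_linear_Re])
  moreover have "(\<lambda>x. Re (airy (of_real x))) = Ai"
    using Ai_eq_airy by (metis Re_complex_of_real ext)
  ultimately show ?thesis by (simp add: has_real_derivative_iff_has_vector_derivative)
qed

lemma deriv_Ai: "of_real (deriv Ai x) = airy' (of_real x)"
proof -
  have "((\<lambda>x. airy (of_real x)) has_vector_derivative airy' (of_real x)) (at x)"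
    by (rule has_vector_derivative_real_field[OF airy_has_field_derivative])
  moreover have "((\<lambda>x. airy (of_real x)) has_vector_derivative of_real (deriv Ai x)) (at x)"
    unfolding Ai_eq_airy[symmetric] using Ai_has_derivative[of x]
    by (intro has_vector_derivative_of_real) (simp add: DERIV_imp_deriv)
  ultimately show ?thesis by (rule vector_derivative_unique_at[rotated])
qed

lemma airy_branch_Ai:
  "\<exists>\<gamma> s1 K. airy_branch (- 1) (\<lambda>s. of_real (Ai s)) (\<lambda>s. of_real (deriv Ai s)) \<gamma> s1 K"
  using airy_branch_exists[of 0 1] by (auto simp: Ai_eq_airy deriv_Ai)

text \<open>As \<open>\<omega>3\<close> = -cis (-pi / 3), the negative axis is carried to the ray of
  argument -pi / 3, that is, \<theta> = pi / 6.\<close>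

lemma AimiBi_neg: "AimiBi (- s) = 2 * cis (- pi / 3) * airy (of_real s * cis (- 2 * (pi / 6)))"
proof -
  have w: "\<omega>3 = - cis (- pi / 3)" by (simp add: omega3 cis.ctr cos_60 sin_60 complex_eq_iff)
  have "\<omega>3 * of_real (- s) = of_real s * cis (- 2 * (pi / 6))" unfolding w by simp
  then show ?thesis unfolding AimiBi_eq_airy by (simp only:)
qed

text \<open>Here \<rho> = -cis (-pi / 2) = i. The phase -pi / 4, collected from cis (-pi / 3) and
  cis (pi / 12), is the source of the shift by pi / 4 in the final direction.\<close>

lemma airy_branch_AimiBi:
  "\<exists>s1 K. airy_branch \<i> (\<lambda>s. AimiBi (- s)) (\<lambda>s. - AimiBi' (- s)) (cis (- pi / 4) / of_real (sqrt pi)) s1 K"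
proof -
  define E1 where "E1 = (\<lambda>s. 2 * cis (- pi / 3) * cis (- 2 * (pi / 6)) * airy' (of_real s * cis (- 2 * (pi / 6))))"
  obtain s1 K where A: "airy_branch (- cis (- 3 * (pi / 6))) (\<lambda>s. AimiBi (- s)) E1
      (2 * cis (- pi / 3) * cis (pi / 6 / 2) / of_real (2 * sqrt pi)) s1 K"
    using airy_branch_exists[of "pi / 6" "2 * cis (- pi / 3)"] unfolding AimiBi_neg E1_def by auto
  interpret airy_branch "- cis (- 3 * (pi / 6))" "\<lambda>s. AimiBi (- s)" E1 "2 * cis (- pi / 3) * cis (pi / 6 / 2) / of_real (2 * sqrt pi)" s1 K
    by (rule A)
  have "- cis (- 3 * (pi / 6)) = \<i>" by (simp add: complex_eq_iff)
  moreover have "2 * cis (- pi / 3) * cis (pi / 6 / 2) / of_real (2 * sqrt pi) = cis (- pi / 4) / of_real (sqrt pi)"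
  proof -
    have "cis (- pi / 3) * cis (pi / 6 / 2) = cis (- pi / 4)" by (simp add: cis_mult)
    then show ?thesis by (simp add: mult.assoc)
  qed
  moreover have "E1 = (\<lambda>s. - AimiBi' (- s))"
  proof
    fix s
    have "((\<lambda>s. AimiBi (- (- s))) has_vector_derivative (- 1) *\<^sub>R E1 (- (- s))) (at (- s))"
      using vector_diff_chain_at[OF has_vector_derivative_minus[OF has_vector_derivative_id], of "\<lambda>s. AimiBi (- s)" "E1 s" "- s"] dE[of s]
      by (simp add: o_def)
    then have "AimiBi' (- s) = - E1 s" unfolding AimiBi'_def by (simp add: vector_derivative_at)
    then show "E1 s = - AimiBi' (- s)" by simp
  qed
  ultimately have "airy_branch \<i> (\<lambda>s. AimiBi (- s)) (\<lambda>s. - AimiBi' (- s)) (cis (- pi / 4) / of_real (sqrt pi)) s1 K"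
    using A by simp
  then show ?thesis by blast
qed

section \<open>Comparison of solutions with approximate solutions\<close>

text \<open>Takes the place of integral estimates below: a bound for a derivative is integrated by
  exhibiting a primitive of the bound, with one-sided derivatives at the ends.\<close>

lemma norm_diff_le_primitive:
  fixes f :: "real \<Rightarrow> 'a :: euclidean_space"
  assumes "p \<le> q"
    and f: "\<And>s. s \<in> {p..q} \<Longrightarrow> (f has_vector_derivative f' s) (at s within {p..q})"
    and g: "\<And>s. s \<in> {p..q} \<Longrightarrow> (g has_real_derivative g' s) (at s within {p..q})"
    and le: "\<And>s. s \<in> {p..q} \<Longrightarrow> norm (f' s) \<le> g' s"
    and x: "p \<le> x" "x \<le> y" "y \<le> q"
  shows "norm (f y - f x) \<le> g y - g x"
proof (cases "x = y")
  case False
  then have xy: "x < y" using x by simp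
  have sub: "{x..y} \<subseteq> {p..q}" using x by auto
  have f1: "(f has_vector_derivative f' s) (at s within {x..y})" if "s \<in> {x..y}" for s
    using f[of s] that sub by (meson has_vector_derivative_within_subset subsetD)
  have g1: "(g has_vector_derivative g' s) (at s within {x..y})" if "s \<in> {x..y}" for s
    using g[of s] that sub unfolding has_real_derivative_iff_has_vector_derivative
    by (meson has_vector_derivative_within_subset subsetD)
  show ?thesis
  proof (rule differentiable_bound_general[OF xy])
    show "continuous_on {x..y} f" by (rule continuous_on_vector_derivative[OF f1])
    show "continuous_on {x..y} g" by (rule continuous_on_vector_derivative[OF g1])
    fix s assume s: "x < s" "s < y"
    then have at: "at s within {x..y} = at s" by (intro at_within_interior) auto
    show "(f has_vector_derivative f' s) (at s)" "(g has_vector_derivative g' s) (at s)"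
      using f1[of s] g1[of s] s unfolding at by auto
    show "norm (f' s) \<le> g' s" using le s x by auto
  qed
qed simp

text \<open>The Wronskian \<open>a cnj Y - b cnj X\<close> against an approximate solution \<open>X\<close> is almost constant, and \<open>a\<close> is recovered
  from it because \<open>X\<close> and its conjugate are independent.\<close>

lemma variation_of_constants:
  fixes a b \<Gamma> \<Gamma>' k Q :: "real \<Rightarrow> real" and X Y P :: "real \<Rightarrow> complex"
  assumes pq: "p \<le> q"
    and a: "\<And>s. s \<in> {p..q} \<Longrightarrow> (a has_real_derivative b s) (at s within {p..q})"
    and b: "\<And>s. s \<in> {p..q} \<Longrightarrow> (b has_real_derivative - Q s * a s) (at s within {p..q})"
    and X: "\<And>s. s \<in> {p..q} \<Longrightarrow> (X has_vector_derivative Y s) (at s within {p..q})"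
    and Y: "\<And>s. s \<in> {p..q} \<Longrightarrow> (Y has_vector_derivative - P s * X s) (at s within {p..q})"
    and k: "\<And>s. s \<in> {p..q} \<Longrightarrow> norm (of_real (Q s) - P s) * (norm (X s))\<^sup>2 \<le> \<Gamma>' s"
    and \<Gamma>: "\<And>s. s \<in> {p..q} \<Longrightarrow> (\<Gamma> has_real_derivative \<Gamma>' s) (at s within {p..q})"
    and B: "\<Gamma> q - \<Gamma> p \<le> B" and w0: "w0 > 0" and small: "4 * B \<le> w0"
    and W: "\<And>s. s \<in> {p..q} \<Longrightarrow> norm (X s * cnj (Y s) - cnj (X s) * Y s) \<ge> w0"
    and t: "t \<in> {p..q}"
  defines "D0 \<equiv> norm ((of_real (a p) - of_real (Re (X p))) * cnj (Y p) - (of_real (b p) - of_real (Re (Y p))) * cnj (X p))"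
  shows "\<bar>a t - Re (X t)\<bar> \<le> 2 * (2 * D0 + 4 * B) / w0 * norm (X t)"
    and "\<bar>b t - Re (Y t)\<bar> \<le> 2 * (2 * D0 + 4 * B) / w0 * norm (Y t)"
proof -
  \<comment> \<open>The Wronskian of the error a - Re X with the conjugate of X. As Re X = (X + cnj
    X) / 2, it is the Wronskian of a minus half of that of X, and its derivative contains only
    differences of Q, P and cnj P.\<close>
  define D where "D = (\<lambda>s. (of_real (a s) - of_real (Re (X s))) * cnj (Y s) - (of_real (b s) - of_real (Re (Y s))) * cnj (X s))"
  define Wr where "Wr = (\<lambda>s. X s * cnj (Y s) - cnj (X s) * Y s)"
  have D_alt: "D s = of_real (a s) * cnj (Y s) - of_real (b s) * cnj (X s) - Wr s / 2" for s
    unfolding D_def Wr_def by (simp add: complex_eq_iff field_simps)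
  \<comment> \<open>Cramer's rule: the error and its derivative are real, so D and its conjugate are
    two linear equations that determine them.\<close>
  have ida: "(of_real (a s) - of_real (Re (X s))) * Wr s = D s * X s - cnj (D s * X s)" for s
    unfolding D_def Wr_def by (simp add: complex_eq_iff algebra_simps)
  have idb: "(of_real (b s) - of_real (Re (Y s))) * Wr s = D s * Y s - cnj (D s * Y s)" for s
    unfolding D_def Wr_def by (simp add: complex_eq_iff algebra_simps)
  have bound: "\<bar>r\<bar> \<le> 2 * norm (D s) / w0 * norm z" if "of_real r * Wr s = D s * z - cnj (D s * z)" "s \<in> {p..q}" for r s z
  proof -
    have "\<bar>r\<bar> * w0 \<le> \<bar>r\<bar> * norm (Wr s)" using W[OF that(2)] by (intro mult_left_mono) (auto simp: Wr_def)
    also have "\<dots> = norm (D s * z - cnj (D s * z))" unfolding that(1)[symmetric] by (simp add: norm_mult)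
    also have "\<dots> \<le> norm (D s * z) + norm (cnj (D s * z))" by (rule norm_triangle_ineq4)
    also have "\<dots> = 2 * (norm (D s) * norm z)" by (simp only: complex_mod_cnj norm_mult mult_2)
    finally show ?thesis using w0 by (simp add: pos_le_divide_eq mult_ac)
  qed
  have da: "\<bar>a s - Re (X s)\<bar> \<le> 2 * norm (D s) / w0 * norm (X s)" if "s \<in> {p..q}" for s
    using bound[of "a s - Re (X s)" s "X s"] ida[of s] that by simp
  have db: "\<bar>b s - Re (Y s)\<bar> \<le> 2 * norm (D s) / w0 * norm (Y s)" if "s \<in> {p..q}" for s
    using bound[of "b s - Re (Y s)" s "Y s"] idb[of s] that by simp
  define D' where "D' = (\<lambda>s. (of_real (Q s) - cnj (P s)) * of_real (a s) * cnj (X s) - (P s - cnj (P s)) * (X s * cnj (X s)) / 2)"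
  have dD: "(D has_vector_derivative D' s) (at s within {p..q})" if s: "s \<in> {p..q}" for s
  proof -
    note [derivative_intros] = has_vector_derivative_mult has_vector_derivative_diff has_vector_derivative_of_real bounded_linear.has_vector_derivative[OF bounded_linear_cnj]
    have "((\<lambda>s. of_real (a s) * cnj (Y s) - of_real (b s) * cnj (X s) - (X s * cnj (Y s) - cnj (X s) * Y s) * (1 / 2)) has_vector_derivative
        (of_real (a s) * cnj (- P s * X s) + of_real (b s) * cnj (Y s)) - (of_real (b s) * cnj (Y s) + of_real (- Q s * a s) * cnj (X s)) -
        ((X s * cnj (- P s * X s) + Y s * cnj (Y s)) - (cnj (X s) * (- P s * X s) + cnj (Y s) * Y s)) * (1 / 2)) (at s within {p..q})"
      using a[OF s] b[OF s] X[OF s] Y[OF s]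
      by (intro derivative_intros has_vector_derivative_mult_left)
    also have "(\<lambda>s. of_real (a s) * cnj (Y s) - of_real (b s) * cnj (X s) - (X s * cnj (Y s) - cnj (X s) * Y s) * (1 / 2)) = D"
      unfolding D_alt Wr_def by (simp add: D_alt Wr_def fun_eq_iff)
    also have "(of_real (a s) * cnj (- P s * X s) + of_real (b s) * cnj (Y s)) - (of_real (b s) * cnj (Y s) + of_real (- Q s * a s) * cnj (X s)) -
        ((X s * cnj (- P s * X s) + Y s * cnj (Y s)) - (cnj (X s) * (- P s * X s) + cnj (Y s) * Y s)) * (1 / 2) = D' s"
      unfolding D'_def by (simp add: field_simps)
    finally show ?thesis .
  qed
  have "continuous_on {p..q} (\<lambda>s. norm (D s))"
    by (rule continuous_on_norm[OF continuous_on_vector_derivative[OF dD]])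
  \<comment> \<open>The maximum of |D| is attained; bounding D in terms of its own maximum replaces
    a Gronwall argument.\<close>
  then obtain s0 where s0: "s0 \<in> {p..q}" "\<And>s. s \<in> {p..q} \<Longrightarrow> norm (D s) \<le> norm (D s0)"
    using continuous_attains_sup[of "{p..q}" "\<lambda>s. norm (D s)"] pq by (auto simp: atLeastatMost_empty_iff)
  define M where "M = norm (D s0)"
  have M: "M \<ge> 0" by (simp add: M_def)
  have nD: "norm (D' s) \<le> (2 + 2 * M / w0) * \<Gamma>' s" if s: "s \<in> {p..q}" for s
  proof -
    define d where "d = norm (of_real (Q s) - P s)"
    have c1: "norm (of_real (Q s) - cnj (P s)) = d"
      by (metis complex_cnj_complex_of_real complex_cnj_diff complex_mod_cnj d_def)
    have "P s - cnj (P s) = (of_real (Q s) - cnj (P s)) - (of_real (Q s) - P s)" by simp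
    then have c2: "norm (P s - cnj (P s)) \<le> 2 * d"
      using norm_triangle_ineq4[of "of_real (Q s) - cnj (P s)" "of_real (Q s) - P s"] c1 d_def by simp
    have "\<bar>a s\<bar> \<le> \<bar>a s - Re (X s)\<bar> + \<bar>Re (X s)\<bar>" by linarith
    also have "\<dots> \<le> 2 * norm (D s) / w0 * norm (X s) + norm (X s)"
      using da[OF s] abs_Re_le_cmod by (intro add_mono)
    also have "\<dots> \<le> 2 * M / w0 * norm (X s) + norm (X s)"
      using s0(2)[OF s] w0 by (intro add_mono mult_right_mono divide_right_mono) (auto simp: M_def)
    finally have ab: "\<bar>a s\<bar> \<le> (1 + 2 * M / w0) * norm (X s)" by (simp add: algebra_simps)
    have "norm (D' s) \<le> norm ((of_real (Q s) - cnj (P s)) * of_real (a s) * cnj (X s)) + norm ((P s - cnj (P s)) * (X s * cnj (X s)) / 2)"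
      unfolding D'_def by (rule norm_triangle_ineq4)
    also have "\<dots> = d * \<bar>a s\<bar> * norm (X s) + norm (P s - cnj (P s)) * (norm (X s) * norm (X s)) / 2"
      by (simp add: norm_mult norm_divide c1)
    also have "\<dots> \<le> d * ((1 + 2 * M / w0) * norm (X s)) * norm (X s) + (2 * d) * (norm (X s) * norm (X s)) / 2"
      by (intro add_mono mult_right_mono mult_left_mono divide_right_mono ab c2) (auto simp: d_def)
    also have "\<dots> = (2 + 2 * M / w0) * (d * (norm (X s))\<^sup>2)"
      by (simp add: algebra_simps power2_eq_square)
    also have "\<dots> \<le> (2 + 2 * M / w0) * \<Gamma>' s"
      using k[OF s] M w0 by (intro mult_left_mono) (auto simp: d_def)
    finally show ?thesis .
  qed
  have G': "((\<lambda>s. (2 + 2 * M / w0) * \<Gamma> s) has_real_derivative (2 + 2 * M / w0) * \<Gamma>' s) (at s within {p..q})" if "s \<in> {p..q}" for s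
    using \<Gamma>[OF that] by (rule DERIV_cmult)
  have "norm (D s0 - D p) \<le> (2 + 2 * M / w0) * \<Gamma> s0 - (2 + 2 * M / w0) * \<Gamma> p"
    by (rule norm_diff_le_primitive[OF pq dD G' nD]) (use s0 in auto)
  also have "\<dots> = (2 + 2 * M / w0) * (\<Gamma> s0 - \<Gamma> p)" by (simp only: right_diff_distrib)
  finally have 0: "norm (D s0 - D p) \<le> (2 + 2 * M / w0) * (\<Gamma> s0 - \<Gamma> p)" .
  have "\<Gamma> s0 \<le> \<Gamma> q"
  proof -
    have "norm (\<Gamma> q - \<Gamma> s0) \<le> \<Gamma> q - \<Gamma> s0"
    proof (rule norm_diff_le_primitive[OF pq _ \<Gamma>, where f' = \<Gamma>'])
      show "(\<Gamma> has_vector_derivative \<Gamma>' s) (at s within {p..q})" if "s \<in> {p..q}" for s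
        using \<Gamma>[OF that] by (simp add: has_real_derivative_iff_has_vector_derivative)
      show "norm (\<Gamma>' s) \<le> \<Gamma>' s" if "s \<in> {p..q}" for s
        using order_trans[OF _ k[OF that]] by simp
    qed (use s0 in auto)
    then show ?thesis by simp
  qed
  then have "(2 + 2 * M / w0) * (\<Gamma> s0 - \<Gamma> p) \<le> (2 + 2 * M / w0) * B"
    using B M w0 by (intro mult_left_mono) auto
  with 0 have 1: "norm (D s0 - D p) \<le> (2 + 2 * M / w0) * B" by linarith
  have "M \<le> norm (D p) + norm (D s0 - D p)" unfolding M_def by (metis norm_triangle_sub add.commute)
  then have "M \<le> D0 + (2 + 2 * M / w0) * B" using 1 by (simp add: D0_def D_def)
  \<comment> \<open>The smallness of B makes the feedback of M into itself at most M / 2, so it can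
    be absorbed.\<close>
  moreover have "2 * M / w0 * B \<le> M / 2"
    using mult_left_mono[OF small, of "M"] M w0 by (simp add: field_simps)
  ultimately have "M \<le> 2 * D0 + 4 * B" by (simp add: distrib_right)
  then have "norm (D t) \<le> 2 * D0 + 4 * B" using s0(2)[OF t] by (simp add: M_def)
  then have le: "2 * norm (D t) / w0 \<le> 2 * (2 * D0 + 4 * B) / w0" using w0 by (simp add: divide_right_mono)
  show "\<bar>a t - Re (X t)\<bar> \<le> 2 * (2 * D0 + 4 * B) / w0 * norm (X t)"
    using da[OF t] mult_right_mono[OF le norm_ge_zero[of "X t"]] by linarith
  show "\<bar>b t - Re (Y t)\<bar> \<le> 2 * (2 * D0 + 4 * B) / w0 * norm (Y t)"
    using db[OF t] mult_right_mono[OF le norm_ge_zero[of "Y t"]] by linarith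
qed

text \<open>Reduction of order: \<open>w = a / X\<close> satisfies \<open>(w' X\<^sup>2)' = - R w X\<^sup>2\<close>. As \<open>X\<close> is recessive, \<open>X\<^sup>2 B\<close> with
  \<open>B(s) = C M \<kappa> s\<^bsup>-3/2\<^esup> + K \<kappa> e\<^bsup>s-q\<^esup>\<close> is a barrier for \<open>w' X\<^sup>2\<close>, integrated backwards from \<open>q\<close>; the second
  term absorbs the mismatch of the initial slopes.\<close>

lemma recessive_comparison:
  fixes a a' X X' R :: "real \<Rightarrow> real"
  assumes p: "1 \<le> p" "p \<le> q"
    and a: "\<And>s. s \<in> {p..q} \<Longrightarrow> (a has_real_derivative a' s) (at s within {p..q})"
    and a': "\<And>s. s \<in> {p..q} \<Longrightarrow> (a' has_real_derivative Q s * a s) (at s within {p..q})"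
    and X: "\<And>s. s \<in> {p..q} \<Longrightarrow> (X has_real_derivative H s * X s) (at s within {p..q})"
    and X': "\<And>s. s \<in> {p..q} \<Longrightarrow> (X' has_real_derivative (Q s + R s) * X s) (at s within {p..q})"
    and X'_eq: "\<And>s. s \<in> {p..q} \<Longrightarrow> X' s = H s * X s"
    and nz: "\<And>s. s \<in> {p..q} \<Longrightarrow> X s \<noteq> 0"
    and H: "\<And>s. s \<in> {p..q} \<Longrightarrow> H s \<le> - 1" "\<And>s. s \<in> {p..q} \<Longrightarrow> H s \<le> - sqrt s / 2"
    and R: "\<And>s. s \<in> {p..q} \<Longrightarrow> \<bar>R s\<bar> \<le> C * \<kappa> / s"
    and init: "a q = X q" "\<bar>a' q / a q - H q\<bar> \<le> K * \<kappa>"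
    and pos: "\<kappa> > 0" "C \<ge> 0" "K \<ge> 0" and small: "4 * C * \<kappa> \<le> 1" "K * \<kappa> \<le> 1"
    and t: "t \<in> {p..q}"
  shows "\<bar>a t / X t - 1\<bar> \<le> (8 * C + K) * \<kappa>"
    and "\<bar>a' t / X t - H t * (a t / X t)\<bar> \<le> (8 * C + K) * \<kappa>"
proof -
  define w where "w = (\<lambda>s. a s / X s)"
  \<comment> \<open>This is \<open>w' X\<^sup>2\<close> written as a Wronskian, so that Q cancels in
    its derivative and only R remains.\<close>
  define V where "V = (\<lambda>s. a' s * X s - a s * X' s)"
  have dV: "(V has_real_derivative - (R s * w s * (X s)\<^sup>2)) (at s within {p..q})" if s: "s \<in> {p..q}" for s
  proof -
    have "(V has_real_derivative (Q s * a s * X s + H s * X s * a' s) - (a' s * X' s + (Q s + R s) * X s * a s)) (at s within {p..q})"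
      unfolding V_def by (intro DERIV_diff DERIV_mult a a' X X' s)
    also have "(Q s * a s * X s + H s * X s * a' s) - (a' s * X' s + (Q s + R s) * X s * a s) = - (R s * w s * (X s)\<^sup>2)"
      using nz[OF s] X'_eq[OF s] by (simp add: w_def power2_eq_square algebra_simps)
    finally show ?thesis .
  qed
  have dw: "(w has_real_derivative V s / (X s)\<^sup>2) (at s within {p..q})" if s: "s \<in> {p..q}" for s
  proof -
    have "(w has_real_derivative (a' s * X s - a s * (H s * X s)) / (X s * X s)) (at s within {p..q})"
      unfolding w_def by (intro DERIV_divide a X s nz)
    then show ?thesis by (simp add: V_def X'_eq[OF s] power2_eq_square)
  qed
  have w'_eq: "V s / (X s)\<^sup>2 = a' s / X s - H s * w s" if s: "s \<in> {p..q}" for s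
    using nz[OF s] by (simp add: V_def X'_eq[OF s] w_def power2_eq_square field_simps)
  have wq: "w q = 1" using init nz[of q] p by (simp add: w_def)
  have "continuous_on {p..q} (\<lambda>s. \<bar>w s\<bar>)"
    using dw by (intro continuous_on_rabs DERIV_continuous_on)
  then obtain s0 where s0: "s0 \<in> {p..q}" "\<And>s. s \<in> {p..q} \<Longrightarrow> \<bar>w s\<bar> \<le> \<bar>w s0\<bar>"
    using continuous_attains_sup[of "{p..q}" "\<lambda>s. \<bar>w s\<bar>"] p by (auto simp: atLeastatMost_empty_iff)
  define M where "M = \<bar>w s0\<bar>"
  have M: "M \<ge> 0" by (simp add: M_def)
  define B where "B = (\<lambda>s. C * M * \<kappa> * s powr (-3/2) + K * \<kappa> * exp (s - q))"
  define B' where "B' = (\<lambda>s. C * M * \<kappa> * (-3/2 * s powr (-5/2)) + K * \<kappa> * exp (s - q))"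
  have dB: "(B has_real_derivative B' s) (at s within {p..q})" if s: "s \<in> {p..q}" for s
    unfolding B_def B'_def using s p by (auto intro!: derivative_eq_intros)
  have V_le: "\<bar>V s\<bar> \<le> (X s)\<^sup>2 * B s" if s: "s \<in> {p..q}" for s
  proof -
    \<comment> \<open>The barrier decreases, hence the minus sign. Its decay rate -2 H \<ge> sqrt s
      turns the s^(-3/2) term into a bound for R w, while -2 H \<ge> 2 outweighs the growth rate 1
      of the exponential term.\<close>
    have d: "((\<lambda>s. - ((X s)\<^sup>2 * B s)) has_real_derivative (X s)\<^sup>2 * (- 2 * H s * B s - B' s)) (at s within {p..q})" if s: "s \<in> {p..q}" for s
    proof -
      have "((\<lambda>s. - ((X s * X s) * B s)) has_real_derivative - ((H s * X s * X s + H s * X s * X s) * B s + B' s * (X s * X s))) (at s within {p..q})"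
        by (intro DERIV_minus DERIV_mult X s dB)
      also have "- ((H s * X s * X s + H s * X s * X s) * B s + B' s * (X s * X s)) = (X s)\<^sup>2 * (- 2 * H s * B s - B' s)"
        by (simp add: power2_eq_square algebra_simps)
      finally show ?thesis by (simp add: power2_eq_square)
    qed
    have le: "norm (- (R s * w s * (X s)\<^sup>2)) \<le> (X s)\<^sup>2 * (- 2 * H s * B s - B' s)" if s: "s \<in> {p..q}" for s
    proof -
      have s1: "s \<ge> 1" using s p by auto
      have "sqrt s * s powr (-3/2) = s powr (1/2) * s powr (-3/2)" using s1 by (simp add: powr_half_sqrt)
      also have "\<dots> = 1 / s" unfolding powr_add [symmetric] using s1 by (simp add: powr_minus_divide)
      finally have ss: "sqrt s * s powr (-3/2) = 1 / s" .
      have 1: "- 2 * H s * (C * M * \<kappa> * s powr (-3/2)) \<ge> sqrt s * (C * M * \<kappa> * s powr (-3/2))"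
        using H(2)[OF s] pos M by (intro mult_right_mono) auto
      have 2: "- 2 * H s * (K * \<kappa> * exp (s - q)) \<ge> 2 * (K * \<kappa> * exp (s - q))"
        using H(1)[OF s] pos by (intro mult_right_mono) auto
      have 3: "C * M * \<kappa> * (3/2 * s powr (-5/2)) \<ge> 0" "K * \<kappa> * exp (s - q) \<ge> 0" using pos M by auto
      have "- 2 * H s * B s - B' s = - 2 * H s * (C * M * \<kappa> * s powr (-3/2)) + - 2 * H s * (K * \<kappa> * exp (s - q))
         + C * M * \<kappa> * (3/2 * s powr (-5/2)) - K * \<kappa> * exp (s - q)"
        by (simp add: B_def B'_def algebra_simps)
      also have "\<dots> \<ge> sqrt s * (C * M * \<kappa> * s powr (-3/2))" using 1 2 3 by linarith
      also have "sqrt s * (C * M * \<kappa> * s powr (-3/2)) = C * M * \<kappa> * (1 / s)" unfolding ss[symmetric] by simp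
      finally have "C * M * \<kappa> * (1 / s) \<le> - 2 * H s * B s - B' s" .
      moreover have "\<bar>R s * w s\<bar> \<le> C * \<kappa> / s * M"
        unfolding abs_mult using R[OF s] s0(2)[OF s] by (intro mult_mono) (auto simp: M_def)
      ultimately have "\<bar>R s * w s\<bar> \<le> - 2 * H s * B s - B' s" by (simp add: mult_ac)
      then have "(X s)\<^sup>2 * \<bar>R s * w s\<bar> \<le> (X s)\<^sup>2 * (- 2 * H s * B s - B' s)" by (intro mult_left_mono) auto
      then show ?thesis by (simp add: abs_mult mult.commute)
    qed
    have "norm (V q - V s) \<le> - ((X q)\<^sup>2 * B q) - - ((X s)\<^sup>2 * B s)"
      by (rule norm_diff_le_primitive[OF p(2) dV[unfolded has_real_derivative_iff_has_vector_derivative] d le]) (use s in auto)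
    moreover have "\<bar>V q\<bar> \<le> (X q)\<^sup>2 * B q"
    proof -
      have q: "q \<in> {p..q}" using p by simp
      have "V q = (X q)\<^sup>2 * (a' q / a q - H q)"
        using init nz[OF q] by (simp add: V_def X'_eq[OF q] power2_eq_square field_simps)
      then have "\<bar>V q\<bar> \<le> (X q)\<^sup>2 * (K * \<kappa>)" using init by (simp add: abs_mult mult_left_mono)
      also have "K * \<kappa> \<le> B q" unfolding B_def using pos M by simp
      finally show ?thesis by (simp add: mult_left_mono)
    qed
    ultimately show ?thesis by (simp add: abs_le_iff)
  qed
  have w'_le: "\<bar>V s / (X s)\<^sup>2\<bar> \<le> B s" if s: "s \<in> {p..q}" for s
    using V_le[OF s] nz[OF s] by (simp add: abs_divide pos_divide_le_eq mult.commute)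
  define P where "P = (\<lambda>s. C * M * \<kappa> * (- 2 * s powr (-1/2)) + K * \<kappa> * exp (s - q))"
  have dP: "(P has_real_derivative B s) (at s within {p..q})" if s: "s \<in> {p..q}" for s
    unfolding P_def B_def using s p by (auto intro!: derivative_eq_intros)
  have w1: "\<bar>w s - 1\<bar> \<le> (2 * C * M + K) * \<kappa>" if s: "s \<in> {p..q}" for s
  proof -
    have s1: "s \<ge> 1" using s p by auto
    have "norm (w q - w s) \<le> P q - P s"
      by (rule norm_diff_le_primitive[OF p(2) dw[unfolded has_real_derivative_iff_has_vector_derivative] dP]) (use s w'_le in auto)
    also have "\<dots> \<le> (2 * C * M + K) * \<kappa>"
    proof -
      have "s powr (-1/2) \<le> 1" using powr_mono[of "-1/2" 0 s] s1 by simp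
      then have "C * M * \<kappa> * s powr (-1/2) \<le> C * M * \<kappa> * 1" using pos M by (intro mult_left_mono) auto
      moreover have "C * M * \<kappa> * q powr (-1/2) \<ge> 0" "K * \<kappa> * exp (s - q) \<ge> 0" using pos M by auto
      ultimately show ?thesis by (simp add: P_def algebra_simps)
    qed
    finally show ?thesis by (simp add: wq abs_minus_commute)
  qed
  \<comment> \<open>A priori bound: 2 C M \<kappa> \<le> M / 2 and K \<kappa> \<le> 1 give M \<le> 2
    + M / 2.\<close>
  have "M \<le> 1 + \<bar>w s0 - 1\<bar>" unfolding M_def by linarith
  also have "\<dots> \<le> 1 + (2 * C * M + K) * \<kappa>" using w1[OF s0(1)] by simp
  also have "\<dots> \<le> 1 + (M / 2 + 1)"
    using mult_left_mono[OF small(1) M] small(2) by (simp add: algebra_simps)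
  finally have M4: "M \<le> 4" by simp
  have CM: "C * M \<le> C * 4" using M4 pos by (intro mult_left_mono) auto
  then have "(2 * C * M + K) * \<kappa> \<le> (8 * C + K) * \<kappa>" using pos by (intro mult_right_mono) auto
  then show "\<bar>a t / X t - 1\<bar> \<le> (8 * C + K) * \<kappa>"
    using w1[OF t] by (simp add: w_def)
  have "B t \<le> C * M * \<kappa> + K * \<kappa>"
  proof -
    have t1: "t \<ge> 1" using t p by auto
    have "t powr (-3/2) \<le> 1" using powr_mono[of "-3/2" 0 t] t1 by simp
    then have "C * M * \<kappa> * t powr (-3/2) \<le> C * M * \<kappa> * 1" using pos M by (intro mult_left_mono) auto
    moreover have "K * \<kappa> * exp (t - q) \<le> K * \<kappa> * 1" using pos t by (intro mult_left_mono) auto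
    ultimately show ?thesis unfolding B_def by linarith
  qed
  also have "\<dots> = (C * M + K) * \<kappa>" by (simp add: algebra_simps)
  also have "\<dots> \<le> (8 * C + K) * \<kappa>" using CM pos by (intro mult_right_mono) auto
  finally show "\<bar>a' t / X t - H t * (a t / X t)\<bar> \<le> (8 * C + K) * \<kappa>"
    using w'_le[OF t] w'_eq[OF t] by (simp add: w_def)
qed

section \<open>Corrected Liouville-Green approximants\<close>

text \<open>The Riccati form of the equation for the approximant. With r = sqrt s, q = sqrt g, z =
  \<open>\<sigma> s\<close>, c = \<rho>, k = \<kappa> and a, b the first two derivatives of g, the
  left side is H' + H^2 and the right side is \<rho>^2 s g + R. The first bracket is the derivative
  of E' / E.\<close>

lemma wkb_identity:
  fixes r q z c k a b :: complex
  assumes "r \<noteq> 0" "q \<noteq> 0"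
  shows "(c\<^sup>2 * r\<^sup>2 - (z + c * r)\<^sup>2) + c * ((q\<^sup>2 + r\<^sup>2 * (k * a)) / (2 * (r * q)) - 1 / (2 * r))
     - k\<^sup>2 * (b * q\<^sup>2 - a\<^sup>2) / (4 * (q\<^sup>2)\<^sup>2) + (z + c * (r * q) - k * a / (4 * q\<^sup>2))\<^sup>2
    = c\<^sup>2 * r\<^sup>2 * q\<^sup>2 + (2 * c * ((q - 1) * r) * (z + 1 / (4 * r\<^sup>2))
      - k\<^sup>2 * (b * q\<^sup>2 - a\<^sup>2) / (4 * (q\<^sup>2)\<^sup>2) + k\<^sup>2 * a\<^sup>2 / (16 * (q\<^sup>2)\<^sup>2) - z * (k * a / (2 * q\<^sup>2)))"
proof -
  have "(c\<^sup>2 * r\<^sup>2 - (z + c * r)\<^sup>2) + c * ((q\<^sup>2 + r\<^sup>2 * (k * a)) / (2 * (r * q)) - 1 / (2 * r))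
     + (z + c * (r * q) - k * a / (4 * q\<^sup>2))\<^sup>2
    = c\<^sup>2 * r\<^sup>2 * q\<^sup>2 + 2 * c * ((q - 1) * r) * (z + 1 / (4 * r\<^sup>2))
      + k\<^sup>2 * a\<^sup>2 / (16 * (q\<^sup>2)\<^sup>2) - z * (k * a / (2 * q\<^sup>2))"
    using assms by (simp add: field_simps power2_eq_square)
  then show ?thesis by (simp add: algebra_simps)
qed

lemma norm_triangle4: "norm (a - b + c - d) \<le> norm a + norm b + norm c + norm (d :: complex)"
proof -
  have "norm (a - b + c - d) \<le> norm (a - b + c) + norm d" by (rule norm_triangle_ineq4)
  also have "norm (a - b + c) \<le> norm (a - b) + norm c" by (rule norm_triangle_ineq)
  also have "norm (a - b) \<le> norm a + norm b" by (rule norm_triangle_ineq4)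
  finally show ?thesis by simp
qed

text \<open>One fixed \<kappa>, with g as a function of u = \<kappa> s. \<Theta> is only the
  difference between the true phase and the phase of Airy's equation, because E already contains the
  latter.\<close>

locale wkb = airy_branch +
  fixes g g1 g2 \<Theta> :: "real \<Rightarrow> real" and \<nu> G \<kappa> s0 :: real
  assumes \<nu>: "0 < \<nu>" "\<nu> \<le> 1" and \<kappa>: "0 < \<kappa>" and s0: "s1 \<le> s0" "\<kappa> * s0 \<le> \<nu>"
    and g_bounds: "\<And>u. u \<in> {0<..\<nu>} \<Longrightarrow> 1 / 2 \<le> g u \<and> g u \<le> 2"
    and g_1: "\<And>u. u \<in> {0<..\<nu>} \<Longrightarrow> \<bar>g u - 1\<bar> \<le> G * u"
    and dg: "\<And>u. u \<in> {0<..\<nu>} \<Longrightarrow> (g has_real_derivative g1 u) (at u)"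
    and dg1: "\<And>u. u \<in> {0<..\<nu>} \<Longrightarrow> (g1 has_real_derivative g2 u) (at u)"
    and g1_le: "\<And>u. u \<in> {0<..\<nu>} \<Longrightarrow> \<bar>g1 u\<bar> \<le> G"
    and g2_le: "\<And>u. u \<in> {0<..\<nu>} \<Longrightarrow> \<bar>g2 u\<bar> \<le> G"
    and d\<Theta>: "\<And>s. s \<in> {s0..\<nu>/\<kappa>} \<Longrightarrow>
       (\<Theta> has_real_derivative sqrt (s * g (\<kappa> * s)) - sqrt s) (at s within {s0..\<nu>/\<kappa>})"
begin

text \<open>With \<open>H\<close> its logarithmic derivative, \<open>X\<close> solves \<open>X'' = (\<rho>\<^sup>2 s g + R) X\<close>. The leading term of \<open>R\<close> is of size \<open>\<kappa> / s\<close>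
  only because \<open>E' / E\<close> is known up to the second order, including the term \<open>- 1 / (4 s)\<close>.\<close>

definition X :: "real \<Rightarrow> complex" where
  "X s = of_real (g (\<kappa> * s) powr (-1/4)) * E s * exp (\<rho> * of_real (\<Theta> s))"

text \<open>E' / E without its leading part; it is -1 / (4 s) up to O(s^(-5/2)).\<close>

definition \<sigma> :: "real \<Rightarrow> complex" where
  "\<sigma> s = E1 s / E s - \<rho> * of_real (sqrt s)"

definition H :: "real \<Rightarrow> complex" where
  "H s = \<sigma> s + \<rho> * of_real (sqrt s * sqrt (g (\<kappa> * s))) - of_real (\<kappa> * g1 (\<kappa> * s) / (4 * g (\<kappa> * s)))"

definition R :: "real \<Rightarrow> complex" where
  "R s = 2 * \<rho> * of_real ((sqrt (g (\<kappa> * s)) - 1) * sqrt s) * (\<sigma> s + of_real (1 / (4 * s)))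
     - of_real (\<kappa>\<^sup>2 * (g2 (\<kappa> * s) * g (\<kappa> * s) - (g1 (\<kappa> * s))\<^sup>2) / (4 * (g (\<kappa> * s))\<^sup>2))
     + of_real (\<kappa>\<^sup>2 * (g1 (\<kappa> * s))\<^sup>2 / (16 * (g (\<kappa> * s))\<^sup>2))
     - \<sigma> s * of_real (\<kappa> * g1 (\<kappa> * s) / (2 * g (\<kappa> * s)))"

context
  fixes s assumes s: "s \<in> {s0..\<nu>/\<kappa>}"
begin

lemma s_ge: "s \<ge> s1" "s \<ge> 1" and u_in: "\<kappa> * s \<in> {0<..\<nu>}"
  using s s0 s1 \<kappa> by (auto simp: field_simps intro: mult_pos_pos)

lemma g_pos: "g (\<kappa> * s) > 0" and sqrt_g: "1 / 2 \<le> sqrt (g (\<kappa> * s))" "sqrt (g (\<kappa> * s)) \<le> 2"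
  and G_nonneg: "G \<ge> 0"
proof -
  have g: "1 / 2 \<le> g (\<kappa> * s)" "g (\<kappa> * s) \<le> 2" using g_bounds[OF u_in] by auto
  then show "g (\<kappa> * s) > 0" by linarith
  show "1 / 2 \<le> sqrt (g (\<kappa> * s))" by (rule real_le_rsqrt) (use g in \<open>simp add: power2_eq_square\<close>)
  show "sqrt (g (\<kappa> * s)) \<le> 2" by (rule real_le_lsqrt) (use g in auto)
  show "G \<ge> 0" using g1_le[OF u_in] by linarith
qed

lemma \<sigma>_bounds: "norm (\<sigma> s + of_real (1 / (4 * s))) \<le> K * s powr (-5/2)" "norm (\<sigma> s) \<le> (K + 1) / s"
proof -
  show 1: "norm (\<sigma> s + of_real (1 / (4 * s))) \<le> K * s powr (-5/2)"
    using log_deriv[OF s_ge(1)] by (simp add: \<sigma>_def)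
  have "s powr (-5/2) \<le> s powr (-1)" using s_ge by (intro powr_mono) auto
  also have "\<dots> = 1 / s" using s_ge by (simp add: powr_minus_divide)
  finally have "K * s powr (-5/2) \<le> K * (1 / s)" by (intro mult_left_mono K)
  moreover have "norm (\<sigma> s) \<le> norm (\<sigma> s + of_real (1 / (4 * s))) + norm (of_real (1 / (4 * s)) :: complex)"
    using norm_triangle_ineq4[of "\<sigma> s + of_real (1 / (4 * s))" "of_real (1 / (4 * s)) :: complex"] by simp
  moreover have "norm (of_real (1 / (4 * s)) :: complex) \<le> 1 / s" using s_ge unfolding norm_of_real by (simp add: field_simps)
  ultimately show "norm (\<sigma> s) \<le> (K + 1) / s" using 1 by (simp add: add_divide_distrib)
qed

lemma sqrt_g_1: "\<bar>sqrt (g (\<kappa> * s)) - 1\<bar> \<le> G * \<kappa> * s"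
proof -
  define q where "q = sqrt (g (\<kappa> * s))"
  have q: "q \<ge> 0" "g (\<kappa> * s) = q\<^sup>2" using g_pos by (auto simp: q_def)
  have "\<bar>q - 1\<bar> * 1 \<le> \<bar>q - 1\<bar> * (q + 1)" using q by (intro mult_left_mono) auto
  also have "\<dots> = \<bar>(q - 1) * (q + 1)\<bar>" using q by (simp add: abs_mult)
  also have "(q - 1) * (q + 1) = g (\<kappa> * s) - 1" unfolding q by (simp add: power2_eq_square algebra_simps)
  also have "\<bar>g (\<kappa> * s) - 1\<bar> \<le> G * (\<kappa> * s)" by (rule g_1[OF u_in])
  finally show ?thesis by (simp add: q_def mult.assoc)
qed

lemma \<kappa>_le: "\<kappa> \<le> 1 / s" "\<kappa> \<le> 1"
proof -
  have "\<kappa> * s \<le> 1" using u_in \<nu> by auto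
  then show "\<kappa> \<le> 1 / s" using s_ge by (simp add: pos_le_divide_eq)
  also have "1 / s \<le> 1" using s_ge by simp
  finally show "\<kappa> \<le> 1" .
qed

text \<open>The first term is the delicate one: its factors are of size \<kappa> s, sqrt s and
  s^(-5/2), with product \<kappa> / s. The terms with \<kappa>^2 follow from \<kappa> \<le> 1 / s,
  the last one from \<sigma> = O(1 / s).\<close>

lemma R_bound: "norm (R s) \<le> (2 * G * K + 2 * G + 2 * G\<^sup>2 + (K + 1) * G) * \<kappa> / s"
proof -
  define y where "y = g (\<kappa> * s)"
  have y: "1 / 2 \<le> y" "y \<le> 2" using g_bounds[OF u_in] by (auto simp: y_def)
  have y2: "1 / 4 \<le> y\<^sup>2" using power_mono[OF y(1), of 2] by (simp add: power_divide)
  have G: "G \<ge> 0" by (rule G_nonneg)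
  have g1: "\<bar>g1 (\<kappa> * s)\<bar> \<le> G" and g2: "\<bar>g2 (\<kappa> * s)\<bar> \<le> G" using g1_le g2_le u_in by auto
  have g1s: "(g1 (\<kappa> * s))\<^sup>2 \<le> G\<^sup>2" using power_mono[OF g1, of 2] by simp
  have kk: "\<kappa>\<^sup>2 \<le> \<kappa> / s" using mult_left_mono[OF \<kappa>_le(1), of \<kappa>] \<kappa> by (simp add: power2_eq_square)
  have s0: "s > 0" using s_ge by simp
  have 1: "norm (2 * \<rho> * of_real ((sqrt y - 1) * sqrt s) * (\<sigma> s + of_real (1 / (4 * s)))) \<le> 2 * G * K * (\<kappa> / s)"
  proof -
    have "norm (2 * \<rho> * of_real ((sqrt y - 1) * sqrt s) * (\<sigma> s + of_real (1 / (4 * s)))) = 2 * (\<bar>sqrt y - 1\<bar> * sqrt s) * norm (\<sigma> s + of_real (1 / (4 * s)))"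
      unfolding norm_mult norm_\<rho> norm_of_real using s0 by (simp add: abs_mult)
    also have "\<dots> \<le> 2 * ((G * \<kappa> * s) * sqrt s) * (K * s powr (-5/2))"
      using sqrt_g_1 \<sigma>_bounds(1) s0 G \<kappa> K
      by (intro mult_mono mult_right_mono mult_left_mono) (auto simp: y_def)
    also have "\<dots> = 2 * G * K * \<kappa> * (s powr 1 * s powr (1/2) * s powr (-5/2))" using s0 by (simp add: powr_half_sqrt)
    also have "s powr 1 * s powr (1/2) * s powr (-5/2) = 1 / s" unfolding powr_add [symmetric] using s0 by (simp add: powr_minus_divide)
    finally show ?thesis by simp
  qed
  have 2: "norm (complex_of_real (\<kappa>\<^sup>2 * (g2 (\<kappa> * s) * y - (g1 (\<kappa> * s))\<^sup>2) / (4 * y\<^sup>2))) \<le> (2 * G + G\<^sup>2) * (\<kappa> / s)"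
  proof -
    have "\<bar>g2 (\<kappa> * s) * y - (g1 (\<kappa> * s))\<^sup>2\<bar> \<le> \<bar>g2 (\<kappa> * s)\<bar> * \<bar>y\<bar> + (g1 (\<kappa> * s))\<^sup>2"
      unfolding abs_mult[symmetric] by (smt (verit) zero_le_power2)
    also have "\<dots> \<le> G * 2 + G\<^sup>2" using g2 g1s y G by (intro add_mono mult_mono) auto
    finally have n: "\<bar>g2 (\<kappa> * s) * y - (g1 (\<kappa> * s))\<^sup>2\<bar> \<le> 2 * G + G\<^sup>2" by simp
    have "norm (complex_of_real (\<kappa>\<^sup>2 * (g2 (\<kappa> * s) * y - (g1 (\<kappa> * s))\<^sup>2) / (4 * y\<^sup>2))) = \<kappa>\<^sup>2 * \<bar>g2 (\<kappa> * s) * y - (g1 (\<kappa> * s))\<^sup>2\<bar> / (4 * y\<^sup>2)"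
      unfolding norm_of_real by (simp add: abs_mult)
    also have "\<dots> \<le> (\<kappa> / s) * (2 * G + G\<^sup>2) / 1"
      using n kk y2 G \<kappa> s0 by (intro frac_le mult_mono) auto
    finally show ?thesis by (simp add: mult.commute)
  qed
  have 3: "norm (complex_of_real (\<kappa>\<^sup>2 * (g1 (\<kappa> * s))\<^sup>2 / (16 * y\<^sup>2))) \<le> G\<^sup>2 * (\<kappa> / s)"
  proof -
    have "norm (complex_of_real (\<kappa>\<^sup>2 * (g1 (\<kappa> * s))\<^sup>2 / (16 * y\<^sup>2))) = \<kappa>\<^sup>2 * (g1 (\<kappa> * s))\<^sup>2 / (16 * y\<^sup>2)"
      unfolding norm_of_real by (simp add: abs_mult)
    also have "\<dots> \<le> (\<kappa> / s) * G\<^sup>2 / 1"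
      using g1s kk y2 G \<kappa> s0 by (intro frac_le mult_mono) auto
    finally show ?thesis by (simp add: mult.commute)
  qed
  have 4: "norm (\<sigma> s * of_real (\<kappa> * g1 (\<kappa> * s) / (2 * y))) \<le> (K + 1) * G * (\<kappa> / s)"
  proof -
    have "norm (\<sigma> s * of_real (\<kappa> * g1 (\<kappa> * s) / (2 * y))) = norm (\<sigma> s) * (\<kappa> * \<bar>g1 (\<kappa> * s)\<bar> / (2 * y))"
      unfolding norm_mult norm_of_real using \<kappa> y by (simp add: abs_mult)
    also have "\<dots> \<le> (K + 1) / s * (\<kappa> * G / 1)"
      using \<sigma>_bounds(2) g1 \<kappa> y K s0 G by (intro mult_mono frac_le) auto
    finally show ?thesis by (simp add: mult_ac)
  qed
  have "norm (R s) \<le> 2 * G * K * (\<kappa> / s) + (2 * G + G\<^sup>2) * (\<kappa> / s) + G\<^sup>2 * (\<kappa> / s) + (K + 1) * G * (\<kappa> / s)"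
    unfolding R_def y_def[symmetric] by (rule order_trans[OF norm_triangle4]) (intro add_mono 1 2 3 4)
  also have "\<dots> = (2 * G * K + 2 * G + 2 * G\<^sup>2 + (K + 1) * G) * \<kappa> / s"
    unfolding times_divide_eq_right [symmetric] by (simp only: distrib_right) simp
  finally show ?thesis .
qed

text \<open>X' equals H X, whereas the approximant of the second component is sqrt g (E' / E) X; the
  first bound is the price of exchanging them. The second bound isolates the leading rate.\<close>

lemma H_near: "norm (H s - of_real (sqrt (g (\<kappa> * s))) * (E1 s / E s)) \<le> G * (K + 2) * \<kappa>"
  "norm (H s - \<rho> * of_real (sqrt (s * g (\<kappa> * s)))) \<le> (K + 1) / s + G * \<kappa>"
proof -
  define y where "y = g (\<kappa> * s)"
  have y: "1 / 2 \<le> y" "y \<le> 2" using g_bounds[OF u_in] by (auto simp: y_def)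
  have g1: "\<bar>g1 (\<kappa> * s)\<bar> \<le> G" using g1_le u_in by auto
  have s0: "s > 0" using s_ge by simp
  have G: "G \<ge> 0" by (rule G_nonneg)
  have 1: "norm (of_real (\<kappa> * g1 (\<kappa> * s) / (4 * y)) :: complex) \<le> G * \<kappa>"
  proof -
    have "norm (of_real (\<kappa> * g1 (\<kappa> * s) / (4 * y)) :: complex) = \<kappa> * \<bar>g1 (\<kappa> * s)\<bar> / (4 * y)"
      unfolding norm_of_real using \<kappa> y by (simp add: abs_mult)
    also have "\<dots> \<le> \<kappa> * G / 1" using g1 \<kappa> y G by (intro frac_le mult_mono) auto
    finally show ?thesis by (simp add: mult.commute)
  qed
  have "E1 s / E s = \<sigma> s + \<rho> * of_real (sqrt s)" by (simp add: \<sigma>_def)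
  then have "H s - of_real (sqrt y) * (E1 s / E s) = \<sigma> s * of_real (1 - sqrt y) - of_real (\<kappa> * g1 (\<kappa> * s) / (4 * y))"
    unfolding H_def y_def[symmetric] by (simp add: algebra_simps)
  also have "norm \<dots> \<le> norm (\<sigma> s * of_real (1 - sqrt y)) + norm (of_real (\<kappa> * g1 (\<kappa> * s) / (4 * y)) :: complex)"
    by (rule norm_triangle_ineq4)
  also have "norm (\<sigma> s * of_real (1 - sqrt y)) \<le> (K + 1) / s * (G * \<kappa> * s)"
    unfolding norm_mult norm_of_real using \<sigma>_bounds(2) sqrt_g_1 K s0
    by (intro mult_mono) (auto simp: y_def abs_minus_commute)
  also have "(K + 1) / s * (G * \<kappa> * s) = (K + 1) * G * \<kappa>" using s0 by simp
  finally show "norm (H s - of_real (sqrt (g (\<kappa> * s))) * (E1 s / E s)) \<le> G * (K + 2) * \<kappa>"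
    using 1 by (simp add: y_def algebra_simps)
  have "H s - \<rho> * of_real (sqrt (s * y)) = \<sigma> s - of_real (\<kappa> * g1 (\<kappa> * s) / (4 * y))"
    unfolding H_def y_def[symmetric] by (simp add: real_sqrt_mult)
  also have "norm \<dots> \<le> norm (\<sigma> s) + norm (of_real (\<kappa> * g1 (\<kappa> * s) / (4 * y)) :: complex)"
    by (rule norm_triangle_ineq4)
  finally show "norm (H s - \<rho> * of_real (sqrt (s * g (\<kappa> * s)))) \<le> (K + 1) / s + G * \<kappa>"
    using 1 \<sigma>_bounds(2) by (simp add: y_def)
qed

lemma X_nz: "X s \<noteq> 0"
  using g_pos E_nz[OF s_ge(1)] by (simp add: X_def)

end

end

context wkb begin

text \<open>The second claim rests on (H X)' = (H' + H^2) X and the Riccati identity; H' is computed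
  from the Riccati equation that Airy's equation imposes on E' / E.\<close>

lemma X_derivative:
  assumes s: "s \<in> {s0..\<nu>/\<kappa>}"
  shows "(X has_vector_derivative H s * X s) (at s within {s0..\<nu>/\<kappa>})"
    and "((\<lambda>s. H s * X s) has_vector_derivative (\<rho>\<^sup>2 * of_real (s * g (\<kappa> * s)) + R s) * X s) (at s within {s0..\<nu>/\<kappa>})"
proof -
  define S where "S = {s0..\<nu>/\<kappa>}"
  have s_pos: "s > 0" using s_ge[OF s] by simp
  have y_pos: "g (\<kappa> * s) > 0" by (rule g_pos[OF s])
  have d\<kappa>: "((\<lambda>s. \<kappa> * s) has_real_derivative \<kappa>) (at s within S)"
    by (auto intro!: derivative_eq_intros)
  have dg': "((\<lambda>s. g (\<kappa> * s)) has_real_derivative \<kappa> * g1 (\<kappa> * s)) (at s within S)"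
    using DERIV_chain2[where g="\<lambda>s. \<kappa> * s", OF dg[OF u_in[OF s]] d\<kappa>] by (simp add: mult.commute)
  have dg1': "((\<lambda>s. g1 (\<kappa> * s)) has_real_derivative \<kappa> * g2 (\<kappa> * s)) (at s within S)"
    using DERIV_chain2[where g="\<lambda>s. \<kappa> * s", OF dg1[OF u_in[OF s]] d\<kappa>] by (simp add: mult.commute)
  have dA: "((\<lambda>s. g (\<kappa> * s) powr (-1/4)) has_real_derivative - (\<kappa> * g1 (\<kappa> * s) / (4 * g (\<kappa> * s))) * g (\<kappa> * s) powr (-1/4)) (at s within S)"
  proof -
    have "((\<lambda>y. y powr (-1/4)) has_real_derivative (-1/4) * g (\<kappa> * s) powr (-1/4 - 1)) (at (g (\<kappa> * s)))"
      using y_pos by (rule has_real_derivative_powr)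
    from DERIV_chain2[OF this dg']
    have "((\<lambda>s. g (\<kappa> * s) powr (-1/4)) has_real_derivative (-1/4) * g (\<kappa> * s) powr (-1/4 - 1) * (\<kappa> * g1 (\<kappa> * s))) (at s within S)" .
    also have "g (\<kappa> * s) powr (-1/4 - 1) = g (\<kappa> * s) powr (-1/4) / g (\<kappa> * s)"
      using y_pos by (subst powr_diff) simp
    finally show ?thesis by (simp add: mult_ac)
  qed
  have de: "((\<lambda>s. exp (\<rho> * of_real (\<Theta> s))) has_vector_derivative (\<rho> * of_real (sqrt (s * g (\<kappa> * s)) - sqrt s)) * exp (\<rho> * of_real (\<Theta> s))) (at s within S)"
  proof -
    have "((\<lambda>s. \<rho> * of_real (\<Theta> s)) has_vector_derivative \<rho> * of_real (sqrt (s * g (\<kappa> * s)) - sqrt s)) (at s within S)"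
      unfolding S_def by (intro has_vector_derivative_mult_right has_vector_derivative_of_real d\<Theta> s)
    from field_vector_diff_chain_within[OF this has_field_derivative_at_within[OF DERIV_exp]]
    show ?thesis by (simp add: o_def)
  qed
  have dEs: "(E has_vector_derivative E1 s) (at s within S)" "(E1 has_vector_derivative \<rho>\<^sup>2 * of_real s * E s) (at s within S)"
    using dE dE1 by (auto intro: has_vector_derivative_at_within)
  have Enz: "E s \<noteq> 0" using E_nz s_ge[OF s] by blast
  have E1: "E1 s = (\<sigma> s + \<rho> * of_real (sqrt s)) * E s" using Enz by (simp add: \<sigma>_def)
  have "(X has_vector_derivative
     of_real (g (\<kappa> * s) powr (-1/4)) * E s * ((\<rho> * of_real (sqrt (s * g (\<kappa> * s)) - sqrt s)) * exp (\<rho> * of_real (\<Theta> s)))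
     + (of_real (g (\<kappa> * s) powr (-1/4)) * E1 s + of_real (- (\<kappa> * g1 (\<kappa> * s) / (4 * g (\<kappa> * s))) * g (\<kappa> * s) powr (-1/4)) * E s) * exp (\<rho> * of_real (\<Theta> s)))
     (at s within S)"
    unfolding X_def[abs_def] by (intro has_vector_derivative_mult has_vector_derivative_of_real dA dEs de)
  also have "of_real (g (\<kappa> * s) powr (-1/4)) * E s * ((\<rho> * of_real (sqrt (s * g (\<kappa> * s)) - sqrt s)) * exp (\<rho> * of_real (\<Theta> s)))
     + (of_real (g (\<kappa> * s) powr (-1/4)) * E1 s + of_real (- (\<kappa> * g1 (\<kappa> * s) / (4 * g (\<kappa> * s))) * g (\<kappa> * s) powr (-1/4)) * E s) * exp (\<rho> * of_real (\<Theta> s))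
     = H s * X s"
  proof -
    have "A * Es * ((\<rho> * of_real (u * v - u)) * e) + (A * ((z + \<rho> * of_real u) * Es) + of_real (- c) * A * Es) * e =
        (z + \<rho> * of_real (u * v) - of_real c) * (A * Es * e)" for A Es e z and u v c :: real
      by (simp add: algebra_simps)
    then show ?thesis
      unfolding X_def H_def E1 real_sqrt_mult of_real_mult[of "- _"] .
  qed
  finally show dX: "(X has_vector_derivative H s * X s) (at s within {s0..\<nu>/\<kappa>})" unfolding S_def .
  define p where "p = E1 s / E s"
  have dp: "((\<lambda>s. E1 s / E s) has_vector_derivative \<rho>\<^sup>2 * of_real s - p\<^sup>2) (at s within S)"
  proof -
    have "((\<lambda>s. E1 s / E s) has_vector_derivative (\<rho>\<^sup>2 * of_real s * E s * E s - E1 s * E1 s) / (E s * E s)) (at s within S)"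
      using has_derivative_divide'[OF dEs(2)[unfolded has_vector_derivative_def] dEs(1)[unfolded has_vector_derivative_def] Enz]
      unfolding has_vector_derivative_def by (simp add: scaleR_conv_of_real algebra_simps)
    then show ?thesis using Enz by (simp add: p_def power2_eq_square diff_divide_distrib)
  qed
  define y r where "y = g (\<kappa> * s)" and "r = sqrt s"
  have dsq: "((\<lambda>s. sqrt s * sqrt (g (\<kappa> * s)) - sqrt s) has_real_derivative (y + s * (\<kappa> * g1 (\<kappa> * s))) / (2 * (sqrt s * sqrt y)) - 1 / (2 * sqrt s)) (at s within S)"
  proof -
    have 1: "((\<lambda>s. sqrt s) has_real_derivative inverse (sqrt s) / 2) (at s within S)"
      by (rule has_field_derivative_at_within[OF DERIV_real_sqrt[OF s_pos]])
    have 2: "((\<lambda>s. sqrt (g (\<kappa> * s))) has_real_derivative inverse (sqrt y) / 2 * (\<kappa> * g1 (\<kappa> * s))) (at s within S)"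
      unfolding y_def by (rule DERIV_chain2[OF DERIV_real_sqrt[OF y_pos] dg'])
    have "((\<lambda>s. sqrt s * sqrt (g (\<kappa> * s)) - sqrt s) has_real_derivative
        inverse (sqrt s) / 2 * sqrt y + (inverse (sqrt y) / 2 * (\<kappa> * g1 (\<kappa> * s))) * sqrt s - inverse (sqrt s) / 2) (at s within S)"
      using DERIV_diff[OF DERIV_mult[OF 1 2] 1] by (simp add: y_def)
    moreover have "inverse a / 2 * b + (inverse b / 2 * c) * a - inverse a / 2 = (b * b + a * a * c) / (2 * (a * b)) - 1 / (2 * a)"
      if "a \<noteq> 0" "b \<noteq> 0" for a b c :: real
      using that by (simp add: field_simps)
    from this[of "sqrt s" "sqrt y" "\<kappa> * g1 (\<kappa> * s)"]
    have "inverse (sqrt s) / 2 * sqrt y + (inverse (sqrt y) / 2 * (\<kappa> * g1 (\<kappa> * s))) * sqrt s - inverse (sqrt s) / 2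
      = (y + s * (\<kappa> * g1 (\<kappa> * s))) / (2 * (sqrt s * sqrt y)) - 1 / (2 * sqrt s)"
      using s_pos y_pos by (simp add: y_def)
    ultimately show ?thesis by (simp only:)
  qed
  have dq: "((\<lambda>s. \<kappa> * g1 (\<kappa> * s) / (4 * g (\<kappa> * s))) has_real_derivative \<kappa>\<^sup>2 * (g2 (\<kappa> * s) * y - (g1 (\<kappa> * s))\<^sup>2) / (4 * y\<^sup>2)) (at s within S)"
  proof -
    have "((\<lambda>s. \<kappa> * g1 (\<kappa> * s) / (4 * g (\<kappa> * s))) has_real_derivative
       (\<kappa> * (\<kappa> * g2 (\<kappa> * s)) * (4 * y) - \<kappa> * g1 (\<kappa> * s) * (4 * (\<kappa> * g1 (\<kappa> * s)))) / ((4 * y) * (4 * y))) (at s within S)"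
      unfolding y_def by (intro DERIV_divide DERIV_cmult dg' dg1') (use y_pos in auto)
    moreover have "(\<kappa> * (\<kappa> * g2 (\<kappa> * s)) * (4 * y) - \<kappa> * g1 (\<kappa> * s) * (4 * (\<kappa> * g1 (\<kappa> * s)))) / ((4 * y) * (4 * y))
       = (4 * (\<kappa>\<^sup>2 * (g2 (\<kappa> * s) * y - (g1 (\<kappa> * s))\<^sup>2))) / (4 * (4 * y\<^sup>2))"
      by (rule arg_cong2[where f="(/)"]) (simp_all add: power2_eq_square algebra_simps)
    ultimately show ?thesis by simp
  qed
  define H' where "H' = (\<rho>\<^sup>2 * of_real s - p\<^sup>2) + \<rho> * of_real ((y + s * (\<kappa> * g1 (\<kappa> * s))) / (2 * (sqrt s * sqrt y)) - 1 / (2 * sqrt s))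
      - of_real (\<kappa>\<^sup>2 * (g2 (\<kappa> * s) * y - (g1 (\<kappa> * s))\<^sup>2) / (4 * y\<^sup>2))"
  have dH: "(H has_vector_derivative H') (at s within S)"
  proof -
    have "((\<lambda>s. E1 s / E s + \<rho> * of_real (sqrt s * sqrt (g (\<kappa> * s)) - sqrt s) - of_real (\<kappa> * g1 (\<kappa> * s) / (4 * g (\<kappa> * s)))) has_vector_derivative H') (at s within S)"
      unfolding H'_def by (intro has_vector_derivative_add has_vector_derivative_diff has_vector_derivative_mult_right has_vector_derivative_of_real dp dsq dq)
    also have "(\<lambda>s. E1 s / E s + \<rho> * of_real (sqrt s * sqrt (g (\<kappa> * s)) - sqrt s) - of_real (\<kappa> * g1 (\<kappa> * s) / (4 * g (\<kappa> * s)))) = H"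
    proof
      fix s
      have "A + \<rho> * of_real (B - C) - D = A - \<rho> * of_real C + \<rho> * of_real B - D" for A D and B C :: real
        by (simp add: algebra_simps)
      then show "E1 s / E s + \<rho> * of_real (sqrt s * sqrt (g (\<kappa> * s)) - sqrt s) - of_real (\<kappa> * g1 (\<kappa> * s) / (4 * g (\<kappa> * s))) = H s"
        unfolding H_def \<sigma>_def .
    qed
    finally show ?thesis .
  qed
  have "H' + (H s)\<^sup>2 = \<rho>\<^sup>2 * of_real (s * g (\<kappa> * s)) + R s"
  proof -
    define q where "q = sqrt y"
    have y: "y = q\<^sup>2" "s = r\<^sup>2" using y_pos s_pos by (auto simp: q_def y_def r_def)
    have nz: "complex_of_real r \<noteq> 0" "complex_of_real q \<noteq> 0" using y_pos s_pos by (auto simp: q_def y_def r_def)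
    have q0: "\<bar>q\<bar> = q" using y_pos by (simp add: q_def y_def)
    have p: "p = \<sigma> s + \<rho> * of_real r" by (simp add: p_def \<sigma>_def r_def)
    have H: "H s = \<sigma> s + \<rho> * (of_real r * of_real q) - of_real \<kappa> * of_real (g1 (\<kappa> * s)) / (4 * (of_real q)\<^sup>2)"
      unfolding H_def y_def[symmetric] unfolding q_def[symmetric] r_def[symmetric] y(1) by (simp add: q0)
    have R: "R s = (2 * \<rho> * ((of_real q - 1) * of_real r) * (\<sigma> s + 1 / (4 * (of_real r)\<^sup>2))
      - (of_real \<kappa>)\<^sup>2 * (of_real (g2 (\<kappa> * s)) * (of_real q)\<^sup>2 - (of_real (g1 (\<kappa> * s)))\<^sup>2) / (4 * ((of_real q)\<^sup>2)\<^sup>2) +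
        (of_real \<kappa>)\<^sup>2 * (of_real (g1 (\<kappa> * s)))\<^sup>2 / (16 * ((of_real q)\<^sup>2)\<^sup>2) - \<sigma> s * (of_real \<kappa> * of_real (g1 (\<kappa> * s)) / (2 * (of_real q)\<^sup>2)))"
    proof -
      have "1 / (4 * s) = 1 / (4 * r\<^sup>2)" using y(2) by simp
      then show ?thesis
        unfolding R_def y_def[symmetric] q_def[symmetric] r_def[symmetric] unfolding y(1) by (simp add: q0)
    qed
    have H': "H' = (\<rho>\<^sup>2 * (of_real r)\<^sup>2 - (\<sigma> s + \<rho> * of_real r)\<^sup>2) + \<rho> * (((of_real q)\<^sup>2 + (of_real r)\<^sup>2 * (of_real \<kappa> * of_real (g1 (\<kappa> * s)))) / (2 * (of_real r * of_real q)) - 1 / (2 * of_real r))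
     - (of_real \<kappa>)\<^sup>2 * (of_real (g2 (\<kappa> * s)) * (of_real q)\<^sup>2 - (of_real (g1 (\<kappa> * s)))\<^sup>2) / (4 * ((of_real q)\<^sup>2)\<^sup>2)"
    proof -
      have "complex_of_real s = (of_real r)\<^sup>2" "s * (\<kappa> * g1 (\<kappa> * s)) = r\<^sup>2 * (\<kappa> * g1 (\<kappa> * s))" using y(2) by auto
      then show ?thesis
        unfolding H'_def p q_def[symmetric] r_def[symmetric] unfolding y(1) by (simp add: q0)
    qed
    have "H' + (H s)\<^sup>2 = \<rho>\<^sup>2 * (of_real r)\<^sup>2 * (of_real q)\<^sup>2 + R s"
      unfolding H H' R by (rule wkb_identity[OF nz])
    also have "\<rho>\<^sup>2 * (of_real r)\<^sup>2 * (of_real q)\<^sup>2 = \<rho>\<^sup>2 * of_real (s * g (\<kappa> * s))"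
      using y by (simp add: y_def)
    finally show ?thesis .
  qed
  then have eq0: "(H' + (H s)\<^sup>2) * X s = (\<rho>\<^sup>2 * of_real (s * g (\<kappa> * s)) + R s) * X s" by (simp only:)
  have eq: "H s * (H s * X s) + H' * X s = (\<rho>\<^sup>2 * of_real (s * g (\<kappa> * s)) + R s) * X s"
    unfolding eq0[symmetric] by (simp add: power2_eq_square algebra_simps)
  have "((\<lambda>s. H s * X s) has_vector_derivative H s * (H s * X s) + H' * X s) (at s within S)"
    using dX unfolding S_def[symmetric] by (intro has_vector_derivative_mult dH)
  then show "((\<lambda>s. H s * X s) has_vector_derivative (\<rho>\<^sup>2 * of_real (s * g (\<kappa> * s)) + R s) * X s) (at s within {s0..\<nu>/\<kappa>})"
    unfolding eq S_def .
qed

end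

section \<open>True solutions compared with the approximants, for one fixed \<kappa>\<close>

context wkb begin

definition CR :: real where "CR = 2 * G * K + 2 * G + 2 * G\<^sup>2 + (K + 1) * G"

lemma interval_nonempty: "s0 \<le> \<nu> / \<kappa>"
  using s0 \<kappa> by (simp add: field_simps)

lemma CR_nonneg: "CR \<ge> 0"
  using K G_nonneg[of s0] interval_nonempty by (auto simp: CR_def)

lemma R_le: "s \<in> {s0..\<nu>/\<kappa>} \<Longrightarrow> norm (R s) \<le> CR * \<kappa> / s"
  using R_bound by (simp add: CR_def)

text \<open>The two errors of \<open>H_near\<close> are 1/16 each, and 5/8 is admissible because
  (5/8)^2 < 1/2. With sqrt s \<ge> 2 the rate 5/8 sqrt s - 1/8 is at least sqrt s / 2 and at least
  1, as the comparisons need.\<close>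

lemma H_dominant:
  assumes s: "s \<in> {s0..\<nu>/\<kappa>}" and large: "s0 \<ge> 4" "s0 \<ge> 16 * (K + 1)" and small: "16 * G * \<kappa> \<le> 1"
  shows "norm (H s - \<rho> * of_real (sqrt (s * g (\<kappa> * s)))) \<le> 1 / 8"
    and "sqrt (s * g (\<kappa> * s)) \<ge> 5 / 8 * sqrt s" and "sqrt s \<ge> 2"
proof -
  have "s \<ge> 16 * (K + 1)" "s > 0" using s large by auto
  then have "(K + 1) / s \<le> 1 / 16" using K by (simp add: field_simps)
  moreover have "G * \<kappa> \<le> 1 / 16" using small by simp
  ultimately show "norm (H s - \<rho> * of_real (sqrt (s * g (\<kappa> * s)))) \<le> 1 / 8"
    using H_near(2)[OF s] by linarith
  have "(5 / 8)\<^sup>2 \<le> (1 / 2 :: real)" by (simp add: power2_eq_square)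
  also have "\<dots> \<le> g (\<kappa> * s)" using g_bounds[OF u_in[OF s]] by simp
  finally have "5 / 8 \<le> sqrt (g (\<kappa> * s))" by (rule real_le_rsqrt)
  then show "sqrt (s * g (\<kappa> * s)) \<ge> 5 / 8 * sqrt s"
    unfolding real_sqrt_mult using \<open>s > 0\<close> by (simp add: mult.commute mult_right_mono)
  show "sqrt s \<ge> 2" using s large by (intro real_le_rsqrt) auto
qed

text \<open>Serves to restate errors of size O(\<kappa>) |X| as errors relative to the approximant
  of the derivative.\<close>

lemma p_lower:
  assumes s: "s \<in> {s0..\<nu>/\<kappa>}" and large: "s0 \<ge> 4" "s0 \<ge> 16 * (K + 1)"
  shows "norm (of_real (sqrt (g (\<kappa> * s))) * (E1 s / E s)) \<ge> 1 / 2"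
proof -
  have "s \<ge> 16 * (K + 1)" "s > 0" using s large by auto
  then have "(K + 1) / s \<le> 1 / 16" using K by (simp add: field_simps)
  then have "norm (\<sigma> s) \<le> 1 / 16" using \<sigma>_bounds(2)[OF s] by linarith
  moreover have "sqrt s \<ge> 2" using s large by (intro real_le_rsqrt) auto
  moreover have "norm (\<rho> * of_real (sqrt s)) \<le> norm (E1 s / E s) + norm (\<sigma> s)"
    using norm_triangle_ineq4[of "E1 s / E s" "\<sigma> s"] by (simp add: \<sigma>_def)
  moreover have "norm (\<rho> * of_real (sqrt s)) = sqrt s" using \<open>s > 0\<close> by (simp add: norm_mult norm_\<rho>)
  ultimately have "norm (E1 s / E s) \<ge> 1" by linarith
  then have "1 / 2 * 1 \<le> sqrt (g (\<kappa> * s)) * norm (E1 s / E s)"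
    using sqrt_g[OF s] g_pos[OF s] by (intro mult_mono) auto
  moreover have "\<bar>sqrt (g (\<kappa> * s))\<bar> = sqrt (g (\<kappa> * s))" using sqrt_g[OF s] by linarith
  ultimately show ?thesis unfolding norm_mult norm_of_real by (simp only: mult_1_right)
qed

text \<open>\<open>recessive_comparison\<close> applied to Re X, which is X itself since E is real
  and \<rho> = -1. The second estimate then trades H for sqrt g E' / E.\<close>

lemma recessive_solution:
  assumes \<rho>: "\<rho> = - 1" and real: "\<And>s. E s \<in> \<real>"
    and large: "s0 \<ge> 4" "s0 \<ge> 16 * (K + 1)" and small: "16 * G * \<kappa> \<le> 1"
    and a: "\<And>s. s \<in> {s0..\<nu>/\<kappa>} \<Longrightarrow> (a has_real_derivative a' s) (at s within {s0..\<nu>/\<kappa>})"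
    and a': "\<And>s. s \<in> {s0..\<nu>/\<kappa>} \<Longrightarrow> (a' has_real_derivative s * g (\<kappa> * s) * a s) (at s within {s0..\<nu>/\<kappa>})"
    and init: "a (\<nu> / \<kappa>) = Re (X (\<nu> / \<kappa>))"
      "\<bar>a' (\<nu> / \<kappa>) / a (\<nu> / \<kappa>) + sqrt (\<nu> / \<kappa> * g \<nu>)\<bar> \<le> L * \<kappa>"
    and L: "L \<ge> 0" and small2: "4 * CR * \<kappa> \<le> 1" "(L + (K + 1) / \<nu> + G) * \<kappa> \<le> 1"
    and t: "t \<in> {s0..\<nu>/\<kappa>}"
  defines "C \<equiv> 8 * CR + (L + (K + 1) / \<nu> + G)"
  shows "\<bar>a t - Re (X t)\<bar> \<le> C * \<kappa> * \<bar>Re (X t)\<bar>"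
    and "\<bar>a' t - Re (of_real (sqrt (g (\<kappa> * t))) * (E1 t / E t) * X t)\<bar>
        \<le> (8 * (G * (K + 2)) + 3 * C) * \<kappa> * \<bar>Re (of_real (sqrt (g (\<kappa> * t))) * (E1 t / E t) * X t)\<bar>"
proof -
  let ?S = "{s0..\<nu>/\<kappa>}"
  have s0_1: "s0 \<ge> 1" using large by simp
  have Xr: "X s = of_real (Re (X s))" for s
  proof -
    obtain e where "E s = of_real e" using real[of s] by (auto elim: Reals_cases)
    moreover have "exp (\<rho> * of_real (\<Theta> s)) = of_real (exp (- \<Theta> s))"
      using \<rho> by (simp flip: exp_of_real)
    ultimately have "X s = of_real (g (\<kappa> * s) powr (-1/4) * e * exp (- \<Theta> s))"
      unfolding X_def by simp
    then show ?thesis by (metis Re_complex_of_real)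
  qed
  have ReX: "Re (z * X s) = Re z * Re (X s)" for z s
    by (subst Xr) simp
  have absX: "\<bar>Re (X s)\<bar> = norm (X s)" for s by (subst (2) Xr) simp
  define K2 where "K2 = L + (K + 1) / \<nu> + G"
  have K2: "K2 \<ge> 0" using L K \<nu> G_nonneg[of s0] interval_nonempty by (auto simp: K2_def)
  have q: "\<nu> / \<kappa> \<in> ?S" using interval_nonempty by simp
  have dX: "((\<lambda>s. Re (X s)) has_real_derivative Re (H s) * Re (X s)) (at s within ?S)" if "s \<in> ?S" for s
    using bounded_linear.has_vector_derivative[OF bounded_linear_Re X_derivative(1)[OF that]]
    unfolding has_real_derivative_iff_has_vector_derivative ReX .
  have dX': "((\<lambda>s. Re (H s) * Re (X s)) has_real_derivative (s * g (\<kappa> * s) + Re (R s)) * Re (X s)) (at s within ?S)" if "s \<in> ?S" for s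
  proof -
    have "Re (\<rho>\<^sup>2 * of_real x + z) = x + Re z" for x z using \<rho> by simp
    then show ?thesis
      using bounded_linear.has_vector_derivative[OF bounded_linear_Re X_derivative(2)[OF that]]
      unfolding has_real_derivative_iff_has_vector_derivative ReX by (simp only:)
  qed
  have H_le: "Re (H s) \<le> - 1" "Re (H s) \<le> - sqrt s / 2" if s: "s \<in> ?S" for s
  proof -
    have "Re (H s) + sqrt (s * g (\<kappa> * s)) \<le> 1 / 8"
      using H_dominant(1)[OF s large small] complex_Re_le_cmod[of "H s - \<rho> * of_real (sqrt (s * g (\<kappa> * s)))"] by (simp add: \<rho>)
    then show "Re (H s) \<le> - 1" "Re (H s) \<le> - sqrt s / 2"
      using H_dominant(2,3)[OF s large small] by linarith+
  qed
  \<comment> \<open>The hypothesis concerns the leading slope -sqrt (s g); at s = \<nu> / \<kappa>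
    the passage to H costs (K + 1) \<kappa> / \<nu> + G \<kappa>.\<close>
  have ini2: "\<bar>a' (\<nu> / \<kappa>) / a (\<nu> / \<kappa>) - Re (H (\<nu> / \<kappa>))\<bar> \<le> K2 * \<kappa>"
  proof -
    have "\<bar>Re (H (\<nu> / \<kappa>)) + sqrt (\<nu> / \<kappa> * g \<nu>)\<bar> \<le> (K + 1) / (\<nu> / \<kappa>) + G * \<kappa>"
      using H_near(2)[OF q] abs_Re_le_cmod[of "H (\<nu>/\<kappa>) - \<rho> * of_real (sqrt (\<nu>/\<kappa> * g (\<kappa> * (\<nu>/\<kappa>))))"] \<kappa> by (simp add: \<rho>)
    moreover have "(K + 1) / (\<nu> / \<kappa>) + G * \<kappa> = ((K + 1) / \<nu> + G) * \<kappa>" using \<kappa> \<nu> by (simp add: field_simps)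
    ultimately show ?thesis using init(2) by (simp add: K2_def distrib_right)
  qed
  have C: "C = 8 * CR + K2" by (simp add: C_def K2_def)
  have C0: "C \<ge> 0" using CR_nonneg K2 by (simp add: C)
  have nzX: "Re (X s) \<noteq> 0" if "s \<in> ?S" for s using X_nz[OF that] absX[of s] by auto
  note cmp = recessive_comparison[where a=a and a'=a' and X="\<lambda>s. Re (X s)" and X'="\<lambda>s. Re (H s) * Re (X s)" and R="\<lambda>s. Re (R s)"
      and H="\<lambda>s. Re (H s)" and p=s0 and q="\<nu>/\<kappa>" and Q="\<lambda>s. s * g (\<kappa> * s)" and C=CR and K=K2 and \<kappa>=\<kappa> and t=t]
  have Rr: "\<bar>Re (R s)\<bar> \<le> CR * \<kappa> / s" if "s \<in> ?S" for s using R_le[OF that] abs_Re_le_cmod order_trans by blast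
  have 1: "\<bar>a t / Re (X t) - 1\<bar> \<le> C * \<kappa>"
    unfolding C by (rule cmp(1)) (use s0_1 interval_nonempty a a' dX dX' nzX H_le Rr init(1) ini2 \<kappa> CR_nonneg K2 small2 t in \<open>auto simp: K2_def\<close>)
  have 2: "\<bar>a' t / Re (X t) - Re (H t) * (a t / Re (X t))\<bar> \<le> C * \<kappa>"
    unfolding C by (rule cmp(2)) (use s0_1 interval_nonempty a a' dX dX' nzX H_le Rr init(1) ini2 \<kappa> CR_nonneg K2 small2 t in \<open>auto simp: K2_def\<close>)
  have "a t - Re (X t) = (a t / Re (X t) - 1) * Re (X t)" using nzX[OF t] by (simp add: field_simps)
  then show "\<bar>a t - Re (X t)\<bar> \<le> C * \<kappa> * \<bar>Re (X t)\<bar>"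
    using mult_right_mono[OF 1, of "\<bar>Re (X t)\<bar>"] by (simp add: abs_mult)
  define w where "w = a t / Re (X t)"
  define z where "z = Re (of_real (sqrt (g (\<kappa> * t))) * (E1 t / E t))"
  have z: "\<bar>z\<bar> \<ge> 1 / 2"
  proof -
    obtain e where e: "E t = of_real e" using real[of t] by (auto elim: Reals_cases)
    have "(E has_vector_derivative E1 t) (at t)" by (rule dE)
    then have "((\<lambda>s. Im (E s)) has_vector_derivative Im (E1 t)) (at t)"
      by (rule bounded_linear.has_vector_derivative[OF bounded_linear_Im])
    moreover have "(\<lambda>s. Im (E s)) = (\<lambda>s. 0)" using real complex_is_Real_iff by auto
    ultimately have "Im (E1 t) = 0"
      by (metis has_vector_derivative_const vector_derivative_unique_at)
    then have "E1 t = of_real (Re (E1 t))" by (simp add: complex_eq_iff)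
    then have "of_real (sqrt (g (\<kappa> * t))) * (E1 t / E t) = of_real (sqrt (g (\<kappa> * t)) * (Re (E1 t) / e))"
      using e by (metis of_real_divide of_real_mult)
    then show ?thesis using p_lower[OF t large] unfolding z_def by (metis Re_complex_of_real norm_of_real)
  qed
  have Hz: "\<bar>Re (H t) - z\<bar> \<le> G * (K + 2) * \<kappa>"
    using H_near(1)[OF t] abs_Re_le_cmod[of "H t - of_real (sqrt (g (\<kappa> * t))) * (E1 t / E t)"] by (simp add: z_def)
  have "C * \<kappa> \<le> 3" using small2 by (simp add: C K2_def distrib_right)
  then have w4: "\<bar>w\<bar> \<le> 4" using 1 unfolding w_def by linarith
  show "\<bar>a' t - Re (of_real (sqrt (g (\<kappa> * t))) * (E1 t / E t) * X t)\<bar>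
        \<le> (8 * (G * (K + 2)) + 3 * C) * \<kappa> * \<bar>Re (of_real (sqrt (g (\<kappa> * t))) * (E1 t / E t) * X t)\<bar>"
  proof -
    define d where "d = a' t / Re (X t) - Re (H t) * w"
    have d: "\<bar>d\<bar> \<le> C * \<kappa>" using 2 by (simp add: d_def w_def)
    define x where "x = Re (X t)"
    have x: "x \<noteq> 0" using nzX[OF t] by (simp add: x_def)
    \<comment> \<open>The error splits into the change of exponent, the error of the quotient w, and
      the error d of its derivative; |z| \<ge> 1/2 makes the first and the third relative to
      z.\<close>
    have "a' t - z * x = ((Re (H t) - z) * w + z * (w - 1) + d) * x"
      using x unfolding d_def x_def[symmetric] by (simp add: field_simps)
    moreover have "\<bar>(Re (H t) - z) * w + z * (w - 1) + d\<bar> \<le> (8 * (G * (K + 2)) + 3 * C) * \<kappa> * \<bar>z\<bar>"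
    proof -
      have P: "G * (K + 2) * \<kappa> \<ge> 0" using abs_ge_zero Hz by (rule order_trans)
      have Q: "C * \<kappa> \<ge> 0" using abs_ge_zero d by (rule order_trans)
      have A: "\<bar>(Re (H t) - z) * w\<bar> \<le> G * (K + 2) * \<kappa> * 4" unfolding abs_mult using Hz w4 P by (intro mult_mono) auto
      have B: "\<bar>z * (w - 1)\<bar> \<le> \<bar>z\<bar> * (C * \<kappa>)" unfolding abs_mult using 1 by (intro mult_left_mono) (auto simp: w_def)
      have A': "G * (K + 2) * \<kappa> * 4 \<le> G * (K + 2) * \<kappa> * (8 * \<bar>z\<bar>)" using z by (intro mult_left_mono[OF _ P]) auto
      have D': "C * \<kappa> \<le> C * \<kappa> * (2 * \<bar>z\<bar>)" using mult_left_mono[OF _ Q, of 1 "2 * \<bar>z\<bar>"] z by simp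
      have "\<bar>(Re (H t) - z) * w + z * (w - 1) + d\<bar> \<le> \<bar>(Re (H t) - z) * w\<bar> + \<bar>z * (w - 1)\<bar> + \<bar>d\<bar>" by linarith
      also have "\<dots> \<le> G * (K + 2) * \<kappa> * (8 * \<bar>z\<bar>) + \<bar>z\<bar> * (C * \<kappa>) + C * \<kappa> * (2 * \<bar>z\<bar>)"
        using A A' B D' d by linarith
      also have "\<dots> = (8 * (G * (K + 2)) + 3 * C) * \<kappa> * \<bar>z\<bar>" by (simp add: algebra_simps)
      finally show ?thesis .
    qed
    ultimately have "\<bar>a' t - z * x\<bar> \<le> (8 * (G * (K + 2)) + 3 * C) * \<kappa> * \<bar>z\<bar> * \<bar>x\<bar>"
      by (simp add: abs_mult mult_right_mono)
    then show ?thesis unfolding ReX z_def[symmetric] x_def[symmetric] by (simp add: abs_mult mult.assoc)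
  qed
qed

text \<open>The factor (s g)^(1/4) cancels the amplitude: s^(1/4) belongs to E and g^(1/4) to the
  correction. The two phases add up to the complete phase integral.\<close>

lemma phase_factor:
  assumes \<rho>: "\<rho> = \<i>" and s: "s \<in> {s0..\<nu>/\<kappa>}"
  shows "norm (X s * of_real ((s * g (\<kappa> * s)) powr (1/4)) - \<gamma> * exp (\<rho> * of_real (\<Theta> s + 2 / 3 * s powr (3/2)))) \<le> K / s"
proof -
  have sp: "s > 0" "s \<ge> 1" using s_ge[OF s] by auto
  have y: "g (\<kappa> * s) > 0" by (rule g_pos[OF s])
  have c: "complex_of_real (g (\<kappa> * s) powr (-1/4)) * of_real ((s * g (\<kappa> * s)) powr (1/4)) = of_real (s powr (1/4))"
  proof -
    have "g (\<kappa> * s) powr (-1/4) * g (\<kappa> * s) powr (1/4) = 1" using y unfolding powr_add [symmetric] by simp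
    then have "g (\<kappa> * s) powr (-1/4) * (s * g (\<kappa> * s)) powr (1/4) = s powr (1/4)"
      using sp y by (simp add: powr_mult)
    then show ?thesis by (metis of_real_mult)
  qed
  define e1 e2 where "e1 = exp (- \<rho> * of_real (2 / 3 * s powr (3/2)))" and "e2 = exp (\<rho> * of_real (\<Theta> s + 2 / 3 * s powr (3/2)))"
  have e: "exp (\<rho> * of_real (\<Theta> s)) = e1 * e2" unfolding e1_def e2_def mult_exp_exp by (simp add: algebra_simps)
  have n: "norm e2 = 1" using \<rho> by (simp add: e2_def)
  have "X s * of_real ((s * g (\<kappa> * s)) powr (1/4)) =
     (complex_of_real (g (\<kappa> * s) powr (-1/4)) * of_real ((s * g (\<kappa> * s)) powr (1/4))) * E s * (e1 * e2)"
    unfolding X_def e by (simp only: mult_ac)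
  then have eq: "X s * of_real ((s * g (\<kappa> * s)) powr (1/4)) - \<gamma> * e2 = (E s * of_real (s powr (1/4)) * e1 - \<gamma>) * e2"
    unfolding c by (simp add: algebra_simps)
  have "norm (X s * of_real ((s * g (\<kappa> * s)) powr (1/4)) - \<gamma> * e2) \<le> K * s powr (-3/2)"
    using asymp[OF s_ge(1)[OF s], folded e1_def] unfolding eq norm_mult[of "_ - _"] n mult_1_right .
  also have "\<dots> \<le> K * (1 / s)"
    using powr_mono[of "-3/2" "-1" s] sp K by (intro mult_left_mono) (auto simp: powr_minus_divide)
  finally show ?thesis by (simp add: e2_def)
qed

text \<open>\<open>phase_factor\<close> with an error of at most |\<gamma>| / 2 makes |X| comparable
  to s^(-1/4) from both sides; sqrt g between 1/2 and 2 accounts for the remaining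
  constants.\<close>

lemma X_modulus:
  assumes \<rho>: "\<rho> = \<i>" and s: "s \<in> {s0..\<nu>/\<kappa>}" and large: "2 * K \<le> norm \<gamma> * s0"
  shows "(norm \<gamma>)\<^sup>2 / 8 \<le> sqrt s * (norm (X s))\<^sup>2" and "sqrt s * (norm (X s))\<^sup>2 \<le> 5 * (norm \<gamma>)\<^sup>2"
proof -
  have sp: "s > 0" "s \<ge> 1" using s_ge[OF s] by auto
  have "norm \<gamma> * s0 \<le> norm \<gamma> * s" using s by (intro mult_left_mono) auto
  then have "2 * K \<le> norm \<gamma> * s" using large by linarith
  then have Ks: "K / s \<le> norm \<gamma> / 2" using sp by (simp add: field_simps)
  define Z where "Z = X s * of_real ((s * g (\<kappa> * s)) powr (1/4))"
  define u where "u = \<gamma> * exp (\<rho> * of_real (\<Theta> s + 2 / 3 * s powr (3/2)))"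
  have u: "norm u = norm \<gamma>" using \<rho> by (simp add: u_def norm_mult)
  have Zu: "norm (Z - u) \<le> norm \<gamma> / 2" unfolding Z_def u_def using phase_factor[OF \<rho> s] Ks by (rule order_trans)
  have Z: "norm \<gamma> / 2 \<le> norm Z" "norm Z \<le> 3 / 2 * norm \<gamma>"
    using Zu u norm_triangle_ineq2[of u Z] norm_triangle_ineq2[of Z u] norm_minus_commute[of u Z] by linarith+
  have y: "g (\<kappa> * s) > 0" by (rule g_pos[OF s])
  have "((s * g (\<kappa> * s)) powr (1/4))\<^sup>2 = (s * g (\<kappa> * s)) powr (1/2)"
    using sp y by (simp add: powr_power)
  also have "\<dots> = sqrt s * sqrt (g (\<kappa> * s))" using sp y by (simp add: powr_half_sqrt real_sqrt_mult)
  finally have "(norm Z)\<^sup>2 = sqrt s * (norm (X s))\<^sup>2 * sqrt (g (\<kappa> * s))"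
    unfolding Z_def norm_mult power_mult_distrib by simp
  then have eq: "sqrt s * (norm (X s))\<^sup>2 = (norm Z)\<^sup>2 / sqrt (g (\<kappa> * s))" using y by simp
  have "(norm \<gamma>)\<^sup>2 / 4 \<le> (norm Z)\<^sup>2" using power_mono[OF Z(1), of 2] by (simp add: power_divide)
  then have "((norm \<gamma>)\<^sup>2 / 4) / 2 \<le> (norm Z)\<^sup>2 / sqrt (g (\<kappa> * s))" using sqrt_g[OF s] g_pos[OF s] by (intro frac_le) auto
  then show "(norm \<gamma>)\<^sup>2 / 8 \<le> sqrt s * (norm (X s))\<^sup>2" unfolding eq by simp
  have "(norm Z)\<^sup>2 \<le> 9 / 4 * (norm \<gamma>)\<^sup>2" using power_mono[OF Z(2), of 2] by (simp add: power_mult_distrib power_divide)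
  then have "(norm Z)\<^sup>2 / sqrt (g (\<kappa> * s)) \<le> (9 / 4 * (norm \<gamma>)\<^sup>2) / (1 / 2)" using sqrt_g[OF s] g_pos[OF s] by (intro frac_le) auto
  also have "\<dots> \<le> 5 * (norm \<gamma>)\<^sup>2" by simp
  finally show "sqrt s * (norm (X s))\<^sup>2 \<le> 5 * (norm \<gamma>)\<^sup>2" unfolding eq .
qed

text \<open>The Wronskian has modulus 2 |X|^2 |Im H| \<ge> sqrt s |X|^2, which
  \<open>X_modulus\<close> bounds below by |\<gamma>|^2 / 8. The number 320 is 4 times 10 times 8,
  just what \<open>variation_of_constants\<close> demands of B = 10 CR |\<gamma>|^2
  \<kappa>.\<close>

lemma oscillatory_solution:
  assumes \<rho>: "\<rho> = \<i>"
    and large: "s0 \<ge> 4" "s0 \<ge> 16 * (K + 1)" "2 * K \<le> norm \<gamma> * s0" and small: "16 * G * \<kappa> \<le> 1" "320 * CR * \<kappa> \<le> 1"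
    and a: "\<And>s. s \<in> {s0..\<nu>/\<kappa>} \<Longrightarrow> (a has_real_derivative b s) (at s within {s0..\<nu>/\<kappa>})"
    and b: "\<And>s. s \<in> {s0..\<nu>/\<kappa>} \<Longrightarrow> (b has_real_derivative - (s * g (\<kappa> * s)) * a s) (at s within {s0..\<nu>/\<kappa>})"
    and init: "norm ((of_real (a s0) - of_real (Re (X s0))) * cnj (H s0 * X s0)
        - (of_real (b s0) - of_real (Re (H s0 * X s0))) * cnj (X s0)) \<le> d * \<kappa>"
    and t: "t \<in> {s0..\<nu>/\<kappa>}"
  defines "C \<equiv> 16 * (2 * d / (norm \<gamma>)\<^sup>2 + 40 * CR)"
  shows "\<bar>a t - Re (X t)\<bar> \<le> C * \<kappa> * norm (X t)"
    and "\<bar>b t - Re (H t * X t)\<bar> \<le> C * \<kappa> * norm (H t * X t)"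
proof -
  let ?S = "{s0..\<nu>/\<kappa>}"
  have g0: "(norm \<gamma>)\<^sup>2 > 0" using \<gamma> by simp
  have s0_1: "s0 \<ge> 1" using large by simp
  define P where "P = (\<lambda>s. of_real (s * g (\<kappa> * s)) - R s)"
  define \<Gamma> where "\<Gamma> = (\<lambda>s. 5 * CR * (norm \<gamma>)\<^sup>2 * \<kappa> * (- 2 * s powr (-1/2)))"
  define \<Gamma>' where "\<Gamma>' = (\<lambda>s. 5 * CR * (norm \<gamma>)\<^sup>2 * \<kappa> * s powr (-3/2))"
  define B where "B = 10 * CR * (norm \<gamma>)\<^sup>2 * \<kappa>"
  have dY: "((\<lambda>s. H s * X s) has_vector_derivative - P s * X s) (at s within ?S)" if "s \<in> ?S" for s
  proof -
    have "(\<rho>\<^sup>2 * x + r) * z = - (x - r) * z" for x r z using \<rho> by (simp add: algebra_simps)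
    then show ?thesis using X_derivative(2)[OF that] unfolding P_def by (simp only:)
  qed
  have d\<Gamma>: "(\<Gamma> has_real_derivative \<Gamma>' s) (at s within ?S)" if "s \<in> ?S" for s
    unfolding \<Gamma>_def \<Gamma>'_def using that s0_1 by (auto intro!: derivative_eq_intros)
  have k: "norm (of_real (s * g (\<kappa> * s)) - P s) * (norm (X s))\<^sup>2 \<le> \<Gamma>' s" if s: "s \<in> ?S" for s
  proof -
    have sp: "s > 0" "s \<ge> 1" using s s0_1 by auto
    have X2: "(norm (X s))\<^sup>2 \<le> 5 * (norm \<gamma>)\<^sup>2 * s powr (-1/2)"
    proof -
      have "s powr (-1/2) = 1 / sqrt s" using sp by (simp add: powr_minus_divide powr_half_sqrt)
      then show ?thesis using X_modulus(2)[OF \<rho> s large(3)] sp by (simp add: pos_le_divide_eq mult.commute)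
    qed
    have "norm (of_real (s * g (\<kappa> * s)) - P s) * (norm (X s))\<^sup>2 \<le> (CR * \<kappa> / s) * (5 * (norm \<gamma>)\<^sup>2 * s powr (-1/2))"
      using R_le[OF s] X2 CR_nonneg \<kappa> sp by (intro mult_mono) (auto simp: P_def)
    also have "\<dots> = 5 * CR * (norm \<gamma>)\<^sup>2 * \<kappa> * (s powr (-1) * s powr (-1/2))" using sp by (simp add: powr_minus_divide)
    also have "s powr (-1) * s powr (-1/2) = s powr (-3/2)" unfolding powr_add [symmetric] by simp
    finally show ?thesis by (simp add: \<Gamma>'_def)
  qed
  have BG: "\<Gamma> (\<nu>/\<kappa>) - \<Gamma> s0 \<le> B"
  proof -
    have c: "5 * CR * (norm \<gamma>)\<^sup>2 * \<kappa> \<ge> 0" using CR_nonneg \<kappa> by simp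
    have "s0 powr (-1/2) \<le> 1" using powr_mono[of "-1/2" 0 s0] s0_1 by simp
    then have "- 2 * (\<nu>/\<kappa>) powr (-1/2) - (- 2 * s0 powr (-1/2)) \<le> 2" using powr_ge_zero[of "\<nu>/\<kappa>" "-1/2"] by linarith
    from mult_left_mono[OF this c] show ?thesis by (simp add: \<Gamma>_def B_def algebra_simps)
  qed
  have W: "norm (X s * cnj (H s * X s) - cnj (X s) * (H s * X s)) \<ge> (norm \<gamma>)\<^sup>2 / 8" if s: "s \<in> ?S" for s
  proof -
    have "X s * cnj (H s * X s) - cnj (X s) * (H s * X s) = of_real ((norm (X s))\<^sup>2) * (- 2 * \<i> * of_real (Im (H s)))"
      unfolding complex_norm_square by (simp add: complex_eq_iff algebra_simps)
    then have eq: "norm (X s * cnj (H s * X s) - cnj (X s) * (H s * X s)) = 2 * (norm (X s))\<^sup>2 * \<bar>Im (H s)\<bar>"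
      by (simp add: norm_mult norm_power)
    have "\<bar>Im (H s) - sqrt (s * g (\<kappa> * s))\<bar> \<le> 1 / 8"
      using H_dominant(1)[OF s large(1,2) small(1)] abs_Im_le_cmod[of "H s - \<rho> * of_real (sqrt (s * g (\<kappa> * s)))"] by (simp add: \<rho>)
    then have "\<bar>Im (H s)\<bar> \<ge> sqrt s / 2" using H_dominant(2,3)[OF s large(1,2) small(1)] by linarith
    then have "2 * (norm (X s))\<^sup>2 * (sqrt s / 2) \<le> 2 * (norm (X s))\<^sup>2 * \<bar>Im (H s)\<bar>" by (intro mult_left_mono) auto
    then show ?thesis unfolding eq using X_modulus(1)[OF \<rho> s large(3)] by (simp add: mult.commute)
  qed
  have B4: "4 * B \<le> (norm \<gamma>)\<^sup>2 / 8"
    using mult_right_mono[OF small(2), of "(norm \<gamma>)\<^sup>2 / 8"] by (simp add: B_def algebra_simps)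
  define D0 where "D0 = norm ((of_real (a s0) - of_real (Re (X s0))) * cnj (H s0 * X s0)
        - (of_real (b s0) - of_real (Re (H s0 * X s0))) * cnj (X s0))"
  note vc = variation_of_constants[where a=a and b=b and X=X and Y="\<lambda>s. H s * X s" and P=P and Q="\<lambda>s. s * g (\<kappa> * s)" and \<Gamma>=\<Gamma> and \<Gamma>'=\<Gamma>' and B=B
      and p=s0 and q="\<nu>/\<kappa>" and t=t, folded D0_def]
  have C: "2 * (2 * D0 + 4 * B) / ((norm \<gamma>)\<^sup>2 / 8) \<le> C * \<kappa>"
  proof -
    have "2 * (2 * D0 + 4 * B) / ((norm \<gamma>)\<^sup>2 / 8) \<le> 2 * (2 * (d * \<kappa>) + 4 * B) / ((norm \<gamma>)\<^sup>2 / 8)"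
      using init g0 by (intro divide_right_mono) (auto simp: D0_def)
    also have "\<dots> = C * \<kappa>" using g0 by (simp add: C_def B_def field_simps)
    finally show ?thesis .
  qed
  have "\<bar>a t - Re (X t)\<bar> \<le> 2 * (2 * D0 + 4 * B) / ((norm \<gamma>)\<^sup>2 / 8) * norm (X t)"
    by (rule vc(1)) (use interval_nonempty a b X_derivative(1) dY k d\<Gamma> BG g0 B4 W t in auto)
  then show "\<bar>a t - Re (X t)\<bar> \<le> C * \<kappa> * norm (X t)"
    using mult_right_mono[OF C norm_ge_zero[of "X t"]] by linarith
  have "\<bar>b t - Re (H t * X t)\<bar> \<le> 2 * (2 * D0 + 4 * B) / ((norm \<gamma>)\<^sup>2 / 8) * norm (H t * X t)"
    by (rule vc(2)) (use interval_nonempty a b X_derivative(1) dY k d\<Gamma> BG g0 B4 W t in auto)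
  then show "\<bar>b t - Re (H t * X t)\<bar> \<le> C * \<kappa> * norm (H t * X t)"
    using mult_right_mono[OF C norm_ge_zero[of "H t * X t"]] by linarith
qed

end

section \<open>The regions away from the turning point\<close>

text \<open>With v = y^(1/4) one has y - 1 = (v - 1) (v + 1) (v^2 + 1), and v \<ge> 1/2 controls the
  reciprocal.\<close>

lemma powr_quarter_near_1:
  fixes y :: real
  assumes "1 / 2 \<le> y"
  shows "\<bar>y powr (-1/4) - 1\<bar> \<le> 2 * \<bar>y - 1\<bar>"
proof -
  define v where "v = y powr (1/4)"
  have v: "v > 0" "v ^ 4 = y" using assms by (simp_all add: v_def powr_power)
  have "(1/2) ^ 4 \<le> v ^ 4" using assms v by (simp add: power4_eq_xxxx)
  then have v2: "1 / 2 \<le> v" using v power_le_imp_le_base[of "1/2" 3 v] by (simp add: eval_nat_numeral)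
  have "y - 1 = (v - 1) * ((v + 1) * (v\<^sup>2 + 1))" unfolding v(2)[symmetric] by (simp add: power2_eq_square power4_eq_xxxx algebra_simps)
  then have "\<bar>y - 1\<bar> = \<bar>v - 1\<bar> * ((v + 1) * (v\<^sup>2 + 1))" using v by (simp add: abs_mult)
  moreover have "1 * 1 \<le> (v + 1) * (v\<^sup>2 + 1)" using v by (intro mult_mono) auto
  ultimately have 1: "\<bar>v - 1\<bar> \<le> \<bar>y - 1\<bar>" using mult_left_mono[of 1 "(v + 1) * (v\<^sup>2 + 1)" "\<bar>v - 1\<bar>"] by simp
  have "y powr (-1/4) = 1 / v" using assms by (simp add: v_def powr_minus_divide)
  then have "y powr (-1/4) - 1 = (1 - v) / v" using v by (simp add: diff_divide_distrib)
  then have "\<bar>y powr (-1/4) - 1\<bar> = \<bar>v - 1\<bar> / v" using v by (simp add: abs_minus_commute)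
  also have "\<dots> \<le> \<bar>y - 1\<bar> / (1 / 2)" using 1 v2 by (intro frac_le) auto
  finally show ?thesis by simp
qed

text \<open>Here \<open>s = |t| / \<kappa>\<close> with \<open>\<kappa> = \<epsilon>\<^bsup>2/3\<^esup>\<close>, the equation is \<open>a'' = \<rho>\<^sup>2 s g(\<kappa> s) a\<close>, and \<open>\<Psi>\<close> is the modulus of the
  phase integral; \<open>Xf\<close> and \<open>Yf\<close> are the approximants of \<open>a\<close> and \<open>a'\<close> in the theorem.\<close>

locale profile = airy_branch +
  fixes g g1 g2 \<Psi> :: "real \<Rightarrow> real" and \<nu> G s0 :: real
  assumes \<nu>: "0 < \<nu>" "\<nu> \<le> 1" and s0: "s1 \<le> s0"
    and large: "s0 \<ge> 4" "s0 \<ge> 16 * (K + 1)" "2 * K \<le> norm \<gamma> * s0"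
    and g_bounds: "\<And>u. u \<in> {0<..\<nu>} \<Longrightarrow> 1 / 2 \<le> g u \<and> g u \<le> 2"
    and g_1: "\<And>u. u \<in> {0<..\<nu>} \<Longrightarrow> \<bar>g u - 1\<bar> \<le> G * u"
    and dg: "\<And>u. u \<in> {0<..\<nu>} \<Longrightarrow> (g has_real_derivative g1 u) (at u)"
    and dg1: "\<And>u. u \<in> {0<..\<nu>} \<Longrightarrow> (g1 has_real_derivative g2 u) (at u)"
    and g1_le: "\<And>u. u \<in> {0<..\<nu>} \<Longrightarrow> \<bar>g1 u\<bar> \<le> G"
    and g2_le: "\<And>u. u \<in> {0<..\<nu>} \<Longrightarrow> \<bar>g2 u\<bar> \<le> G"
    and d\<Psi>: "\<And>u. u \<in> {0<..\<nu>} \<Longrightarrow> (\<Psi> has_real_derivative sqrt (u * g u)) (at u within {0..\<nu>})"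
    and \<Psi>_near: "\<And>u. u \<in> {0<..\<nu>} \<Longrightarrow> \<bar>\<Psi> u - 2 / 3 * u powr (3/2)\<bar> \<le> G * u powr (5/2)"
begin

text \<open>The phase correction in the scaled variable: the divisor \<kappa>^(3/2) is \<epsilon>,
  and after the division the subtracted term is 2/3 s^(3/2), the phase of Airy's equation.\<close>

definition Th :: "real \<Rightarrow> real \<Rightarrow> real" where
  "Th \<kappa> s = (\<Psi> (\<kappa> * s) - 2 / 3 * (\<kappa> * s) powr (3/2)) / \<kappa> powr (3/2)"

definition Xf :: "real \<Rightarrow> real \<Rightarrow> complex" where
  "Xf \<kappa> s = of_real (g (\<kappa> * s) powr (-1/4)) * E s * exp (\<rho> * of_real (Th \<kappa> s))"

definition Yf :: "real \<Rightarrow> real \<Rightarrow> complex" where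
  "Yf \<kappa> s = of_real (g (\<kappa> * s) powr (1/4)) * E1 s * exp (\<rho> * of_real (Th \<kappa> s))"

lemma G_nonneg: "G \<ge> 0"
  using g1_le[of \<nu>] \<nu> by auto

text \<open>\<kappa> is not a parameter of \<open>profile\<close>, so constants obtained in this
  locale are uniform in \<kappa>; every admissible \<kappa> yields one instance of
  \<open>wkb\<close>.\<close>

lemma wkb_instance:
  assumes \<kappa>: "0 < \<kappa>" "\<kappa> * s0 \<le> \<nu>"
  shows "wkb \<rho> E E1 \<gamma> s1 K g g1 g2 (Th \<kappa>) \<nu> G \<kappa> s0"
proof
  fix s assume s: "s \<in> {s0..\<nu>/\<kappa>}"
  have sp: "s > 0" using s s0 s1 by auto
  have u: "\<kappa> * s \<in> {0<..\<nu>}" using s sp \<kappa> by (auto simp: field_simps)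
  have d\<kappa>: "((\<lambda>s. \<kappa> * s) has_real_derivative \<kappa>) (at s within {s0..\<nu>/\<kappa>})"
    by (auto intro!: derivative_eq_intros)
  have img: "(\<lambda>s. \<kappa> * s) ` {s0..\<nu>/\<kappa>} \<subseteq> {0..\<nu>}" using \<kappa> s0 s1 by (auto simp: field_simps)
  have 1: "((\<lambda>s. \<Psi> (\<kappa> * s)) has_real_derivative sqrt (\<kappa> * s * g (\<kappa> * s)) * \<kappa>) (at s within {s0..\<nu>/\<kappa>})"
    using DERIV_image_chain[where g="\<lambda>s. \<kappa> * s" and f=\<Psi>, OF has_field_derivative_subset[OF d\<Psi>[OF u] img] d\<kappa>] by (simp add: o_def)
  have 2: "((\<lambda>s. 2 / 3 * (\<kappa> * s) powr (3/2)) has_real_derivative sqrt (\<kappa> * s) * \<kappa>) (at s within {s0..\<nu>/\<kappa>})"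
  proof -
    have "((\<lambda>u. 2 / 3 * u powr (3/2)) has_real_derivative 2 / 3 * (3/2 * (\<kappa> * s) powr (3/2 - 1))) (at (\<kappa> * s))"
      using u by (intro DERIV_cmult has_real_derivative_powr) auto
    from DERIV_chain2[where g="\<lambda>s. \<kappa> * s", OF this d\<kappa>] show ?thesis using u by (simp add: powr_half_sqrt)
  qed
  have kk: "\<kappa> powr (3/2) = \<kappa> * sqrt \<kappa>"
    using powr_add[of \<kappa> 1 "1/2"] \<kappa> by (simp add: powr_half_sqrt)
  have "(Th \<kappa> has_real_derivative (sqrt (\<kappa> * s * g (\<kappa> * s)) * \<kappa> - sqrt (\<kappa> * s) * \<kappa>) / \<kappa> powr (3/2)) (at s within {s0..\<nu>/\<kappa>})"
    unfolding Th_def[abs_def] by (intro DERIV_cdivide DERIV_diff 1 2)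
  also have "(sqrt (\<kappa> * s * g (\<kappa> * s)) * \<kappa> - sqrt (\<kappa> * s) * \<kappa>) / \<kappa> powr (3/2) = sqrt (s * g (\<kappa> * s)) - sqrt s"
    unfolding kk using \<kappa> by (simp add: real_sqrt_mult field_simps)
  finally show "(Th \<kappa> has_real_derivative sqrt (s * g (\<kappa> * s)) - sqrt s) (at s within {s0..\<nu>/\<kappa>})" .
qed (use \<nu> s0 \<kappa> g_bounds g_1 dg dg1 g1_le g2_le in auto)

lemma Yf_eq:
  assumes "0 < \<kappa>" "s \<in> {s0..\<nu>/\<kappa>}"
  shows "Yf \<kappa> s = of_real (sqrt (g (\<kappa> * s))) * (E1 s / E s) * Xf \<kappa> s"
proof -
  have "\<kappa> * s \<in> {0<..\<nu>}" using assms s0 s1 by (auto simp: field_simps intro: mult_pos_pos)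
  then have g: "g (\<kappa> * s) > 0" using g_bounds[of "\<kappa> * s"] by simp
  have "g (\<kappa> * s) powr (1/4) = g (\<kappa> * s) powr (1/2) * g (\<kappa> * s) powr (-1/4)" unfolding powr_add [symmetric] by simp
  then have "g (\<kappa> * s) powr (1/4) = sqrt (g (\<kappa> * s)) * g (\<kappa> * s) powr (-1/4)" using g by (simp add: powr_half_sqrt)
  moreover have "E s \<noteq> 0" using E_nz[of s] assms s0 by auto
  ultimately show ?thesis unfolding Yf_def Xf_def by simp
qed

text \<open>At the fixed point s0 both correction factors are 1 + O(\<kappa>): g - 1 is O(\<kappa>
  s0) and the phase correction is O(\<kappa> s0^(5/2)). This links the outer approximants to the
  pure Airy functions used in between.\<close>

lemma edge_estimates:
  shows "\<exists>C\<ge>0. \<exists>\<kappa>0>0. \<forall>\<kappa>. 0 < \<kappa> \<and> \<kappa> < \<kappa>0 \<longrightarrow> norm (Xf \<kappa> s0 - E s0) \<le> C * \<kappa> \<and> norm (Yf \<kappa> s0 - E1 s0) \<le> C * \<kappa>"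
proof -
  define T where "T = G * s0 powr (5/2)"
  define F where "F = 4 * G * s0 + 3 / 2 * T"
  define C where "C = F * norm (E s0) + (F + 2 * G * s0 * (F + 1)) * norm (E1 s0)"
  have s0p: "s0 > 0" "s0 \<ge> 1" using large by auto
  have T: "T \<ge> 0" using G_nonneg by (simp add: T_def)
  have F: "F \<ge> 0" using T G_nonneg s0p by (simp add: F_def)
  have C: "C \<ge> 0" using F G_nonneg s0p by (simp add: C_def)
  \<comment> \<open>The last bound keeps T \<kappa> \<le> 1/2, where exp z - 1 is controlled
    linearly by z.\<close>
  define \<kappa>0 where "\<kappa>0 = min (\<nu> / s0) (min 1 (1 / (2 * T + 1)))"
  have \<kappa>0: "\<kappa>0 > 0" using \<nu> s0p T by (auto simp: \<kappa>0_def)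
  have "norm (Xf \<kappa> s0 - E s0) \<le> C * \<kappa> \<and> norm (Yf \<kappa> s0 - E1 s0) \<le> C * \<kappa>" if \<kappa>: "0 < \<kappa>" "\<kappa> < \<kappa>0" for \<kappa>
  proof -
    have k1: "\<kappa> \<le> 1" and ks: "\<kappa> * s0 \<in> {0<..\<nu>}" and kT: "T * \<kappa> \<le> 1 / 2"
    proof -
      show "\<kappa> \<le> 1" using \<kappa> by (simp add: \<kappa>0_def)
      have "\<kappa> \<le> \<nu> / s0" using \<kappa> by (simp add: \<kappa>0_def)
      then show "\<kappa> * s0 \<in> {0<..\<nu>}" using \<kappa> s0p by (simp add: pos_le_divide_eq)
      have "\<kappa> \<le> 1 / (2 * T + 1)" using \<kappa> by (simp add: \<kappa>0_def)
      then have "\<kappa> * (2 * T + 1) \<le> 1" using T by (simp add: pos_le_divide_eq)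
      then show "T * \<kappa> \<le> 1 / 2" using \<kappa> by (simp add: algebra_simps)
    qed
    define y where "y = g (\<kappa> * s0)"
    have y: "1 / 2 \<le> y" "y \<le> 2" "\<bar>y - 1\<bar> \<le> G * \<kappa> * s0" using g_bounds[OF ks] g_1[OF ks] by (auto simp: y_def mult_ac)
    have Th: "\<bar>Th \<kappa> s0\<bar> \<le> T * \<kappa>"
    proof -
      have "\<bar>Th \<kappa> s0\<bar> = \<bar>\<Psi> (\<kappa> * s0) - 2 / 3 * (\<kappa> * s0) powr (3/2)\<bar> / \<kappa> powr (3/2)"
        unfolding Th_def by (simp add: abs_divide)
      also have "\<dots> \<le> (G * (\<kappa> * s0) powr (5/2)) / \<kappa> powr (3/2)" by (intro divide_right_mono \<Psi>_near ks) auto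
      also have "\<dots> = T * (\<kappa> powr (5/2) / \<kappa> powr (3/2))" using \<kappa> s0p by (simp add: T_def powr_mult)
      also have "\<kappa> powr (5/2) / \<kappa> powr (3/2) = \<kappa>" unfolding powr_diff [symmetric] using \<kappa> by simp
      finally show ?thesis .
    qed
    define e where "e = exp (\<rho> * of_real (Th \<kappa> s0))"
    have nz: "norm (\<rho> * of_real (Th \<kappa> s0)) \<le> T * \<kappa>" using Th by (simp add: norm_mult norm_\<rho>)
    then have e1: "norm (e - 1) \<le> 3 / 2 * (T * \<kappa>)"
      using norm_exp_bounds(2)[of "\<rho> * of_real (Th \<kappa> s0)"] kT unfolding e_def by linarith
    have e2: "norm e \<le> 2" using norm_triangle_sub[of e 1] e1 kT by simp
    define f where "f = of_real (y powr (-1/4)) * e"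
    have f1: "norm (f - 1) \<le> F * \<kappa>"
    proof -
      have "f - 1 = of_real (y powr (-1/4) - 1) * e + (e - 1)" by (simp add: f_def algebra_simps)
      also have "norm \<dots> \<le> norm (of_real (y powr (-1/4) - 1) * e) + norm (e - 1)" by (rule norm_triangle_ineq)
      also have "norm (of_real (y powr (-1/4) - 1) * e) \<le> (2 * (G * \<kappa> * s0)) * 2"
        unfolding norm_mult norm_of_real using powr_quarter_near_1[OF y(1)] y(3) e2 by (intro mult_mono) auto
      finally show ?thesis using e1 by (simp add: F_def algebra_simps)
    qed
    have "Xf \<kappa> s0 - E s0 = (f - 1) * E s0" by (simp add: Xf_def f_def e_def y_def algebra_simps)
    then have "norm (Xf \<kappa> s0 - E s0) \<le> F * \<kappa> * norm (E s0)" using f1 by (simp add: norm_mult mult_right_mono)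
    moreover have "norm (Yf \<kappa> s0 - E1 s0) \<le> (F + 2 * G * s0 * (F + 1)) * \<kappa> * norm (E1 s0)"
    proof -
      have "Yf \<kappa> s0 = of_real (sqrt y) * f * E1 s0"
      proof -
        have "y powr (1/4) = y powr (1/2) * y powr (-1/4)" unfolding powr_add [symmetric] by simp
        then have "y powr (1/4) = sqrt y * y powr (-1/4)" using y by (simp add: powr_half_sqrt)
        then show ?thesis by (simp add: Yf_def f_def e_def y_def)
      qed
      then have "Yf \<kappa> s0 - E1 s0 = ((f - 1) + of_real (sqrt y - 1) * f) * E1 s0" by (simp add: algebra_simps)
      moreover have "norm ((f - 1) + of_real (sqrt y - 1) * f) \<le> (F + 2 * G * s0 * (F + 1)) * \<kappa>"
      proof -
        have "sqrt y * sqrt y = y" using y by simp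
        then have "(sqrt y - 1) * (sqrt y + 1) = y - 1" by (simp add: algebra_simps)
        then have "\<bar>sqrt y - 1\<bar> * (sqrt y + 1) = \<bar>y - 1\<bar>" using y by (simp add: abs_mult flip: \<open>(sqrt y - 1) * (sqrt y + 1) = y - 1\<close>)
        moreover have "\<bar>sqrt y - 1\<bar> \<le> \<bar>sqrt y - 1\<bar> * (sqrt y + 1)"
          using mult_left_mono[of 1 "sqrt y + 1" "\<bar>sqrt y - 1\<bar>"] y by simp
        ultimately have sy: "\<bar>sqrt y - 1\<bar> \<le> G * \<kappa> * s0" using y by linarith
        have "F * \<kappa> \<le> F * 1" using k1 F by (intro mult_left_mono) auto
        then have nf: "norm f \<le> F + 1" using norm_triangle_sub[of f 1] f1 by simp
        have "norm ((f - 1) + of_real (sqrt y - 1) * f) \<le> norm (f - 1) + norm (of_real (sqrt y - 1) * f)" by (rule norm_triangle_ineq)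
        also have "norm (of_real (sqrt y - 1) * f) \<le> (G * \<kappa> * s0) * (F + 1)"
          unfolding norm_mult norm_of_real using sy nf by (intro mult_mono) auto
        finally have "norm ((f - 1) + of_real (sqrt y - 1) * f) \<le> F * \<kappa> + (G * \<kappa> * s0) * (F + 1)" using f1 by linarith
        also have "(G * \<kappa> * s0) * (F + 1) \<le> 2 * ((G * \<kappa> * s0) * (F + 1))" using F G_nonneg \<kappa> s0p by simp
        finally show ?thesis by (simp add: algebra_simps)
      qed
      ultimately show ?thesis by (simp add: norm_mult mult_right_mono)
    qed
    moreover have "F * \<kappa> * norm (E s0) \<le> C * \<kappa>" "(F + 2 * G * s0 * (F + 1)) * \<kappa> * norm (E1 s0) \<le> C * \<kappa>"
      using F G_nonneg s0p \<kappa> by (simp_all add: C_def algebra_simps)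
    ultimately show ?thesis by linarith
  qed
  then show ?thesis using C \<kappa>0 by blast
qed

text \<open>Makes the constants uniform in \<kappa> and records the values at s0, which are the
  initial data for the middle region.\<close>

lemma recessive_region:
  assumes \<rho>: "\<rho> = - 1" and real: "\<And>s. E s \<in> \<real>" "\<And>s. E1 s \<in> \<real>" and L: "L \<ge> 0"
  shows "\<exists>C\<ge>0. \<exists>\<kappa>0>0. \<forall>\<kappa>. 0 < \<kappa> \<and> \<kappa> < \<kappa>0 \<longrightarrow> (\<forall>a a'.
     (\<forall>s\<in>{s0..\<nu>/\<kappa>}. (a has_real_derivative a' s) (at s within {s0..\<nu>/\<kappa>}) \<and>
        (a' has_real_derivative s * g (\<kappa> * s) * a s) (at s within {s0..\<nu>/\<kappa>})) \<and>
     a (\<nu> / \<kappa>) = Re (Xf \<kappa> (\<nu> / \<kappa>)) \<and> \<bar>a' (\<nu> / \<kappa>) / a (\<nu> / \<kappa>) + sqrt (\<nu> / \<kappa> * g \<nu>)\<bar> \<le> L * \<kappa>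
     \<longrightarrow> (\<forall>t\<in>{s0..\<nu>/\<kappa>}. \<bar>a t - Re (Xf \<kappa> t)\<bar> \<le> C * \<kappa> * \<bar>Re (Xf \<kappa> t)\<bar> \<and> \<bar>a' t - Re (Yf \<kappa> t)\<bar> \<le> C * \<kappa> * \<bar>Re (Yf \<kappa> t)\<bar>)
       \<and> \<bar>a s0 - Re (E s0)\<bar> \<le> C * \<kappa> \<and> \<bar>a' s0 - Re (E1 s0)\<bar> \<le> C * \<kappa>)"
proof -
  define CR where "CR = wkb.CR K G"
  define C0 where "C0 = 8 * CR + (L + (K + 1) / \<nu> + G)"
  define C1 where "C1 = 8 * (G * (K + 2)) + 3 * C0"
  obtain Ce \<kappa>e where e: "Ce \<ge> 0" "\<kappa>e > 0"
    "\<And>\<kappa>. 0 < \<kappa> \<Longrightarrow> \<kappa> < \<kappa>e \<Longrightarrow> norm (Xf \<kappa> s0 - E s0) \<le> Ce * \<kappa> \<and> norm (Yf \<kappa> s0 - E1 s0) \<le> Ce * \<kappa>"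
    using edge_estimates by blast
  \<comment> \<open>\<open>CR\<close> is a polynomial in K and G; its sign is read off from an
    instance at one admissible \<kappa>.\<close>
  have CR: "CR \<ge> 0"
  proof -
    define k where "k = \<nu> / s0"
    have "0 < k" "k * s0 \<le> \<nu>" using \<nu> large by (auto simp: k_def)
    then interpret w: wkb \<rho> E E1 \<gamma> s1 K g g1 g2 "Th k" \<nu> G k s0 by (rule wkb_instance)
    show ?thesis unfolding CR_def by (rule w.CR_nonneg)
  qed
  have C0: "C0 \<ge> 0" using CR L K \<nu> G_nonneg by (simp add: C0_def)
  have C1: "C1 \<ge> C0" "C1 \<ge> 0" using C0 K G_nonneg by (simp_all add: C1_def)
  define D where "D = norm (E s0) + norm (E1 s0) + Ce"
  define C where "C = C1 * (1 + D) + Ce"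
  have D: "D \<ge> 0" using e by (simp add: D_def)
  have C: "C \<ge> 0" "C \<ge> C1" using C1 D e by (simp_all add: C_def algebra_simps)
  \<comment> \<open>A sum of nonnegative terms: Z \<kappa> \<le> 1 implies every smallness condition
    at once, including \<kappa> s0 \<le> \<nu>.\<close>
  define Z where "Z = 1 + 16 * G + 4 * CR + (L + (K + 1) / \<nu> + G) + s0 / \<nu>"
  have Zp: "Z \<ge> 1" using G_nonneg CR L K \<nu> large by (simp add: Z_def)
  define \<kappa>0 where "\<kappa>0 = min \<kappa>e (1 / Z)"
  have \<kappa>0: "\<kappa>0 > 0" using e Zp by (simp add: \<kappa>0_def)
  show ?thesis
  proof (rule exI[of _ C], rule conjI[OF C(1)], rule exI[of _ \<kappa>0], rule conjI[OF \<kappa>0], intro allI impI conjI)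
    fix \<kappa> :: real and a a' :: "real \<Rightarrow> real"
    assume \<kappa>: "0 < \<kappa> \<and> \<kappa> < \<kappa>0" and as: "(\<forall>s\<in>{s0..\<nu>/\<kappa>}. (a has_real_derivative a' s) (at s within {s0..\<nu>/\<kappa>}) \<and>
        (a' has_real_derivative s * g (\<kappa> * s) * a s) (at s within {s0..\<nu>/\<kappa>})) \<and>
     a (\<nu> / \<kappa>) = Re (Xf \<kappa> (\<nu> / \<kappa>)) \<and> \<bar>a' (\<nu> / \<kappa>) / a (\<nu> / \<kappa>) + sqrt (\<nu> / \<kappa> * g \<nu>)\<bar> \<le> L * \<kappa>"
    have Zk: "Z * \<kappa> \<le> 1" using \<kappa> Zp by (simp add: \<kappa>0_def pos_less_divide_eq mult.commute)
    have sm: "x * \<kappa> \<le> 1" if "x \<le> Z" for x using mult_right_mono[OF that, of \<kappa>] \<kappa> Zk by linarith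
    have p: "16 * G \<ge> 0" "4 * CR \<ge> 0" "L + (K + 1) / \<nu> + G \<ge> 0" "s0 / \<nu> \<ge> 0" using G_nonneg CR L K \<nu> large by auto
    have small: "16 * G * \<kappa> \<le> 1" "4 * CR * \<kappa> \<le> 1" "(L + (K + 1) / \<nu> + G) * \<kappa> \<le> 1" "s0 / \<nu> * \<kappa> \<le> 1" "1 * \<kappa> \<le> 1"
      by (rule sm, unfold Z_def, insert p, linarith)+
    have ks: "\<kappa> * s0 \<le> \<nu>" using small(4) \<nu> by (simp add: pos_divide_le_eq mult.commute)
    interpret w: wkb \<rho> E E1 \<gamma> s1 K g g1 g2 "Th \<kappa>" \<nu> G \<kappa> s0 by (rule wkb_instance) (use \<kappa> ks in auto)
    have X: "w.X = Xf \<kappa>" by (simp add: fun_eq_iff w.X_def Xf_def)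
    have main: "\<bar>a t - Re (Xf \<kappa> t)\<bar> \<le> C0 * \<kappa> * \<bar>Re (Xf \<kappa> t)\<bar> \<and> \<bar>a' t - Re (Yf \<kappa> t)\<bar> \<le> C1 * \<kappa> * \<bar>Re (Yf \<kappa> t)\<bar>"
      if t: "t \<in> {s0..\<nu>/\<kappa>}" for t
    proof
      have d: "(a has_real_derivative a' s) (at s within {s0..\<nu>/\<kappa>})" "(a' has_real_derivative s * g (\<kappa> * s) * a s) (at s within {s0..\<nu>/\<kappa>})"
        if "s \<in> {s0..\<nu>/\<kappa>}" for s using as that by auto
      note r = w.recessive_solution[OF \<rho> real(1) large(1,2) small(1) d _ _ L small(2,3)[unfolded CR_def] t, unfolded X, folded CR_def, folded C0_def, folded C1_def]
      show "\<bar>a t - Re (Xf \<kappa> t)\<bar> \<le> C0 * \<kappa> * \<bar>Re (Xf \<kappa> t)\<bar>" by (rule r(1)) (use as in auto)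
      show "\<bar>a' t - Re (Yf \<kappa> t)\<bar> \<le> C1 * \<kappa> * \<bar>Re (Yf \<kappa> t)\<bar>"
        unfolding Yf_eq[OF conjunct1[OF \<kappa>] t] by (rule r(2)) (use as in auto)
    qed
    have up: "c * \<kappa> * \<bar>x\<bar> \<le> C * \<kappa> * \<bar>x\<bar>" if "c \<le> C1" for c x :: real
      using that C \<kappa> by (intro mult_right_mono) auto
    have s0_in: "s0 \<in> {s0..\<nu>/\<kappa>}" using ks \<kappa> by (simp add: pos_le_divide_eq mult.commute)
    have ed: "norm (Xf \<kappa> s0 - E s0) \<le> Ce * \<kappa>" "norm (Yf \<kappa> s0 - E1 s0) \<le> Ce * \<kappa>" using e(3)[of \<kappa>] \<kappa> by (auto simp: \<kappa>0_def)
    have fin: "\<bar>u - Re z\<bar> \<le> C * \<kappa>" if u: "\<bar>u - Re x\<bar> \<le> c * \<kappa> * \<bar>Re x\<bar>" and c: "c \<le> C1" and xz: "norm (x - z) \<le> Ce * \<kappa>" and z: "norm z + Ce \<le> D" for u x z c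
    proof -
      have "Ce * \<kappa> \<le> Ce * 1" using small(5) e by (intro mult_left_mono) auto
      then have "norm x \<le> D" using norm_triangle_sub[of x z] xz z by linarith
      then have rx: "\<bar>Re x\<bar> \<le> D" using abs_Re_le_cmod[of x] by linarith
      have "c * \<kappa> * \<bar>Re x\<bar> \<le> C1 * \<kappa> * \<bar>Re x\<bar>" using c \<kappa> by (intro mult_right_mono) auto
      also have "\<dots> \<le> C1 * \<kappa> * D" using rx C1 \<kappa> by (intro mult_left_mono) auto
      finally have 1: "\<bar>u - Re x\<bar> \<le> C1 * \<kappa> * D" using u by linarith
      have 2: "\<bar>Re x - Re z\<bar> \<le> Ce * \<kappa>" using abs_Re_le_cmod[of "x - z"] xz by simp
      have "\<bar>u - Re z\<bar> \<le> C1 * \<kappa> * D + Ce * \<kappa>" using 1 2 by linarith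
      also have "\<dots> \<le> C * \<kappa>" using C1 \<kappa> by (simp add: C_def algebra_simps)
      finally show ?thesis .
    qed
    show "\<forall>t\<in>{s0..\<nu>/\<kappa>}. \<bar>a t - Re (Xf \<kappa> t)\<bar> \<le> C * \<kappa> * \<bar>Re (Xf \<kappa> t)\<bar> \<and> \<bar>a' t - Re (Yf \<kappa> t)\<bar> \<le> C * \<kappa> * \<bar>Re (Yf \<kappa> t)\<bar>"
      using main up[OF C1(1)] up[OF order_refl] order_trans by blast
    show "\<bar>a s0 - Re (E s0)\<bar> \<le> C * \<kappa>"
      by (rule fin[OF conjunct1[OF main[OF s0_in]] C1(1) ed(1)]) (simp add: D_def)
    show "\<bar>a' s0 - Re (E1 s0)\<bar> \<le> C * \<kappa>"
      by (rule fin[OF conjunct2[OF main[OF s0_in]] order_refl ed(2)]) (simp add: D_def)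
  qed
qed

end

context profile begin

text \<open>Besides the uniform estimate, both components are evaluated at s = \<nu> / \<kappa> with
  their amplitudes (s g)^(-1/4) and (s g)^(1/4) removed; these values determine the fibre over
  \<nu>.\<close>

lemma oscillatory_region:
  assumes \<rho>: "\<rho> = \<i>" and D: "D \<ge> 0"
  shows "\<exists>C\<ge>0. \<exists>\<kappa>0>0. \<forall>\<kappa>. 0 < \<kappa> \<and> \<kappa> < \<kappa>0 \<longrightarrow> (\<forall>a b.
     (\<forall>s\<in>{s0..\<nu>/\<kappa>}. (a has_real_derivative b s) (at s within {s0..\<nu>/\<kappa>}) \<and>
        (b has_real_derivative - (s * g (\<kappa> * s)) * a s) (at s within {s0..\<nu>/\<kappa>})) \<and>
     \<bar>a s0 - Re (E s0)\<bar> \<le> D * \<kappa> \<and> \<bar>b s0 - Re (E1 s0)\<bar> \<le> D * \<kappa>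
     \<longrightarrow> (\<forall>t\<in>{s0..\<nu>/\<kappa>}. \<bar>a t - Re (Xf \<kappa> t)\<bar> \<le> C * \<kappa> * norm (Xf \<kappa> t) \<and> \<bar>b t - Re (Yf \<kappa> t)\<bar> \<le> C * \<kappa> * norm (Yf \<kappa> t))
       \<and> \<bar>a (\<nu>/\<kappa>) * (\<nu>/\<kappa> * g \<nu>) powr (1/4) - Re (\<gamma> * exp (\<rho> * of_real (\<Psi> \<nu> / \<kappa> powr (3/2))))\<bar> \<le> C * \<kappa>
       \<and> \<bar>b (\<nu>/\<kappa>) * (\<nu>/\<kappa> * g \<nu>) powr (-1/4) - Re (\<rho> * \<gamma> * exp (\<rho> * of_real (\<Psi> \<nu> / \<kappa> powr (3/2))))\<bar> \<le> C * \<kappa>)"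
proof -
  define CR where "CR = wkb.CR K G"
  define k2 where "k2 = G * (K + 2)"
  have k2: "k2 \<ge> 0" using G_nonneg K by (simp add: k2_def)
  obtain Ce \<kappa>e where e: "Ce \<ge> 0" "\<kappa>e > 0"
    "\<And>\<kappa>. 0 < \<kappa> \<Longrightarrow> \<kappa> < \<kappa>e \<Longrightarrow> norm (Xf \<kappa> s0 - E s0) \<le> Ce * \<kappa> \<and> norm (Yf \<kappa> s0 - E1 s0) \<le> Ce * \<kappa>"
    using edge_estimates by blast
  have CR: "CR \<ge> 0"
  proof -
    define k where "k = \<nu> / s0"
    have "0 < k" "k * s0 \<le> \<nu>" using \<nu> large by (auto simp: k_def)
    then interpret w: wkb \<rho> E E1 \<gamma> s1 K g g1 g2 "Th k" \<nu> G k s0 by (rule wkb_instance)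
    show ?thesis unfolding CR_def by (rule w.CR_nonneg)
  qed
  define A B where "A = norm (E s0) + Ce" and "B = norm (E1 s0) + Ce"
  have AB: "A \<ge> 0" "B \<ge> 0" using e by (auto simp: A_def B_def)
  \<comment> \<open>Bounds the initial Wronskian error: a and b deviate from Re X and Re (H X) by D
    + Ce, plus k2 A for the exchange of H, while |X| \<le> A and |H X| \<le> B + k2 A.\<close>
  define d where "d = (D + Ce) * (B + k2 * A) + (D + Ce + k2 * A) * A"
  define C0 where "C0 = 16 * (2 * d / (norm \<gamma>)\<^sup>2 + 40 * CR)"
  have C0: "C0 \<ge> 0" using D e AB k2 CR by (simp add: C0_def d_def)
  define C1 where "C1 = C0 * (1 + 2 * k2) + 2 * k2"
  have C1: "C1 \<ge> C0" "C1 \<ge> 0" using C0 k2 by (auto simp: C1_def algebra_simps)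
  define h where "h = (K + 1) / \<nu> + G"
  have h: "h \<ge> 0" using K \<nu> G_nonneg by (simp add: h_def)
  define z where "z = norm \<gamma> + K / \<nu>"
  have z: "z \<ge> 0" "K / \<nu> \<ge> 0" using K \<nu> by (auto simp: z_def)
  define C2 where "C2 = C0 * z + K / \<nu>"
  define C3 where "C3 = C0 * ((1 + h) * z) + (h * z + K / \<nu>)"
  define C where "C = C1 + C2 + C3"
  have C23: "C2 \<ge> 0" "C3 \<ge> 0" using C0 h z by (auto simp: C2_def C3_def)
  have C: "C \<ge> 0" "C1 \<le> C" "C2 \<le> C" "C3 \<le> C" using C1 C23 by (auto simp: C_def)
  define Z where "Z = 1 + 16 * G + 320 * CR + s0 / \<nu>"
  have Zp: "Z \<ge> 1" using G_nonneg CR \<nu> large by (simp add: Z_def)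
  define \<kappa>0 where "\<kappa>0 = min \<kappa>e (1 / Z)"
  have \<kappa>0: "\<kappa>0 > 0" using e Zp by (simp add: \<kappa>0_def)
  show ?thesis
  proof (rule exI[of _ C], rule conjI[OF C(1)], rule exI[of _ \<kappa>0], rule conjI[OF \<kappa>0], intro allI impI conjI)
    fix \<kappa> :: real and a b :: "real \<Rightarrow> real"
    assume \<kappa>: "0 < \<kappa> \<and> \<kappa> < \<kappa>0" and as: "(\<forall>s\<in>{s0..\<nu>/\<kappa>}. (a has_real_derivative b s) (at s within {s0..\<nu>/\<kappa>}) \<and>
        (b has_real_derivative - (s * g (\<kappa> * s)) * a s) (at s within {s0..\<nu>/\<kappa>})) \<and>
     \<bar>a s0 - Re (E s0)\<bar> \<le> D * \<kappa> \<and> \<bar>b s0 - Re (E1 s0)\<bar> \<le> D * \<kappa>"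
    have Zk: "Z * \<kappa> \<le> 1" using \<kappa> Zp by (simp add: \<kappa>0_def pos_less_divide_eq mult.commute)
    have sm: "x * \<kappa> \<le> 1" if "x \<le> Z" for x using mult_right_mono[OF that, of \<kappa>] \<kappa> Zk by linarith
    have p: "16 * G \<ge> 0" "320 * CR \<ge> 0" "s0 / \<nu> \<ge> 0" using G_nonneg CR \<nu> large by auto
    have small: "16 * G * \<kappa> \<le> 1" "320 * CR * \<kappa> \<le> 1" "s0 / \<nu> * \<kappa> \<le> 1" "1 * \<kappa> \<le> 1"
      by (rule sm, unfold Z_def, insert p, linarith)+
    have kp: "\<kappa> > 0" using \<kappa> by simp
    have ks: "\<kappa> * s0 \<le> \<nu>" using small(3) \<nu> by (simp add: pos_divide_le_eq mult.commute)
    interpret w: wkb \<rho> E E1 \<gamma> s1 K g g1 g2 "Th \<kappa>" \<nu> G \<kappa> s0 by (rule wkb_instance) (use \<kappa> ks in auto)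
    have X: "w.X = Xf \<kappa>" by (simp add: fun_eq_iff w.X_def Xf_def)
    have s0_in: "s0 \<in> {s0..\<nu>/\<kappa>}" using ks \<kappa> by (simp add: pos_le_divide_eq mult.commute)
    have ed: "norm (Xf \<kappa> s0 - E s0) \<le> Ce * \<kappa>" "norm (Yf \<kappa> s0 - E1 s0) \<le> Ce * \<kappa>" using e(3)[of \<kappa>] \<kappa> by (auto simp: \<kappa>0_def)
    have HXY: "norm (w.H t * Xf \<kappa> t - Yf \<kappa> t) \<le> k2 * \<kappa> * norm (Xf \<kappa> t)" if t: "t \<in> {s0..\<nu>/\<kappa>}" for t
    proof -
      have "w.H t * Xf \<kappa> t - Yf \<kappa> t = (w.H t - of_real (sqrt (g (\<kappa> * t))) * (E1 t / E t)) * Xf \<kappa> t"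
        unfolding Yf_eq[OF kp t] by (simp add: algebra_simps)
      then show ?thesis using w.H_near(1)[OF t] by (simp add: norm_mult k2_def mult_right_mono)
    qed
    have init: "norm ((of_real (a s0) - of_real (Re (Xf \<kappa> s0))) * cnj (w.H s0 * Xf \<kappa> s0)
        - (of_real (b s0) - of_real (Re (w.H s0 * Xf \<kappa> s0))) * cnj (Xf \<kappa> s0)) \<le> d * \<kappa>"
    proof -
      define x y hx where "x = Xf \<kappa> s0" and "y = Yf \<kappa> s0" and "hx = w.H s0 * Xf \<kappa> s0"
      have Ce1: "Ce * \<kappa> \<le> Ce" using mult_left_mono[OF small(4), of Ce] e by simp
      have nx: "norm x \<le> A" using norm_triangle_sub[of x "E s0"] ed(1) Ce1 by (simp add: x_def A_def)
      have ny: "norm y \<le> B" using norm_triangle_sub[of y "E1 s0"] ed(2) Ce1 by (simp add: y_def B_def)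
      have hy: "norm (hx - y) \<le> k2 * \<kappa> * A"
        using order_trans[OF HXY[OF s0_in] mult_left_mono[OF nx[unfolded x_def]]] k2 kp by (simp add: hx_def y_def)
      have "k2 * \<kappa> * A \<le> k2 * A" using mult_left_mono[OF small(4), of "k2 * A"] k2 AB by (simp add: mult_ac)
      then have nh: "norm hx \<le> B + k2 * A" using norm_triangle_sub[of hx y] hy ny by linarith
      have ax: "\<bar>a s0 - Re x\<bar> \<le> (D + Ce) * \<kappa>"
      proof -
        have "\<bar>a s0 - Re (E s0)\<bar> \<le> D * \<kappa>" using as by simp
        moreover have "\<bar>Re x - Re (E s0)\<bar> \<le> Ce * \<kappa>" using ed(1) abs_Re_le_cmod[of "x - E s0"] by (simp add: x_def)
        ultimately show ?thesis by (simp add: distrib_right)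
      qed
      have bh: "\<bar>b s0 - Re hx\<bar> \<le> (D + Ce + k2 * A) * \<kappa>"
      proof -
        have "\<bar>b s0 - Re (E1 s0)\<bar> \<le> D * \<kappa>" using as by simp
        moreover have "\<bar>Re y - Re (E1 s0)\<bar> \<le> Ce * \<kappa>" using ed(2) abs_Re_le_cmod[of "y - E1 s0"] by (simp add: y_def)
        moreover have "\<bar>Re hx - Re y\<bar> \<le> k2 * \<kappa> * A" using hy abs_Re_le_cmod[of "hx - y"] by simp
        moreover have "(D + Ce + k2 * A) * \<kappa> = D * \<kappa> + Ce * \<kappa> + k2 * \<kappa> * A" by (simp add: algebra_simps)
        ultimately show ?thesis by linarith
      qed
      have "norm ((of_real (a s0) - of_real (Re x)) * cnj hx - (of_real (b s0) - of_real (Re hx)) * cnj x)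
        \<le> norm ((of_real (a s0) - of_real (Re x)) * cnj hx) + norm ((of_real (b s0) - of_real (Re hx)) * cnj x)"
        by (rule norm_triangle_ineq4)
      also have "\<dots> = \<bar>a s0 - Re x\<bar> * norm hx + \<bar>b s0 - Re hx\<bar> * norm x"
        unfolding of_real_diff[symmetric] norm_mult norm_of_real complex_mod_cnj ..
      also have "\<dots> \<le> ((D + Ce) * \<kappa>) * (B + k2 * A) + ((D + Ce + k2 * A) * \<kappa>) * A"
        using ax nh bh nx D e kp k2 AB by (intro add_mono mult_mono) auto
      also have "\<dots> = d * \<kappa>" by (simp add: d_def algebra_simps)
      finally show ?thesis by (simp add: x_def hx_def)
    qed
    have da: "(a has_real_derivative b s) (at s within {s0..\<nu>/\<kappa>})" "(b has_real_derivative - (s * g (\<kappa> * s)) * a s) (at s within {s0..\<nu>/\<kappa>})"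
      if "s \<in> {s0..\<nu>/\<kappa>}" for s using as that by auto
    note r = w.oscillatory_solution[OF \<rho> large small(1) small(2)[unfolded CR_def] da, unfolded X, OF _ _ init, folded CR_def, folded C0_def]
    have ra: "\<bar>a t - Re (Xf \<kappa> t)\<bar> \<le> C0 * \<kappa> * norm (Xf \<kappa> t)" and rb: "\<bar>b t - Re (w.H t * Xf \<kappa> t)\<bar> \<le> C0 * \<kappa> * norm (w.H t * Xf \<kappa> t)"
      if t: "t \<in> {s0..\<nu>/\<kappa>}" for t using r t by auto
    show "\<forall>t\<in>{s0..\<nu>/\<kappa>}. \<bar>a t - Re (Xf \<kappa> t)\<bar> \<le> C * \<kappa> * norm (Xf \<kappa> t) \<and> \<bar>b t - Re (Yf \<kappa> t)\<bar> \<le> C * \<kappa> * norm (Yf \<kappa> t)"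
    proof (intro ballI conjI)
      fix t assume t: "t \<in> {s0..\<nu>/\<kappa>}"
      have "C0 * \<kappa> * norm (Xf \<kappa> t) \<le> C * \<kappa> * norm (Xf \<kappa> t)" using C C1 kp by (intro mult_right_mono) auto
      then show "\<bar>a t - Re (Xf \<kappa> t)\<bar> \<le> C * \<kappa> * norm (Xf \<kappa> t)" using ra[OF t] by linarith
      \<comment> \<open>The available error is relative to H X. The bound |Xf| \<le> 2 |Yf| makes
        it, and the cost of replacing H X by \<open>Yf\<close>, relative to
        \<open>Yf\<close>.\<close>
      have "1 / 2 * norm (Xf \<kappa> t) \<le> norm (Yf \<kappa> t)"
        unfolding Yf_eq[OF kp t] norm_mult[of _ "Xf \<kappa> t"] using w.p_lower[OF t large(1,2)] by (intro mult_right_mono) auto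
      then have xy: "norm (Xf \<kappa> t) \<le> 2 * norm (Yf \<kappa> t)" by simp
      have hy: "norm (w.H t * Xf \<kappa> t - Yf \<kappa> t) \<le> k2 * \<kappa> * (2 * norm (Yf \<kappa> t))"
        by (rule order_trans[OF HXY[OF t] mult_left_mono[OF xy]]) (use k2 kp in auto)
      have "k2 * \<kappa> * (2 * norm (Yf \<kappa> t)) \<le> k2 * (2 * norm (Yf \<kappa> t))"
        using mult_left_mono[OF small(4), of "k2 * (2 * norm (Yf \<kappa> t))"] k2 by (simp add: mult_ac)
      then have "norm (w.H t * Xf \<kappa> t) \<le> norm (Yf \<kappa> t) + k2 * (2 * norm (Yf \<kappa> t))"
        using norm_triangle_sub[of "w.H t * Xf \<kappa> t" "Yf \<kappa> t"] hy by linarith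
      then have "C0 * \<kappa> * norm (w.H t * Xf \<kappa> t) \<le> C0 * \<kappa> * (norm (Yf \<kappa> t) + k2 * (2 * norm (Yf \<kappa> t)))"
        using C0 kp by (intro mult_left_mono) auto
      moreover have "\<bar>Re (w.H t * Xf \<kappa> t) - Re (Yf \<kappa> t)\<bar> \<le> k2 * \<kappa> * (2 * norm (Yf \<kappa> t))"
        using order_trans[OF abs_Re_le_cmod hy] by simp
      ultimately have "\<bar>b t - Re (Yf \<kappa> t)\<bar> \<le> C0 * \<kappa> * (norm (Yf \<kappa> t) + k2 * (2 * norm (Yf \<kappa> t))) + k2 * \<kappa> * (2 * norm (Yf \<kappa> t))"
        using rb[OF t] by linarith
      also have "\<dots> = C1 * (\<kappa> * norm (Yf \<kappa> t))" by (simp add: C1_def algebra_simps)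
      also have "\<dots> \<le> C * (\<kappa> * norm (Yf \<kappa> t))" using C kp by (intro mult_right_mono) auto
      finally show "\<bar>b t - Re (Yf \<kappa> t)\<bar> \<le> C * \<kappa> * norm (Yf \<kappa> t)" by (simp add: mult.assoc)
    qed
    define q where "q = \<nu> / \<kappa>"
    have q: "q \<in> {s0..\<nu>/\<kappa>}" using s0_in by (simp add: q_def)
    have kq: "\<kappa> * q = \<nu>" using kp by (simp add: q_def)
    have qp: "q > 0" using q large by auto
    have gp: "g \<nu> > 0" using g_bounds[of \<nu>] \<nu> by simp
    define m where "m = (q * g \<nu>) powr (1/4)"
    have mp: "m > 0" using qp gp by (simp add: m_def)
    define ex where "ex = exp (\<rho> * of_real (\<Psi> \<nu> / \<kappa> powr (3/2)))"
    have nex: "norm ex = 1" using \<rho> by (simp add: ex_def)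
    define ZZ where "ZZ = Xf \<kappa> q * of_real m"
    \<comment> \<open>At the right end the correction and Airy's own phase recombine to the full
      phase integral.\<close>
    have ph: "Th \<kappa> q + 2 / 3 * q powr (3/2) = \<Psi> \<nu> / \<kappa> powr (3/2)"
      unfolding Th_def kq using \<nu> kp by (simp add: q_def powr_divide diff_divide_distrib)
    have Kq: "K / q = K / \<nu> * \<kappa>" by (simp add: q_def)
    have ZZ: "norm (ZZ - \<gamma> * ex) \<le> K / \<nu> * \<kappa>"
      using w.phase_factor[OF \<rho> q] unfolding X kq ph m_def[symmetric] ZZ_def[symmetric] ex_def[symmetric] Kq .
    have "K / \<nu> * \<kappa> \<le> K / \<nu>" using mult_left_mono[OF small(4) z(2)] by simp
    then have nZ: "norm ZZ \<le> z" using norm_triangle_sub[of ZZ "\<gamma> * ex"] ZZ by (simp add: norm_mult nex z_def)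
    have am: "\<bar>a q * m - Re ZZ\<bar> \<le> C0 * \<kappa> * z"
    proof -
      have "a q * m - Re ZZ = (a q - Re (Xf \<kappa> q)) * m" by (simp add: ZZ_def algebra_simps)
      then have "\<bar>a q * m - Re ZZ\<bar> = \<bar>a q - Re (Xf \<kappa> q)\<bar> * m" using mp by (simp add: abs_mult)
      also have "\<dots> \<le> (C0 * \<kappa> * norm (Xf \<kappa> q)) * m" using ra[OF q] mp by (intro mult_right_mono) auto
      also have "\<dots> = C0 * \<kappa> * norm ZZ" using mp by (simp add: ZZ_def norm_mult)
      also have "\<dots> \<le> C0 * \<kappa> * z" using nZ C0 kp by (intro mult_left_mono) auto
      finally show ?thesis .
    qed
    have "\<bar>Re ZZ - Re (\<gamma> * ex)\<bar> \<le> K / \<nu> * \<kappa>" using order_trans[OF abs_Re_le_cmod ZZ] by simp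
    then have "\<bar>a q * m - Re (\<gamma> * ex)\<bar> \<le> C0 * \<kappa> * z + K / \<nu> * \<kappa>" using am by linarith
    also have "\<dots> = C2 * \<kappa>" unfolding C2_def distrib_right by (simp only: mult_ac)
    also have "\<dots> \<le> C * \<kappa>" using C kp by (intro mult_right_mono) auto
    finally show "\<bar>a (\<nu>/\<kappa>) * (\<nu>/\<kappa> * g \<nu>) powr (1/4) - Re (\<gamma> * exp (\<rho> * of_real (\<Psi> \<nu> / \<kappa> powr (3/2))))\<bar> \<le> C * \<kappa>"
      unfolding m_def q_def ex_def .
    define v where "v = sqrt (q * g \<nu>)"
    have v: "v \<ge> 1"
      using w.H_dominant(2,3)[OF q large(1,2) small(1)] unfolding kq v_def by linarith
    have mv: "(q * g \<nu>) powr (-1/4) = m / v"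
    proof -
      have "(q * g \<nu>) powr (-1/4) * (q * g \<nu>) powr (1/2) = m" unfolding m_def powr_add [symmetric] by simp
      moreover have "(q * g \<nu>) powr (1/2) = v" using qp gp by (simp add: v_def powr_half_sqrt)
      ultimately show ?thesis using v by (simp add: field_simps)
    qed
    \<comment> \<open>H in units of sqrt (s g) is \<rho> + O(\<kappa>); this gives the second
      component its extra factor \<rho> and its power (s g)^(-1/4).\<close>
    define U where "U = w.H q / of_real v"
    have U: "norm (U - \<rho>) \<le> h * \<kappa>"
    proof -
      have "U - \<rho> = (w.H q - \<rho> * of_real v) / of_real v" using v by (simp add: U_def diff_divide_distrib)
      then have "norm (U - \<rho>) = norm (w.H q - \<rho> * of_real v) / v" using v by (simp add: norm_divide)
      also have "\<dots> \<le> ((K + 1) / q + G * \<kappa>) / 1"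
        using w.H_near(2)[OF q] v unfolding kq v_def[symmetric] by (intro frac_le) (auto intro: order_trans[OF norm_ge_zero])
      also have "\<dots> = h * \<kappa>" using kp \<nu> by (simp add: h_def q_def distrib_right)
      finally show ?thesis .
    qed
    have hk: "h * \<kappa> \<le> h" using mult_left_mono[OF small(4) h] by simp
    have nU: "norm U \<le> 1 + h" using norm_triangle_sub[of U \<rho>] U hk norm_\<rho> by linarith
    have bm: "\<bar>b q * (m / v) - Re (U * ZZ)\<bar> \<le> C0 * \<kappa> * ((1 + h) * z)"
    proof -
      have eq: "U * ZZ = (w.H q * Xf \<kappa> q) * of_real (m / v)" by (simp add: U_def ZZ_def)
      have "Re (U * ZZ) = Re (w.H q * Xf \<kappa> q) * (m / v)" unfolding eq by simp
      then have "b q * (m / v) - Re (U * ZZ) = (b q - Re (w.H q * Xf \<kappa> q)) * (m / v)" by (simp only: left_diff_distrib)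
      then have "\<bar>b q * (m / v) - Re (U * ZZ)\<bar> = \<bar>b q - Re (w.H q * Xf \<kappa> q)\<bar> * (m / v)" using mp v by (simp add: abs_mult)
      also have "\<dots> \<le> (C0 * \<kappa> * norm (w.H q * Xf \<kappa> q)) * (m / v)" using rb[OF q] mp v by (intro mult_right_mono) auto
      also have "\<dots> = C0 * \<kappa> * norm (U * ZZ)" unfolding eq norm_mult[of _ "of_real (m / v)"] norm_of_real using mp v by simp
      also have "\<dots> \<le> C0 * \<kappa> * ((1 + h) * z)"
        unfolding norm_mult using nU nZ C0 kp h by (intro mult_left_mono mult_mono) auto
      finally show ?thesis .
    qed
    have "norm (U * ZZ - \<rho> * \<gamma> * ex) \<le> (h * z + K / \<nu>) * \<kappa>"
    proof -
      have "U * ZZ - \<rho> * \<gamma> * ex = (U - \<rho>) * ZZ + \<rho> * (ZZ - \<gamma> * ex)" by (simp add: algebra_simps)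
      also have "norm \<dots> \<le> norm ((U - \<rho>) * ZZ) + norm (\<rho> * (ZZ - \<gamma> * ex))" by (rule norm_triangle_ineq)
      also have "\<dots> \<le> (h * \<kappa>) * z + K / \<nu> * \<kappa>"
        unfolding norm_mult norm_\<rho> mult_1 using U nZ ZZ h kp z by (intro add_mono mult_mono) auto
      also have "\<dots> = (h * z + K / \<nu>) * \<kappa>" unfolding distrib_right by (simp only: mult_ac)
      finally show ?thesis .
    qed
    then have "\<bar>Re (U * ZZ) - Re (\<rho> * \<gamma> * ex)\<bar> \<le> (h * z + K / \<nu>) * \<kappa>"
      using abs_Re_le_cmod[of "U * ZZ - \<rho> * \<gamma> * ex"] unfolding minus_complex.sel by linarith
    then have "\<bar>b q * (m / v) - Re (\<rho> * \<gamma> * ex)\<bar> \<le> C0 * \<kappa> * ((1 + h) * z) + (h * z + K / \<nu>) * \<kappa>" using bm by linarith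
    also have "\<dots> = C3 * \<kappa>" unfolding C3_def distrib_right by (simp only: mult_ac)
    also have "\<dots> \<le> C * \<kappa>" using C kp by (intro mult_right_mono) auto
    finally show "\<bar>b (\<nu>/\<kappa>) * (\<nu>/\<kappa> * g \<nu>) powr (-1/4) - Re (\<rho> * \<gamma> * exp (\<rho> * of_real (\<Psi> \<nu> / \<kappa> powr (3/2))))\<bar> \<le> C * \<kappa>"
      unfolding mv[symmetric] q_def ex_def .
  qed
qed

text \<open>The expression equals -2 i |E|^2 Im (E' / E), and Im (E' / E) is close to sqrt
  s0.\<close>

lemma wronskian_nonzero: "\<rho> = \<i> \<Longrightarrow> E s0 * cnj (E1 s0) - cnj (E s0) * E1 s0 \<noteq> 0"
proof -
  assume \<rho>: "\<rho> = \<i>"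
  have s: "s0 \<ge> s1" by (rule s0)
  have nz: "E s0 \<noteq> 0" using E_nz s by blast
  define p where "p = E1 s0 / E s0"
  have E1: "E1 s0 = p * E s0" using nz by (simp add: p_def)
  have "s0 \<ge> 4" "s0 \<ge> 16 * (K + 1)" using large by auto
  then have "(K + 1) / s0 \<le> 1 / 16" using K by (simp add: field_simps)
  have "norm (p - \<rho> * of_real (sqrt s0) + of_real (1 / (4 * s0))) \<le> K * s0 powr (-5/2)" using log_deriv[OF s] by (simp add: p_def)
  also have "K * s0 powr (-5/2) \<le> K * (1 / s0)"
    using powr_mono[of "-5/2" "-1" s0] large K by (intro mult_left_mono) (auto simp: powr_minus_divide)
  also have "\<dots> \<le> 1 / 16" using \<open>(K + 1) / s0 \<le> 1 / 16\<close> large by (simp add: add_divide_distrib)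
  finally have "\<bar>Im (p - \<rho> * of_real (sqrt s0) + of_real (1 / (4 * s0)))\<bar> \<le> 1 / 16" using abs_Im_le_cmod order_trans by blast
  then have "\<bar>Im p - sqrt s0\<bar> \<le> 1 / 16" by (simp add: \<rho>)
  moreover have "sqrt s0 \<ge> 2" using large by (intro real_le_rsqrt) auto
  ultimately have "Im p > 0" by linarith
  moreover have "E s0 * cnj (E1 s0) - cnj (E s0) * E1 s0 = of_real ((norm (E s0))\<^sup>2) * (- 2 * \<i> * of_real (Im p))"
    unfolding E1 complex_norm_square by (simp add: complex_eq_iff algebra_simps)
  ultimately show ?thesis using nz by simp
qed

end

section \<open>The region around the turning point\<close>

text \<open>The interval [-s0, s0] does not depend on \<kappa>, so E itself can be the approximant:
  the coefficient differs from s by O(\<kappa>) only. The complex branch is used on the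
  non-oscillating half too, because its Wronskian with the conjugate is a nonzero constant.\<close>

lemma (in airy_branch) middle_region:
  fixes f :: "real \<Rightarrow> real"
  assumes \<rho>: "\<rho> = \<i>" and s0: "s0 > 0" and W: "E s0 * cnj (E1 s0) - cnj (E s0) * E1 s0 \<noteq> 0"
    and \<nu>: "\<nu> > 0" and f: "\<And>u. \<bar>u\<bar> \<le> \<nu> \<Longrightarrow> \<bar>f u - 1\<bar> \<le> G * \<bar>u\<bar>" and D: "D \<ge> 0" and G: "G \<ge> 0"
  shows "\<exists>C\<ge>0. \<exists>\<kappa>0>0. \<forall>\<kappa>. 0 < \<kappa> \<and> \<kappa> < \<kappa>0 \<longrightarrow> (\<forall>a b.
     (\<forall>s\<in>{-s0..s0}. (a has_real_derivative b s) (at s within {-s0..s0}) \<and>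
        (b has_real_derivative - (s * f (\<kappa> * s)) * a s) (at s within {-s0..s0})) \<and>
     \<bar>a (- s0) - Re (E (- s0))\<bar> \<le> D * \<kappa> \<and> \<bar>b (- s0) - Re (E1 (- s0))\<bar> \<le> D * \<kappa>
     \<longrightarrow> (\<forall>t\<in>{-s0..s0}. \<bar>a t - Re (E t)\<bar> \<le> C * \<kappa> \<and> \<bar>b t - Re (E1 t)\<bar> \<le> C * \<kappa>))"
proof -
  let ?S = "{-s0..s0}"
  have dEs: "(E has_vector_derivative E1 s) (at s within ?S)" "(E1 has_vector_derivative - of_real s * E s) (at s within ?S)" for s
    using has_vector_derivative_at_within[OF dE] has_vector_derivative_at_within[OF dE1[of s]] by (auto simp: \<rho>)
  have "continuous_on ?S (\<lambda>s. norm (E s) + norm (E1 s))"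
    by (intro continuous_intros continuous_on_vector_derivative[OF dEs(1)] continuous_on_vector_derivative[OF dEs(2)])
  then obtain M0 where M0: "\<And>s. s \<in> ?S \<Longrightarrow> norm (E s) + norm (E1 s) \<le> M0"
  proof -
    assume c: "continuous_on ?S (\<lambda>s. norm (E s) + norm (E1 s))" and that: "\<And>M0. (\<And>s. s \<in> ?S \<Longrightarrow> norm (E s) + norm (E1 s) \<le> M0) \<Longrightarrow> thesis"
    have "bounded ((\<lambda>s. norm (E s) + norm (E1 s)) ` ?S)" using compact_continuous_image[OF c compact_Icc] by (rule compact_imp_bounded)
    then obtain B where "\<forall>s\<in>?S. \<bar>norm (E s) + norm (E1 s)\<bar> \<le> B" by (auto simp: bounded_iff)
    then show thesis by (intro that[of B]) (auto dest!: bspec)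
  qed
  define M where "M = M0"
  have M: "norm (E s) \<le> M" "norm (E1 s) \<le> M" if "s \<in> ?S" for s
    using M0[OF that] norm_ge_zero[of "E s"] norm_ge_zero[of "E1 s"] unfolding M_def by linarith+
  have Mp: "M \<ge> 0" using M(1)[of 0] s0 by (auto intro: order_trans[OF norm_ge_zero])
  define Wr where "Wr = (\<lambda>s. E s * cnj (E1 s) - cnj (E s) * E1 s)"
  define w where "w = norm (Wr s0)"
  have w: "w > 0" using W by (simp add: w_def Wr_def)
  \<comment> \<open>Airy's equation has real coefficients, so the conjugate is a solution as
    well.\<close>
  have dW: "(Wr has_vector_derivative 0) (at s within ?S)" for s
  proof -
    have c: "((\<lambda>s. cnj (E s)) has_vector_derivative cnj (E1 s)) (at s within ?S)" "((\<lambda>s. cnj (E1 s)) has_vector_derivative cnj (- of_real s * E s)) (at s within ?S)"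
      by (rule bounded_linear.has_vector_derivative[OF bounded_linear_cnj dEs(1)], rule bounded_linear.has_vector_derivative[OF bounded_linear_cnj dEs(2)])
    have "(Wr has_vector_derivative (E s * cnj (- of_real s * E s) + E1 s * cnj (E1 s)) - (cnj (E s) * (- of_real s * E s) + cnj (E1 s) * E1 s)) (at s within ?S)"
      unfolding Wr_def by (rule has_vector_derivative_diff[OF has_vector_derivative_mult[OF dEs(1) c(2)] has_vector_derivative_mult[OF c(1) dEs(2)]])
    then show ?thesis by (simp add: algebra_simps)
  qed
  have Wc: "norm (Wr s) = w" if "s \<in> ?S" for s
  proof -
    obtain c where "\<And>x. x \<in> ?S \<Longrightarrow> Wr x = c"
      using has_vector_derivative_zero_constant[of ?S Wr] dW by auto
    then show ?thesis using that s0 by (simp add: w_def)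
  qed
  \<comment> \<open>The length 2 s0, times the coefficient error s0 G \<kappa> s0, times the bound
    for |E|^2, with \<kappa> taken out.\<close>
  define BB where "BB = 2 * G * s0 ^ 3 * M\<^sup>2"
  have BB: "BB \<ge> 0" using G s0 by (simp add: BB_def)
  define C where "C = 2 * (2 * (2 * D * M) + 4 * BB) / w * M"
  have C: "C \<ge> 0" using D Mp BB w by (simp add: C_def)
  define \<kappa>0 where "\<kappa>0 = min (\<nu> / s0) (w / (4 * BB + 1))"
  have \<kappa>0: "\<kappa>0 > 0" using \<nu> s0 w BB by (auto simp: \<kappa>0_def)
  show ?thesis
  proof (rule exI[of _ C], rule conjI[OF C], rule exI[of _ \<kappa>0], rule conjI[OF \<kappa>0], intro allI impI)
    fix \<kappa> :: real and a b :: "real \<Rightarrow> real"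
    assume \<kappa>: "0 < \<kappa> \<and> \<kappa> < \<kappa>0" and as: "(\<forall>s\<in>{-s0..s0}. (a has_real_derivative b s) (at s within {-s0..s0}) \<and>
        (b has_real_derivative - (s * f (\<kappa> * s)) * a s) (at s within {-s0..s0})) \<and>
     \<bar>a (- s0) - Re (E (- s0))\<bar> \<le> D * \<kappa> \<and> \<bar>b (- s0) - Re (E1 (- s0))\<bar> \<le> D * \<kappa>"
    have kp: "\<kappa> > 0" using \<kappa> by simp
    have "\<kappa> \<le> w / (4 * BB + 1)" using \<kappa> by (simp add: \<kappa>0_def)
    then have "\<kappa> * (4 * BB + 1) \<le> w" using BB by (simp add: pos_le_divide_eq)
    then have small: "4 * (BB * \<kappa>) \<le> w" using kp by (simp add: algebra_simps)
    have "\<kappa> \<le> \<nu> / s0" using \<kappa> by (simp add: \<kappa>0_def)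
    then have ks: "\<kappa> * s0 \<le> \<nu>" using s0 by (simp add: pos_le_divide_eq)
    define D0 where "D0 = norm ((of_real (a (- s0)) - of_real (Re (E (- s0)))) * cnj (E1 (- s0)) - (of_real (b (- s0)) - of_real (Re (E1 (- s0)))) * cnj (E (- s0)))"
    have D0: "D0 \<le> 2 * D * M * \<kappa>"
    proof -
      have "D0 \<le> norm ((of_real (a (- s0)) - of_real (Re (E (- s0)))) * cnj (E1 (- s0))) + norm ((of_real (b (- s0)) - of_real (Re (E1 (- s0)))) * cnj (E (- s0)))"
        unfolding D0_def by (rule norm_triangle_ineq4)
      also have "\<dots> = \<bar>a (- s0) - Re (E (- s0))\<bar> * norm (E1 (- s0)) + \<bar>b (- s0) - Re (E1 (- s0))\<bar> * norm (E (- s0))"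
        unfolding of_real_diff[symmetric] norm_mult norm_of_real complex_mod_cnj ..
      also have "\<dots> \<le> (D * \<kappa>) * M + (D * \<kappa>) * M"
        using as M[of "- s0"] s0 D kp by (intro add_mono mult_mono) auto
      finally show ?thesis by (simp add: mult_ac)
    qed
    define \<Gamma> where "\<Gamma> = (\<lambda>s. (s0 * (G * (\<kappa> * s0)) * M\<^sup>2) * s)"
    have d\<Gamma>: "(\<Gamma> has_real_derivative s0 * (G * (\<kappa> * s0)) * M\<^sup>2) (at s within ?S)" for s
      unfolding \<Gamma>_def by (auto intro!: derivative_eq_intros)
    have k: "norm (of_real (s * f (\<kappa> * s)) - of_real s :: complex) * (norm (E s))\<^sup>2 \<le> s0 * (G * (\<kappa> * s0)) * M\<^sup>2" if s: "s \<in> ?S" for s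
    proof -
      have s': "\<bar>s\<bar> \<le> s0" using s by auto
      have us: "\<bar>\<kappa> * s\<bar> \<le> \<kappa> * s0" using s' kp by (simp add: abs_mult mult_left_mono)
      then have "\<bar>f (\<kappa> * s) - 1\<bar> \<le> G * \<bar>\<kappa> * s\<bar>" using ks by (intro f) simp
      also have "\<dots> \<le> G * (\<kappa> * s0)" using us G by (rule mult_left_mono)
      finally have f1: "\<bar>f (\<kappa> * s) - 1\<bar> \<le> G * (\<kappa> * s0)" .
      have "norm (of_real (s * f (\<kappa> * s)) - of_real s :: complex) = \<bar>s\<bar> * \<bar>f (\<kappa> * s) - 1\<bar>"
        unfolding of_real_diff[symmetric] norm_of_real by (simp add: right_diff_distrib flip: abs_mult)
      also have "\<dots> \<le> s0 * (G * (\<kappa> * s0))" using s' f1 s0 by (intro mult_mono) auto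
      finally show ?thesis using M(1)[OF s] G kp s0 by (intro mult_mono power_mono) auto
    qed
    have B: "\<Gamma> s0 - \<Gamma> (- s0) \<le> BB * \<kappa>" by (simp add: \<Gamma>_def BB_def power3_eq_cube algebra_simps)
    note vc = variation_of_constants[where a=a and b=b and X=E and Y=E1 and P="of_real" and Q="\<lambda>s. s * f (\<kappa> * s)" and \<Gamma>=\<Gamma>
        and \<Gamma>'="\<lambda>s. s0 * (G * (\<kappa> * s0)) * M\<^sup>2" and B="BB * \<kappa>" and p="- s0" and q=s0, folded D0_def, OF _ _ _ dEs k d\<Gamma> B w small _]
    have Wl: "norm (E s * cnj (E1 s) - cnj (E s) * E1 s) \<ge> w" if "s \<in> ?S" for s using Wc[OF that] by (simp add: Wr_def)
    have le: "2 * (2 * D0 + 4 * (BB * \<kappa>)) / w * M \<le> C * \<kappa>"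
    proof -
      have "2 * (2 * D0 + 4 * (BB * \<kappa>)) / w * M \<le> 2 * (2 * (2 * D * M * \<kappa>) + 4 * (BB * \<kappa>)) / w * M"
        using D0 w Mp by (intro mult_right_mono divide_right_mono) auto
      also have "\<dots> = C * \<kappa>" by (simp add: C_def algebra_simps)
      finally show ?thesis .
    qed
    have D0n: "2 * (2 * D0 + 4 * (BB * \<kappa>)) / w \<ge> 0" using w BB kp by (simp add: D0_def)
    show "\<forall>t\<in>{-s0..s0}. \<bar>a t - Re (E t)\<bar> \<le> C * \<kappa> \<and> \<bar>b t - Re (E1 t)\<bar> \<le> C * \<kappa>"
    proof (intro ballI conjI)
      fix t assume t: "t \<in> {-s0..s0}"
      have "\<bar>a t - Re (E t)\<bar> \<le> 2 * (2 * D0 + 4 * (BB * \<kappa>)) / w * norm (E t)"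
        by (rule vc(1)) (use as s0 Wl t in auto)
      then show "\<bar>a t - Re (E t)\<bar> \<le> C * \<kappa>" using mult_left_mono[OF M(1)[OF t] D0n] le by linarith
      have "\<bar>b t - Re (E1 t)\<bar> \<le> 2 * (2 * D0 + 4 * (BB * \<kappa>)) / w * norm (E1 t)"
        by (rule vc(2)) (use as s0 Wl t in auto)
      then show "\<bar>b t - Re (E1 t)\<bar> \<le> C * \<kappa>" using mult_left_mono[OF M(2)[OF t] D0n] le by linarith
    qed
  qed
qed

section \<open>Existence for linear second-order equations\<close>

text \<open>The n-th pair is the n-th increment rather than the n-th iterate: the solution is the
  sum over n, a Neumann series whose zeroth term carries the initial data.\<close>

fun picard :: "real \<Rightarrow> (real \<Rightarrow> real) \<Rightarrow> real \<Rightarrow> real \<Rightarrow> nat \<Rightarrow> (real \<Rightarrow> real) \<times> (real \<Rightarrow> real)" where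
  "picard p Q \<alpha> \<beta> 0 = ((\<lambda>t. \<alpha>), (\<lambda>t. \<beta>))"
| "picard p Q \<alpha> \<beta> (Suc n) = ((\<lambda>t. integral {p..t} (snd (picard p Q \<alpha> \<beta> n))),
     (\<lambda>t. integral {p..t} (\<lambda>s. Q s * fst (picard p Q \<alpha> \<beta> n) s)))"

text \<open>The increments are bounded by c (Kq (t - p))^n / n!, so the series and the series of
  derivatives converge uniformly on the whole interval, whatever its length.\<close>

lemma linear_ode_exists:
  fixes Q :: "real \<Rightarrow> real"
  assumes pq: "p \<le> q" and Q: "continuous_on {p..q} Q"
  shows "\<exists>x y. x p = \<alpha> \<and> y p = \<beta> \<and> (\<forall>t\<in>{p..q}. (x has_real_derivative y t) (at t within {p..q}) \<and>
           (y has_real_derivative Q t * x t) (at t within {p..q}))"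
proof -
  define F where "F = (\<lambda>n. fst (picard p Q \<alpha> \<beta> n))"
  define H where "H = (\<lambda>n. snd (picard p Q \<alpha> \<beta> n))"
  have F0: "F 0 = (\<lambda>t. \<alpha>)" "H 0 = (\<lambda>t. \<beta>)" by (simp_all add: F_def H_def)
  have FS: "F (Suc n) = (\<lambda>t. integral {p..t} (H n))" "H (Suc n) = (\<lambda>t. integral {p..t} (\<lambda>s. Q s * F n s))" for n
    by (simp_all add: F_def H_def)
  have cont: "continuous_on {p..q} (F n) \<and> continuous_on {p..q} (H n)" for n
  proof (induction n)
    case (Suc n)
    have 1: "(F (Suc n) has_real_derivative H n t) (at t within {p..q})" if "t \<in> {p..q}" for t
      unfolding FS using Suc that by (intro integral_has_real_derivative) auto
    have 2: "(H (Suc n) has_real_derivative Q t * F n t) (at t within {p..q})" if "t \<in> {p..q}" for t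
      unfolding FS using Suc that Q by (intro integral_has_real_derivative continuous_on_mult) auto
    show ?case using DERIV_continuous_on[OF 1] DERIV_continuous_on[OF 2] by (rule conjI)
  qed (simp add: F0)
  have dF: "(F (Suc n) has_real_derivative H n t) (at t within {p..q})" if "t \<in> {p..q}" for t n
    unfolding FS using cont that by (intro integral_has_real_derivative) auto
  have dH: "(H (Suc n) has_real_derivative Q t * F n t) (at t within {p..q})" if "t \<in> {p..q}" for t n
    unfolding FS using cont that Q by (intro integral_has_real_derivative continuous_on_mult) auto
  \<comment> \<open>Kq \<ge> 1 lets one bound serve both components, whose integrands carry the
    factors 1 and Q.\<close>
  obtain Kq where Kq: "\<And>t. t \<in> {p..q} \<Longrightarrow> \<bar>Q t\<bar> \<le> Kq" "Kq \<ge> 1"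
  proof -
    have "bounded (Q ` {p..q})" using compact_continuous_image[OF Q compact_Icc] by (rule compact_imp_bounded)
    then obtain B where "\<forall>t\<in>{p..q}. \<bar>Q t\<bar> \<le> B" by (auto simp: bounded_iff)
    then have "\<bar>Q t\<bar> \<le> max 1 B" if "t \<in> {p..q}" for t using that by (meson max.coboundedI2)
    then show ?thesis using that[of "max 1 B"] by simp
  qed
  define c where "c = \<bar>\<alpha>\<bar> + \<bar>\<beta>\<bar>"
  have bd: "\<forall>t\<in>{p..q}. \<bar>F n t\<bar> \<le> c * (Kq * (t - p)) ^ n / fact n \<and> \<bar>H n t\<bar> \<le> c * (Kq * (t - p)) ^ n / fact n" for n
  proof (induction n)
    case (Suc n)
    show ?case
    proof
      fix t assume t: "t \<in> {p..q}"
      define P where "P = (\<lambda>t. c * (Kq * (t - p)) ^ Suc n / fact (Suc n))"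
      have dP: "(P has_real_derivative Kq * (c * (Kq * (s - p)) ^ n / fact n)) (at s within {p..q})" for s
      proof -
        have "((\<lambda>t. Kq * (t - p)) has_real_derivative Kq) (at s within {p..q})" by (auto intro!: derivative_eq_intros)
        from DERIV_cdivide[OF DERIV_cmult[OF DERIV_power[OF this, of "Suc n"]], of c "fact (Suc n)"]
        have "(P has_real_derivative c * (real (Suc n) * (Kq * (Kq * (s - p)) ^ n)) / (real (Suc n) * fact n)) (at s within {p..q})"
          by (simp add: P_def del: power_Suc of_nat_Suc)
        also have "c * (real (Suc n) * (Kq * (Kq * (s - p)) ^ n)) / (real (Suc n) * fact n) = (real (Suc n) * (Kq * (c * (Kq * (s - p)) ^ n))) / (real (Suc n) * fact n)"
          by (simp only: mult_ac)
        also have "\<dots> = Kq * (c * (Kq * (s - p)) ^ n / fact n)" by (simp del: of_nat_Suc)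
        finally show ?thesis .
      qed
      have nn: "c * (Kq * (s - p)) ^ n / fact n \<ge> 0" if "s \<in> {p..q}" for s using that Kq(2) by (auto simp: c_def)
      have "norm (F (Suc n) t - F (Suc n) p) \<le> P t - P p"
      proof (rule norm_diff_le_primitive[OF pq _ dP, where f' = "H n"])
        show "(F (Suc n) has_vector_derivative H n s) (at s within {p..q})" if "s \<in> {p..q}" for s
          using dF[OF that] by (simp add: has_real_derivative_iff_has_vector_derivative)
        show "norm (H n s) \<le> Kq * (c * (Kq * (s - p)) ^ n / fact n)" if "s \<in> {p..q}" for s
        proof -
          have "\<bar>H n s\<bar> \<le> c * (Kq * (s - p)) ^ n / fact n" using Suc that by blast
          then show ?thesis using mult_right_mono[OF Kq(2) nn[OF that]] unfolding real_norm_def by linarith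
        qed
      qed (use t in auto)
      moreover have "norm (H (Suc n) t - H (Suc n) p) \<le> P t - P p"
      proof (rule norm_diff_le_primitive[OF pq _ dP, where f' = "\<lambda>s. Q s * F n s"])
        show "(H (Suc n) has_vector_derivative Q s * F n s) (at s within {p..q})" if "s \<in> {p..q}" for s
          using dH[OF that] by (simp add: has_real_derivative_iff_has_vector_derivative)
        show "norm (Q s * F n s) \<le> Kq * (c * (Kq * (s - p)) ^ n / fact n)" if "s \<in> {p..q}" for s
          unfolding norm_mult using Suc that Kq by (intro mult_mono) auto
      qed (use t in auto)
      moreover have "P p = 0" "F (Suc n) p = 0" "H (Suc n) p = 0" by (simp_all add: P_def FS)
      ultimately have "\<bar>F (Suc n) t\<bar> \<le> P t \<and> \<bar>H (Suc n) t\<bar> \<le> P t" by simp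
      then show "\<bar>F (Suc n) t\<bar> \<le> c * (Kq * (t - p)) ^ Suc n / fact (Suc n) \<and> \<bar>H (Suc n) t\<bar> \<le> c * (Kq * (t - p)) ^ Suc n / fact (Suc n)"
        unfolding P_def .
    qed
  qed (simp add: F0 c_def)
  define m where "m = (\<lambda>n. c * (Kq * (q - p)) ^ n / fact n)"
  have sm: "summable m"
  proof -
    have "summable (\<lambda>n. c * ((Kq * (q - p)) ^ n /\<^sub>R fact n))" by (intro summable_mult summable_exp_generic)
    then show ?thesis by (simp add: m_def divide_inverse mult_ac)
  qed
  have mono: "c * (Kq * (t - p)) ^ n / fact n \<le> m n" if "t \<in> {p..q}" for t n
    unfolding m_def using that Kq(2) by (intro divide_right_mono mult_left_mono power_mono) (auto simp: c_def)
  have FH: "\<bar>F n t\<bar> \<le> m n" "\<bar>H n t\<bar> \<le> m n" if "t \<in> {p..q}" for n t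
    using order_trans[OF conjunct1[OF bspec[OF bd that]] mono[OF that]] order_trans[OF conjunct2[OF bspec[OF bd that]] mono[OF that]] by auto
  define x where "x = (\<lambda>t. \<Sum>n. F n t)"
  define y where "y = (\<lambda>t. \<Sum>n. H n t)"
  have sumF: "summable (\<lambda>n. F n t)" "summable (\<lambda>n. H n t)" if "t \<in> {p..q}" for t
    using FH[OF that] by (auto intro!: summable_comparison_test'[OF sm])
  have main: "(u has_real_derivative v t) (at t within {p..q})"
    if f: "\<And>t n. t \<in> {p..q} \<Longrightarrow> (f (Suc n) has_real_derivative f' n t) (at t within {p..q})" "\<And>t. f 0 t = f 0 p"
      and b: "\<And>t n. t \<in> {p..q} \<Longrightarrow> \<bar>f' n t\<bar> \<le> k * m n" and u: "\<And>t. t \<in> {p..q} \<Longrightarrow> (\<lambda>n. f n t) sums u t"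
      and v: "\<And>t. t \<in> {p..q} \<Longrightarrow> (\<lambda>n. f' n t) sums v t" and t: "t \<in> {p..q}"
    for f f' :: "nat \<Rightarrow> real \<Rightarrow> real" and u v k t
  proof -
    \<comment> \<open>Differentiation shifts the index by one: the constant zeroth term contributes
      0, the term n + 1 contributes the n-th integrand.\<close>
    define d where "d = (\<lambda>n t. case n of 0 \<Rightarrow> 0 | Suc n \<Rightarrow> f' n t)"
    define b' where "b' = (\<lambda>n. case n of 0 \<Rightarrow> 0 | Suc n \<Rightarrow> k * m n)"
    have "summable (\<lambda>n. b' (Suc n))" unfolding b'_def using sm by (simp add: summable_mult)
    then have sb: "summable b'" by (subst (asm) summable_Suc_iff)
    have ul: "uniform_limit {p..q} (\<lambda>n x. \<Sum>i<n. d i x) (\<lambda>x. suminf (\<lambda>i. d i x)) sequentially"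
      by (rule Weierstrass_m_test[OF _ sb]) (use b in \<open>auto simp: d_def b'_def split: nat.split\<close>)
    have dd: "(f n has_field_derivative d n x) (at x within {p..q})" if "x \<in> {p..q}" for n x
    proof (cases n)
      case 0
      have "f 0 = (\<lambda>t. f 0 p)" using f(2) by auto
      then have "(f 0 has_field_derivative 0) (at x within {p..q})" by (subst \<open>f 0 = _\<close>) (rule DERIV_const)
      then show ?thesis by (simp add: 0 d_def)
    qed (use f(1) that in \<open>simp add: d_def\<close>)
    have "\<exists>g. \<forall>x\<in>{p..q}. (\<lambda>n. f n x) sums g x \<and> (g has_field_derivative suminf (\<lambda>i. d i x)) (at x within {p..q})"
      by (rule has_field_derivative_series[where ?x0.0=p, OF _ dd ul]) (use u[of p] pq in \<open>auto simp: sums_iff\<close>)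
    then obtain g where g: "\<And>x. x \<in> {p..q} \<Longrightarrow> (\<lambda>n. f n x) sums g x"
      "\<And>x. x \<in> {p..q} \<Longrightarrow> (g has_field_derivative suminf (\<lambda>i. d i x)) (at x within {p..q})" by blast
    have "(\<lambda>n. d (Suc n) t) sums v t" using v[OF t] by (simp add: d_def)
    then have "(\<lambda>n. d n t) sums (v t + d 0 t)" by (rule sums_Suc)
    then have "suminf (\<lambda>i. d i t) = v t" by (simp add: sums_iff d_def)
    with g(2)[OF t] have "(g has_field_derivative v t) (at t within {p..q})" by simp
    then show ?thesis
      by (rule has_field_derivative_transform_within[of _ _ _ _ 1]) (use t sums_unique2[OF g(1) u] in auto)
  qed
  have "(x has_real_derivative y t) (at t within {p..q})" if "t \<in> {p..q}" for t
    by (rule main[where f=F and f'=H and k=1]) (use dF F0 FH sumF that in \<open>auto simp: x_def y_def summable_sums\<close>)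
  moreover have "(y has_real_derivative Q t * x t) (at t within {p..q})" if t: "t \<in> {p..q}" for t
  proof (rule main[where f=H and f'="\<lambda>n t. Q t * F n t" and k=Kq and v="\<lambda>t. Q t * x t", OF dH])
    show "\<bar>Q t * F n t\<bar> \<le> Kq * m n" if "t \<in> {p..q}" for t n
      unfolding abs_mult using Kq(1)[OF that] FH(1)[OF that] Kq(2) by (intro mult_mono) auto
    show "(\<lambda>n. Q t * F n t) sums (Q t * x t)" if "t \<in> {p..q}" for t
      using sumF(1)[OF that] unfolding x_def by (intro sums_mult summable_sums)
    show "(\<lambda>n. H n t) sums y t" if "t \<in> {p..q}" for t
      using sumF(2)[OF that] unfolding y_def by (intro summable_sums)
  qed (use F0 t in auto)
  moreover have "x p = \<alpha>"
  proof -
    have "(\<lambda>n. F (Suc n) p) sums 0" by (simp add: FS)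
    then have "(\<lambda>n. F n p) sums (0 + F 0 p)" by (rule sums_Suc)
    then show ?thesis by (simp add: x_def sums_iff F0)
  qed
  moreover have "y p = \<beta>"
  proof -
    have "(\<lambda>n. H (Suc n) p) sums 0" by (simp add: FS)
    then have "(\<lambda>n. H n p) sums (0 + H 0 p)" by (rule sums_Suc)
    then show ?thesis by (simp add: y_def sums_iff F0)
  qed
  ultimately show ?thesis by blast
qed

section \<open>Regularity of the coefficient and of the bundle\<close>

lemma Ck_on_continuous: "Ck_on k f S \<Longrightarrow> continuous_on S f"
proof (cases k)
  case (Suc k')
  assume "Ck_on k f S"
  then obtain f' where "\<forall>x\<in>S. (f has_derivative f' x) (at x within S)" unfolding Suc by auto
  then show ?thesis by (intro has_derivative_continuous_on) auto
qed auto

text \<open>In one dimension the derivative is multiplication by its value at the direction 1, and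
  on an open set the derivative within the set is the ordinary one.\<close>

lemma Ck_on_Suc_real:
  fixes f :: "real \<Rightarrow> real"
  assumes "Ck_on (Suc k) f S" "open S"
  obtains f1 where "\<And>x. x \<in> S \<Longrightarrow> (f has_real_derivative f1 x) (at x)" "Ck_on k f1 S"
proof -
  obtain f' where f': "\<And>x. x \<in> S \<Longrightarrow> (f has_derivative f' x) (at x within S)" "\<And>v. Ck_on k (\<lambda>x. f' x v) S"
    using assms by auto
  have "(f has_real_derivative f' x 1) (at x)" if "x \<in> S" for x
  proof -
    have d: "(f has_derivative f' x) (at x)" using f'(1)[OF that] at_within_open[OF that assms(2)] by simp
    then interpret bounded_linear "f' x" by (rule has_derivative_bounded_linear)
    have "f' x = times (f' x 1)"
    proof
      fix h show "f' x h = f' x 1 * h" using scaleR[of h 1] by simp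
    qed
    with d show ?thesis unfolding has_field_derivative_def by simp
  qed
  then show thesis using f'(2)[of 1] by (rule that)
qed

text \<open>Integration from 0 gains one power of |t|; iterated, it replaces Taylor's formula with
  remainder.\<close>

lemma power_bound_from_derivative:
  fixes f :: "real \<Rightarrow> real"
  assumes "\<And>x. \<bar>x\<bar> \<le> r \<Longrightarrow> (f has_real_derivative f' x) (at x)" "\<And>x. \<bar>x\<bar> \<le> r \<Longrightarrow> \<bar>f' x\<bar> \<le> c * \<bar>x\<bar> ^ n"
    and "f 0 = 0" "c \<ge> 0" "\<bar>t\<bar> \<le> r"
  shows "\<bar>f t\<bar> \<le> c * \<bar>t\<bar> ^ Suc n"
proof -
  have seg: "\<bar>x\<bar> \<le> \<bar>t\<bar>" if "x \<in> closed_segment 0 t" for x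
    using that by (auto simp: closed_segment_eq_real_ivl split: if_splits)
  have "norm (f t - f 0) \<le> (c * \<bar>t\<bar> ^ n) * norm (t - 0)"
  proof (rule field_differentiable_bound[of "closed_segment 0 t" _ f'])
    fix x assume x: "x \<in> closed_segment 0 t"
    then show "(f has_field_derivative f' x) (at x within closed_segment 0 t)"
      using assms(1)[of x] seg[OF x] assms(5) by (auto intro: has_field_derivative_at_within)
    have "\<bar>f' x\<bar> \<le> c * \<bar>x\<bar> ^ n" using assms(2)[of x] seg[OF x] assms(5) by simp
    also have "\<dots> \<le> c * \<bar>t\<bar> ^ n" using seg[OF x] assms(4) by (intro mult_left_mono power_mono) auto
    finally show "norm (f' x) \<le> c * \<bar>t\<bar> ^ n" by simp
  qed auto
  then show ?thesis using assms(3) by (simp add: mult_ac)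
qed

text \<open>The derivatives of \<mu> t / t have the numerators t \<mu>' - \<mu> and t^2 \<mu>'' - 2
  t \<mu>' + 2 \<mu> over t^2 and t^3. The numerators vanish at 0 and have derivatives t \<mu>'' and
  t^2 \<mu>''', so they are O(t^2) and O(t^3), and the quotients stay bounded near 0.\<close>

lemma mu_hat_regular:
  assumes N: "open N" "0 \<in> N" and C: "Ck_on 5 \<mu> N" and \<mu>: "\<mu> 0 = 0" "deriv \<mu> 0 = 1"
  shows "\<exists>\<nu>0>0. \<exists>G\<ge>0. \<exists>g1 g2. \<nu>0 \<le> 1 \<and> {-\<nu>0..\<nu>0} \<subseteq> N \<and> (\<forall>t. t \<noteq> 0 \<and> \<bar>t\<bar> \<le> \<nu>0 \<longrightarrow>
     1 / 2 \<le> mu_hat \<mu> t \<and> mu_hat \<mu> t \<le> 2 \<and> \<bar>mu_hat \<mu> t - 1\<bar> \<le> G * \<bar>t\<bar> \<and>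
     (mu_hat \<mu> has_real_derivative g1 t) (at t) \<and> (g1 has_real_derivative g2 t) (at t) \<and> \<bar>g1 t\<bar> \<le> G \<and> \<bar>g2 t\<bar> \<le> G)"
proof -
  have five: "5 = Suc (Suc (Suc (Suc (Suc 0))))" by simp
  obtain m1 where m1: "\<And>x. x \<in> N \<Longrightarrow> (\<mu> has_real_derivative m1 x) (at x)" and C1: "Ck_on (Suc (Suc (Suc (Suc 0)))) m1 N"
    using Ck_on_Suc_real[OF C[unfolded five] N(1)] by blast
  obtain m2 where m2: "\<And>x. x \<in> N \<Longrightarrow> (m1 has_real_derivative m2 x) (at x)" and C2: "Ck_on (Suc (Suc (Suc 0))) m2 N"
    using Ck_on_Suc_real[OF C1 N(1)] by blast
  obtain m3 where m3: "\<And>x. x \<in> N \<Longrightarrow> (m2 has_real_derivative m3 x) (at x)" and C3: "Ck_on (Suc (Suc 0)) m3 N"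
    using Ck_on_Suc_real[OF C2 N(1)] by blast
  have m10: "m1 0 = 1" using DERIV_imp_deriv[OF m1[OF N(2)]] \<mu> by simp
  obtain r where r: "r > 0" "cball 0 r \<subseteq> N" using N open_contains_cball by blast
  have inN: "x \<in> N" if "\<bar>x\<bar> \<le> r" for x using r that by auto
  have b: "\<exists>B. \<forall>x. \<bar>x\<bar> \<le> r \<longrightarrow> \<bar>f x\<bar> \<le> B" if "continuous_on N f" for f :: "real \<Rightarrow> real"
  proof -
    have "continuous_on (cball 0 r) f" using that r(2) by (rule continuous_on_subset)
    then have "bounded (f ` cball 0 r)" by (intro compact_imp_bounded compact_continuous_image compact_cball)
    then obtain B where "\<forall>x\<in>cball 0 r. \<bar>f x\<bar> \<le> B" by (auto simp: bounded_iff)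
    then have "\<forall>x. \<bar>x\<bar> \<le> r \<longrightarrow> \<bar>f x\<bar> \<le> B" by simp
    then show ?thesis ..
  qed
  obtain B2 where B2: "\<And>x. \<bar>x\<bar> \<le> r \<Longrightarrow> \<bar>m2 x\<bar> \<le> B2" using b[OF Ck_on_continuous[OF C2]] by blast
  obtain B3 where B3: "\<And>x. \<bar>x\<bar> \<le> r \<Longrightarrow> \<bar>m3 x\<bar> \<le> B3" using b[OF Ck_on_continuous[OF C3]] by blast
  define G where "G = max 0 (max B2 B3)"
  have G: "G \<ge> 0" by (simp add: G_def)
  have G2: "\<bar>m2 x\<bar> \<le> G" and G3: "\<bar>m3 x\<bar> \<le> G" if "\<bar>x\<bar> \<le> r" for x using B2[OF that] B3[OF that] by (auto simp: G_def)
  have e1: "\<bar>m1 t - 1\<bar> \<le> G * \<bar>t\<bar> ^ Suc 0" if "\<bar>t\<bar> \<le> r" for t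
    by (rule power_bound_from_derivative[where f="\<lambda>t. m1 t - 1" and f'=m2 and r=r])
       (use inN m2 G2 G m10 that in \<open>auto intro!: derivative_eq_intros\<close>)
  have e2: "\<bar>\<mu> t - t\<bar> \<le> G * \<bar>t\<bar> ^ Suc (Suc 0)" if "\<bar>t\<bar> \<le> r" for t
    by (rule power_bound_from_derivative[where f="\<lambda>t. \<mu> t - t" and f'="\<lambda>t. m1 t - 1" and r=r])
       (use inN m1 e1 G \<mu> that in \<open>auto intro!: derivative_eq_intros\<close>)
  have e3: "\<bar>t * m1 t - \<mu> t\<bar> \<le> G * \<bar>t\<bar> ^ Suc (Suc 0)" if "\<bar>t\<bar> \<le> r" for t
  proof (rule power_bound_from_derivative[where f="\<lambda>t. t * m1 t - \<mu> t" and f'="\<lambda>t. t * m2 t" and r=r])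
    fix x :: real assume x: "\<bar>x\<bar> \<le> r"
    show "((\<lambda>t. t * m1 t - \<mu> t) has_real_derivative x * m2 x) (at x)"
      using m1[OF inN[OF x]] m2[OF inN[OF x]] by (auto intro!: derivative_eq_intros)
    show "\<bar>x * m2 x\<bar> \<le> G * \<bar>x\<bar> ^ Suc 0"
      using mult_left_mono[OF G2[OF x], of "\<bar>x\<bar>"] by (simp add: abs_mult mult.commute)
  qed (use \<mu> G that in auto)
  have e4: "\<bar>t\<^sup>2 * m2 t - 2 * t * m1 t + 2 * \<mu> t\<bar> \<le> G * \<bar>t\<bar> ^ Suc 2" if "\<bar>t\<bar> \<le> r" for t
  proof (rule power_bound_from_derivative[where f="\<lambda>t. t\<^sup>2 * m2 t - 2 * t * m1 t + 2 * \<mu> t" and f'="\<lambda>t. t\<^sup>2 * m3 t" and r=r])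
    fix x :: real assume x: "\<bar>x\<bar> \<le> r"
    show "((\<lambda>t. t\<^sup>2 * m2 t - 2 * t * m1 t + 2 * \<mu> t) has_real_derivative x\<^sup>2 * m3 x) (at x)"
      using m1[OF inN[OF x]] m2[OF inN[OF x]] m3[OF inN[OF x]] by (auto intro!: derivative_eq_intros simp: algebra_simps)
    show "\<bar>x\<^sup>2 * m3 x\<bar> \<le> G * \<bar>x\<bar>\<^sup>2"
      using mult_left_mono[OF G3[OF x], of "x\<^sup>2"] by (simp add: abs_mult mult.commute)
  qed (use \<mu> G that in auto)
  \<comment> \<open>The last bound gives G |t| \<le> 1/2, which keeps \<open>mu_hat\<close> between
    1/2 and 2.\<close>
  define \<nu>0 where "\<nu>0 = min r (min 1 (1 / (2 * G + 2)))"
  have \<nu>0: "\<nu>0 > 0" "\<nu>0 \<le> 1" "\<nu>0 \<le> r" using r G by (auto simp: \<nu>0_def min_le_iff_disj)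
  define g1 g2 where "g1 = (\<lambda>t. (t * m1 t - \<mu> t) / t\<^sup>2)" and "g2 = (\<lambda>t. (t\<^sup>2 * m2 t - 2 * t * m1 t + 2 * \<mu> t) / t ^ 3)"
  have main: "1 / 2 \<le> mu_hat \<mu> t \<and> mu_hat \<mu> t \<le> 2 \<and> \<bar>mu_hat \<mu> t - 1\<bar> \<le> G * \<bar>t\<bar> \<and>
     (mu_hat \<mu> has_real_derivative g1 t) (at t) \<and> (g1 has_real_derivative g2 t) (at t) \<and> \<bar>g1 t\<bar> \<le> G \<and> \<bar>g2 t\<bar> \<le> G"
    if t: "t \<noteq> 0" "\<bar>t\<bar> \<le> \<nu>0" for t
  proof -
    have tr: "\<bar>t\<bar> \<le> r" using t \<nu>0 by linarith
    have tN: "t \<in> N" using inN[OF tr] .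
    have "mu_hat \<mu> t - 1 = (\<mu> t - t) / t" using t by (simp add: mu_hat_def diff_divide_distrib)
    then have "\<bar>mu_hat \<mu> t - 1\<bar> = \<bar>\<mu> t - t\<bar> / \<bar>t\<bar>" by (simp add: abs_divide)
    also have "\<dots> \<le> (G * \<bar>t\<bar> ^ Suc (Suc 0)) / \<bar>t\<bar>" by (intro divide_right_mono e2 tr) auto
    also have "\<dots> = G * \<bar>t\<bar>" using t nonzero_mult_div_cancel_right[of "\<bar>t\<bar>" "G * \<bar>t\<bar>"] by (simp add: mult.assoc)
    finally have c1: "\<bar>mu_hat \<mu> t - 1\<bar> \<le> G * \<bar>t\<bar>" .
    have "\<bar>t\<bar> \<le> 1 / (2 * G + 2)" using t by (simp add: \<nu>0_def)
    then have "\<bar>t\<bar> * (2 * G + 2) \<le> 1" using G by (simp add: pos_le_divide_eq)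
    then have "G * \<bar>t\<bar> \<le> 1 / 2" by (simp add: algebra_simps)
    then have c2: "1 / 2 \<le> mu_hat \<mu> t" "mu_hat \<mu> t \<le> 2" using c1 by linarith+
    have "((\<lambda>t. \<mu> t / t) has_real_derivative (m1 t * t - \<mu> t * 1) / (t * t)) (at t)"
      by (intro DERIV_divide m1 tN DERIV_ident t)
    then have "((\<lambda>t. \<mu> t / t) has_real_derivative g1 t) (at t)" by (simp add: g1_def power2_eq_square mult.commute)
    then have c3: "(mu_hat \<mu> has_real_derivative g1 t) (at t)"
      by (rule has_field_derivative_transform_within_open[of _ _ _ "- {0}"]) (use t in \<open>auto simp: mu_hat_def\<close>)
    have "((\<lambda>t. t * m1 t - \<mu> t) has_real_derivative t * m2 t) (at t)"
      using m1[OF tN] m2[OF tN] by (auto intro!: derivative_eq_intros)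
    moreover have "((\<lambda>t. t\<^sup>2) has_real_derivative 2 * t) (at t)" by (auto intro!: derivative_eq_intros)
    ultimately have "(g1 has_real_derivative ((t * m2 t) * t\<^sup>2 - (t * m1 t - \<mu> t) * (2 * t)) / (t\<^sup>2 * t\<^sup>2)) (at t)"
      unfolding g1_def by (rule DERIV_divide) (use t in auto)
    moreover have "((t * m2 t) * t\<^sup>2 - (t * m1 t - \<mu> t) * (2 * t)) / (t\<^sup>2 * t\<^sup>2) = g2 t"
    proof -
      have "((t * m2 t) * t\<^sup>2 - (t * m1 t - \<mu> t) * (2 * t)) = t * (t\<^sup>2 * m2 t - 2 * t * m1 t + 2 * \<mu> t)" by (simp add: algebra_simps)
      moreover have "t\<^sup>2 * t\<^sup>2 = t * t ^ 3" by (simp add: power2_eq_square power3_eq_cube)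
      ultimately show ?thesis unfolding g2_def using t by simp
    qed
    ultimately have c4: "(g1 has_real_derivative g2 t) (at t)" by simp
    have "\<bar>g1 t\<bar> = \<bar>t * m1 t - \<mu> t\<bar> / t\<^sup>2" by (simp add: g1_def abs_divide)
    also have "\<dots> \<le> (G * \<bar>t\<bar> ^ Suc (Suc 0)) / t\<^sup>2" by (intro divide_right_mono e3 tr) auto
    also have "\<dots> = G" using t by (simp add: power2_eq_square flip: abs_mult)
    finally have c5: "\<bar>g1 t\<bar> \<le> G" .
    have "\<bar>g2 t\<bar> = \<bar>t\<^sup>2 * m2 t - 2 * t * m1 t + 2 * \<mu> t\<bar> / \<bar>t\<bar> ^ 3" by (simp add: g2_def abs_divide power_abs)
    also have "\<dots> \<le> (G * \<bar>t\<bar> ^ Suc 2) / \<bar>t\<bar> ^ 3" by (intro divide_right_mono e4 tr) auto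
    also have "\<dots> = G" using t by (simp add: eval_nat_numeral)
    finally have c6: "\<bar>g2 t\<bar> \<le> G" .
    show ?thesis using c1 c2 c3 c4 c5 c6 by blast
  qed
  have "{-\<nu>0..\<nu>0} \<subseteq> N" using inN \<nu>0 by auto
  then show ?thesis using \<nu>0 G main by blast
qed

text \<open>The difference has derivative sqrt x (sqrt (g x) - 1) = O(x^(3/2)), with a primitive of
  size u^(5/2). Derivatives are taken in the open interval only; continuity covers the end point
  0.\<close>

lemma phase_near:
  fixes \<Psi> g :: "real \<Rightarrow> real"
  assumes \<Psi>: "\<Psi> 0 = 0" "\<And>u. u \<in> {0..\<nu>} \<Longrightarrow> (\<Psi> has_real_derivative sqrt (u * g u)) (at u within {0..\<nu>})"
    and g: "\<And>u. u \<in> {0<..\<nu>} \<Longrightarrow> g u \<ge> 0 \<and> \<bar>g u - 1\<bar> \<le> G * u" and u: "u \<in> {0<..\<nu>}" and G: "G \<ge> 0"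
  shows "\<bar>\<Psi> u - 2 / 3 * u powr (3/2)\<bar> \<le> G * u powr (5/2)"
proof -
  define f where "f = (\<lambda>u. \<Psi> u - 2 / 3 * u powr (3/2))"
  define p where "p = (\<lambda>u::real. G * (2 / 5 * u powr (5/2)))"
  have sub: "{0..u} \<subseteq> {0..\<nu>}" using u by auto
  have "norm (f u - f 0) \<le> p u - p 0"
  proof (rule differentiable_bound_general[where f'="\<lambda>x. sqrt (x * g x) - sqrt x" and \<phi>'="\<lambda>x. G * (x * sqrt x)"])
    have "continuous_on {0..u} \<Psi>"
      by (rule DERIV_continuous_on[OF has_field_derivative_subset[OF \<Psi>(2) sub]]) (use sub in auto)
    then show "continuous_on {0..u} f" unfolding f_def by (intro continuous_intros continuous_on_powr') auto
    show "continuous_on {0..u} p" unfolding p_def by (intro continuous_intros continuous_on_powr') auto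
    fix x assume x: "0 < x" "x < u"
    then have at: "at x within {0..\<nu>} = at x" using u by (intro at_within_interior) auto
    have 32: "((\<lambda>u. 2 / 3 * u powr (3/2)) has_real_derivative sqrt x) (at x)"
      using x by (auto intro!: derivative_eq_intros simp: powr_half_sqrt)
    show "(f has_vector_derivative sqrt (x * g x) - sqrt x) (at x)"
      unfolding f_def has_real_derivative_iff_has_vector_derivative[symmetric]
      using \<Psi>(2)[of x] x u unfolding at by (intro DERIV_diff 32) auto
    show "(p has_vector_derivative G * (x * sqrt x)) (at x)"
    proof -
      have "((\<lambda>u. 2 / 5 * u powr (5/2)) has_real_derivative 2 / 5 * (5 / 2 * x powr (5/2 - 1))) (at x)"
        using x by (intro DERIV_cmult has_real_derivative_powr) auto
      moreover have "x powr (5/2 - 1) = x * sqrt x" using powr_add[of x 1 "1/2"] x by (simp add: powr_half_sqrt)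
      ultimately show ?thesis unfolding p_def has_real_derivative_iff_has_vector_derivative[symmetric] by (intro DERIV_cmult) simp
    qed
    have gx: "g x \<ge> 0" "\<bar>g x - 1\<bar> \<le> G * x" using g[of x] x u by auto
    have "\<bar>sqrt (g x) - 1\<bar> * 1 \<le> \<bar>sqrt (g x) - 1\<bar> * (sqrt (g x) + 1)" using gx by (intro mult_left_mono) auto
    also have "\<dots> = \<bar>(sqrt (g x) - 1) * (sqrt (g x) + 1)\<bar>" using gx by (simp add: abs_mult)
    also have "(sqrt (g x) - 1) * (sqrt (g x) + 1) = g x - 1" using gx by (simp add: algebra_simps)
    finally have "\<bar>sqrt (g x) - 1\<bar> \<le> G * x" using gx by simp
    then have "sqrt x * \<bar>sqrt (g x) - 1\<bar> \<le> sqrt x * (G * x)" using x by (intro mult_left_mono) auto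
    moreover have "\<bar>sqrt (x * g x) - sqrt x\<bar> = sqrt x * \<bar>sqrt (g x) - 1\<bar>"
    proof -
      have "sqrt (x * g x) - sqrt x = sqrt x * (sqrt (g x) - 1)" by (simp add: real_sqrt_mult algebra_simps)
      then show ?thesis using x by (simp add: abs_mult)
    qed
    ultimately show "norm (sqrt (x * g x) - sqrt x) \<le> G * (x * sqrt x)" by (simp add: mult_ac)
  qed (use u in auto)
  moreover have "f 0 = 0" "p 0 = 0" using \<Psi> by (simp_all add: f_def p_def)
  moreover have "p u \<le> G * u powr (5/2)" unfolding p_def using G by (intro mult_left_mono) auto
  ultimately show ?thesis by (simp add: f_def)
qed

lemma DERIV_scale:
  fixes f :: "real \<Rightarrow> real"
  assumes "(f has_real_derivative d) (at (c * s + e) within T)" "\<And>s. s \<in> S \<Longrightarrow> c * s + e \<in> T"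
  shows "((\<lambda>s. f (c * s + e)) has_real_derivative c * d) (at s within S)"
proof -
  have "((\<lambda>s. c * s + e) has_real_derivative c) (at s within S)" by (auto intro!: derivative_eq_intros)
  moreover have "(f has_real_derivative d) (at (c * s + e) within (\<lambda>s. c * s + e) ` S)"
    using assms by (intro has_field_derivative_subset[OF assms(1)]) auto
  ultimately have "(f \<circ> (\<lambda>s. c * s + e) has_real_derivative d * c) (at s within S)" by (intro DERIV_image_chain)
  then show ?thesis by (simp add: o_def mult.commute)
qed

lemma zero_derivative_const:
  fixes f :: "real \<Rightarrow> real"
  assumes "\<And>s. s \<in> {p..q} \<Longrightarrow> (f has_real_derivative 0) (at s within {p..q})" "p \<le> q"
  shows "f q = f p"
proof -
  obtain c where "\<And>x. x \<in> {p..q} \<Longrightarrow> f x = c"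
    using has_field_derivative_zero_constant[of "{p..q}" f] assms(1) by auto
  then show ?thesis using assms(2) by simp
qed

section \<open>Trajectories and the invariant line bundle\<close>

lemma solution_on_iff:
  "solution_on \<mu> \<epsilon> T (\<lambda>\<tau>. (X \<tau>, Y \<tau>, Z \<tau>)) \<longleftrightarrow> (\<forall>\<tau>\<in>T. (X has_real_derivative Y \<tau>) (at \<tau> within T) \<and>
     (Y has_real_derivative - \<mu> (Z \<tau>) * X \<tau>) (at \<tau> within T) \<and> (Z has_real_derivative \<epsilon>) (at \<tau> within T))"
proof -
  have "((\<lambda>\<tau>. (X \<tau>, Y \<tau>, Z \<tau>)) has_vector_derivative (x, y, z)) (at \<tau> within T) \<longleftrightarrow>
     (X has_real_derivative x) (at \<tau> within T) \<and> (Y has_real_derivative y) (at \<tau> within T) \<and> (Z has_real_derivative z) (at \<tau> within T)" for x y z \<tau>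
  proof
    assume l: "((\<lambda>\<tau>. (X \<tau>, Y \<tau>, Z \<tau>)) has_vector_derivative (x, y, z)) (at \<tau> within T)"
    have "((\<lambda>\<tau>. fst (X \<tau>, Y \<tau>, Z \<tau>)) has_vector_derivative fst (x, y, z)) (at \<tau> within T)"
      by (rule bounded_linear.has_vector_derivative[OF bounded_linear_fst l])
    moreover have s: "((\<lambda>\<tau>. snd (X \<tau>, Y \<tau>, Z \<tau>)) has_vector_derivative snd (x, y, z)) (at \<tau> within T)"
      by (rule bounded_linear.has_vector_derivative[OF bounded_linear_snd l])
    moreover have "((\<lambda>\<tau>. fst (snd (X \<tau>, Y \<tau>, Z \<tau>))) has_vector_derivative fst (snd (x, y, z))) (at \<tau> within T)"
      by (rule bounded_linear.has_vector_derivative[OF bounded_linear_fst s])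
    moreover have "((\<lambda>\<tau>. snd (snd (X \<tau>, Y \<tau>, Z \<tau>))) has_vector_derivative snd (snd (x, y, z))) (at \<tau> within T)"
      by (rule bounded_linear.has_vector_derivative[OF bounded_linear_snd s])
    ultimately show "(X has_real_derivative x) (at \<tau> within T) \<and> (Y has_real_derivative y) (at \<tau> within T) \<and> (Z has_real_derivative z) (at \<tau> within T)"
      by (simp add: has_real_derivative_iff_has_vector_derivative)
  next
    assume "(X has_real_derivative x) (at \<tau> within T) \<and> (Y has_real_derivative y) (at \<tau> within T) \<and> (Z has_real_derivative z) (at \<tau> within T)"
    then show "((\<lambda>\<tau>. (X \<tau>, Y \<tau>, Z \<tau>)) has_vector_derivative (x, y, z)) (at \<tau> within T)"
      by (intro has_vector_derivative_Pair) (simp_all add: has_real_derivative_iff_has_vector_derivative)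
  qed
  then show ?thesis unfolding solution_on_def vfield_def by simp
qed

text \<open>By the Riccati equation of h the defect w = \<eta> - h \<xi> satisfies w' = -(h /
  \<epsilon>) w, so it stays 0 if it starts at 0.\<close>

lemma slope_invariant:
  fixes \<xi> \<eta> h :: "real \<Rightarrow> real"
  assumes \<epsilon>: "\<epsilon> > 0" and pq: "p \<le> q" and sub: "{p..q} \<subseteq> {a..b}"
    and h: "\<And>t. t \<in> {a..b} \<Longrightarrow> \<exists>h'. (h has_real_derivative h') (at t within {a..b}) \<and> \<epsilon> * h' = - \<mu> t - (h t)\<^sup>2"
    and \<xi>: "\<And>t. t \<in> {p..q} \<Longrightarrow> (\<xi> has_real_derivative \<eta> t / \<epsilon>) (at t within {p..q})"
    and \<eta>: "\<And>t. t \<in> {p..q} \<Longrightarrow> (\<eta> has_real_derivative - \<mu> t * \<xi> t / \<epsilon>) (at t within {p..q})"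
    and init: "\<eta> p = h p * \<xi> p"
  shows "\<eta> q = h q * \<xi> q"
proof -
  define w where "w = (\<lambda>t. \<eta> t - h t * \<xi> t)"
  have dw: "(w has_real_derivative - (h t / \<epsilon>) * w t) (at t within {p..q})" if t: "t \<in> {p..q}" for t
  proof -
    obtain h' where h': "(h has_real_derivative h') (at t within {a..b})" "\<epsilon> * h' = - \<mu> t - (h t)\<^sup>2" using h[of t] t sub by blast
    have "(h has_real_derivative h') (at t within {p..q})" by (rule has_field_derivative_subset[OF h'(1) sub])
    then have "(w has_real_derivative - \<mu> t * \<xi> t / \<epsilon> - (h' * \<xi> t + \<eta> t / \<epsilon> * h t)) (at t within {p..q})"
      unfolding w_def by (intro DERIV_diff DERIV_mult \<xi> \<eta> t)
    also have "h' = (- \<mu> t - (h t)\<^sup>2) / \<epsilon>" using h'(2) \<epsilon> by (simp add: field_simps)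
    also have "- \<mu> t * \<xi> t / \<epsilon> - ((- \<mu> t - (h t)\<^sup>2) / \<epsilon> * \<xi> t + \<eta> t / \<epsilon> * h t) = - (h t / \<epsilon>) * w t"
      using \<epsilon> by (simp add: w_def field_simps power2_eq_square)
    finally show ?thesis .
  qed
  have ch: "continuous_on {p..q} (\<lambda>t. h t / \<epsilon>)"
  proof (intro continuous_intros)
    have "continuous_on {a..b} h"
      unfolding continuous_on_eq_continuous_within using h DERIV_continuous by blast
    then show "continuous_on {p..q} h" using sub by (rule continuous_on_subset)
  qed (use \<epsilon> in auto)
  define F where "F = (\<lambda>t. integral {p..t} (\<lambda>t. h t / \<epsilon>))"
  have dF: "(F has_real_derivative h t / \<epsilon>) (at t within {p..q})" if "t \<in> {p..q}" for t
    unfolding F_def by (rule integral_has_real_derivative[OF ch that])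
  have "((\<lambda>t. w t * exp (F t)) has_real_derivative 0) (at t within {p..q})" if t: "t \<in> {p..q}" for t
  proof -
    have "((\<lambda>t. exp (F t)) has_real_derivative exp (F t) * (h t / \<epsilon>)) (at t within {p..q})"
      by (rule DERIV_chain2[OF DERIV_exp dF[OF t]])
    from DERIV_mult[OF dw[OF t] this] show ?thesis by (simp add: mult_ac)
  qed
  then have "w q * exp (F q) = w p * exp (F p)" by (rule zero_derivative_const[OF _ pq])
  then have "w q = 0" using init by (simp add: w_def)
  then show ?thesis by (simp add: w_def)
qed

text \<open>A reference solution, parametrised by t and starting on the bundle over -\<nu>;
  \<open>h\<close> is the slice of the family \<open>hh\<close> at the given \<epsilon>. The
  divisions by \<epsilon> come from the change of time t = \<epsilon> \<tau>.\<close>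

context
  fixes \<mu> h x y :: "real \<Rightarrow> real" and N :: "real set" and a b \<nu> \<epsilon> :: real and hh :: "real \<Rightarrow> real \<Rightarrow> real"
  assumes \<epsilon>: "\<epsilon> > 0" and \<nu>: "\<nu> > 0" and N: "{-\<nu>..\<nu>} \<subseteq> N" and ab: "-\<nu> \<in> {a..b}" "{a..b} \<subseteq> N \<inter> {..<0}"
    and hh: "h = (\<lambda>t. hh t \<epsilon>)"
    and h: "\<And>t. t \<in> {a..b} \<Longrightarrow> \<exists>h'. (h has_real_derivative h') (at t within {a..b}) \<and> \<epsilon> * h' = - \<mu> t - (h t)\<^sup>2"
    and x: "\<And>t. t \<in> {-\<nu>..\<nu>} \<Longrightarrow> (x has_real_derivative y t / \<epsilon>) (at t within {-\<nu>..\<nu>})"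
    and y: "\<And>t. t \<in> {-\<nu>..\<nu>} \<Longrightarrow> (y has_real_derivative - \<mu> t * x t / \<epsilon>) (at t within {-\<nu>..\<nu>})"
    and init: "y (- \<nu>) = h (- \<nu>) * x (- \<nu>)"
begin

lemma solution_on_interval: "solution_on \<mu> \<epsilon> {-\<nu>/\<epsilon>..\<nu>/\<epsilon>} (\<lambda>\<tau>. (x (\<epsilon> * \<tau>), y (\<epsilon> * \<tau>), \<epsilon> * \<tau>))"
  unfolding solution_on_iff
proof (intro ballI conjI)
  fix \<tau> assume \<tau>: "\<tau> \<in> {-\<nu>/\<epsilon>..\<nu>/\<epsilon>}"
  have im: "\<epsilon> * s + 0 \<in> {-\<nu>..\<nu>}" if "s \<in> {-\<nu>/\<epsilon>..\<nu>/\<epsilon>}" for s using that \<epsilon> by (auto simp: field_simps)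
  show "((\<lambda>\<tau>. x (\<epsilon> * \<tau>)) has_real_derivative y (\<epsilon> * \<tau>)) (at \<tau> within {-\<nu>/\<epsilon>..\<nu>/\<epsilon>})"
    using DERIV_scale[where S="{-\<nu>/\<epsilon>..\<nu>/\<epsilon>}", OF x[OF im[OF \<tau>]] im] \<epsilon> by simp
  show "((\<lambda>\<tau>. y (\<epsilon> * \<tau>)) has_real_derivative - \<mu> (\<epsilon> * \<tau>) * x (\<epsilon> * \<tau>)) (at \<tau> within {-\<nu>/\<epsilon>..\<nu>/\<epsilon>})"
    using DERIV_scale[where S="{-\<nu>/\<epsilon>..\<nu>/\<epsilon>}", OF y[OF im[OF \<tau>]] im] \<epsilon> by simp
  show "(times \<epsilon> has_real_derivative \<epsilon>) (at \<tau> within {-\<nu>/\<epsilon>..\<nu>/\<epsilon>})" by (auto intro!: derivative_eq_intros)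
qed

text \<open>Started over -\<nu>, the trajectory is over t after the time (t + \<nu>) / \<epsilon>.
  The factor c, admissible by linearity, is there for the span.\<close>

lemma scaled_in_Wu:
  assumes t: "t \<in> {-\<nu>..\<nu>}"
  shows "(c * x t, c * y t, t) \<in> Wu \<mu> N a b hh \<epsilon>"
proof -
  define T where "T = (t + \<nu>) / \<epsilon>"
  have T: "T \<ge> 0" using t \<epsilon> by (simp add: T_def)
  have im: "\<epsilon> * s + - \<nu> \<in> {-\<nu>..\<nu>}" if "s \<in> {0..T}" for s
  proof -
    have "\<epsilon> * s \<le> \<epsilon> * T" using that \<epsilon> by (intro mult_left_mono) auto
    then show ?thesis using that \<epsilon> t by (simp add: T_def)
  qed
  define u where "u = (\<lambda>\<tau>. (c * x (\<epsilon> * \<tau> + - \<nu>), c * y (\<epsilon> * \<tau> + - \<nu>), \<epsilon> * \<tau> + - \<nu>))"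
  have "solution_on \<mu> \<epsilon> {0..T} u"
    unfolding u_def solution_on_iff
  proof (intro ballI conjI)
    fix \<tau> assume \<tau>: "\<tau> \<in> {0..T}"
    show "((\<lambda>\<tau>. c * x (\<epsilon> * \<tau> + - \<nu>)) has_real_derivative c * y (\<epsilon> * \<tau> + - \<nu>)) (at \<tau> within {0..T})"
      using DERIV_cmult[where c=c, OF DERIV_scale[where S="{0..T}", OF x[OF im[OF \<tau>]] im]] \<epsilon> by simp
    show "((\<lambda>\<tau>. c * y (\<epsilon> * \<tau> + - \<nu>)) has_real_derivative - \<mu> (\<epsilon> * \<tau> + - \<nu>) * (c * x (\<epsilon> * \<tau> + - \<nu>))) (at \<tau> within {0..T})"
      using DERIV_cmult[where c=c, OF DERIV_scale[where S="{0..T}", OF y[OF im[OF \<tau>]] im]] \<epsilon> by (simp add: mult_ac)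
    show "((\<lambda>\<tau>. \<epsilon> * \<tau> + - \<nu>) has_real_derivative \<epsilon>) (at \<tau> within {0..T})" by (auto intro!: derivative_eq_intros)
  qed
  moreover have "u 0 \<in> Wu_local a b hh \<epsilon>" using ab init by (simp add: u_def Wu_local_def hh)
  moreover have "u T = (c * x t, c * y t, t)" using \<epsilon> by (simp add: u_def T_def)
  moreover have "\<forall>\<tau>\<in>{0..T}. snd (snd (u \<tau>)) \<in> N" using im N by (auto simp: u_def)
  ultimately show ?thesis unfolding Wu_def using T by blast
qed

text \<open>A trajectory in W^u may start over any t0 in [a, b], on either side of -\<nu>. At the
  later of the two starting points both it and the reference solution lie on the bundle, so their
  Wronskian vanishes there, and hence at \<nu>.\<close>

lemma Wu_section_end:
  assumes nz: "(x \<nu>, y \<nu>) \<noteq> (0, 0)"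
  shows "Wu_section \<mu> N a b hh \<epsilon> \<nu> = span {(x \<nu>, y \<nu>)}"
proof
  show "span {(x \<nu>, y \<nu>)} \<subseteq> Wu_section \<mu> N a b hh \<epsilon> \<nu>"
    using scaled_in_Wu[of \<nu>] \<nu> by (auto simp: span_singleton Wu_section_def)
  show "Wu_section \<mu> N a b hh \<epsilon> \<nu> \<subseteq> span {(x \<nu>, y \<nu>)}"
  proof
    fix z assume "z \<in> Wu_section \<mu> N a b hh \<epsilon> \<nu>"
    then obtain X Y where z: "z = (X, Y)" "(X, Y, \<nu>) \<in> Wu \<mu> N a b hh \<epsilon>" by (auto simp: Wu_section_def)
    then obtain T u where T: "T \<ge> 0" and sol: "solution_on \<mu> \<epsilon> {0..T} u" and u0: "u 0 \<in> Wu_local a b hh \<epsilon>" and uT: "u T = (X, Y, \<nu>)"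
      by (auto simp: Wu_def)
    define U V S where "U = (\<lambda>\<tau>. fst (u \<tau>))" and "V = (\<lambda>\<tau>. fst (snd (u \<tau>)))" and "S = (\<lambda>\<tau>. snd (snd (u \<tau>)))"
    have u: "u = (\<lambda>\<tau>. (U \<tau>, V \<tau>, S \<tau>))" by (simp add: U_def V_def S_def)
    have dU: "(U has_real_derivative V \<tau>) (at \<tau> within {0..T})" and dV: "(V has_real_derivative - \<mu> (S \<tau>) * U \<tau>) (at \<tau> within {0..T})"
      and dS: "(S has_real_derivative \<epsilon>) (at \<tau> within {0..T})" if "\<tau> \<in> {0..T}" for \<tau>
      using sol that unfolding u solution_on_iff by auto
    define t0 where "t0 = S 0"
    have t0: "t0 \<in> {a..b}" "V 0 = h t0 * U 0" using u0 by (auto simp: u Wu_local_def hh t0_def)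
    have S: "S \<tau> = t0 + \<epsilon> * \<tau>" if \<tau>: "\<tau> \<in> {0..T}" for \<tau>
    proof -
      have "S \<tau> - \<epsilon> * \<tau> = S 0 - \<epsilon> * 0"
      proof (rule zero_derivative_const[where f="\<lambda>\<tau>. S \<tau> - \<epsilon> * \<tau>"])
        fix s assume s: "s \<in> {0..\<tau>}"
        have "(S has_real_derivative \<epsilon>) (at s within {0..\<tau>})"
          by (rule has_field_derivative_subset[OF dS]) (use s \<tau> in auto)
        from DERIV_diff[OF this DERIV_cmult_Id[of \<epsilon>]] show "((\<lambda>\<tau>. S \<tau> - \<epsilon> * \<tau>) has_real_derivative 0) (at s within {0..\<tau>})" by simp
      qed (use \<tau> in auto)
      then show ?thesis by (simp add: t0_def)
    qed
    have "S T = \<nu>" using uT by (simp add: u)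
    then have T_eq: "\<epsilon> * T = \<nu> - t0" using S[of T] T by simp
    define \<xi> \<eta> where "\<xi> = (\<lambda>t. U (1 / \<epsilon> * t + - t0 / \<epsilon>))" and "\<eta> = (\<lambda>t. V (1 / \<epsilon> * t + - t0 / \<epsilon>))"
    have t0\<nu>: "t0 \<le> \<nu>" using T_eq T \<epsilon> mult_nonneg_nonneg[of \<epsilon> T] by simp
    have im: "1 / \<epsilon> * t + - t0 / \<epsilon> \<in> {0..T}" if "t \<in> {t0..\<nu>}" for t
    proof -
      have e: "1 / \<epsilon> * t + - t0 / \<epsilon> = (t - t0) / \<epsilon>" by (simp add: diff_divide_distrib)
      have "(t - t0) / \<epsilon> \<le> (\<epsilon> * T) / \<epsilon>" using that \<epsilon> T_eq by (intro divide_right_mono) auto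
      then show ?thesis unfolding e using that \<epsilon> by simp
    qed
    have Se: "S (1 / \<epsilon> * t + - t0 / \<epsilon>) = t" if "t \<in> {t0..\<nu>}" for t
      using S[OF im[OF that]] \<epsilon> by (simp add: field_simps)
    have d\<xi>: "(\<xi> has_real_derivative \<eta> t / \<epsilon>) (at t within {t0..\<nu>})" if t: "t \<in> {t0..\<nu>}" for t
      using DERIV_scale[where S="{t0..\<nu>}", OF dU[OF im[OF t]] im] by (simp add: \<xi>_def \<eta>_def)
    have d\<eta>: "(\<eta> has_real_derivative - \<mu> t * \<xi> t / \<epsilon>) (at t within {t0..\<nu>})" if t: "t \<in> {t0..\<nu>}" for t
      using DERIV_scale[where S="{t0..\<nu>}", OF dV[OF im[OF t]] im] Se[OF t] by (simp add: \<xi>_def \<eta>_def)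
    have \<xi>0: "\<eta> t0 = h t0 * \<xi> t0" using t0 by (simp add: \<xi>_def \<eta>_def)
    have "1 / \<epsilon> * \<nu> + - t0 / \<epsilon> = T" using T_eq \<epsilon> by (simp add: field_simps)
    then have \<xi>\<nu>: "\<xi> \<nu> = X" "\<eta> \<nu> = Y" using uT by (simp_all add: \<xi>_def \<eta>_def u)
    \<comment> \<open>Both t0 and -\<nu> lie over the local bundle, hence so does t1, and
      \<open>slope_invariant\<close> applies up to it.\<close>
    define t1 where "t1 = max t0 (- \<nu>)"
    have t1: "t1 \<in> {a..b}" "t0 \<le> t1" "- \<nu> \<le> t1" "t1 \<le> \<nu>" using t0 ab t0\<nu> \<nu> by (auto simp: t1_def max_def)
    have 1: "\<eta> t1 = h t1 * \<xi> t1"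
    proof (rule slope_invariant[where \<xi>=\<xi> and \<eta>=\<eta> and h=h and \<mu>=\<mu> and p=t0 and q=t1 and a=a and b=b, OF \<epsilon> t1(2) _ h _ _ \<xi>0])
      show "(\<xi> has_real_derivative \<eta> t / \<epsilon>) (at t within {t0..t1})" "(\<eta> has_real_derivative - \<mu> t * \<xi> t / \<epsilon>) (at t within {t0..t1})"
        if "t \<in> {t0..t1}" for t
        using has_field_derivative_subset[OF d\<xi>[of t], of "{t0..t1}"] has_field_derivative_subset[OF d\<eta>[of t], of "{t0..t1}"] that t1 by auto
    qed (use t0 t1 in auto)
    have 2: "y t1 = h t1 * x t1"
    proof (rule slope_invariant[where \<xi>=x and \<eta>=y and h=h and \<mu>=\<mu> and p="- \<nu>" and q=t1 and a=a and b=b, OF \<epsilon> t1(3) _ h _ _ init])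
      show "(x has_real_derivative y t / \<epsilon>) (at t within {- \<nu>..t1})" "(y has_real_derivative - \<mu> t * x t / \<epsilon>) (at t within {- \<nu>..t1})"
        if "t \<in> {- \<nu>..t1}" for t
        using has_field_derivative_subset[OF x[of t], of "{- \<nu>..t1}"] has_field_derivative_subset[OF y[of t], of "{- \<nu>..t1}"] that t1 by auto
    qed (use ab t1 in auto)
    have "\<xi> \<nu> * y \<nu> - \<eta> \<nu> * x \<nu> = \<xi> t1 * y t1 - \<eta> t1 * x t1"
    proof (rule zero_derivative_const[where f="\<lambda>t. \<xi> t * y t - \<eta> t * x t"])
      fix t assume t: "t \<in> {t1..\<nu>}"
      have d: "(\<xi> has_real_derivative \<eta> t / \<epsilon>) (at t within {t1..\<nu>})" "(\<eta> has_real_derivative - \<mu> t * \<xi> t / \<epsilon>) (at t within {t1..\<nu>})"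
        "(x has_real_derivative y t / \<epsilon>) (at t within {t1..\<nu>})" "(y has_real_derivative - \<mu> t * x t / \<epsilon>) (at t within {t1..\<nu>})"
        using has_field_derivative_subset[OF d\<xi>[of t], of "{t1..\<nu>}"] has_field_derivative_subset[OF d\<eta>[of t], of "{t1..\<nu>}"]
          has_field_derivative_subset[OF x[of t], of "{t1..\<nu>}"] has_field_derivative_subset[OF y[of t], of "{t1..\<nu>}"] t t1 by auto
      have "((\<lambda>t. \<xi> t * y t - \<eta> t * x t) has_real_derivative (\<eta> t / \<epsilon> * y t + - \<mu> t * x t / \<epsilon> * \<xi> t) - (- \<mu> t * \<xi> t / \<epsilon> * x t + y t / \<epsilon> * \<eta> t)) (at t within {t1..\<nu>})"
        by (intro DERIV_diff DERIV_mult d)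
      then show "((\<lambda>t. \<xi> t * y t - \<eta> t * x t) has_real_derivative 0) (at t within {t1..\<nu>})" by (simp add: mult_ac)
    qed (use t1 in auto)
    then have W: "X * y \<nu> = Y * x \<nu>" using 1 2 by (simp add: \<xi>\<nu>)
    have "\<exists>c. X = c * x \<nu> \<and> Y = c * y \<nu>"
    proof (cases "x \<nu> = 0")
      case True
      then have "y \<nu> \<noteq> 0" "X = 0" using nz W by auto
      then show ?thesis using True by (intro exI[of _ "Y / y \<nu>"]) simp
    next
      case False
      then show ?thesis using W by (intro exI[of _ "X / x \<nu>"]) (simp add: field_simps)
    qed
    then show "z \<in> span {(x \<nu>, y \<nu>)}" unfolding z span_singleton by auto
  qed
qed

end

text \<open>Joint differentiability up to the edge \<epsilon> = 0, used at (t, 0) in the direction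
  of \<epsilon>: B bounds the derivative, and 1 is the tolerance chosen for the remainder.\<close>

lemma fenichel_initial_slope:
  assumes F: "fenichel_slope \<mu> a b \<epsilon>\<^sub>1 h" and \<epsilon>1: "\<epsilon>\<^sub>1 > 0" and t: "t \<in> {a..b}"
  shows "\<exists>L\<ge>0. \<exists>e>0. e \<le> \<epsilon>\<^sub>1 \<and> (\<forall>\<epsilon>. 0 < \<epsilon> \<and> \<epsilon> < e \<longrightarrow> \<bar>h t \<epsilon> - sqrt (- \<mu> t)\<bar> \<le> L * \<epsilon>)"
proof -
  have "5 = Suc 4" by simp
  then have "Ck_on (Suc 4) (\<lambda>(t, \<epsilon>). h t \<epsilon>) ({a..b} \<times> {0..<\<epsilon>\<^sub>1})" using F unfolding fenichel_slope_def by metis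
  then obtain f' where all: "\<forall>x\<in>{a..b} \<times> {0..<\<epsilon>\<^sub>1}. ((\<lambda>(t, \<epsilon>). h t \<epsilon>) has_derivative f' x) (at x within {a..b} \<times> {0..<\<epsilon>\<^sub>1})"
    unfolding Ck_on.simps by blast
  have "(t, 0) \<in> {a..b} \<times> {0..<\<epsilon>\<^sub>1}" using t \<epsilon>1 by simp
  with all have f': "((\<lambda>(t, \<epsilon>). h t \<epsilon>) has_derivative f' (t, 0)) (at (t, 0) within {a..b} \<times> {0..<\<epsilon>\<^sub>1})"
    by (rule bspec)
  have "bounded_linear (f' (t, 0))" using f' by (rule has_derivative_bounded_linear)
  then obtain B where B: "B > 0" "\<And>x. norm (f' (t, 0) x) \<le> norm x * B" using bounded_linear.pos_bounded by blast
  obtain d where d: "d > 0" "\<And>y. y \<in> {a..b} \<times> {0..<\<epsilon>\<^sub>1} \<Longrightarrow> norm (y - (t, 0)) < d \<Longrightarrow>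
     norm ((case y of (t, \<epsilon>) \<Rightarrow> h t \<epsilon>) - h t 0 - f' (t, 0) (y - (t, 0))) \<le> 1 * norm (y - (t, 0))"
  proof -
    have "\<forall>e>0. \<exists>d>0. \<forall>y\<in>{a..b} \<times> {0..<\<epsilon>\<^sub>1}. norm (y - (t, 0)) < d \<longrightarrow>
       norm ((case y of (t, \<epsilon>) \<Rightarrow> h t \<epsilon>) - (case (t, 0) of (t, \<epsilon>) \<Rightarrow> h t \<epsilon>) - f' (t, 0) (y - (t, 0))) \<le> e * norm (y - (t, 0))"
      using f' unfolding has_derivative_within_alt by blast
    from this[rule_format, OF zero_less_one] show thesis using that by auto
  qed
  have "\<bar>h t \<epsilon> - sqrt (- \<mu> t)\<bar> \<le> (B + 1) * \<epsilon>" if \<epsilon>: "0 < \<epsilon>" "\<epsilon> < min d \<epsilon>\<^sub>1" for \<epsilon>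
  proof -
    have n: "norm ((t, \<epsilon>) - (t, 0)) = \<epsilon>" using \<epsilon> by (simp add: norm_Pair)
    have "norm ((case (t, \<epsilon>) of (t, \<epsilon>) \<Rightarrow> h t \<epsilon>) - h t 0 - f' (t, 0) ((t, \<epsilon>) - (t, 0))) \<le> 1 * norm ((t, \<epsilon>) - (t, 0))"
      by (rule d(2)) (use \<epsilon> t n in auto)
    then have "\<bar>h t \<epsilon> - h t 0 - f' (t, 0) ((t, \<epsilon>) - (t, 0))\<bar> \<le> \<epsilon>" unfolding n by simp
    moreover have "\<bar>f' (t, 0) ((t, \<epsilon>) - (t, 0))\<bar> \<le> \<epsilon> * B" using B(2)[of "(t, \<epsilon>) - (t, 0)"] unfolding n by simp
    moreover have "h t 0 = sqrt (- \<mu> t)" using F t by (simp add: fenichel_slope_def)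
    ultimately show ?thesis by (simp add: algebra_simps)
  qed
  then show ?thesis using B d \<epsilon>1 by (intro exI[of _ "B + 1"] conjI exI[of _ "min d \<epsilon>\<^sub>1"]) auto
qed

section \<open>Matching\<close>

text \<open>This is the matching across the turning point: the real part of the oscillating branch
  continues Ai.\<close>

lemma Re_AimiBi: "Re (AimiBi x) = Ai x"
  by (simp add: AimiBi_def)

lemma Re_AimiBi': "Re (AimiBi' x) = deriv Ai x"
proof -
  obtain s1 K where "airy_branch \<i> (\<lambda>s. AimiBi (- s)) (\<lambda>s. - AimiBi' (- s)) (cis (- pi / 4) / of_real (sqrt pi)) s1 K"
    using airy_branch_AimiBi by blast
  then interpret airy_branch \<i> "\<lambda>s. AimiBi (- s)" "\<lambda>s. - AimiBi' (- s)" "cis (- pi / 4) / of_real (sqrt pi)" s1 K .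
  have "((\<lambda>s. Re (AimiBi (- s))) has_vector_derivative Re (- AimiBi' (- (- x)))) (at (- x))"
    by (rule bounded_linear.has_vector_derivative[OF bounded_linear_Re dE])
  then have 1: "((\<lambda>s. Ai (- s)) has_real_derivative - Re (AimiBi' x)) (at (- x))"
    by (simp add: Re_AimiBi has_real_derivative_iff_has_vector_derivative)
  have "(Ai has_real_derivative deriv Ai x) (at x)"
    using Ai_has_derivative DERIV_imp_deriv by metis
  then have "((\<lambda>s. Ai (- s)) has_real_derivative deriv Ai x * - 1) (at (- x))"
    by (intro DERIV_chain2[where g="\<lambda>s. - s"]) (auto intro!: derivative_eq_intros)
  with 1 show ?thesis using DERIV_unique by fastforce
qed

lemma relative_error_real:
  fixes u v c :: real
  assumes "\<bar>u - v\<bar> \<le> c * \<bar>v\<bar>" "c \<ge> 0"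
  shows "\<exists>r. \<bar>r\<bar> \<le> c \<and> u = v * (1 + r)"
proof (cases "v = 0")
  case False
  then have "\<bar>(u - v) / v\<bar> \<le> c" using assms by (simp add: abs_divide pos_divide_le_eq)
  then show ?thesis using False by (intro exI[of _ "(u - v) / v"]) (simp add: field_simps)
next
  case True
  then show ?thesis using assms by (intro exI[of _ 0]) simp
qed

text \<open>The real error is absorbed into a complex factor, r = (u - Re z) / z. A real r need not
  exist where Re z vanishes, which is why the factors on \<open>J3\<close> are complex.\<close>

lemma relative_error_Re:
  fixes u c :: real and z :: complex
  assumes "\<bar>u - Re z\<bar> \<le> c * norm z" "c \<ge> 0"
  shows "\<exists>r. cmod r \<le> c \<and> u = Re (z * (1 + r))"
proof (cases "z = 0")
  case False
  have "norm (of_real (u - Re z) / z) \<le> c"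
    using assms False unfolding norm_divide norm_of_real by (simp add: pos_divide_le_eq)
  moreover have "z * (1 + of_real (u - Re z) / z) = z + of_real (u - Re z)" using False by (simp add: distrib_left)
  then have "Re (z * (1 + of_real (u - Re z) / z)) = u" by (simp only: plus_complex.sel Re_complex_of_real)
  ultimately show ?thesis by metis
next
  case True
  then show ?thesis using assms by (intro exI[of _ 0]) simp
qed

text \<open>An absolute bound gives both clauses; r = (v - a) / a handles the relative one.\<close>

lemma osc_approxI: "\<bar>v - a\<bar> \<le> B \<Longrightarrow> osc_approx B a v"
  unfolding osc_approx_def
proof (intro conjI allI impI)
  assume B: "\<bar>v - a\<bar> \<le> B"
  show "\<exists>r. \<bar>r\<bar> \<le> B \<and> v = a + r" using B by (intro exI[of _ "v - a"]) simp
  fix \<eta> :: real assume \<eta>: "\<eta> > 0" "\<eta> \<le> \<bar>a\<bar>"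
  have "\<bar>v - a\<bar> / \<bar>a\<bar> \<le> B / \<eta>" using B \<eta> by (intro frac_le) auto
  then show "\<exists>r. \<bar>r\<bar> \<le> B / \<eta> \<and> v = a * (1 + r)" using \<eta>
    by (intro exI[of _ "(v - a) / a"]) (auto simp: field_simps abs_divide)
qed

lemma span_scale_pair:
  fixes x y c :: real
  assumes "c \<noteq> 0"
  shows "span {(x, y)} = span {(c * x, c * y)}"
proof -
  have "k *\<^sub>R (x, y) = (k / c) *\<^sub>R (c * x, c * y)" "k *\<^sub>R (c * x, c * y) = (k * c) *\<^sub>R (x, y)" for k
    using assms by simp_all
  then show ?thesis unfolding span_singleton by (metis (no_types, lifting) image_subset_iff range_eqI subset_antisym)
qed

text \<open>The interval integral is oriented, so the formula holds with the same sign on both sides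
  of 0.\<close>

lemma interval_integral_derivative:
  fixes f :: "real \<Rightarrow> real"
  assumes "continuous_on {a..b} f" "a \<le> 0" "0 \<le> b" "u \<in> {a..b}"
  shows "((\<lambda>u. LBINT \<sigma>=0..u. f \<sigma>) has_real_derivative f u) (at u within {a..b})"
  using interval_integral_FTC2[of a 0 b f u] assms
  by (simp add: has_real_derivative_iff_has_vector_derivative zero_ereal_def)

text \<open>The substitution t = c s, to be used with c = \<kappa> and c = -\<kappa>. As
  \<epsilon>^2 = \<kappa>^3, the coefficient becomes -(c / \<kappa>) s g, oscillating for t > 0 and,
  after the reflection, exponential for t < 0.\<close>

lemma scaled_solution:
  fixes x v g \<mu> :: "real \<Rightarrow> real"
  assumes x: "\<And>t. t \<in> {-\<nu>..\<nu>} \<Longrightarrow> (x has_real_derivative v t) (at t within {-\<nu>..\<nu>})"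
    and v: "\<And>t. t \<in> {-\<nu>..\<nu>} \<Longrightarrow> (v has_real_derivative - \<mu> t / \<epsilon>\<^sup>2 * x t) (at t within {-\<nu>..\<nu>})"
    and g: "\<And>t. \<mu> t = t * g t" and c: "c\<^sup>2 = \<kappa>\<^sup>2" and \<kappa>: "\<epsilon>\<^sup>2 = \<kappa> ^ 3" "\<kappa> > 0"
    and S: "\<And>s. s \<in> S \<Longrightarrow> c * s \<in> {-\<nu>..\<nu>}" "s \<in> S"
  shows "((\<lambda>s. x (c * s)) has_real_derivative c * v (c * s)) (at s within S)"
    "((\<lambda>s. c * v (c * s)) has_real_derivative - (c / \<kappa>) * s * g (c * s) * x (c * s)) (at s within S)"
proof -
  note d = DERIV_scale[where c=c and e=0 and S=S and T="{-\<nu>..\<nu>}", unfolded add_0_right]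
  show "((\<lambda>s. x (c * s)) has_real_derivative c * v (c * s)) (at s within S)"
    by (rule d[OF x[OF S(1)[OF S(2)]] S(1)])
  have "((\<lambda>s. c * v (c * s)) has_real_derivative c * (c * (- \<mu> (c * s) / \<epsilon>\<^sup>2 * x (c * s)))) (at s within S)"
    by (intro DERIV_cmult d[OF v[OF S(1)[OF S(2)]] S(1)])
  moreover have "c * (c * (- \<mu> (c * s) / \<epsilon>\<^sup>2 * x (c * s))) = c\<^sup>2 * (- (c * s * g (c * s)) / \<kappa> ^ 3 * x (c * s))"
    unfolding g[of "c * s"] \<kappa>(1) by (simp add: power2_eq_square)
  moreover have "\<dots> = - (c / \<kappa>) * s * g (c * s) * x (c * s)"
    unfolding c using \<kappa>(2) by (simp add: power2_eq_square power3_eq_cube)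
  ultimately show "((\<lambda>s. c * v (c * s)) has_real_derivative - (c / \<kappa>) * s * g (c * s) * x (c * s)) (at s within S)" by simp
qed

text \<open>The left side is reflected, \<open>u = - t\<close>, so that both profiles live on \<open>{0<..\<nu>}\<close>.\<close>

locale turning_point =
  m: profile "- 1" "\<lambda>s. complex_of_real (Ai s)" "\<lambda>s. complex_of_real (deriv Ai s)" \<gamma>A sA KA gm "\<lambda>u. - g1 (- u)" "\<lambda>u. g2 (- u)" \<Psi>m \<nu> G s0 +
  p: profile \<i> "\<lambda>s. AimiBi (- s)" "\<lambda>s. - AimiBi' (- s)" \<gamma>B sB KB "mu_hat \<mu>" g1 g2 \<Psi>p \<nu> G s0
  for \<gamma>A sA KA gm g1 g2 \<Psi>m \<nu> G s0 \<gamma>B sB KB \<mu> \<Psi>p +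
  assumes \<mu>_0: "\<mu> 0 = 0" and c\<mu>: "continuous_on {-\<nu>..\<nu>} \<mu>"
    and gm_def: "gm = (\<lambda>u. mu_hat \<mu> (- u))"
    and \<Psi>p_def: "\<Psi>p = (\<lambda>u::real. LBINT \<sigma>=0..u. sqrt (\<mu> \<sigma>))"
    and \<Psi>m_def: "\<Psi>m = (\<lambda>u::real. - (LBINT \<sigma>=0..(- u). sqrt (- \<mu> \<sigma>)))"
    and \<gamma>B_def: "\<gamma>B = cis (- pi / 4) / complex_of_real (sqrt pi)"
begin

text \<open>The regions are glued from left to right: the constant of one region is the tolerance D
  of the next, and all three are fixed before \<epsilon>. The solution is constructed afterwards,
  and the three estimates are applied to it.\<close>

lemma connection:
  fixes N :: "real set" and \<delta> a b \<epsilon>\<^sub>1 :: real and h :: "real \<Rightarrow> real \<Rightarrow> real"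
  assumes s0_def: "s0 = \<delta> powr (-2/3)" and N: "{-\<nu>..\<nu>} \<subseteq> N" and ab: "-\<nu> \<in> {a..b}" "{a..b} \<subseteq> N \<inter> {..<0}"
    and \<epsilon>1: "0 < \<epsilon>\<^sub>1" and F: "fenichel_slope \<mu> a b \<epsilon>\<^sub>1 h"
  shows "(\<exists>C>0. \<exists>\<epsilon>\<^sub>0>0. \<epsilon>\<^sub>0 \<le> \<epsilon>\<^sub>1 \<and> (\<forall>\<epsilon>. 0 < \<epsilon> \<and> \<epsilon> < \<epsilon>\<^sub>0 \<longrightarrow>
      {-\<nu>..\<nu>} = J1 \<delta> \<nu> \<epsilon> \<union> J2 \<delta> \<epsilon> \<union> J3 \<delta> \<nu> \<epsilon> \<and>
      interior (J1 \<delta> \<nu> \<epsilon>) \<inter> interior (J2 \<delta> \<epsilon>) = {} \<and>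
      interior (J2 \<delta> \<epsilon>) \<inter> interior (J3 \<delta> \<nu> \<epsilon>) = {} \<and>
      interior (J1 \<delta> \<nu> \<epsilon>) \<inter> interior (J3 \<delta> \<nu> \<epsilon>) = {} \<and>
      (\<exists>x y :: real \<Rightarrow> real.
        solution_on \<mu> \<epsilon> {-\<nu>/\<epsilon>..\<nu>/\<epsilon>} (\<lambda>\<tau>. (x (\<epsilon> * \<tau>), y (\<epsilon> * \<tau>), \<epsilon> * \<tau>)) \<and>
        (\<forall>t\<in>{-\<nu>..\<nu>}. (x t, y t, t) \<in> Wu \<mu> N a b h \<epsilon>) \<and>
        (\<forall>t\<in>J1 \<delta> \<nu> \<epsilon>. \<exists>r s :: real.
           \<bar>r\<bar> \<le> C * \<epsilon> powr (2/3) \<and> \<bar>s\<bar> \<le> C * \<epsilon> powr (2/3) \<and>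
           x t = mu_hat \<mu> t powr (-1/4) * Ai (- (\<epsilon> powr (-2/3)) * t)
                 * exp (1/\<epsilon> * ((LBINT \<sigma>=0..t. sqrt (- \<mu> \<sigma>)) + 2/3 * (-t) powr (3/2)))
                 * (1 + r) \<and>
           y t = - (\<epsilon> powr (1/3)) * mu_hat \<mu> t powr (1/4) * deriv Ai (- (\<epsilon> powr (-2/3)) * t)
                 * exp (1/\<epsilon> * ((LBINT \<sigma>=0..t. sqrt (- \<mu> \<sigma>)) + 2/3 * (-t) powr (3/2)))
                 * (1 + s)) \<and>
        (\<forall>t\<in>J2 \<delta> \<epsilon>.
           osc_approx (C * \<epsilon> powr (2/3)) (Ai (- (\<epsilon> powr (-2/3)) * t)) (x t) \<and>
           (\<exists>Y :: real.
             osc_approx (C * \<epsilon> powr (2/3)) (deriv Ai (- (\<epsilon> powr (-2/3)) * t)) Y \<and>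
             y t = - (\<epsilon> powr (1/3)) * Y)) \<and>
        (\<forall>t\<in>J3 \<delta> \<nu> \<epsilon>. \<exists>r s :: complex.
           cmod r \<le> C * \<epsilon> powr (2/3) \<and> cmod s \<le> C * \<epsilon> powr (2/3) \<and>
           x t = mu_hat \<mu> t powr (-1/4)
                 * Re (AimiBi (- (\<epsilon> powr (-2/3)) * t)
                       * exp (\<i>/\<epsilon> * ((LBINT \<sigma>=0..t. sqrt (\<mu> \<sigma>)) - 2/3 * t powr (3/2)))
                       * (1 + r)) \<and>
           y t = - (\<epsilon> powr (1/3)) * mu_hat \<mu> t powr (1/4)
                 * Re (AimiBi' (- (\<epsilon> powr (-2/3)) * t)
                       * exp (\<i>/\<epsilon> * ((LBINT \<sigma>=0..t. sqrt (\<mu> \<sigma>)) - 2/3 * t powr (3/2)))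
                       * (1 + s)))) \<and>
      (\<exists>r s :: real. \<bar>r\<bar> \<le> C * \<epsilon> powr (2/3) \<and> \<bar>s\<bar> \<le> C * \<epsilon> powr (2/3) \<and>
        Wu_section \<mu> N a b h \<epsilon> \<nu> =
          span {(cos (1/\<epsilon> * (LBINT \<sigma>=0..\<nu>. sqrt (\<mu> \<sigma>)) - pi/4) + r,
                 - sqrt (\<mu> \<nu>) * sin (1/\<epsilon> * (LBINT \<sigma>=0..\<nu>. sqrt (\<mu> \<sigma>)) - pi/4) + s)})))"
proof -
  have \<nu>: "0 < \<nu>" "\<nu> \<le> 1" by (fact p.\<nu>)+
  have G: "G \<ge> 0" by (fact p.G_nonneg)
  have s0p: "s0 > 0" using p.large by linarith
  have \<mu>_eq: "\<mu> t = t * mu_hat \<mu> t" for t using \<mu>_0 by (simp add: mu_hat_def)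
  have ric: "\<exists>h'. ((\<lambda>t. h t \<epsilon>) has_real_derivative h') (at t within {a..b}) \<and> \<epsilon> * h' = - \<mu> t - (h t \<epsilon>)\<^sup>2"
    if "0 < \<epsilon>" "\<epsilon> < \<epsilon>\<^sub>1" "t \<in> {a..b}" for \<epsilon> t
    using F that unfolding fenichel_slope_def by auto
  obtain L e where L: "L \<ge> 0" "e > 0" "e \<le> \<epsilon>\<^sub>1" and slope: "\<And>\<epsilon>. 0 < \<epsilon> \<Longrightarrow> \<epsilon> < e \<Longrightarrow> \<bar>h (- \<nu>) \<epsilon> - sqrt (- \<mu> (- \<nu>))\<bar> \<le> L * \<epsilon>"
    using fenichel_initial_slope[OF F \<epsilon>1 ab(1)] by blast
  have mh1: "\<bar>mu_hat \<mu> u - 1\<bar> \<le> G * \<bar>u\<bar>" if "\<bar>u\<bar> \<le> \<nu>" for u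
  proof (cases u "0::real" rule: linorder_cases)
    case less
    then show ?thesis using m.g_1[of "- u"] that by (simp add: gm_def)
  next
    case greater
    then show ?thesis using p.g_1[of u] that by simp
  qed (simp add: mu_hat_def)
  have realA: "complex_of_real (Ai s) \<in> \<real>" "complex_of_real (deriv Ai s) \<in> \<real>" for s by simp_all
  obtain Cm \<kappa>m where Cm: "Cm \<ge> 0" "\<kappa>m > 0" and left: "\<forall>\<kappa>. 0 < \<kappa> \<and> \<kappa> < \<kappa>m \<longrightarrow> (\<forall>a a'.
     (\<forall>s\<in>{s0..\<nu>/\<kappa>}. (a has_real_derivative a' s) (at s within {s0..\<nu>/\<kappa>}) \<and>
        (a' has_real_derivative s * gm (\<kappa> * s) * a s) (at s within {s0..\<nu>/\<kappa>})) \<and>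
     a (\<nu> / \<kappa>) = Re (m.Xf \<kappa> (\<nu> / \<kappa>)) \<and> \<bar>a' (\<nu> / \<kappa>) / a (\<nu> / \<kappa>) + sqrt (\<nu> / \<kappa> * gm \<nu>)\<bar> \<le> L * \<kappa>
     \<longrightarrow> (\<forall>t\<in>{s0..\<nu>/\<kappa>}. \<bar>a t - Re (m.Xf \<kappa> t)\<bar> \<le> Cm * \<kappa> * \<bar>Re (m.Xf \<kappa> t)\<bar> \<and> \<bar>a' t - Re (m.Yf \<kappa> t)\<bar> \<le> Cm * \<kappa> * \<bar>Re (m.Yf \<kappa> t)\<bar>)
       \<and> \<bar>a s0 - Re (complex_of_real (Ai s0))\<bar> \<le> Cm * \<kappa> \<and> \<bar>a' s0 - Re (complex_of_real (deriv Ai s0))\<bar> \<le> Cm * \<kappa>)"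
    using m.recessive_region[OF refl realA L(1)] by (elim exE conjE) (rule that)
  obtain C2 \<kappa>2 where C2: "C2 \<ge> 0" "\<kappa>2 > 0" and middle: "\<forall>\<kappa>. 0 < \<kappa> \<and> \<kappa> < \<kappa>2 \<longrightarrow> (\<forall>a b.
     (\<forall>s\<in>{-s0..s0}. (a has_real_derivative b s) (at s within {-s0..s0}) \<and>
        (b has_real_derivative - (s * mu_hat \<mu> (\<kappa> * s)) * a s) (at s within {-s0..s0})) \<and>
     \<bar>a (- s0) - Re (AimiBi (- (- s0)))\<bar> \<le> Cm * \<kappa> \<and> \<bar>b (- s0) - Re (- AimiBi' (- (- s0)))\<bar> \<le> Cm * \<kappa>
     \<longrightarrow> (\<forall>t\<in>{-s0..s0}. \<bar>a t - Re (AimiBi (- t))\<bar> \<le> C2 * \<kappa> \<and> \<bar>b t - Re (- AimiBi' (- t))\<bar> \<le> C2 * \<kappa>))"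
    by (rule p.middle_region[OF refl s0p p.wronskian_nonzero[OF refl] \<nu>(1) mh1 Cm(1) G, THEN exE])
      ((elim exE conjE, rule that, assumption+) | assumption)+
  obtain C3 \<kappa>3 where C3: "C3 \<ge> 0" "\<kappa>3 > 0" and right: "\<forall>\<kappa>. 0 < \<kappa> \<and> \<kappa> < \<kappa>3 \<longrightarrow> (\<forall>a b.
     (\<forall>s\<in>{s0..\<nu>/\<kappa>}. (a has_real_derivative b s) (at s within {s0..\<nu>/\<kappa>}) \<and>
        (b has_real_derivative - (s * mu_hat \<mu> (\<kappa> * s)) * a s) (at s within {s0..\<nu>/\<kappa>})) \<and>
     \<bar>a s0 - Re (AimiBi (- s0))\<bar> \<le> C2 * \<kappa> \<and> \<bar>b s0 - Re (- AimiBi' (- s0))\<bar> \<le> C2 * \<kappa>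
     \<longrightarrow> (\<forall>t\<in>{s0..\<nu>/\<kappa>}. \<bar>a t - Re (p.Xf \<kappa> t)\<bar> \<le> C3 * \<kappa> * norm (p.Xf \<kappa> t) \<and> \<bar>b t - Re (p.Yf \<kappa> t)\<bar> \<le> C3 * \<kappa> * norm (p.Yf \<kappa> t))
       \<and> \<bar>a (\<nu>/\<kappa>) * (\<nu>/\<kappa> * mu_hat \<mu> \<nu>) powr (1/4) - Re (\<gamma>B * exp (\<i> * of_real (\<Psi>p \<nu> / \<kappa> powr (3/2))))\<bar> \<le> C3 * \<kappa>
       \<and> \<bar>b (\<nu>/\<kappa>) * (\<nu>/\<kappa> * mu_hat \<mu> \<nu>) powr (-1/4) - Re (\<i> * \<gamma>B * exp (\<i> * of_real (\<Psi>p \<nu> / \<kappa> powr (3/2))))\<bar> \<le> C3 * \<kappa>)"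
    using p.oscillatory_region[OF refl C2(1)] by (elim exE conjE) (rule that)
  \<comment> \<open>The entry \<open>1 / (4 * C3 + 1)\<close> makes the errors at \<nu> at most 1/2,
    so that the end vector cannot vanish; the entry with s0 keeps \<open>J1\<close> and
    \<open>J3\<close> nondegenerate.\<close>
  define \<kappa>0 where "\<kappa>0 = min (min \<kappa>m \<kappa>2) (min \<kappa>3 (min (\<nu> / s0) (1 / (4 * C3 + 1))))"
  have \<kappa>0: "\<kappa>0 > 0" "\<kappa>0 \<le> \<kappa>m" "\<kappa>0 \<le> \<kappa>2" "\<kappa>0 \<le> \<kappa>3" "\<kappa>0 \<le> \<nu> / s0" "\<kappa>0 \<le> 1 / (4 * C3 + 1)"
    using Cm C2 C3 \<nu> s0p by (auto simp: \<kappa>0_def)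
  define \<epsilon>0 where "\<epsilon>0 = min e (\<kappa>0 powr (3/2))"
  have \<epsilon>0: "\<epsilon>0 > 0" "\<epsilon>0 \<le> \<epsilon>\<^sub>1" using L \<kappa>0(1) by (auto simp: \<epsilon>0_def)
  have gp: "1 / 2 \<le> mu_hat \<mu> \<nu>" "1 / 2 \<le> gm \<nu>" using p.g_bounds[of \<nu>] m.g_bounds[of \<nu>] \<nu> by auto
  have \<mu>\<nu>: "\<mu> \<nu> = \<nu> * mu_hat \<mu> \<nu>" "- \<mu> (- \<nu>) = \<nu> * gm \<nu>" using \<mu>_eq[of \<nu>] \<mu>_eq[of "- \<nu>"] by (simp_all add: gm_def)
  define C where "C = Cm + C2 + C3 + 2 * C3 * (1 + sqrt (\<mu> \<nu>)) + 1"
  have sq: "sqrt (\<mu> \<nu>) \<ge> 0" using gp \<nu> by (simp add: \<mu>\<nu>)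
  have C: "C > 0" "Cm \<le> C" "C2 \<le> C" "C3 \<le> C" "2 * C3 \<le> C" "sqrt (\<mu> \<nu>) * (2 * C3) \<le> C"
  proof -
    have "sqrt (\<mu> \<nu>) * (2 * C3) \<ge> 0" using sq C3 by simp
    moreover have "C = Cm + C2 + C3 + 2 * C3 + sqrt (\<mu> \<nu>) * (2 * C3) + 1" by (simp add: C_def algebra_simps)
    ultimately show "C > 0" "Cm \<le> C" "C2 \<le> C" "C3 \<le> C" "2 * C3 \<le> C" "sqrt (\<mu> \<nu>) * (2 * C3) \<le> C"
      using Cm(1) C2(1) C3(1) by (smt (verit))+
  qed
  show ?thesis
  proof (rule exI[of _ C], rule conjI[OF C(1)], rule exI[of _ \<epsilon>0], rule conjI[OF \<epsilon>0(1)], rule conjI[OF \<epsilon>0(2)], intro allI impI, goal_cases)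
    case (1 \<epsilon>)
    then have \<epsilon>: "0 < \<epsilon>" "\<epsilon> < e" "\<epsilon> < \<epsilon>\<^sub>1" "\<epsilon> < \<kappa>0 powr (3/2)" using L \<epsilon>0 by (auto simp: \<epsilon>0_def)
    define \<kappa> where "\<kappa> = \<epsilon> powr (2/3)"
    \<comment> \<open>This is sqrt \<kappa>, the factor between y and the derivative of x with
      respect to s.\<close>
    define p3 where "p3 = \<epsilon> powr (1/3)"
    have \<kappa>p: "\<kappa> > 0" "p3 > 0" using \<epsilon> by (simp_all add: \<kappa>_def p3_def)
    have "\<kappa> < (\<kappa>0 powr (3/2)) powr (2/3)" unfolding \<kappa>_def using \<epsilon> by (intro powr_less_mono2) auto
    then have \<kappa>l: "\<kappa> < \<kappa>0" using \<kappa>0(1) by (simp add: powr_powr)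
    have p3: "p3 * \<kappa> = \<epsilon>" "p3\<^sup>2 = \<kappa>" "\<epsilon>\<^sup>2 = \<kappa> ^ 3" "\<kappa> powr (3/2) = \<epsilon>" "\<epsilon> powr (-2/3) = 1 / \<kappa>"
      using \<epsilon>(1) by (simp_all add: p3_def \<kappa>_def powr_powr powr_power powr_minus_divide flip: powr_add)
    have \<kappa>s0: "\<kappa> * s0 < \<nu>" using \<kappa>l \<kappa>0(5) s0p by (simp add: pos_le_divide_eq) (meson less_le_trans mult_strict_right_mono)
    have arg: "- (\<epsilon> powr (-2/3)) * t = - (t / \<kappa>)" for t unfolding p3(5) by simp
    have bd: "\<epsilon> powr (2/3) * \<delta> powr (-2/3) = \<kappa> * s0" by (simp add: \<kappa>_def s0_def)
    have s0\<nu>: "s0 \<le> \<nu> / \<kappa>" using \<kappa>s0 \<kappa>p by (simp add: pos_le_divide_eq mult.commute)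
    \<comment> \<open>Normalisation: of all solutions in W^u the one is taken that agrees with the
      approximant at -\<nu>; h then prescribes its slope.\<close>
    define \<alpha> where "\<alpha> = Re (m.Xf \<kappa> (\<nu> / \<kappa>))"
    have ReX: "Re (m.Xf \<kappa> z) = gm (\<kappa> * z) powr (-1/4) * Ai z * exp (- m.Th \<kappa> z)"
      "Re (m.Yf \<kappa> z) = gm (\<kappa> * z) powr (1/4) * deriv Ai z * exp (- m.Th \<kappa> z)" for z
    proof -
      have e: "exp (- 1 * complex_of_real (m.Th \<kappa> z)) = of_real (exp (- m.Th \<kappa> z))" by (simp flip: exp_of_real)
      show "Re (m.Xf \<kappa> z) = gm (\<kappa> * z) powr (-1/4) * Ai z * exp (- m.Th \<kappa> z)"
        "Re (m.Yf \<kappa> z) = gm (\<kappa> * z) powr (1/4) * deriv Ai z * exp (- m.Th \<kappa> z)"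
        unfolding m.Xf_def m.Yf_def e of_real_mult[symmetric] Re_complex_of_real by simp_all
    qed
    have "Ai (\<nu> / \<kappa>) \<noteq> 0" using m.E_nz[of "\<nu> / \<kappa>"] m.s0 s0\<nu> by simp
    then have \<alpha>: "\<alpha> \<noteq> 0" using gp \<kappa>p by (simp add: \<alpha>_def ReX)
    have "continuous_on {-\<nu>..\<nu>} (\<lambda>t. - \<mu> t / \<epsilon>\<^sup>2)" using \<epsilon> by (intro continuous_intros c\<mu>) auto
    from linear_ode_exists[OF _ this, of \<alpha> "h (- \<nu>) \<epsilon> * \<alpha> / \<epsilon>"] \<nu>
    obtain x v where init: "x (- \<nu>) = \<alpha>" "v (- \<nu>) = h (- \<nu>) \<epsilon> * \<alpha> / \<epsilon>"
      and x: "\<And>t. t \<in> {-\<nu>..\<nu>} \<Longrightarrow> (x has_real_derivative v t) (at t within {-\<nu>..\<nu>})"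
      and v: "\<And>t. t \<in> {-\<nu>..\<nu>} \<Longrightarrow> (v has_real_derivative - \<mu> t / \<epsilon>\<^sup>2 * x t) (at t within {-\<nu>..\<nu>})" by auto
    define y where "y = (\<lambda>t. \<epsilon> * v t)"
    have x': "(x has_real_derivative y t / \<epsilon>) (at t within {-\<nu>..\<nu>})" if "t \<in> {-\<nu>..\<nu>}" for t
      using x[OF that] \<epsilon> by (simp add: y_def)
    have y': "(y has_real_derivative - \<mu> t * x t / \<epsilon>) (at t within {-\<nu>..\<nu>})" if "t \<in> {-\<nu>..\<nu>}" for t
      using DERIV_cmult[OF v[OF that], of \<epsilon>] \<epsilon> by (simp add: y_def power2_eq_square)
    have yi: "y (- \<nu>) = (\<lambda>t. h t \<epsilon>) (- \<nu>) * x (- \<nu>)" using \<epsilon> by (simp add: y_def init)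
    note patched = \<epsilon>(1) \<nu>(1) N ab refl ric[OF \<epsilon>(1,3)] x' y' yi
    have sol: "solution_on \<mu> \<epsilon> {-\<nu>/\<epsilon>..\<nu>/\<epsilon>} (\<lambda>\<tau>. (x (\<epsilon> * \<tau>), y (\<epsilon> * \<tau>), \<epsilon> * \<tau>))"
      by (rule solution_on_interval[where \<mu>=\<mu> and hh=h and x=x and y=y, OF patched])
    have wu: "\<forall>t\<in>{-\<nu>..\<nu>}. (x t, y t, t) \<in> Wu \<mu> N a b h \<epsilon>"
      using scaled_in_Wu[where \<mu>=\<mu> and hh=h and x=x and y=y, OF patched, of _ 1] by simp
    have y_v: "y t = p3 * (\<kappa> * v t)" for t by (simp add: y_def p3(1)[symmetric])
    have im: "\<kappa> * s \<in> {0..\<nu>}" if "s \<in> {s0..\<nu>/\<kappa>}" for s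
    proof -
      have "\<kappa> * s \<le> \<kappa> * (\<nu> / \<kappa>)" using that \<kappa>p by (intro mult_left_mono) auto
      then show ?thesis using that \<kappa>p s0p by auto
    qed
    have im2: "\<kappa> * s \<in> {-\<nu>..\<nu>}" if "s \<in> {-s0..s0}" for s
    proof -
      have "\<bar>\<kappa> * s\<bar> \<le> \<kappa> * s0" using that \<kappa>p unfolding abs_mult by (intro mult_mono) auto
      then show ?thesis using \<kappa>s0 by auto
    qed
    have ode: "\<kappa>\<^sup>2 = \<kappa>\<^sup>2" "(- \<kappa>)\<^sup>2 = \<kappa>\<^sup>2" by simp_all
    \<comment> \<open>The same solution in the variables s = -t / \<kappa> and s = t / \<kappa>; the
      reflection changes the sign of the derivative.\<close>
    define am am' where "am = (\<lambda>s. x (- \<kappa> * s))" and "am' = (\<lambda>s. - \<kappa> * v (- \<kappa> * s))"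
    define ap bp where "ap = (\<lambda>s. x (\<kappa> * s))" and "bp = (\<lambda>s. \<kappa> * v (\<kappa> * s))"
    have dam: "(am has_real_derivative am' s) (at s within {s0..\<nu>/\<kappa>}) \<and> (am' has_real_derivative s * gm (\<kappa> * s) * am s) (at s within {s0..\<nu>/\<kappa>})"
      if s: "s \<in> {s0..\<nu>/\<kappa>}" for s
    proof -
      have *: "- \<kappa> * u \<in> {-\<nu>..\<nu>}" if "u \<in> {s0..\<nu>/\<kappa>}" for u using im[OF that] by auto
      show ?thesis using scaled_solution[OF x v \<mu>_eq ode(2) p3(3) \<kappa>p(1) * s] \<kappa>p(1) by (simp add: am_def am'_def gm_def)
    qed
    have dap: "(ap has_real_derivative bp s) (at s within T) \<and> (bp has_real_derivative - (s * mu_hat \<mu> (\<kappa> * s)) * ap s) (at s within T)"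
      if "\<And>s. s \<in> T \<Longrightarrow> \<kappa> * s \<in> {-\<nu>..\<nu>}" "s \<in> T" for s T
      using scaled_solution[OF x v \<mu>_eq ode(1) p3(3) \<kappa>p(1) that] \<kappa>p(1) by (simp add: ap_def bp_def)
    have am_init: "am (\<nu> / \<kappa>) = \<alpha>" "am' (\<nu> / \<kappa>) = - (h (- \<nu>) \<epsilon> / p3) * \<alpha>"
      using \<kappa>p \<epsilon> by (simp_all add: am_def am'_def init p3(1)[symmetric])
    \<comment> \<open>The O(\<epsilon>) mismatch between h and sqrt (-\<mu>) becomes O(\<kappa>)
      after division by \<open>p3\<close>, since \<epsilon> is \<open>p3\<close> times
      \<kappa>.\<close>
    have am_slope: "\<bar>am' (\<nu> / \<kappa>) / am (\<nu> / \<kappa>) + sqrt (\<nu> / \<kappa> * gm \<nu>)\<bar> \<le> L * \<kappa>"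
    proof -
      have "sqrt (\<nu> / \<kappa> * gm \<nu>) = sqrt (- \<mu> (- \<nu>)) / p3" using \<kappa>p
        by (simp add: \<mu>\<nu> p3(2)[symmetric] real_sqrt_divide real_sqrt_mult)
      then have "am' (\<nu> / \<kappa>) / am (\<nu> / \<kappa>) + sqrt (\<nu> / \<kappa> * gm \<nu>) = - (h (- \<nu>) \<epsilon> - sqrt (- \<mu> (- \<nu>))) / p3"
        using \<alpha> by (simp add: am_init diff_divide_distrib)
      also have "\<bar>\<dots>\<bar> = \<bar>h (- \<nu>) \<epsilon> - sqrt (- \<mu> (- \<nu>))\<bar> / p3" using \<kappa>p by (simp add: abs_divide abs_minus_commute)
      also have "\<dots> \<le> L * \<epsilon> / p3" using slope[OF \<epsilon>(1,2)] \<kappa>p by (intro divide_right_mono) auto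
      also have "\<dots> = L * \<kappa>" using \<kappa>p by (simp add: p3(1)[symmetric])
      finally show ?thesis .
    qed
    have left': "\<forall>t\<in>{s0..\<nu>/\<kappa>}. \<bar>am t - Re (m.Xf \<kappa> t)\<bar> \<le> Cm * \<kappa> * \<bar>Re (m.Xf \<kappa> t)\<bar> \<and> \<bar>am' t - Re (m.Yf \<kappa> t)\<bar> \<le> Cm * \<kappa> * \<bar>Re (m.Yf \<kappa> t)\<bar>"
      "\<bar>am s0 - Ai s0\<bar> \<le> Cm * \<kappa>" "\<bar>am' s0 - deriv Ai s0\<bar> \<le> Cm * \<kappa>"
      using left[rule_format, of \<kappa> am am'] dam am_init(1) am_slope \<kappa>p \<kappa>l \<kappa>0(2) unfolding \<alpha>_def by auto
    \<comment> \<open>Both scalings describe the point t = -\<kappa> s0 here, and Re (Ai - i Bi) =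
      Ai identifies the approximants.\<close>
    have "\<bar>ap (- s0) - Re (AimiBi (- (- s0)))\<bar> \<le> Cm * \<kappa>" "\<bar>bp (- s0) - Re (- AimiBi' (- (- s0)))\<bar> \<le> Cm * \<kappa>"
      using left'(2,3) by (simp_all add: Re_AimiBi Re_AimiBi' ap_def bp_def am_def am'_def abs_minus_commute)
    note edge = this
    have \<kappa>b: "0 < \<kappa> \<and> \<kappa> < \<kappa>2" "0 < \<kappa> \<and> \<kappa> < \<kappa>3" using \<kappa>p \<kappa>l \<kappa>0 by auto
    have "\<forall>s\<in>{-s0..s0}. (ap has_real_derivative bp s) (at s within {-s0..s0}) \<and>
        (bp has_real_derivative - (s * mu_hat \<mu> (\<kappa> * s)) * ap s) (at s within {-s0..s0})"
      by (intro ballI dap im2)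
    then have middle': "\<bar>ap t - Re (AimiBi (- t))\<bar> \<le> C2 * \<kappa>" "\<bar>bp t - Re (- AimiBi' (- t))\<bar> \<le> C2 * \<kappa>" if "t \<in> {-s0..s0}" for t
      using middle[THEN spec, THEN mp, OF \<kappa>b(1), THEN spec, THEN spec, THEN mp, of ap bp] edge that by blast+
    have im3: "\<kappa> * s \<in> {-\<nu>..\<nu>}" if "s \<in> {s0..\<nu>/\<kappa>}" for s using im[OF that] by auto
    have right_ode: "\<forall>s\<in>{s0..\<nu>/\<kappa>}. (ap has_real_derivative bp s) (at s within {s0..\<nu>/\<kappa>}) \<and>
        (bp has_real_derivative - (s * mu_hat \<mu> (\<kappa> * s)) * ap s) (at s within {s0..\<nu>/\<kappa>})"
      by (intro ballI dap im3)
    have "s0 \<in> {-s0..s0}" using s0p by simp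
    note right_all = right[THEN spec, THEN mp, OF \<kappa>b(2), THEN spec, THEN spec, THEN mp, of ap bp,
        OF conjI[OF right_ode conjI[OF middle'[OF this]]], unfolded p3(4)]
    note right' = right_all[THEN conjunct1] right_all[THEN conjunct2, THEN conjunct1] right_all[THEN conjunct2, THEN conjunct2]
    have le: "c * \<kappa> \<le> C * \<kappa>" if "c \<le> C" for c using that \<kappa>p by simp
    have j1: "\<forall>t\<in>J1 \<delta> \<nu> \<epsilon>. \<exists>r s :: real.
         \<bar>r\<bar> \<le> C * \<epsilon> powr (2/3) \<and> \<bar>s\<bar> \<le> C * \<epsilon> powr (2/3) \<and>
         x t = mu_hat \<mu> t powr (-1/4) * Ai (- (\<epsilon> powr (-2/3)) * t)
               * exp (1/\<epsilon> * ((LBINT \<sigma>=0..t. sqrt (- \<mu> \<sigma>)) + 2/3 * (-t) powr (3/2)))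
               * (1 + r) \<and>
         y t = - (\<epsilon> powr (1/3)) * mu_hat \<mu> t powr (1/4) * deriv Ai (- (\<epsilon> powr (-2/3)) * t)
               * exp (1/\<epsilon> * ((LBINT \<sigma>=0..t. sqrt (- \<mu> \<sigma>)) + 2/3 * (-t) powr (3/2)))
               * (1 + s)"
    proof
      fix t assume "t \<in> J1 \<delta> \<nu> \<epsilon>"
      then have t: "- \<nu> \<le> t" "t \<le> - (\<kappa> * s0)" unfolding J1_def bd by simp_all
      define z where "z = - (t / \<kappa>)"
      have z: "\<kappa> * z = - t" "- \<kappa> * z = t" using \<kappa>p by (simp_all add: z_def)
      have zI: "z \<in> {s0..\<nu>/\<kappa>}" using t \<kappa>p by (auto simp: z_def field_simps)
      obtain r where r: "\<bar>r\<bar> \<le> Cm * \<kappa>" "am z = Re (m.Xf \<kappa> z) * (1 + r)"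
        using relative_error_real[of "am z" "Re (m.Xf \<kappa> z)" "Cm * \<kappa>"] left'(1) zI Cm \<kappa>p by auto
      obtain s where s: "\<bar>s\<bar> \<le> Cm * \<kappa>" "am' z = Re (m.Yf \<kappa> z) * (1 + s)"
        using relative_error_real[of "am' z" "Re (m.Yf \<kappa> z)" "Cm * \<kappa>"] left'(1) zI Cm \<kappa>p by auto
      have \<Psi>t: "\<Psi>m (- t) = - (LBINT \<sigma>=0..t. sqrt (- \<mu> \<sigma>))" by (simp add: \<Psi>m_def)
      have ph: "- m.Th \<kappa> z = 1/\<epsilon> * ((LBINT \<sigma>=0..t. sqrt (- \<mu> \<sigma>)) + 2/3 * (-t) powr (3/2))"
        unfolding m.Th_def z p3(4) \<Psi>t minus_divide_left by simp
      have gz: "gm (\<kappa> * z) = mu_hat \<mu> t" by (simp add: gm_def z)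
      have xt: "x t = am z" using z(2) by (simp add: am_def)
      have yt: "y t = - p3 * am' z" using z(2) by (simp add: am'_def y_v)
      show "\<exists>r s :: real.
         \<bar>r\<bar> \<le> C * \<epsilon> powr (2/3) \<and> \<bar>s\<bar> \<le> C * \<epsilon> powr (2/3) \<and>
         x t = mu_hat \<mu> t powr (-1/4) * Ai (- (\<epsilon> powr (-2/3)) * t)
               * exp (1/\<epsilon> * ((LBINT \<sigma>=0..t. sqrt (- \<mu> \<sigma>)) + 2/3 * (-t) powr (3/2)))
               * (1 + r) \<and>
         y t = - (\<epsilon> powr (1/3)) * mu_hat \<mu> t powr (1/4) * deriv Ai (- (\<epsilon> powr (-2/3)) * t)
               * exp (1/\<epsilon> * ((LBINT \<sigma>=0..t. sqrt (- \<mu> \<sigma>)) + 2/3 * (-t) powr (3/2)))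
               * (1 + s)"
        unfolding arg z_def[symmetric] \<kappa>_def[symmetric] p3_def[symmetric] ph[symmetric] xt yt r(2) s(2) ReX gz
        using r(1) s(1) le[OF C(2)] by (intro exI[of _ r] exI[of _ s]) simp
    qed
    have j2: "\<forall>t\<in>J2 \<delta> \<epsilon>.
         osc_approx (C * \<epsilon> powr (2/3)) (Ai (- (\<epsilon> powr (-2/3)) * t)) (x t) \<and>
         (\<exists>Y :: real.
           osc_approx (C * \<epsilon> powr (2/3)) (deriv Ai (- (\<epsilon> powr (-2/3)) * t)) Y \<and>
           y t = - (\<epsilon> powr (1/3)) * Y)"
      unfolding arg \<kappa>_def[symmetric] p3_def[symmetric]
    proof (intro ballI conjI)
      fix t assume "t \<in> J2 \<delta> \<epsilon>"
      then have t: "- (\<kappa> * s0) \<le> t" "t \<le> \<kappa> * s0" unfolding J2_def bd by simp_all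
      have zI: "t / \<kappa> \<in> {-s0..s0}" using t \<kappa>p by (auto simp: field_simps)
      have e: "ap (t / \<kappa>) = x t" "bp (t / \<kappa>) = \<kappa> * v t" using \<kappa>p by (simp_all add: ap_def bp_def)
      show "osc_approx (C * \<kappa>) (Ai (- (t / \<kappa>))) (x t)"
        using middle'(1)[OF zI] le[OF C(3)] by (intro osc_approxI) (simp add: e Re_AimiBi)
      show "\<exists>Y. osc_approx (C * \<kappa>) (deriv Ai (- (t / \<kappa>))) Y \<and> y t = - p3 * Y"
      proof (intro exI[of _ "- (\<kappa> * v t)"] conjI osc_approxI)
        show "\<bar>- (\<kappa> * v t) - deriv Ai (- (t / \<kappa>))\<bar> \<le> C * \<kappa>"
          using middle'(2)[OF zI] le[OF C(3)] by (simp add: e Re_AimiBi')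
      qed (simp add: y_v)
    qed
    have j3: "\<forall>t\<in>J3 \<delta> \<nu> \<epsilon>. \<exists>r s :: complex.
         cmod r \<le> C * \<epsilon> powr (2/3) \<and> cmod s \<le> C * \<epsilon> powr (2/3) \<and>
         x t = mu_hat \<mu> t powr (-1/4)
               * Re (AimiBi (- (\<epsilon> powr (-2/3)) * t)
                     * exp (\<i>/\<epsilon> * ((LBINT \<sigma>=0..t. sqrt (\<mu> \<sigma>)) - 2/3 * t powr (3/2)))
                     * (1 + r)) \<and>
         y t = - (\<epsilon> powr (1/3)) * mu_hat \<mu> t powr (1/4)
               * Re (AimiBi' (- (\<epsilon> powr (-2/3)) * t)
                     * exp (\<i>/\<epsilon> * ((LBINT \<sigma>=0..t. sqrt (\<mu> \<sigma>)) - 2/3 * t powr (3/2)))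
                     * (1 + s))"
    proof
      fix t assume "t \<in> J3 \<delta> \<nu> \<epsilon>"
      then have t: "\<kappa> * s0 \<le> t" "t \<le> \<nu>" unfolding J3_def bd by simp_all
      define z where "z = t / \<kappa>"
      have z: "\<kappa> * z = t" using \<kappa>p by (simp add: z_def)
      have zI: "z \<in> {s0..\<nu>/\<kappa>}" using t \<kappa>p by (auto simp: z_def field_simps)
      obtain r where r: "cmod r \<le> C3 * \<kappa>" "ap z = Re (p.Xf \<kappa> z * (1 + r))"
        using relative_error_Re[of "ap z" "p.Xf \<kappa> z" "C3 * \<kappa>"] right'(1) zI C3 \<kappa>p by auto
      obtain s where s: "cmod s \<le> C3 * \<kappa>" "bp z = Re (p.Yf \<kappa> z * (1 + s))"
        using relative_error_Re[of "bp z" "p.Yf \<kappa> z" "C3 * \<kappa>"] right'(1) zI C3 \<kappa>p by auto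
      have \<Psi>t: "\<Psi>p t = (LBINT \<sigma>=0..t. sqrt (\<mu> \<sigma>))" by (simp add: \<Psi>p_def)
      have ph: "\<i>/\<epsilon> * ((LBINT \<sigma>=0..t. sqrt (\<mu> \<sigma>)) - 2/3 * t powr (3/2)) = \<i> * of_real (p.Th \<kappa> z)"
        unfolding p.Th_def z p3(4) \<Psi>t by simp
      have xt: "x t = ap z" by (simp add: ap_def z)
      have yt: "y t = p3 * bp z" by (simp add: bp_def z y_v)
      have Re_scale: "Re (of_real c * w * w' * w'') = c * Re (w * w' * w'')" for c w w' w''
        by (simp add: mult.assoc)
      show "\<exists>r s :: complex.
         cmod r \<le> C * \<epsilon> powr (2/3) \<and> cmod s \<le> C * \<epsilon> powr (2/3) \<and>
         x t = mu_hat \<mu> t powr (-1/4)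
               * Re (AimiBi (- (\<epsilon> powr (-2/3)) * t)
                     * exp (\<i>/\<epsilon> * ((LBINT \<sigma>=0..t. sqrt (\<mu> \<sigma>)) - 2/3 * t powr (3/2)))
                     * (1 + r)) \<and>
         y t = - (\<epsilon> powr (1/3)) * mu_hat \<mu> t powr (1/4)
               * Re (AimiBi' (- (\<epsilon> powr (-2/3)) * t)
                     * exp (\<i>/\<epsilon> * ((LBINT \<sigma>=0..t. sqrt (\<mu> \<sigma>)) - 2/3 * t powr (3/2)))
                     * (1 + s))"
        unfolding ph
        unfolding arg z_def[symmetric] \<kappa>_def[symmetric] p3_def[symmetric] xt yt r(2) s(2) p.Xf_def p.Yf_def Re_scale z
        using r(1) s(1) le[OF C(4)] by (intro exI[of _ r] exI[of _ s]) (simp del: times_complex.sel)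
    qed
    have direction: "\<exists>r s :: real. \<bar>r\<bar> \<le> C * \<epsilon> powr (2/3) \<and> \<bar>s\<bar> \<le> C * \<epsilon> powr (2/3) \<and>
      Wu_section \<mu> N a b h \<epsilon> \<nu> =
        span {(cos (1/\<epsilon> * (LBINT \<sigma>=0..\<nu>. sqrt (\<mu> \<sigma>)) - pi/4) + r,
               - sqrt (\<mu> \<nu>) * sin (1/\<epsilon> * (LBINT \<sigma>=0..\<nu>. sqrt (\<mu> \<sigma>)) - pi/4) + s)}"
    proof -
      define \<theta> where "\<theta> = 1/\<epsilon> * (LBINT \<sigma>=0..\<nu>. sqrt (\<mu> \<sigma>)) - pi/4"
      \<comment> \<open>Multiplying the end vector by sqrt pi M normalises both components at once:
        the first loses its amplitude 1 / M, the second becomes \<open>p3 * M\<^sup>2\<close> = sqrt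
        (\<mu> \<nu>) times a number of order one.\<close>
      define M where "M = (\<nu>/\<kappa> * mu_hat \<mu> \<nu>) powr (1/4)"
      have qg: "\<nu>/\<kappa> * mu_hat \<mu> \<nu> > 0" using \<nu> \<kappa>p gp by simp
      then have M: "M > 0" "(\<nu>/\<kappa> * mu_hat \<mu> \<nu>) powr (-1/4) = 1 / M" "p3 * M\<^sup>2 = sqrt (\<mu> \<nu>)"
      proof -
        show "M > 0" "(\<nu>/\<kappa> * mu_hat \<mu> \<nu>) powr (-1/4) = 1 / M" using qg by (auto simp: M_def powr_minus_divide)
        have "M\<^sup>2 = (\<nu>/\<kappa> * mu_hat \<mu> \<nu>) powr (1/2)" using qg unfolding M_def by (subst powr_power) auto
        also have "\<dots> = sqrt (\<nu> * mu_hat \<mu> \<nu>) / p3" using qg \<kappa>p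
          by (simp add: powr_half_sqrt p3(2)[symmetric] real_sqrt_divide real_sqrt_mult)
        finally show "p3 * M\<^sup>2 = sqrt (\<mu> \<nu>)" using \<kappa>p by (simp add: \<mu>\<nu>)
      qed
      \<comment> \<open>The real parts of this number and of i times it are cos \<theta> / sqrt pi
        and -sin \<theta> / sqrt pi.\<close>
      have arc: "\<gamma>B * exp (\<i> * of_real (\<Psi>p \<nu> / \<epsilon>)) = cis \<theta> / of_real (sqrt pi)"
        unfolding \<gamma>B_def cis_conv_exp[symmetric] by (simp add: cis_mult \<theta>_def \<Psi>p_def)
      define r where "r = sqrt pi * M * x \<nu> - cos \<theta>"
      define r' where "r' = sqrt pi * (\<kappa> * v \<nu> / M) + sin \<theta>"
      have sp: "0 < sqrt pi" "sqrt pi \<le> 2"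
      proof -
        have "sqrt pi \<le> sqrt (2\<^sup>2)" using pi_less_4 by (intro real_sqrt_le_mono) simp
        then show "0 < sqrt pi" "sqrt pi \<le> 2" by simp_all
      qed
      have e: "ap (\<nu> / \<kappa>) = x \<nu>" "bp (\<nu> / \<kappa>) = \<kappa> * v \<nu>" using \<kappa>p by (simp_all add: ap_def bp_def)
      have "\<bar>x \<nu> * M - cos \<theta> / sqrt pi\<bar> \<le> C3 * \<kappa>"
        using right'(2) unfolding arc e M_def[symmetric] by (simp flip: of_real_divide)
      then have "sqrt pi * \<bar>x \<nu> * M - cos \<theta> / sqrt pi\<bar> \<le> 2 * (C3 * \<kappa>)" using sp by (intro mult_mono) auto
      moreover have "r = sqrt pi * (x \<nu> * M - cos \<theta> / sqrt pi)" using sp by (simp add: r_def right_diff_distrib)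
      ultimately have r: "\<bar>r\<bar> \<le> 2 * C3 * \<kappa>" using sp by (simp add: abs_mult)
      have "\<bar>\<kappa> * v \<nu> / M + sin \<theta> / sqrt pi\<bar> \<le> C3 * \<kappa>"
        using right'(3) unfolding mult.assoc arc e M(2) by (simp flip: of_real_divide)
      then have "sqrt pi * \<bar>\<kappa> * v \<nu> / M + sin \<theta> / sqrt pi\<bar> \<le> 2 * (C3 * \<kappa>)" using sp by (intro mult_mono) auto
      moreover have "r' = sqrt pi * (\<kappa> * v \<nu> / M + sin \<theta> / sqrt pi)" using sp by (simp add: r'_def distrib_left)
      ultimately have r': "\<bar>r'\<bar> \<le> 2 * C3 * \<kappa>" using sp by (simp add: abs_mult)
      have X: "sqrt pi * M * x \<nu> = cos \<theta> + r" by (simp add: r_def)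
      have Y: "sqrt pi * M * y \<nu> = - sqrt (\<mu> \<nu>) * sin \<theta> + sqrt (\<mu> \<nu>) * r'"
        using M(1) unfolding M(3)[symmetric] r'_def y_v by (simp add: field_simps power2_eq_square)
      \<comment> \<open>Otherwise |cos \<theta>| and |sin \<theta>| would both be at most
        1/2.\<close>
      have nz: "(x \<nu>, y \<nu>) \<noteq> (0, 0)"
      proof
        assume "(x \<nu>, y \<nu>) = (0, 0)"
        then have "cos \<theta> = - r" "sin \<theta> = r'" using \<epsilon> by (simp_all add: r_def r'_def y_def)
        moreover have "2 * C3 * \<kappa> \<le> 1 / 2"
        proof -
          have "\<kappa> * (4 * C3 + 1) \<le> 1" using \<kappa>l \<kappa>0(6) C3 by (simp add: pos_le_divide_eq) (smt (verit) mult_right_mono)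
          then show ?thesis using \<kappa>p by (simp add: algebra_simps)
        qed
        ultimately have "\<bar>cos \<theta>\<bar> \<le> 1 / 2" "\<bar>sin \<theta>\<bar> \<le> 1 / 2" using r r' by auto
        then have "(cos \<theta>)\<^sup>2 \<le> (1 / 2)\<^sup>2" "(sin \<theta>)\<^sup>2 \<le> (1 / 2)\<^sup>2" by (intro abs_le_square_iff[THEN iffD1]; simp)+
        then show False using sin_cos_squared_add[of \<theta>] by (simp add: power2_eq_square)
      qed
      have "Wu_section \<mu> N a b h \<epsilon> \<nu> = span {(x \<nu>, y \<nu>)}" by (rule Wu_section_end[where \<mu>=\<mu> and hh=h and x=x and y=y, OF patched nz])
      also have "\<dots> = span {(sqrt pi * M * x \<nu>, sqrt pi * M * y \<nu>)}" using sp M by (intro span_scale_pair) simp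
      also have "\<dots> = span {(cos \<theta> + r, - sqrt (\<mu> \<nu>) * sin \<theta> + sqrt (\<mu> \<nu>) * r')}" unfolding X Y ..
      finally have W: "Wu_section \<mu> N a b h \<epsilon> \<nu> = span {(cos \<theta> + r, - sqrt (\<mu> \<nu>) * sin \<theta> + sqrt (\<mu> \<nu>) * r')}" .
      have b1: "\<bar>r\<bar> \<le> C * \<kappa>" using r le[OF C(5)] by linarith
      have "\<bar>sqrt (\<mu> \<nu>) * r'\<bar> = sqrt (\<mu> \<nu>) * \<bar>r'\<bar>" using sq by (simp add: abs_mult)
      also have "\<dots> \<le> sqrt (\<mu> \<nu>) * (2 * C3 * \<kappa>)" using sq r' by (intro mult_left_mono) auto
      also have "\<dots> = (sqrt (\<mu> \<nu>) * (2 * C3)) * \<kappa>" by simp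
      also have "\<dots> \<le> C * \<kappa>" by (rule le[OF C(6)])
      finally have b2: "\<bar>sqrt (\<mu> \<nu>) * r'\<bar> \<le> C * \<kappa>" .
      show ?thesis unfolding \<kappa>_def[symmetric] \<theta>_def[symmetric]
        by (rule exI[of _ r], rule exI[of _ "sqrt (\<mu> \<nu>) * r'"], intro conjI b1 b2 W)
    qed
    have \<kappa>s0p: "\<kappa> * s0 > 0" using \<kappa>p s0p by simp
    show ?case
    proof (intro conjI, goal_cases)
      case 1
      show ?case unfolding J1_def J2_def J3_def bd using \<kappa>s0 \<kappa>s0p by auto
    next
      case 5
      show ?case by (rule exI[of _ x], rule exI[of _ y], intro conjI sol wu j1 j2 j3)
    next
      case 6
      show ?case by (rule direction)
    qed (unfold J1_def J2_def J3_def bd interior_atLeastAtMost_real, insert \<kappa>s0 \<kappa>s0p, auto)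
  qed
qed

end

text \<open>The threshold for \<delta> comes from the Airy functions and the one for \<nu> from
  \<mu> and its neighbourhood, both before the bundle is chosen. C and the bound on \<epsilon> may
  depend on \<delta>, \<nu> and the chosen h, but C depends on neither t nor \<epsilon>.\<close>

theorem theorem3p1:
  fixes \<mu> :: "real \<Rightarrow> real" and N :: "real set"
  assumes "open N" and "0 \<in> N"
    and "Ck_on 5 \<mu> N"
    and "\<mu> 0 = 0" and "deriv \<mu> 0 = 1"
    and "\<forall>t\<in>N. \<mu> t = 0 \<longleftrightarrow> t = 0"
  shows "\<exists>\<delta>\<^sub>0>0. \<exists>\<nu>\<^sub>0>0. \<forall>\<delta> \<nu> a b \<epsilon>\<^sub>1 h.
    0 < \<delta> \<and> \<delta> < \<delta>\<^sub>0 \<and> 0 < \<nu> \<and> \<nu> < \<nu>\<^sub>0 \<and> {-\<nu>..\<nu>} \<subseteq> N \<and>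
    a < b \<and> -\<nu> \<in> {a..b} \<and> {a..b} \<subseteq> N \<inter> {..<0} \<and>
    0 < \<epsilon>\<^sub>1 \<and> fenichel_slope \<mu> a b \<epsilon>\<^sub>1 h
    \<longrightarrow>
    (\<exists>C>0. \<exists>\<epsilon>\<^sub>0>0. \<epsilon>\<^sub>0 \<le> \<epsilon>\<^sub>1 \<and> (\<forall>\<epsilon>. 0 < \<epsilon> \<and> \<epsilon> < \<epsilon>\<^sub>0 \<longrightarrow>
      {-\<nu>..\<nu>} = J1 \<delta> \<nu> \<epsilon> \<union> J2 \<delta> \<epsilon> \<union> J3 \<delta> \<nu> \<epsilon> \<and>
      interior (J1 \<delta> \<nu> \<epsilon>) \<inter> interior (J2 \<delta> \<epsilon>) = {} \<and>
      interior (J2 \<delta> \<epsilon>) \<inter> interior (J3 \<delta> \<nu> \<epsilon>) = {} \<and>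
      interior (J1 \<delta> \<nu> \<epsilon>) \<inter> interior (J3 \<delta> \<nu> \<epsilon>) = {} \<and>
      (\<exists>x y :: real \<Rightarrow> real.
        solution_on \<mu> \<epsilon> {-\<nu>/\<epsilon>..\<nu>/\<epsilon>} (\<lambda>\<tau>. (x (\<epsilon> * \<tau>), y (\<epsilon> * \<tau>), \<epsilon> * \<tau>)) \<and>
        (\<forall>t\<in>{-\<nu>..\<nu>}. (x t, y t, t) \<in> Wu \<mu> N a b h \<epsilon>) \<and>
        (\<forall>t\<in>J1 \<delta> \<nu> \<epsilon>. \<exists>r s :: real.
           \<bar>r\<bar> \<le> C * \<epsilon> powr (2/3) \<and> \<bar>s\<bar> \<le> C * \<epsilon> powr (2/3) \<and>
           x t = mu_hat \<mu> t powr (-1/4) * Ai (- (\<epsilon> powr (-2/3)) * t)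
                 * exp (1/\<epsilon> * ((LBINT \<sigma>=0..t. sqrt (- \<mu> \<sigma>)) + 2/3 * (-t) powr (3/2)))
                 * (1 + r) \<and>
           y t = - (\<epsilon> powr (1/3)) * mu_hat \<mu> t powr (1/4) * deriv Ai (- (\<epsilon> powr (-2/3)) * t)
                 * exp (1/\<epsilon> * ((LBINT \<sigma>=0..t. sqrt (- \<mu> \<sigma>)) + 2/3 * (-t) powr (3/2)))
                 * (1 + s)) \<and>
        (\<forall>t\<in>J2 \<delta> \<epsilon>.
           osc_approx (C * \<epsilon> powr (2/3)) (Ai (- (\<epsilon> powr (-2/3)) * t)) (x t) \<and>
           (\<exists>Y :: real.
             osc_approx (C * \<epsilon> powr (2/3)) (deriv Ai (- (\<epsilon> powr (-2/3)) * t)) Y \<and>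
             y t = - (\<epsilon> powr (1/3)) * Y)) \<and>
        (\<forall>t\<in>J3 \<delta> \<nu> \<epsilon>. \<exists>r s :: complex.
           cmod r \<le> C * \<epsilon> powr (2/3) \<and> cmod s \<le> C * \<epsilon> powr (2/3) \<and>
           x t = mu_hat \<mu> t powr (-1/4)
                 * Re (AimiBi (- (\<epsilon> powr (-2/3)) * t)
                       * exp (\<i>/\<epsilon> * ((LBINT \<sigma>=0..t. sqrt (\<mu> \<sigma>)) - 2/3 * t powr (3/2)))
                       * (1 + r)) \<and>
           y t = - (\<epsilon> powr (1/3)) * mu_hat \<mu> t powr (1/4)
                 * Re (AimiBi' (- (\<epsilon> powr (-2/3)) * t)
                       * exp (\<i>/\<epsilon> * ((LBINT \<sigma>=0..t. sqrt (\<mu> \<sigma>)) - 2/3 * t powr (3/2)))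
                       * (1 + s)))) \<and>
      (\<exists>r s :: real. \<bar>r\<bar> \<le> C * \<epsilon> powr (2/3) \<and> \<bar>s\<bar> \<le> C * \<epsilon> powr (2/3) \<and>
        Wu_section \<mu> N a b h \<epsilon> \<nu> =
          span {(cos (1/\<epsilon> * (LBINT \<sigma>=0..\<nu>. sqrt (\<mu> \<sigma>)) - pi/4) + r,
                 - sqrt (\<mu> \<nu>) * sin (1/\<epsilon> * (LBINT \<sigma>=0..\<nu>. sqrt (\<mu> \<sigma>)) - pi/4) + s)})))"
proof -
  obtain \<nu>0 G g1 g2 where \<nu>0: "\<nu>0 > 0" "\<nu>0 \<le> 1" and G: "G \<ge> 0"
    and reg: "\<And>t. t \<noteq> 0 \<Longrightarrow> \<bar>t\<bar> \<le> \<nu>0 \<Longrightarrow>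
     1 / 2 \<le> mu_hat \<mu> t \<and> mu_hat \<mu> t \<le> 2 \<and> \<bar>mu_hat \<mu> t - 1\<bar> \<le> G * \<bar>t\<bar> \<and>
     (mu_hat \<mu> has_real_derivative g1 t) (at t) \<and> (g1 has_real_derivative g2 t) (at t) \<and> \<bar>g1 t\<bar> \<le> G \<and> \<bar>g2 t\<bar> \<le> G"
    using mu_hat_regular[OF assms(1-5)] by blast
  have cont\<mu>: "continuous_on N \<mu>" using assms(3) by (rule Ck_on_continuous)
  have \<mu>_eq: "\<mu> t = t * mu_hat \<mu> t" for t using assms(4) by (simp add: mu_hat_def)
  obtain \<gamma>A sA KA where A: "airy_branch (- 1) (\<lambda>s. of_real (Ai s)) (\<lambda>s. of_real (deriv Ai s)) \<gamma>A sA KA"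
    using airy_branch_Ai by blast
  define \<gamma>B where "\<gamma>B = cis (- pi / 4) / complex_of_real (sqrt pi)"
  obtain sB KB where B: "airy_branch \<i> (\<lambda>s. AimiBi (- s)) (\<lambda>s. - AimiBi' (- s)) \<gamma>B sB KB"
    using airy_branch_AimiBi unfolding \<gamma>B_def by blast
  interpret A: airy_branch "- 1" "\<lambda>s. of_real (Ai s)" "\<lambda>s. of_real (deriv Ai s)" \<gamma>A sA KA by (rule A)
  interpret B: airy_branch \<i> "\<lambda>s. AimiBi (- s)" "\<lambda>s. - AimiBi' (- s)" \<gamma>B sB KB by (rule B)
  define qA qB where "qA = 2 * KA / norm \<gamma>A" and "qB = 2 * KB / norm \<gamma>B"
  \<comment> \<open>One number above all thresholds that the two Airy branches impose on s0;
    \<open>qA\<close> and \<open>qB\<close> encode 2 K \<le> |\<gamma>| s0.\<close>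
  define S where "S = 4 + sA + sB + 16 * (KA + 1) + 16 * (KB + 1) + qA + qB"
  have quot: "qA \<ge> 0" "qB \<ge> 0" using A.K B.K by (simp_all add: qA_def qB_def)
  have S: "S \<ge> 4" "S \<ge> sA" "S \<ge> sB" "S \<ge> 16 * (KA + 1)" "S \<ge> 16 * (KB + 1)" "S \<ge> qA" "S \<ge> qB"
    using A.s1 B.s1 A.K B.K quot by (simp_all add: S_def)
  \<comment> \<open>As s0 = \<delta>^(-2/3) decreases in \<delta>, the condition \<delta> < S^(-3/2)
    says that s0 > S.\<close>
  define \<delta>0 where "\<delta>0 = S powr (-3/2)"
  have \<delta>0: "\<delta>0 > 0" using S(1) by (simp add: \<delta>0_def)
  have s0_large: "S \<le> \<delta> powr (-2/3)" if "0 < \<delta>" "\<delta> < \<delta>0" for \<delta>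
  proof -
    have "\<delta>0 powr (-2/3) < \<delta> powr (-2/3)" using that by (intro powr_less_mono2_neg) auto
    moreover have "\<delta>0 powr (-2/3) = S" using S(1) by (simp add: \<delta>0_def powr_powr)
    ultimately show ?thesis by simp
  qed
  show ?thesis
  proof (rule exI[of _ \<delta>0], rule conjI[OF \<delta>0], rule exI[of _ \<nu>0], rule conjI[OF \<nu>0(1)], intro allI impI, goal_cases)
    case (1 \<delta> \<nu> a b \<epsilon>\<^sub>1 h)
    then have \<nu>: "0 < \<nu>" "\<nu> < \<nu>0" "\<nu> \<le> 1" and N: "{-\<nu>..\<nu>} \<subseteq> N" and ab: "-\<nu> \<in> {a..b}" "{a..b} \<subseteq> N \<inter> {..<0}"
      and \<epsilon>1: "0 < \<epsilon>\<^sub>1" and F: "fenichel_slope \<mu> a b \<epsilon>\<^sub>1 h" and \<delta>: "0 < \<delta>" "\<delta> < \<delta>0" using \<nu>0 by auto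
    define s0 where "s0 = \<delta> powr (-2/3)"
    have Ss: "S \<le> s0" unfolding s0_def using \<delta> by (rule s0_large)
    have c\<mu>: "continuous_on {-\<nu>..\<nu>} \<mu>" using cont\<mu> N by (rule continuous_on_subset)
    define gm where "gm = (\<lambda>u. mu_hat \<mu> (- u))"
    define \<Psi>p where "\<Psi>p = (\<lambda>u::real. LBINT \<sigma>=0..u. sqrt (\<mu> \<sigma>))"
    define \<Psi>m where "\<Psi>m = (\<lambda>u::real. - (LBINT \<sigma>=0..(- u). sqrt (- \<mu> \<sigma>)))"
    have d\<Psi>p: "(\<Psi>p has_real_derivative sqrt (u * mu_hat \<mu> u)) (at u within {0..\<nu>})" if "u \<in> {0..\<nu>}" for u
    proof -
      have "continuous_on {0..\<nu>} (\<lambda>\<sigma>. sqrt (\<mu> \<sigma>))" using \<nu> by (intro continuous_intros continuous_on_subset[OF c\<mu>]) auto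
      from interval_integral_derivative[OF this _ _ that] show ?thesis using \<nu> by (simp add: \<Psi>p_def \<mu>_eq[of u])
    qed
    \<comment> \<open>The reflection u = -t and the sign in \<open>\<Psi>m\<close> cancel, so the
      left phase is increasing in u like the right one.\<close>
    have d\<Psi>m: "(\<Psi>m has_real_derivative sqrt (u * gm u)) (at u within {0..\<nu>})" if u: "u \<in> {0..\<nu>}" for u
    proof -
      have "continuous_on {-\<nu>..0} (\<lambda>\<sigma>. sqrt (- \<mu> \<sigma>))" using \<nu> by (intro continuous_intros continuous_on_subset[OF c\<mu>]) auto
      from interval_integral_derivative[OF this, of "- 1 * u + 0"] u \<nu>
      have "((\<lambda>u. LBINT \<sigma>=0..u. sqrt (- \<mu> \<sigma>)) has_real_derivative sqrt (- \<mu> (- u))) (at (- 1 * u + 0) within {-\<nu>..0})" by simp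
      from DERIV_minus[OF DERIV_scale[where S="{0..\<nu>}", OF this]]
      have "((\<lambda>s. - (LBINT \<sigma>=0..(- 1 * s + 0). sqrt (- \<mu> \<sigma>))) has_real_derivative - (- 1 * sqrt (- \<mu> (- u)))) (at u within {0..\<nu>})"
        by simp
      then show ?thesis by (simp add: \<Psi>m_def gm_def \<mu>_eq[of "- u"])
    qed
    have \<Psi>0: "\<Psi>p 0 = 0" "\<Psi>m 0 = 0" by (simp_all add: \<Psi>p_def \<Psi>m_def zero_ereal_def[symmetric])
    have dneg: "((\<lambda>u. f (- u)) has_real_derivative - d) (at u)" if "(f has_real_derivative d) (at (- u))" for f d and u :: real
    proof -
      have "(uminus has_real_derivative - 1) (at u)" by (auto intro!: derivative_eq_intros)
      from DERIV_chain2[OF that this] show ?thesis by simp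
    qed
    have regp: "1 / 2 \<le> mu_hat \<mu> u" "mu_hat \<mu> u \<le> 2" "\<bar>mu_hat \<mu> u - 1\<bar> \<le> G * u" "(mu_hat \<mu> has_real_derivative g1 u) (at u)"
      "(g1 has_real_derivative g2 u) (at u)" "\<bar>g1 u\<bar> \<le> G" "\<bar>g2 u\<bar> \<le> G" if "u \<in> {0<..\<nu>}" for u
      using reg[of u] that \<nu> by auto
    \<comment> \<open>The bounds hold for both signs of t; the reflection flips the sign of the
      first derivative and keeps that of the second.\<close>
    have regm: "1 / 2 \<le> gm u" "gm u \<le> 2" "\<bar>gm u - 1\<bar> \<le> G * u" "(gm has_real_derivative - g1 (- u)) (at u)"
      "((\<lambda>u. - g1 (- u)) has_real_derivative g2 (- u)) (at u)" "\<bar>- g1 (- u)\<bar> \<le> G" "\<bar>g2 (- u)\<bar> \<le> G" if "u \<in> {0<..\<nu>}" for u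
      using reg[of "- u"] dneg[of "mu_hat \<mu>" "g1 (- u)" u] DERIV_minus[OF dneg[of g1 "g2 (- u)" u]] that \<nu> by (auto simp: gm_def)
    have q: "2 * KA \<le> norm \<gamma>A * s0" "2 * KB \<le> norm \<gamma>B * s0"
    proof -
      have "2 * KA / norm \<gamma>A \<le> s0" "2 * KB / norm \<gamma>B \<le> s0" using S Ss unfolding qA_def qB_def by simp_all
      then show "2 * KA \<le> norm \<gamma>A * s0" "2 * KB \<le> norm \<gamma>B * s0" using A.\<gamma> B.\<gamma> by (simp_all add: pos_divide_le_eq mult.commute)
    qed
    have nearp: "\<bar>\<Psi>p u - 2 / 3 * u powr (3/2)\<bar> \<le> G * u powr (5/2)" if "u \<in> {0<..\<nu>}" for u
    proof (rule phase_near[where g="mu_hat \<mu>", OF \<Psi>0(1) d\<Psi>p _ that G])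
      fix v assume "v \<in> {0<..\<nu>}"
      from regp(1,3)[OF this] show "mu_hat \<mu> v \<ge> 0 \<and> \<bar>mu_hat \<mu> v - 1\<bar> \<le> G * v" by simp
    qed
    have nearm: "\<bar>\<Psi>m u - 2 / 3 * u powr (3/2)\<bar> \<le> G * u powr (5/2)" if "u \<in> {0<..\<nu>}" for u
    proof (rule phase_near[where g=gm, OF \<Psi>0(2) d\<Psi>m _ that G])
      fix v assume "v \<in> {0<..\<nu>}"
      from regm(1,3)[OF this] show "gm v \<ge> 0 \<and> \<bar>gm v - 1\<bar> \<le> G * v" by simp
    qed
    interpret m: profile "- 1" "\<lambda>s. of_real (Ai s)" "\<lambda>s. of_real (deriv Ai s)" \<gamma>A sA KA gm "\<lambda>u. - g1 (- u)" "\<lambda>u. g2 (- u)" \<Psi>m \<nu> G s0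
    proof
      show "s0 \<ge> 4" "s0 \<ge> 16 * (KA + 1)" "sA \<le> s0" using S Ss by linarith+
      show "0 < \<nu>" "\<nu> \<le> 1" by (fact \<nu>)+
      show "2 * KA \<le> norm \<gamma>A * s0" by (fact q(1))
      fix u assume u: "u \<in> {0<..\<nu>}"
      then have u': "u \<in> {0..\<nu>}" by simp
      show "1 / 2 \<le> gm u \<and> gm u \<le> 2" using regm(1,2)[OF u] by blast
      show "\<bar>gm u - 1\<bar> \<le> G * u" "(gm has_real_derivative - g1 (- u)) (at u)" by (fact regm(3,4)[OF u])+
      show "((\<lambda>u. - g1 (- u)) has_real_derivative g2 (- u)) (at u)" "\<bar>- g1 (- u)\<bar> \<le> G" "\<bar>g2 (- u)\<bar> \<le> G" by (fact regm(5-7)[OF u])+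
      show "(\<Psi>m has_real_derivative sqrt (u * gm u)) (at u within {0..\<nu>})" by (fact d\<Psi>m[OF u'])
      show "\<bar>\<Psi>m u - 2 / 3 * u powr (3/2)\<bar> \<le> G * u powr (5/2)" by (fact nearm[OF u])
    qed
    interpret p: profile \<i> "\<lambda>s. AimiBi (- s)" "\<lambda>s. - AimiBi' (- s)" \<gamma>B sB KB "mu_hat \<mu>" g1 g2 \<Psi>p \<nu> G s0
    proof
      show "s0 \<ge> 4" "s0 \<ge> 16 * (KB + 1)" "sB \<le> s0" using S Ss by linarith+
      show "0 < \<nu>" "\<nu> \<le> 1" by (fact \<nu>)+
      show "2 * KB \<le> norm \<gamma>B * s0" by (fact q(2))
      fix u assume u: "u \<in> {0<..\<nu>}"
      then have u': "u \<in> {0..\<nu>}" by simp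
      show "1 / 2 \<le> mu_hat \<mu> u \<and> mu_hat \<mu> u \<le> 2" using regp(1,2)[OF u] by blast
      show "\<bar>mu_hat \<mu> u - 1\<bar> \<le> G * u" "(mu_hat \<mu> has_real_derivative g1 u) (at u)" by (fact regp(3,4)[OF u])+
      show "(g1 has_real_derivative g2 u) (at u)" "\<bar>g1 u\<bar> \<le> G" "\<bar>g2 u\<bar> \<le> G" by (fact regp(5-7)[OF u])+
      show "(\<Psi>p has_real_derivative sqrt (u * mu_hat \<mu> u)) (at u within {0..\<nu>})" by (fact d\<Psi>p[OF u'])
      show "\<bar>\<Psi>p u - 2 / 3 * u powr (3/2)\<bar> \<le> G * u powr (5/2)" by (fact nearp[OF u])
    qed
    interpret t: turning_point \<gamma>A sA KA gm g1 g2 \<Psi>m \<nu> G s0 \<gamma>B sB KB \<mu> \<Psi>p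
      by unfold_locales (use assms(4) c\<mu> in \<open>simp_all add: gm_def \<Psi>m_def \<Psi>p_def \<gamma>B_def\<close>)
    show ?case by (rule t.connection[OF s0_def N ab \<epsilon>1 F])
  qed
qed

end
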